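(* Let $R=\bigoplus_{n\ge 0}R_n$ be a graded commutative Noetherian ring, where $R_0$ is a Noetherian local ring with maximal ideal $\mathfrak{m}_0$ and $R$ is generated as an $R_0$-algebra by finitely many elements of $R_1$. Let $R_+=\bigoplus_{n>0}R_n$ and let $M$ be a non-zero finitely generated graded $R$-module. Let $g(M)$ denote the cohomological finite length dimension of $M$ with respect to $R_+$; suppose $g(M)<\infty$ and let $j\le g(M)$ be a non-negative integer. Then one of the following statements holds: (i) $\mathrm{depth}_{R_0}(H^j_{R_+}(M)_n)=0$ for all $n\ll 0$; (ii) $\mathrm{depth}_{R_0}(H^j_{R_+}(M)_n)=1$ for all $n\ll 0$; (iii) $\mathrm{depth}_{R_0}(H^j_{R_+}(M)_n)\ge 2$ for all $n\ll 0$.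
   Context: $H^j_{R_+}(M)$ denotes the $j$-th local cohomology module of $M$ with respect to $R_+$, with its natural grading, and $H^j_{R_+}(M)_n$ is its $n$-th graded component ($n\in\mathbb{Z}$), which is a finitely generated $R_0$-module. The cohomological finite length dimension of $M$ with respect to $R_+$ is $$g(M):=\sup\{\, i : \text{for all } j<i,\ \ell_{R_0}(H^j_{R_+}(M)_n)<\infty \text{ for all } n\ll 0 \,\},$$ where $\ell_{R_0}$ denotes length over $R_0$. For a finitely generated $R_0$-module $X$, $\mathrm{depth}_{R_0}(X)$ is the least integer $i$ such that $H^i_{\mathfrak{m}_0}(X)\neq 0$, with the convention $\mathrm{depth}_{R_0}(0)=\infty$. "For all $n\ll 0$" means: there is $n_0\in\mathbb{Z}$ such that the assertion holds for all integers $n\le n_0$. *)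

theory Defs
  imports "HOL-Library.Extended_Nat" "HOL-Algebra.Algebra"
begin

section \<open>Modules\<close>

definition mod_hom ::
  "('a, 'r) ring_scheme \<Rightarrow> ('a, 'b, 'm) module_scheme \<Rightarrow> ('a, 'c, 'n) module_scheme \<Rightarrow> ('b \<Rightarrow> 'c) set"
  where "mod_hom R M N =
    {f \<in> carrier M \<rightarrow> carrier N.
       (\<forall>x \<in> carrier M. \<forall>y \<in> carrier M. f (x \<oplus>\<^bsub>M\<^esub> y) = f x \<oplus>\<^bsub>N\<^esub> f y) \<and>
       (\<forall>r \<in> carrier R. \<forall>x \<in> carrier M. f (r \<odot>\<^bsub>M\<^esub> x) = r \<odot>\<^bsub>N\<^esub> f x)}"

definition mod_kernel ::
  "('a, 'b, 'm) module_scheme \<Rightarrow> ('a, 'c, 'n) module_scheme \<Rightarrow> ('b \<Rightarrow> 'c) \<Rightarrow> 'b set"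
  where "mod_kernel M N f = {x \<in> carrier M. f x = \<zero>\<^bsub>N\<^esub>}"

text \<open>The ring fields \<open>mult\<close> and \<open>one\<close> of a module record play no role.\<close>

definition quotient_module :: "('a, 'b, 'm) module_scheme \<Rightarrow> 'b set \<Rightarrow> ('a, 'b set) module"
  where "quotient_module M N =
    \<lparr>carrier = a_rcosets\<^bsub>M\<^esub> N, monoid.mult = undefined, monoid.one = undefined,
      ring.zero = N, ring.add = set_add M,
      smult = (\<lambda>r A. \<Union>x\<in>A. N +>\<^bsub>M\<^esub> (r \<odot>\<^bsub>M\<^esub> x))\<rparr>"

definition finitely_generated_module ::
  "('a, 'r) ring_scheme \<Rightarrow> ('a, 'b, 'm) module_scheme \<Rightarrow> bool"
  where "finitely_generated_module R M \<longleftrightarrow>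
    (\<exists>S. finite S \<and> S \<subseteq> carrier M \<and> \<Inter>{N. submodule N R M \<and> S \<subseteq> N} = carrier M)"

definition module_length :: "('a, 'r) ring_scheme \<Rightarrow> ('a, 'b, 'm) module_scheme \<Rightarrow> enat"
  where "module_length R M =
    Sup {enat n | n. \<exists>N :: nat \<Rightarrow> 'b set.
           (\<forall>i\<le>n. submodule (N i) R M) \<and> (\<forall>i<n. N i \<subset> N (Suc i))}"

definition local_ring :: "('a, 'r) ring_scheme \<Rightarrow> 'a set \<Rightarrow> bool"
  where "local_ring R \<mm> \<longleftrightarrow> cring R \<and> {I. maximalideal I R} = {\<mm>}"


section \<open>Graded rings and modules\<close>

definition internal_direct_sum :: "('b, 'm) ring_scheme \<Rightarrow> ('i \<Rightarrow> 'b set) \<Rightarrow> bool"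
  where "internal_direct_sum G A \<longleftrightarrow>
    (\<forall>i. additive_subgroup (A i) G) \<and>
    (\<forall>x \<in> carrier G. \<exists>!f. (\<forall>i. f i \<in> A i) \<and> finite {i. f i \<noteq> \<zero>\<^bsub>G\<^esub>} \<and>
        x = (\<Oplus>\<^bsub>G\<^esub> i \<in> {i. f i \<noteq> \<zero>\<^bsub>G\<^esub>}. f i))"

definition graded_ring :: "('a, 'r) ring_scheme \<Rightarrow> (nat \<Rightarrow> 'a set) \<Rightarrow> bool"
  where "graded_ring R \<A> \<longleftrightarrow> cring R \<and> internal_direct_sum R \<A> \<and>
    (\<forall>m n. \<forall>a \<in> \<A> m. \<forall>b \<in> \<A> n. a \<otimes>\<^bsub>R\<^esub> b \<in> \<A> (m + n))"

definition degree_zero_ring :: "('a, 'r) ring_scheme \<Rightarrow> (nat \<Rightarrow> 'a set) \<Rightarrow> ('a, 'r) ring_scheme"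
  where "degree_zero_ring R \<A> = R\<lparr>carrier := \<A> 0\<rparr>"

definition irrelevant_ideal :: "('a, 'r) ring_scheme \<Rightarrow> (nat \<Rightarrow> 'a set) \<Rightarrow> 'a set"
  where "irrelevant_ideal R \<A> =
    {\<Oplus>\<^bsub>R\<^esub> n \<in> F. f n | F f. finite F \<and> 0 \<notin> F \<and> (\<forall>n \<in> F. f n \<in> \<A> n)}"

definition generated_in_degree_one :: "('a, 'r) ring_scheme \<Rightarrow> (nat \<Rightarrow> 'a set) \<Rightarrow> bool"
  where "generated_in_degree_one R \<A> \<longleftrightarrow>
    (\<exists>S. finite S \<and> S \<subseteq> \<A> 1 \<and> generate_ring R (\<A> 0 \<union> S) = carrier R)"

definition graded_module ::
  "('a, 'r) ring_scheme \<Rightarrow> (nat \<Rightarrow> 'a set) \<Rightarrow> ('a, 'b, 'm) module_scheme \<Rightarrow> (int \<Rightarrow> 'b set) \<Rightarrow> bool"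
  where "graded_module R \<A> M \<M> \<longleftrightarrow> module R M \<and> internal_direct_sum M \<M> \<and>
    (\<forall>m n. \<forall>a \<in> \<A> m. \<forall>x \<in> \<M> n. a \<odot>\<^bsub>M\<^esub> x \<in> \<M> (int m + n))"

definition graded_hom ::
  "('a, 'r) ring_scheme \<Rightarrow> ('a, 'b, 'm) module_scheme \<Rightarrow> (int \<Rightarrow> 'b set) \<Rightarrow>
   ('a, 'c, 'n) module_scheme \<Rightarrow> (int \<Rightarrow> 'c set) \<Rightarrow> ('b \<Rightarrow> 'c) set"
  where "graded_hom R M \<M> N \<N> = {f \<in> mod_hom R M N. \<forall>n. f ` \<M> n \<subseteq> \<N> n}"


section \<open>Injective resolutions\<close>

text \<open>
  A definition cannot quantify over all types, so the extension property is required for modules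
  \<open>A\<close>, \<open>B\<close> whose carriers lie in the type of ring elements. By Baer's criterion this is the same
  as injectivity with respect to all modules: the ideals of \<open>R\<close> and \<open>R\<close> itself are among the
  test modules. In the graded case the shifted homogeneous ideals \<open>I(n) \<subseteq> R(n)\<close> suffice in the
  same way.
\<close>

definition injective_module :: "('a, 'r) ring_scheme \<Rightarrow> ('a, 'b, 'm) module_scheme \<Rightarrow> bool"
  where "injective_module R E \<longleftrightarrow> module R E \<and>
    (\<forall>(A :: ('a, 'a) module) (B :: ('a, 'a) module) u f.
       module R A \<and> module R B \<and> u \<in> mod_hom R A B \<and> inj_on u (carrier A) \<and>
       f \<in> mod_hom R A E \<longrightarrow>
       (\<exists>h \<in> mod_hom R B E. \<forall>x \<in> carrier A. h (u x) = f x))"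

definition graded_injective_module ::
  "('a, 'r) ring_scheme \<Rightarrow> (nat \<Rightarrow> 'a set) \<Rightarrow> ('a, 'b, 'm) module_scheme \<Rightarrow> (int \<Rightarrow> 'b set) \<Rightarrow> bool"
  where "graded_injective_module R \<A> E \<E> \<longleftrightarrow> graded_module R \<A> E \<E> \<and>
    (\<forall>(A :: ('a, 'a) module) \<G> (B :: ('a, 'a) module) \<H> u f.
       graded_module R \<A> A \<G> \<and> graded_module R \<A> B \<H> \<and>
       u \<in> graded_hom R A \<G> B \<H> \<and> inj_on u (carrier A) \<and> f \<in> graded_hom R A \<G> E \<E> \<longrightarrow>
       (\<exists>h \<in> graded_hom R B \<H> E \<E>. \<forall>x \<in> carrier A. h (u x) = f x))"

text \<open>Exactness of \<open>0 \<rightarrow> L \<rightarrow> E 0 \<rightarrow> E 1 \<rightarrow> \<dots>\<close>, with augmentation \<open>\<eta>\<close> and differentials \<open>d\<close>.\<close>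

definition exact_coresolution ::
  "('a, 'r) ring_scheme \<Rightarrow> ('a, 'x, 'm) module_scheme \<Rightarrow> (nat \<Rightarrow> ('a, 'e) module) \<Rightarrow>
   ('x \<Rightarrow> 'e) \<Rightarrow> (nat \<Rightarrow> 'e \<Rightarrow> 'e) \<Rightarrow> bool"
  where "exact_coresolution R L E \<eta> d \<longleftrightarrow>
    \<eta> \<in> mod_hom R L (E 0) \<and> inj_on \<eta> (carrier L) \<and>
    \<eta> ` carrier L = mod_kernel (E 0) (E 1) (d 0) \<and>
    (\<forall>i. d i \<in> mod_hom R (E i) (E (Suc i)) \<and>
         d i ` carrier (E i) = mod_kernel (E (Suc i)) (E (Suc (Suc i))) (d (Suc i)))"

definition injective_resolution ::
  "('a, 'r) ring_scheme \<Rightarrow> ('a, 'x, 'm) module_scheme \<Rightarrow> (nat \<Rightarrow> ('a, 'e) module) \<Rightarrow>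
   ('x \<Rightarrow> 'e) \<Rightarrow> (nat \<Rightarrow> 'e \<Rightarrow> 'e) \<Rightarrow> bool"
  where "injective_resolution R L E \<eta> d \<longleftrightarrow>
    (\<forall>i. injective_module R (E i)) \<and> exact_coresolution R L E \<eta> d"

definition graded_injective_resolution ::
  "('a, 'r) ring_scheme \<Rightarrow> (nat \<Rightarrow> 'a set) \<Rightarrow> ('a, 'x, 'm) module_scheme \<Rightarrow> (int \<Rightarrow> 'x set) \<Rightarrow>
   (nat \<Rightarrow> ('a, 'e) module) \<Rightarrow> (nat \<Rightarrow> int \<Rightarrow> 'e set) \<Rightarrow>
   ('x \<Rightarrow> 'e) \<Rightarrow> (nat \<Rightarrow> 'e \<Rightarrow> 'e) \<Rightarrow> bool"
  where "graded_injective_resolution R \<A> L \<L> E \<E> \<eta> d \<longleftrightarrow>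
    (\<forall>i. graded_injective_module R \<A> (E i) (\<E> i)) \<and> exact_coresolution R L E \<eta> d \<and>
    \<eta> \<in> graded_hom R L \<L> (E 0) (\<E> 0) \<and>
    (\<forall>i. d i \<in> graded_hom R (E i) (\<E> i) (E (Suc i)) (\<E> (Suc i)))"


section \<open>Local cohomology\<close>

definition ideal_power :: "('a, 'r) ring_scheme \<Rightarrow> 'a set \<Rightarrow> nat \<Rightarrow> 'a set"
  where "ideal_power R I n = ((ideal_prod R I) ^^ n) (carrier R)"

definition torsion_submodule ::
  "('a, 'r) ring_scheme \<Rightarrow> 'a set \<Rightarrow> ('a, 'b, 'm) module_scheme \<Rightarrow> 'b set"
  where "torsion_submodule R I M =
    {x \<in> carrier M. \<exists>n. \<forall>a \<in> ideal_power R I n. a \<odot>\<^bsub>M\<^esub> x = \<zero>\<^bsub>M\<^esub>}"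

definition torsion_cocycles ::
  "('a, 'r) ring_scheme \<Rightarrow> 'a set \<Rightarrow> (nat \<Rightarrow> ('a, 'e) module) \<Rightarrow> (nat \<Rightarrow> 'e \<Rightarrow> 'e) \<Rightarrow> nat \<Rightarrow> 'e set"
  where "torsion_cocycles R I E d i =
    torsion_submodule R I (E i) \<inter> mod_kernel (E i) (E (Suc i)) (d i)"

definition torsion_coboundaries ::
  "('a, 'r) ring_scheme \<Rightarrow> 'a set \<Rightarrow> (nat \<Rightarrow> ('a, 'e) module) \<Rightarrow> (nat \<Rightarrow> 'e \<Rightarrow> 'e) \<Rightarrow> nat \<Rightarrow> 'e set"
  where "torsion_coboundaries R I E d i =
    (case i of 0 \<Rightarrow> {\<zero>\<^bsub>E 0\<^esub>} | Suc k \<Rightarrow> d k ` torsion_submodule R I (E k))"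

definition torsion_cohomology ::
  "('a, 'r) ring_scheme \<Rightarrow> 'a set \<Rightarrow> (nat \<Rightarrow> ('a, 'e) module) \<Rightarrow> (nat \<Rightarrow> 'e \<Rightarrow> 'e) \<Rightarrow> nat \<Rightarrow>
   ('a, 'e set) module"
  where "torsion_cohomology R I E d i =
    quotient_module ((E i)\<lparr>carrier := torsion_cocycles R I E d i\<rparr>) (torsion_coboundaries R I E d i)"

text \<open>
  Local cohomology is the right derived functor of the torsion functor, computed from an arbitrarily
  chosen injective resolution; another choice gives an isomorphic module. For Noetherian \<open>R\<close>
  a resolution exists inside the type \<open>('a \<times> 'x) list\<close>: it is infinite and at least as large as
  \<open>'a\<close> and \<open>'x\<close>, and since ideals are finitely generated, an \<open>R\<close>-module embeds into an injective one
  whose cardinality is at most the maximum of those of \<open>R\<close>, the module and \<open>\<nat>\<close> (add solutions of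
  all extension problems \<open>I \<rightarrow> L\<close>, \<open>I \<subseteq> R\<close>, and repeat countably often). The same holds for graded
  modules.
\<close>

definition chosen_resolution ::
  "('a, 'r) ring_scheme \<Rightarrow> ('a, 'x, 'm) module_scheme \<Rightarrow>
   (nat \<Rightarrow> ('a, ('a \<times> 'x) list) module) \<times> (nat \<Rightarrow> ('a \<times> 'x) list \<Rightarrow> ('a \<times> 'x) list)"
  where "chosen_resolution R L = (SOME (E, d). \<exists>\<eta>. injective_resolution R L E \<eta> d)"

definition local_cohomology ::
  "('a, 'r) ring_scheme \<Rightarrow> 'a set \<Rightarrow> ('a, 'x, 'm) module_scheme \<Rightarrow> nat \<Rightarrow>
   ('a, ('a \<times> 'x) list set) module"
  where "local_cohomology R I L i =
    (case chosen_resolution R L of (E, d) \<Rightarrow> torsion_cohomology R I E d i)"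

definition chosen_graded_resolution ::
  "('a, 'r) ring_scheme \<Rightarrow> (nat \<Rightarrow> 'a set) \<Rightarrow> ('a, 'x, 'm) module_scheme \<Rightarrow> (int \<Rightarrow> 'x set) \<Rightarrow>
   (nat \<Rightarrow> ('a, ('a \<times> 'x) list) module) \<times> (nat \<Rightarrow> int \<Rightarrow> ('a \<times> 'x) list set) \<times>
   (nat \<Rightarrow> ('a \<times> 'x) list \<Rightarrow> ('a \<times> 'x) list)"
  where "chosen_graded_resolution R \<A> L \<L> =
    (SOME (E, \<E>, d). \<exists>\<eta>. graded_injective_resolution R \<A> L \<L> E \<E> \<eta> d)"

text \<open>
  For a homogeneous ideal \<open>I\<close>, the natural grading of local cohomology is the one coming from
  a resolution by injective objects of the category of graded modules; such objects are acyclic for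
  the torsion functor, so the underlying module is the usual local cohomology. The degree \<open>n\<close>
  component consists of the classes of the cocycles of degree \<open>n\<close>. The record below
  carries the action of all of \<open>R\<close>; only the degree zero part of \<open>R\<close> maps the component to itself,
  and it is used as a module over that ring.
\<close>

definition graded_local_cohomology_component ::
  "('a, 'r) ring_scheme \<Rightarrow> (nat \<Rightarrow> 'a set) \<Rightarrow> 'a set \<Rightarrow>
   ('a, 'x, 'm) module_scheme \<Rightarrow> (int \<Rightarrow> 'x set) \<Rightarrow> nat \<Rightarrow> int \<Rightarrow> ('a, ('a \<times> 'x) list set) module"
  where "graded_local_cohomology_component R \<A> I L \<L> i n =
    (case chosen_graded_resolution R \<A> L \<L> of (E, \<E>, d) \<Rightarrow>
       (torsion_cohomology R I E d i)
         \<lparr>carrier := (\<lambda>z. torsion_coboundaries R I E d i +>\<^bsub>E i\<^esub> z)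
                        ` (torsion_cocycles R I E d i \<inter> \<E> i n)\<rparr>)"

text \<open>Since \<open>Inf {} = \<infinity>\<close> in \<^typ>\<open>enat\<close>, the zero module has depth \<open>\<infinity>\<close>.\<close>

definition depth :: "('a, 'r) ring_scheme \<Rightarrow> 'a set \<Rightarrow> ('a, 'x, 'm) module_scheme \<Rightarrow> enat"
  where "depth R \<mm> L =
    Inf {enat i | i. carrier (local_cohomology R \<mm> L i) \<noteq> {\<zero>\<^bsub>local_cohomology R \<mm> L i\<^esub>}}"

definition cohomological_finite_length_dimension ::
  "('a, 'r) ring_scheme \<Rightarrow> (nat \<Rightarrow> 'a set) \<Rightarrow> ('a, 'x, 'm) module_scheme \<Rightarrow> (int \<Rightarrow> 'x set) \<Rightarrow> enat"
  where "cohomological_finite_length_dimension R \<A> M \<M> =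
    Sup {enat i | i. \<forall>j<i. \<exists>n\<^sub>0. \<forall>n\<le>n\<^sub>0.
      module_length (degree_zero_ring R \<A>)
        (graded_local_cohomology_component R \<A> (irrelevant_ideal R \<A>) M \<M> j n) < \<infinity>}"

end

theory Submission
  imports Defs
begin

text \<open>Let \<open>E\<close> be a graded injective resolution of \<open>M\<close>, let \<open>r\<^sub>0, \<dots>, r\<^bsub>t - 1\<^esub>\<close> be elements of degree one that
  generate \<open>R\<^sub>+\<close>, and let \<open>\<Gamma>\<close> be the \<open>R\<^sub>+\<close>-torsion functor. In every degree \<open>n \<ll> 0\<close>, the quotient of the
  cocycles \<open>Z\<^sup>q\<close> of \<open>E\<close> by the coboundaries \<open>B\<^sup>q\<close> of \<open>\<Gamma>(E)\<close> has an exact Koszul complex, for all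
  \<open>q \<le> g(M)\<close>. This is clear for \<open>q = 0\<close>, because \<open>M\<close> vanishes in low degrees. For the step from \<open>q\<close> to
  \<open>q + 1\<close>, the Koszul complex of \<open>E\<^sup>q/\<Gamma>(E\<^sup>q)\<close> is exact since \<open>E\<^sup>q\<close> is injective, and the one of \<open>H\<^sup>q\<close> is
  exact in low degrees: by the case \<open>q\<close>, an element of \<open>H\<^sup>q\<close> of low degree that is killed by all \<open>r\<^sub>i\<close> is zero,
  so that \<open>H\<^sup>q\<close>, whose components there have finite length, is artinian in low degrees. The same holds for its
  Koszul homology, which is killed by all \<open>r\<^sub>i\<close> and therefore lives in finitely many of these degrees.

  Exactness at the first two places for \<open>q = j\<close> says that no nonzero element of \<open>H\<^sup>j\<close> of low degree is
  killed by all \<open>r\<^sub>i\<close>, and that compatible families \<open>(y\<^sub>i)\<close> come from one element. Hence, for \<open>n \<ll> 0\<close>,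
  multiplication by some \<open>r\<^sub>i\<close> carries a nonzero element of \<open>Hom(R\<^sub>0/\<mm>\<^sub>0, H\<^sup>j\<^sub>n)\<close> to one in degree
  \<open>n + 1\<close>, and likewise for \<open>Ext\<^sup>1\<close> if the former vanishes in low degrees. A property of degrees
  that passes from \<open>n\<close> to \<open>n + 1\<close> either holds for all \<open>n \<ll> 0\<close> or fails for all \<open>n \<ll> 0\<close>.\<close>

text \<open>Local cohomology and \<open>depth\<close> are read off a resolution picked by
  \<open>SOME\<close>, so nothing is known about them until a resolution is shown to exist inside
  the prescribed type of lists. An embedding into an injective module must therefore find names for
  its new elements in a type fixed in advance, and this shapes the Zorn argument. Once existence is
  known, resolutions need not be compared: every later statement is proved for an arbitrary
  resolution. Quotient complexes and connecting homomorphisms never appear. Exactness of a quotient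
  B/A is expressed by subgroups A, B of one module, and long exact sequences shrink to a few facts
  about chains of subgroups. The induction on q closes because it is run for Z^q/B^q rather than for
  H^q: the differential identifies Z^(q+1)/B^(q+1) with the quotient of E^q by \<Gamma>(E^q) + Z^q.
  Finite length is used only as the descending chain condition over the degree zero ring. The step
  from single components to all low degrees at once is a dual of Hilbert's basis theorem, applied to
  Koszul cocycles and coboundaries.\<close>

lemma (in abelian_group) additive_subgroupI':
  assumes "H \<subseteq> carrier G" "\<zero> \<in> H" "\<And>x y. x \<in> H \<Longrightarrow> y \<in> H \<Longrightarrow> x \<oplus> y \<in> H"
    and "\<And>x. x \<in> H \<Longrightarrow> \<ominus> x \<in> H"
  shows "additive_subgroup H G"
  using assms by (intro additive_subgroupI) (auto simp: subgroup_def a_inv_def)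

lemma additive_subgroup_minus:
  assumes "abelian_group G" "additive_subgroup H G" "x \<in> H" "y \<in> H"
  shows "x \<ominus>\<^bsub>G\<^esub> y \<in> H"
  using assms by (simp add: a_minus_def additive_subgroup.a_closed additive_subgroup.a_inv_closed)

lemma (in abelian_group) minus_add_cancel:
  "x \<in> carrier G \<Longrightarrow> y \<in> carrier G \<Longrightarrow> (x \<ominus> y) \<oplus> y = x"
  "x \<in> carrier G \<Longrightarrow> y \<in> carrier G \<Longrightarrow> y \<oplus> (x \<ominus> y) = x"
  by (simp_all add: minus_eq a_ac l_neg r_neg r_neg1 r_neg2)

lemma (in abelian_group) mem_of_minus_mem:
  assumes "additive_subgroup H G" "x \<in> carrier G" "y \<in> H" "x \<ominus> y \<in> H"
  shows "x \<in> H"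
proof -
  have "y \<in> carrier G" by (rule additive_subgroup.a_Hcarr[OF assms(1,3)])
  then show ?thesis
    using additive_subgroup.a_closed[OF assms(1,4,3)] assms(2) by (simp add: minus_add_cancel)
qed

lemma (in abelian_group) minus_mem_sym:
  assumes "additive_subgroup H G" "x \<in> carrier G" "y \<in> carrier G" "x \<ominus> y \<in> H"
  shows "y \<ominus> x \<in> H"
proof -
  have "y \<ominus> x = \<ominus> (x \<ominus> y)" using assms by (simp add: minus_eq minus_add a_ac)
  then show ?thesis using additive_subgroup.a_inv_closed[OF assms(1,4)] by simp
qed

lemma (in abelian_group) minus_mem_trans:
  assumes "additive_subgroup H G" "x \<in> carrier G" "y \<in> carrier G" "z \<in> carrier G"
    "x \<ominus> y \<in> H" "y \<ominus> z \<in> H"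
  shows "x \<ominus> z \<in> H"
proof -
  have "x \<ominus> z = (x \<ominus> y) \<oplus> (y \<ominus> z)"
    using assms by (simp add: minus_eq a_ac r_neg1 r_neg2)
  then show ?thesis using additive_subgroup.a_closed[OF assms(1,5,6)] by simp
qed

lemma (in abelian_group) minus_eq_zero_iff:
  "x \<in> carrier G \<Longrightarrow> y \<in> carrier G \<Longrightarrow> x \<ominus> y = \<zero> \<longleftrightarrow> x = y"
  using minus_add_cancel(1)[of x y] by (auto simp: minus_eq r_neg)

lemma (in abelian_group) minus_add_distrib:
  "x \<in> carrier G \<Longrightarrow> y \<in> carrier G \<Longrightarrow> u \<in> carrier G \<Longrightarrow> v \<in> carrier G
    \<Longrightarrow> (x \<oplus> y) \<ominus> (u \<oplus> v) = (x \<ominus> u) \<oplus> (y \<ominus> v)"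
  by (simp add: minus_eq minus_add a_ac)

lemma (in module) smult_minus_distrib:
  "a \<in> carrier R \<Longrightarrow> x \<in> carrier M \<Longrightarrow> y \<in> carrier M
    \<Longrightarrow> a \<odot>\<^bsub>M\<^esub> (x \<ominus>\<^bsub>M\<^esub> y) = a \<odot>\<^bsub>M\<^esub> x \<ominus>\<^bsub>M\<^esub> a \<odot>\<^bsub>M\<^esub> y"
  by (simp add: M.minus_eq smult_r_distr smult_r_minus)

lemma (in module) smult_lcomm:
  "a \<in> carrier R \<Longrightarrow> b \<in> carrier R \<Longrightarrow> x \<in> carrier M
    \<Longrightarrow> a \<odot>\<^bsub>M\<^esub> (b \<odot>\<^bsub>M\<^esub> x) = b \<odot>\<^bsub>M\<^esub> (a \<odot>\<^bsub>M\<^esub> x)"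
  by (simp add: smult_assoc1[symmetric] R.m_comm)


section \<open>Additive maps and module homomorphisms\<close>

text \<open>Linearity is not asked, so that the same facts serve homomorphisms, multiplication by a
  ring element, Koszul differentials, and also the component maps of a grading, which are not linear
  over the whole ring.\<close>

locale additive_map = G: abelian_group G + H: abelian_group H for G (structure) and H (structure) +
  fixes f
  assumes closed [simp]: "x \<in> carrier G \<Longrightarrow> f x \<in> carrier H"
    and add [simp]: "x \<in> carrier G \<Longrightarrow> y \<in> carrier G \<Longrightarrow> f (x \<oplus> y) = f x \<oplus>\<^bsub>H\<^esub> f y"
begin

lemma zero [simp]: "f \<zero> = \<zero>\<^bsub>H\<^esub>"
proof -
  have "f \<zero> \<oplus>\<^bsub>H\<^esub> f \<zero> = f \<zero>" using add[of \<zero> \<zero>] by simp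
  then show ?thesis using closed[of \<zero>] H.add.l_cancel_one by simp
qed

lemma a_inv [simp]: "x \<in> carrier G \<Longrightarrow> f (\<ominus> x) = \<ominus>\<^bsub>H\<^esub> f x"
  using add[of "\<ominus> x" x] by (intro H.minus_equality[symmetric]) (simp_all add: G.l_neg)

lemma minus [simp]: "x \<in> carrier G \<Longrightarrow> y \<in> carrier G \<Longrightarrow> f (x \<ominus> y) = f x \<ominus>\<^bsub>H\<^esub> f y"
  by (simp add: G.minus_eq H.minus_eq)

lemma finsum: "finite F \<Longrightarrow> g \<in> F \<rightarrow> carrier G \<Longrightarrow> f (\<Oplus>i\<in>F. g i) = (\<Oplus>\<^bsub>H\<^esub>i\<in>F. f (g i))"
  by (induction F rule: finite_induct) (auto simp: Pi_def)

lemma additive_subgroup_image: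
  assumes "additive_subgroup A G" shows "additive_subgroup (f ` A) H"
proof (rule H.additive_subgroupI')
  interpret A: additive_subgroup A G by fact
  show "f ` A \<subseteq> carrier H" using closed by auto
  show "\<zero>\<^bsub>H\<^esub> \<in> f ` A" using zero A.zero_closed by (metis imageI)
  show "x \<oplus>\<^bsub>H\<^esub> y \<in> f ` A" if "x \<in> f ` A" "y \<in> f ` A" for x y
    using that by (auto simp del: add simp: add[symmetric])
  show "\<ominus>\<^bsub>H\<^esub> x \<in> f ` A" if "x \<in> f ` A" for x
    using that by (auto simp del: a_inv simp: a_inv[symmetric])
qed

lemma additive_subgroup_vimage:
  assumes "additive_subgroup A H" shows "additive_subgroup {x \<in> carrier G. f x \<in> A} G"
proof (rule G.additive_subgroupI')
  interpret A: additive_subgroup A H by fact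
qed (use assms in \<open>auto simp: additive_subgroup.a_closed additive_subgroup.a_inv_closed additive_subgroup.zero_closed\<close>)

end

lemma mod_homI:
  assumes "\<And>x. x \<in> carrier M \<Longrightarrow> f x \<in> carrier N"
    and "\<And>x y. x \<in> carrier M \<Longrightarrow> y \<in> carrier M \<Longrightarrow> f (x \<oplus>\<^bsub>M\<^esub> y) = f x \<oplus>\<^bsub>N\<^esub> f y"
    and "\<And>a x. a \<in> carrier R \<Longrightarrow> x \<in> carrier M \<Longrightarrow> f (a \<odot>\<^bsub>M\<^esub> x) = a \<odot>\<^bsub>N\<^esub> f x"
  shows "f \<in> mod_hom R M N"
  using assms by (simp add: mod_hom_def)

lemma mod_homD:
  assumes "f \<in> mod_hom R M N"
  shows "x \<in> carrier M \<Longrightarrow> f x \<in> carrier N"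
    and "x \<in> carrier M \<Longrightarrow> y \<in> carrier M \<Longrightarrow> f (x \<oplus>\<^bsub>M\<^esub> y) = f x \<oplus>\<^bsub>N\<^esub> f y"
    and "a \<in> carrier R \<Longrightarrow> x \<in> carrier M \<Longrightarrow> f (a \<odot>\<^bsub>M\<^esub> x) = a \<odot>\<^bsub>N\<^esub> f x"
  using assms by (auto simp: mod_hom_def)

lemma module_abelian_group: "module R M \<Longrightarrow> abelian_group M"
  by (simp add: module_def)

lemma mod_hom_additive_map:
  "module R M \<Longrightarrow> module R N \<Longrightarrow> f \<in> mod_hom R M N \<Longrightarrow> additive_map M N f"
  by (simp add: additive_map_def additive_map_axioms_def module_abelian_group mod_homD)

lemma module_smult_additive_map:
  "module R M \<Longrightarrow> a \<in> carrier R \<Longrightarrow> additive_map M M (\<lambda>x. a \<odot>\<^bsub>M\<^esub> x)"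
  by (simp add: additive_map_def additive_map_axioms_def module_abelian_group
      module.smult_closed module.smult_r_distr)

lemma submodule_additive_subgroup: "submodule N R M \<Longrightarrow> additive_subgroup N M"
  by (simp add: submodule_def additive_subgroup_def)

lemma submoduleI':
  assumes "additive_subgroup N M" "\<And>a x. a \<in> carrier R \<Longrightarrow> x \<in> N \<Longrightarrow> a \<odot>\<^bsub>M\<^esub> x \<in> N"
  shows "submodule N R M"
  using assms by (simp add: submodule_def additive_subgroup_def submodule_axioms_def)


section \<open>Homogeneous components\<close>

definition gproj :: "('b, 'm) ring_scheme \<Rightarrow> ('i \<Rightarrow> 'b set) \<Rightarrow> 'i \<Rightarrow> 'b \<Rightarrow> 'b"
  where "gproj G A n x = (THE f. (\<forall>i. f i \<in> A i) \<and> finite {i. f i \<noteq> \<zero>\<^bsub>G\<^esub>} \<and>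
        x = (\<Oplus>\<^bsub>G\<^esub> i \<in> {i. f i \<noteq> \<zero>\<^bsub>G\<^esub>}. f i)) n"

locale direct_sum = abelian_group G for G (structure) +
  fixes A :: "'i \<Rightarrow> 'a set"
  assumes ids: "internal_direct_sum G A"
begin

abbreviation pr where "pr \<equiv> gproj G A"

lemma subgroup: "additive_subgroup (A i) G"
  using ids by (simp add: internal_direct_sum_def)

lemma sub: "x \<in> A i \<Longrightarrow> x \<in> carrier G"
  using additive_subgroup.a_Hcarr[OF subgroup] .

lemma pr_props:
  assumes "x \<in> carrier G"
  shows "pr n x \<in> A n" and "finite {n. pr n x \<noteq> \<zero>}"
    and "x = (\<Oplus> n \<in> {n. pr n x \<noteq> \<zero>}. pr n x)"
proof -
  let ?P = "\<lambda>f. (\<forall>i. f i \<in> A i) \<and> finite {i. f i \<noteq> \<zero>} \<and> x = (\<Oplus> i \<in> {i. f i \<noteq> \<zero>}. f i)"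
  have "\<exists>!f. ?P f" using ids assms by (simp add: internal_direct_sum_def)
  then have "?P (THE f. ?P f)" by (rule theI')
  then have "?P (\<lambda>n. pr n x)" by (simp add: gproj_def)
  then show "pr n x \<in> A n" and "finite {n. pr n x \<noteq> \<zero>}"
    and "x = (\<Oplus> n \<in> {n. pr n x \<noteq> \<zero>}. pr n x)" by blast+
qed

lemma pr_closed [simp]: "x \<in> carrier G \<Longrightarrow> pr n x \<in> carrier G"
  using pr_props(1) sub by blast

lemma sum_pr:
  assumes "x \<in> carrier G" "finite F" "{n. pr n x \<noteq> \<zero>} \<subseteq> F"
  shows "x = (\<Oplus> n \<in> F. pr n x)"
proof -
  have "(\<Oplus> n \<in> {n. pr n x \<noteq> \<zero>}. pr n x) = (\<Oplus> n \<in> F. pr n x)"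
    by (rule add.finprod_mono_neutral_cong_left) (use assms in auto)
  then show ?thesis using pr_props(3)[OF assms(1)] by simp
qed

lemma pr_unique:
  assumes "finite F" "\<And>i. i \<in> F \<Longrightarrow> f i \<in> A i" "\<And>i. i \<notin> F \<Longrightarrow> f i = \<zero>" "x = (\<Oplus> i \<in> F. f i)"
  shows "pr n x = f n"
proof -
  let ?P = "\<lambda>f. (\<forall>i. f i \<in> A i) \<and> finite {i. f i \<noteq> \<zero>} \<and> x = (\<Oplus> i \<in> {i. f i \<noteq> \<zero>}. f i)"
  have fA: "f i \<in> A i" for i
    using assms(2,3) additive_subgroup.zero_closed[OF subgroup] by (cases "i \<in> F") auto
  have fc: "f i \<in> carrier G" for i using fA sub by blast
  have x: "x \<in> carrier G" using fc assms(4) by (simp add: finsum_closed)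
  have fin: "finite {i. f i \<noteq> \<zero>}" using assms(3) by (intro finite_subset[OF _ assms(1)]) blast
  have "(\<Oplus> i \<in> {i. f i \<noteq> \<zero>}. f i) = (\<Oplus> i \<in> F. f i)"
    by (rule add.finprod_mono_neutral_cong_left) (use assms(1,3) fc in auto)
  then have 1: "?P f"
    using fA fin assms(4) by simp
  have "\<exists>!f. ?P f" using ids x by (simp add: internal_direct_sum_def)
  then obtain f0 where f0: "\<And>g. ?P g \<Longrightarrow> g = f0" by (rule ex1E) blast
  have "?P (\<lambda>i. pr i x)" using pr_props[OF x] by blast
  then have "(\<lambda>i. pr i x) = f" using f0[OF 1] f0 by simp
  then show ?thesis by (rule fun_cong)
qed

lemma pr_homogeneous: "x \<in> A n \<Longrightarrow> pr m x = (if m = n then x else \<zero>)"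
  by (rule pr_unique[of "{n}"]) (auto simp: sub)

lemma pr_eq_self_iff: "x \<in> carrier G \<Longrightarrow> pr n x = x \<longleftrightarrow> x \<in> A n"
  using pr_homogeneous[of x n n] pr_props(1)[of x n] by auto

end

text \<open>The images of the components of \<open>x\<close> decompose \<open>f x\<close>, and
  decompositions are unique. The index map \<open>\<sigma>\<close> is a shift of degrees in most
  uses; it may also lead from the natural degrees of the ring to the integral degrees of a module,
  and then some degrees lie outside its range.\<close>

lemma direct_sum_pr_map:
  assumes "direct_sum G A" "direct_sum H B" "additive_map G H f" "inj \<sigma>"
    and "\<And>i x. x \<in> A i \<Longrightarrow> f x \<in> B (\<sigma> i)" and x: "x \<in> carrier G"
  shows "gproj H B (\<sigma> n) (f x) = f (gproj G A n x)"
    and "k \<notin> range \<sigma> \<Longrightarrow> gproj H B k (f x) = \<zero>\<^bsub>H\<^esub>"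
proof -
  interpret G: direct_sum G A by fact
  interpret H: direct_sum H B by fact
  interpret f: additive_map G H f by fact
  define F where "F = {n. G.pr n x \<noteq> \<zero>\<^bsub>G\<^esub>}"
  have fin: "finite F" using G.pr_props(2)[OF x] by (simp add: F_def)
  have *: "f x = (\<Oplus>\<^bsub>H\<^esub> i\<in>F. f (G.pr i x))"
    using f.finsum[OF fin, of "\<lambda>i. G.pr i x"] G.pr_props(3)[OF x] x by (simp add: F_def)
  define g where "g k = (if k \<in> range \<sigma> then f (G.pr (inv_into UNIV \<sigma> k) x) else \<zero>\<^bsub>H\<^esub>)" for k
  have "f x = (\<Oplus>\<^bsub>H\<^esub> k\<in>\<sigma> ` F. g k)"
  proof -
    have "(\<Oplus>\<^bsub>H\<^esub> k\<in>\<sigma> ` F. g k) = (\<Oplus>\<^bsub>H\<^esub> i\<in>F. g (\<sigma> i))"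
      by (rule H.finsum_reindex) (use assms(4) x in \<open>auto simp: g_def intro: inj_on_subset\<close>)
    also have "\<dots> = (\<Oplus>\<^bsub>H\<^esub> i\<in>F. f (G.pr i x))"
      by (rule H.finsum_cong') (use x assms(4) in \<open>auto simp: g_def\<close>)
    finally show ?thesis using * by simp
  qed
  then have "H.pr k (f x) = g k" for k
    by (intro H.pr_unique[of "\<sigma> ` F"])
      (use fin assms(4,5) G.pr_props(1)[OF x] in \<open>auto simp: g_def F_def\<close>)
  then show "H.pr (\<sigma> n) (f x) = f (G.pr n x)" and "k \<notin> range \<sigma> \<Longrightarrow> H.pr k (f x) = \<zero>\<^bsub>H\<^esub>"
    using assms(4) by (simp_all add: g_def)
qed

context direct_sum begin

lemma pr_add:
  assumes "x \<in> carrier G" "y \<in> carrier G"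
  shows "pr n (x \<oplus> y) = pr n x \<oplus> pr n y"
proof (rule pr_unique[of "{n. pr n x \<noteq> \<zero>} \<union> {n. pr n y \<noteq> \<zero>}" ])
  let ?F = "{n. pr n x \<noteq> \<zero>} \<union> {n. pr n y \<noteq> \<zero>}"
  show "finite ?F" using pr_props(2) assms by simp
  have "x \<oplus> y = (\<Oplus> i\<in>?F. pr i x) \<oplus> (\<Oplus> i\<in>?F. pr i y)"
    using sum_pr[of x ?F] sum_pr[of y ?F] assms pr_props(2) by auto
  also have "\<dots> = (\<Oplus> i\<in>?F. pr i x \<oplus> pr i y)"
    by (rule finsum_addf[symmetric]) (use assms in auto)
  finally show "x \<oplus> y = (\<Oplus> i\<in>?F. pr i x \<oplus> pr i y)" .
qed (use assms pr_props(1) in \<open>auto simp: additive_subgroup.a_closed[OF subgroup]\<close>)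

lemma pr_additive_map: "additive_map G G (pr n)"
  by unfold_locales (simp_all add: pr_add)

lemma pr_eq_zeroD:
  assumes "x \<in> carrier G" "\<And>n. pr n x = \<zero>" shows "x = \<zero>"
  using sum_pr[of x "{}"] assms by simp

text \<open>Serves as an induction rule: if the elements with a wanted property form a subgroup,
  only homogeneous components have to be checked.\<close>

lemma pr_mem_imp_mem:
  assumes "additive_subgroup B G" "x \<in> carrier G" "\<And>n. pr n x \<in> B" shows "x \<in> B"
proof -
  have *: "(\<Oplus> n \<in> F. pr n x) \<in> B" if "finite F" for F
    using that by (induction F rule: finite_induct)
      (use assms in \<open>auto simp: additive_subgroup.zero_closed additive_subgroup.a_closed\<close>)
  show ?thesis using pr_props(2,3)[OF assms(2)] * by metis
qed

end

text \<open>Unlike direct sum decompositions, component maps pass directly to quotients, unions of chains and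
  bijective copies of a module.\<close>

definition proj_graded ::
  "('a, 'r) ring_scheme \<Rightarrow> (nat \<Rightarrow> 'a set) \<Rightarrow> ('a, 'b, 'm) module_scheme \<Rightarrow> (int \<Rightarrow> 'b \<Rightarrow> 'b) \<Rightarrow> bool"
  where "proj_graded R \<A> M \<pi> \<longleftrightarrow> module R M \<and>
    (\<forall>n. \<forall>x\<in>carrier M. \<pi> n x \<in> carrier M) \<and>
    (\<forall>n. \<forall>x\<in>carrier M. \<forall>y\<in>carrier M. \<pi> n (x \<oplus>\<^bsub>M\<^esub> y) = \<pi> n x \<oplus>\<^bsub>M\<^esub> \<pi> n y) \<and>
    (\<forall>m n. \<forall>x\<in>carrier M. \<pi> m (\<pi> n x) = (if m = n then \<pi> n x else \<zero>\<^bsub>M\<^esub>)) \<and>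
    (\<forall>x\<in>carrier M. finite {n. \<pi> n x \<noteq> \<zero>\<^bsub>M\<^esub>}) \<and>
    (\<forall>x\<in>carrier M. (\<forall>n. \<pi> n x = \<zero>\<^bsub>M\<^esub>) \<longrightarrow> x = \<zero>\<^bsub>M\<^esub>) \<and>
    (\<forall>m n. \<forall>a\<in>\<A> m. \<forall>x\<in>carrier M. \<pi> (int m + n) (a \<odot>\<^bsub>M\<^esub> x) = a \<odot>\<^bsub>M\<^esub> \<pi> n x)"

lemma proj_gradedD:
  assumes "proj_graded R \<A> M \<pi>"
  shows "module R M"
    and "x \<in> carrier M \<Longrightarrow> \<pi> n x \<in> carrier M"
    and "x \<in> carrier M \<Longrightarrow> y \<in> carrier M \<Longrightarrow> \<pi> n (x \<oplus>\<^bsub>M\<^esub> y) = \<pi> n x \<oplus>\<^bsub>M\<^esub> \<pi> n y"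
    and "x \<in> carrier M \<Longrightarrow> \<pi> m (\<pi> n x) = (if m = n then \<pi> n x else \<zero>\<^bsub>M\<^esub>)"
    and "x \<in> carrier M \<Longrightarrow> finite {n. \<pi> n x \<noteq> \<zero>\<^bsub>M\<^esub>}"
    and "x \<in> carrier M \<Longrightarrow> (\<And>n. \<pi> n x = \<zero>\<^bsub>M\<^esub>) \<Longrightarrow> x = \<zero>\<^bsub>M\<^esub>"
    and "a \<in> \<A> k \<Longrightarrow> x \<in> carrier M \<Longrightarrow> \<pi> (int k + n) (a \<odot>\<^bsub>M\<^esub> x) = a \<odot>\<^bsub>M\<^esub> \<pi> n x"
    and "additive_map M M (\<pi> n)"
proof -
  show m: "module R M"
    and "x \<in> carrier M \<Longrightarrow> \<pi> n x \<in> carrier M"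
    and "x \<in> carrier M \<Longrightarrow> y \<in> carrier M \<Longrightarrow> \<pi> n (x \<oplus>\<^bsub>M\<^esub> y) = \<pi> n x \<oplus>\<^bsub>M\<^esub> \<pi> n y"
    and "x \<in> carrier M \<Longrightarrow> \<pi> m (\<pi> n x) = (if m = n then \<pi> n x else \<zero>\<^bsub>M\<^esub>)"
    and "x \<in> carrier M \<Longrightarrow> finite {n. \<pi> n x \<noteq> \<zero>\<^bsub>M\<^esub>}"
    and "x \<in> carrier M \<Longrightarrow> (\<And>n. \<pi> n x = \<zero>\<^bsub>M\<^esub>) \<Longrightarrow> x = \<zero>\<^bsub>M\<^esub>"
    and "a \<in> \<A> k \<Longrightarrow> x \<in> carrier M \<Longrightarrow> \<pi> (int k + n) (a \<odot>\<^bsub>M\<^esub> x) = a \<odot>\<^bsub>M\<^esub> \<pi> n x"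
    using assms unfolding proj_graded_def by blast+
  show "additive_map M M (\<pi> n)"
    using assms module_abelian_group[OF m] unfolding proj_graded_def additive_map_def additive_map_axioms_def
    by blast
qed

lemma graded_moduleD:
  assumes "graded_module R \<A> M \<M>"
  shows "module R M" and "direct_sum M \<M>"
    and "a \<in> \<A> m \<Longrightarrow> x \<in> \<M> n \<Longrightarrow> a \<odot>\<^bsub>M\<^esub> x \<in> \<M> (int m + n)"
  using assms by (auto simp: graded_module_def direct_sum_def direct_sum_axioms_def module_abelian_group)

lemma graded_ringD:
  assumes "graded_ring R \<A>"
  shows "cring R" and "direct_sum R \<A>"
    and "a \<in> \<A> m \<Longrightarrow> b \<in> \<A> n \<Longrightarrow> a \<otimes>\<^bsub>R\<^esub> b \<in> \<A> (m + n)"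
  using assms by (auto simp: graded_ring_def direct_sum_def direct_sum_axioms_def cring_def ring_def)

lemma graded_module_pr_smult:
  assumes "graded_ring R \<A>" "graded_module R \<A> M \<M>" "a \<in> \<A> m" "x \<in> carrier M"
  shows "gproj M \<M> (int m + n) (a \<odot>\<^bsub>M\<^esub> x) = a \<odot>\<^bsub>M\<^esub> gproj M \<M> n x"
proof -
  have "a \<in> carrier R" using direct_sum.sub[OF graded_ringD(2)[OF assms(1)] assms(3)] .
  then show ?thesis
    by (intro direct_sum_pr_map(1)[where \<sigma> = "\<lambda>n. int m + n"] module_smult_additive_map
        graded_moduleD[OF assms(2)]) (use assms in \<open>auto simp: inj_on_def graded_moduleD\<close>)
qed

section \<open>Direct sum decompositions and component maps compared\<close>

lemma proj_graded_gproj: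
  assumes "graded_ring R \<A>" "graded_module R \<A> M \<M>"
  shows "proj_graded R \<A> M (gproj M \<M>)"
proof -
  interpret M: direct_sum M \<M> using graded_moduleD assms by blast
  show ?thesis unfolding proj_graded_def
  proof (intro conjI allI ballI impI)
    fix x assume x: "x \<in> carrier M"
    show "M.pr m (M.pr n x) = (if m = n then M.pr n x else \<zero>\<^bsub>M\<^esub>)" for m n
      by (rule M.pr_homogeneous[OF M.pr_props(1)[OF x]])
    show "x = \<zero>\<^bsub>M\<^esub>" if "\<forall>n. M.pr n x = \<zero>\<^bsub>M\<^esub>" using M.pr_eq_zeroD[OF x] that by simp
  qed (simp_all add: graded_moduleD(1)[OF assms(2)] M.pr_props(2) M.pr_add graded_module_pr_smult[OF assms])
qed

text \<open>Uniqueness of the decomposition holds because \<open>\<pi> n\<close> returns the summand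
  of degree \<open>n\<close> from a finite sum of homogeneous elements (\<open>key\<close>). For
  existence, \<open>x\<close> and the sum of its components have the same components, so their
  difference has none and vanishes.\<close>

lemma proj_graded_imp_graded_module:
  assumes R: "graded_ring R \<A>" and M: "proj_graded R \<A> M \<pi>"
  shows "graded_module R \<A> M (\<lambda>n. {x \<in> carrier M. \<pi> n x = x})" (is "graded_module R \<A> M ?M")
proof -
  note D = proj_gradedD[OF M]
  interpret M: module R M by (rule D)
  have sub: "additive_subgroup (?M n) M" for n
  proof -
    interpret \<pi>: additive_map M M "\<pi> n" by (rule D)
    show ?thesis by (rule M.additive_subgroupI') auto
  qed
  have "\<exists>!f. (\<forall>i. f i \<in> ?M i) \<and> finite {i. f i \<noteq> \<zero>\<^bsub>M\<^esub>} \<and> x = (\<Oplus>\<^bsub>M\<^esub> i \<in> {i. f i \<noteq> \<zero>\<^bsub>M\<^esub>}. f i)"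
    if x: "x \<in> carrier M" for x
  proof -
    have key: "\<pi> n (\<Oplus>\<^bsub>M\<^esub> i \<in> F. f i) = (if n \<in> F then f n else \<zero>\<^bsub>M\<^esub>)"
      if "finite F" "\<And>i. i \<in> F \<Longrightarrow> f i \<in> ?M i" for F f n
    proof -
      interpret \<pi>: additive_map M M "\<pi> n" by (rule D)
      have c: "f \<in> F \<rightarrow> carrier M" using that(2) by auto
      have 1: "\<pi> n (f i) = (if i = n then f n else \<zero>\<^bsub>M\<^esub>)" if "i \<in> F" for i
      proof -
        have fi: "f i \<in> carrier M" "\<pi> i (f i) = f i" using that \<open>\<And>i. i \<in> F \<Longrightarrow> f i \<in> ?M i\<close> by blast+
        from D(4)[where m = n and n = i, OF fi(1)] fi(2) show ?thesis by (cases "i = n") auto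
      qed
      have "\<pi> n (\<Oplus>\<^bsub>M\<^esub> i \<in> F. f i) = (\<Oplus>\<^bsub>M\<^esub> i \<in> F. \<pi> n (f i))" by (rule \<pi>.finsum) fact+
      also have "\<dots> = (\<Oplus>\<^bsub>M\<^esub> i \<in> F. if i = n then f n else \<zero>\<^bsub>M\<^esub>)"
        by (rule M.finsum_cong') (use c 1 in \<open>auto simp: Pi_iff\<close>)
      also have "\<dots> = (if n \<in> F then f n else \<zero>\<^bsub>M\<^esub>)"
      proof (cases "n \<in> F")
        case True
        then have "(\<Oplus>\<^bsub>M\<^esub> i \<in> F. if i = n then f n else \<zero>\<^bsub>M\<^esub>) = (\<Oplus>\<^bsub>M\<^esub> i \<in> {n}. f n)"
          by (intro M.add.finprod_mono_neutral_cong_right) (use that(1) c in \<open>auto simp: Pi_iff\<close>)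
        then show ?thesis using True c by (auto simp: Pi_iff)
      next
        case False
        have "(\<Oplus>\<^bsub>M\<^esub> i \<in> F. if i = n then f n else \<zero>\<^bsub>M\<^esub>) = (\<Oplus>\<^bsub>M\<^esub> i \<in> F. \<zero>\<^bsub>M\<^esub>)"
          by (rule M.finsum_cong') (use False in auto)
        then show ?thesis using False by (simp add: M.finsum_zero)
      qed
      finally show ?thesis .
    qed
    have pM: "\<pi> i x \<in> ?M i" for i using D(2,4) x by auto
    let ?F = "{i. \<pi> i x \<noteq> \<zero>\<^bsub>M\<^esub>}"
    have fin: "finite ?F" using D(5) x .
    have eq: "x = (\<Oplus>\<^bsub>M\<^esub> i \<in> ?F. \<pi> i x)" (is "x = ?s")
    proof -
      have s: "?s \<in> carrier M" by (rule M.finsum_closed) (use D(2) x in auto)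
      have "\<pi> n (x \<ominus>\<^bsub>M\<^esub> ?s) = \<zero>\<^bsub>M\<^esub>" for n
      proof -
        interpret \<pi>: additive_map M M "\<pi> n" by (rule D)
        have "\<pi> n ?s = \<pi> n x" using key[OF fin pM] by auto
        then show ?thesis using x s by (simp add: M.minus_eq M.r_neg)
      qed
      then have "x \<ominus>\<^bsub>M\<^esub> ?s = \<zero>\<^bsub>M\<^esub>" using D(6) x s by simp
      then show ?thesis using x s M.minus_eq_zero_iff by blast
    qed
    show ?thesis
    proof (rule ex1I[of _ "\<lambda>i. \<pi> i x"])
      show "(\<forall>i. \<pi> i x \<in> ?M i) \<and> finite ?F \<and> x = (\<Oplus>\<^bsub>M\<^esub> i \<in> ?F. \<pi> i x)"
        using pM fin eq by blast
      fix f assume f: "(\<forall>i. f i \<in> ?M i) \<and> finite {i. f i \<noteq> \<zero>\<^bsub>M\<^esub>} \<and> x = (\<Oplus>\<^bsub>M\<^esub> i \<in> {i. f i \<noteq> \<zero>\<^bsub>M\<^esub>}. f i)"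
      then have "\<pi> n x = f n" for n using key[of "{i. f i \<noteq> \<zero>\<^bsub>M\<^esub>}" f n] by auto
      then show "f = (\<lambda>i. \<pi> i x)" by auto
    qed
  qed
  moreover have "a \<odot>\<^bsub>M\<^esub> x \<in> ?M (int m + n)" if "a \<in> \<A> m" "x \<in> ?M n" for a m x n
  proof -
    have "a \<in> carrier R" by (rule direct_sum.sub[OF graded_ringD(2)[OF R] that(1)])
    then show ?thesis using that(2) D(7)[where x = x and n = n, OF that(1)] by simp
  qed
  ultimately show ?thesis using sub D(1)
    by (auto simp: graded_module_def internal_direct_sum_def)
qed

lemma graded_hom_pr:
  assumes "graded_module R \<A> M \<M>" "graded_module R \<A> N \<N>" "f \<in> graded_hom R M \<M> N \<N>" "x \<in> carrier M"
  shows "f (gproj M \<M> n x) = gproj N \<N> n (f x)"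
proof -
  have "additive_map M N f"
    using assms(3) by (intro mod_hom_additive_map[of R] graded_moduleD(1)[OF assms(1)] graded_moduleD(1)[OF assms(2)])
      (simp add: graded_hom_def)
  then have "gproj N \<N> (id n) (f x) = f (gproj M \<M> n x)"
    using assms(3,4) by (intro direct_sum_pr_map(1) graded_moduleD(2)[OF assms(1)] graded_moduleD(2)[OF assms(2)])
      (auto simp: graded_hom_def)
  then show ?thesis by simp
qed


section \<open>Graded rings\<close>

locale graded_cring = cring R for R (structure) +
  fixes \<A> :: "nat \<Rightarrow> 'a set"
  assumes gr: "graded_ring R \<A>"
begin

sublocale ds: direct_sum R \<A> by (rule graded_ringD[OF gr])

lemma deg_mult: "a \<in> \<A> m \<Longrightarrow> b \<in> \<A> n \<Longrightarrow> a \<otimes> b \<in> \<A> (m + n)"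
  using graded_ringD(3)[OF gr] .

lemma pr_mult:
  assumes "a \<in> \<A> m" "b \<in> carrier R"
  shows "ds.pr (m + n) (a \<otimes> b) = a \<otimes> ds.pr n b" and "k < m \<Longrightarrow> ds.pr k (a \<otimes> b) = \<zero>"
proof -
  have a: "a \<in> carrier R" using assms ds.sub by blast
  have *: "additive_map R R (\<lambda>b. a \<otimes> b)"
    by unfold_locales (use a in \<open>auto simp: r_distr\<close>)
  show "ds.pr (m + n) (a \<otimes> b) = a \<otimes> ds.pr n b"
    by (rule direct_sum_pr_map(1)[OF ds.direct_sum_axioms ds.direct_sum_axioms *, of "\<lambda>n. m + n"])
      (use assms in \<open>auto simp: deg_mult\<close>)
  show "ds.pr k (a \<otimes> b) = \<zero>" if "k < m"
    by (rule direct_sum_pr_map(2)[OF ds.direct_sum_axioms ds.direct_sum_axioms *, of "\<lambda>n. m + n"])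
      (use assms that in \<open>auto simp: deg_mult\<close>)
qed

text \<open>Comparing degrees in \<open>x \<otimes> \<one> = x\<close> for homogeneous
  \<open>x\<close> gives \<open>x \<otimes> ?e = x\<close>. By additivity this extends to all
  \<open>x\<close>, in particular to the unit element.\<close>

lemma one_deg0: "\<one> \<in> \<A> 0"
proof -
  let ?e = "ds.pr 0 \<one>"
  have e: "?e \<in> carrier R" by simp
  have "x \<otimes> ?e = x" if "x \<in> \<A> m" for x m
    using pr_mult(1)[OF that, of \<one> 0] ds.pr_homogeneous[OF that, of m] ds.sub[OF that] by simp
  then have *: "(\<ominus> \<one> \<oplus> ?e) \<otimes> x = \<zero>" if "x \<in> \<A> m" for x m
    using that ds.sub[OF that] e by (simp add: l_distr l_minus l_neg m_comm[of ?e x])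
  have "additive_subgroup {x \<in> carrier R. (\<ominus> \<one> \<oplus> ?e) \<otimes> x \<in> {\<zero>}} R"
    by (rule additive_subgroupI') (use e in \<open>auto simp: r_distr r_minus\<close>)
  from ds.pr_mem_imp_mem[OF this, of \<one>] have "\<one> \<in> {x \<in> carrier R. (\<ominus> \<one> \<oplus> ?e) \<otimes> x \<in> {\<zero>}}"
    using * ds.pr_props(1)[of \<one>] by auto
  then have "\<ominus> \<one> \<oplus> ?e = \<zero>" using e by simp
  then have "?e \<ominus> \<one> = \<zero>" using e by (simp add: minus_eq a_comm)
  then have "?e = \<one>" using minus_eq_zero_iff[OF e one_closed] by simp
  then show ?thesis using ds.pr_props(1)[of \<one> 0] by simp
qed

text \<open>Modules are graded by the integers, the ring by natural numbers. Zero components in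
  negative degrees turn the ring into a graded module, whose shifts have the component maps
  \<open>ipr (k - n)\<close>.\<close>

definition ipr :: "int \<Rightarrow> 'a \<Rightarrow> 'a"
  where "ipr k a = (if k \<ge> 0 then ds.pr (nat k) a else \<zero>)"

lemma ipr_props:
  assumes "a \<in> carrier R"
  shows "ipr k a \<in> carrier R" and "ipr m (ipr k a) = (if m = k then ipr k a else \<zero>)"
    and "finite {k. ipr k a \<noteq> \<zero>}" and "(\<And>k. ipr k a = \<zero>) \<Longrightarrow> a = \<zero>"
    and "b \<in> carrier R \<Longrightarrow> ipr k (a \<oplus> b) = ipr k a \<oplus> ipr k b"
    and "b \<in> \<A> m' \<Longrightarrow> ipr (int m' + k) (b \<otimes> a) = b \<otimes> ipr k a"
proof -
  interpret p: additive_map R R "ds.pr (nat n)" for n by (rule ds.pr_additive_map)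
  show "ipr k a \<in> carrier R" using assms by (simp add: ipr_def)
  show "ipr m (ipr k a) = (if m = k then ipr k a else \<zero>)"
    using assms ds.pr_homogeneous[OF ds.pr_props(1)[OF assms], of "nat m" "nat k"]
    by (auto simp: ipr_def)
  show "finite {k. ipr k a \<noteq> \<zero>}"
  proof (rule finite_subset)
    show "{k. ipr k a \<noteq> \<zero>} \<subseteq> int ` {k. ds.pr k a \<noteq> \<zero>}"
    proof
      fix k assume "k \<in> {k. ipr k a \<noteq> \<zero>}"
      then have "k = int (nat k)" "ds.pr (nat k) a \<noteq> \<zero>" by (auto simp: ipr_def split: if_splits)
      then show "k \<in> int ` {k. ds.pr k a \<noteq> \<zero>}" by blast
    qed
  qed (simp add: ds.pr_props(2) assms)
  show "a = \<zero>" if "\<And>k. ipr k a = \<zero>"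
  proof (rule ds.pr_eq_zeroD[OF assms])
    show "ds.pr n a = \<zero>" for n using that[of "int n"] by (simp add: ipr_def)
  qed
  show "ipr k (a \<oplus> b) = ipr k a \<oplus> ipr k b" if "b \<in> carrier R"
    using assms that by (simp add: ipr_def ds.pr_add)
  show "ipr (int m' + k) (b \<otimes> a) = b \<otimes> ipr k a" if "b \<in> \<A> m'"
  proof (cases "k \<ge> 0")
    case True
    then show ?thesis using pr_mult(1)[OF that assms, of "nat k"] by (simp add: ipr_def nat_add_distrib)
  next
    case False
    have "ds.pr (nat (int m' + k)) (b \<otimes> a) = \<zero>" if "int m' + k \<ge> 0"
      by (rule pr_mult(2)[OF \<open>b \<in> \<A> m'\<close> assms]) (use False that in linarith)
    then show ?thesis using False ds.sub[OF \<open>b \<in> \<A> m'\<close>] by (simp add: ipr_def)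
  qed
qed

lemma ipr_one: "ipr k \<one> = (if k = 0 then \<one> else \<zero>)"
proof (cases "k \<ge> 0")
  case True
  then show ?thesis using ds.pr_homogeneous[OF one_deg0, of "nat k"] by (auto simp: ipr_def)
qed (simp add: ipr_def)

end

section \<open>Quotients, products and transport of graded modules\<close>

lemma (in abelian_group) a_coset_mem_iff:
  assumes "additive_subgroup N G" "x \<in> carrier G"
  shows "y \<in> N +> x \<longleftrightarrow> y \<in> carrier G \<and> y \<ominus> x \<in> N"
proof -
  interpret N: additive_subgroup N G by fact
  show ?thesis
  proof
    assume "y \<in> N +> x"
    then obtain h where h: "h \<in> N" "y = h \<oplus> x" by (auto simp: a_r_coset_def')
    then have "y \<ominus> x = h" "y \<in> carrier G" using assms N.a_Hcarr[OF h(1)]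
      by (simp_all add: minus_eq a_assoc r_neg)
    then show "y \<in> carrier G \<and> y \<ominus> x \<in> N" using h by simp
  next
    assume y: "y \<in> carrier G \<and> y \<ominus> x \<in> N"
    then have "y = (y \<ominus> x) \<oplus> x" using assms by (simp add: minus_add_cancel)
    then show "y \<in> N +> x" using y by (auto simp: a_r_coset_def')
  qed
qed

lemma (in abelian_group) a_coset_self:
  "additive_subgroup N G \<Longrightarrow> x \<in> carrier G \<Longrightarrow> x \<in> N +> x"
  by (simp add: a_coset_mem_iff minus_eq r_neg additive_subgroup.zero_closed)

lemma (in abelian_group) a_coset_eq_iff:
  assumes N: "additive_subgroup N G" and x: "x \<in> carrier G" and y: "y \<in> carrier G"
  shows "N +> x = N +> y \<longleftrightarrow> x \<ominus> y \<in> N"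
proof
  assume "N +> x = N +> y"
  then show "x \<ominus> y \<in> N" using a_coset_self[OF N x] a_coset_mem_iff[OF N y] by blast
next
  assume xy: "x \<ominus> y \<in> N"
  have yx: "y \<ominus> x \<in> N" by (rule minus_mem_sym[OF N x y xy])
  show "N +> x = N +> y"
  proof (rule Set.set_eqI)
    fix z
    show "z \<in> N +> x \<longleftrightarrow> z \<in> N +> y"
      using minus_mem_trans[OF N _ x y _ xy, of z] minus_mem_trans[OF N _ y x _ yx, of z]
      by (auto simp: a_coset_mem_iff[OF N x] a_coset_mem_iff[OF N y])
  qed
qed

lemma (in abelian_group) minus_zero_right: "x \<in> carrier G \<Longrightarrow> x \<ominus> \<zero> = x"
  using minus_equality[of \<zero> \<zero>] by (simp add: minus_eq)

lemma (in abelian_group) a_coset_zero: "additive_subgroup N G \<Longrightarrow> N +> \<zero> = N"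
  by (auto simp: a_coset_mem_iff minus_zero_right additive_subgroup.a_Hcarr)

lemma (in abelian_group) a_coset_add:
  "additive_subgroup N G \<Longrightarrow> x \<in> carrier G \<Longrightarrow> y \<in> carrier G
    \<Longrightarrow> (N +> x) <+> (N +> y) = N +> (x \<oplus> y)"
  by (rule abelian_subgroup.a_rcos_sum[OF abelian_subgroupI3]) (simp_all add: abelian_group_axioms)

text \<open>Operations on quotients are unions over all representatives of a class. Such a union is
  a single coset as soon as \<open>f\<close> respects congruence modulo \<open>N\<close>.\<close>

lemma (in abelian_group) a_coset_UN:
  assumes N: "additive_subgroup N G" and x: "x \<in> carrier G"
    and "\<And>y. y \<in> carrier G \<Longrightarrow> f y \<in> carrier G"
    and "\<And>y. y \<in> carrier G \<Longrightarrow> y \<ominus> x \<in> N \<Longrightarrow> f y \<ominus> f x \<in> N"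
  shows "(\<Union>y\<in>N +> x. N +> f y) = N +> f x"
proof -
  have "N +> f y = N +> f x" if "y \<in> N +> x" for y
    using that assms(3,4) x by (simp add: a_coset_mem_iff[OF N x] a_coset_eq_iff[OF N])
  then have "(\<Union>y\<in>N +> x. N +> f y) = (\<Union>y\<in>N +> x. N +> f x)" by (intro SUP_cong refl)
  then show ?thesis using a_coset_self[OF N x] by blast
qed

lemma quotient_module_sel:
  "carrier (quotient_module M N) = (\<lambda>x. N +>\<^bsub>M\<^esub> x) ` carrier M"
  "\<zero>\<^bsub>quotient_module M N\<^esub> = N"
  by (auto simp: quotient_module_def A_RCOSETS_def')

context module begin

context
  fixes N assumes N: "submodule N R M"
begin

lemma quotient_module_add:
  "x \<in> carrier M \<Longrightarrow> y \<in> carrier M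
    \<Longrightarrow> (N +>\<^bsub>M\<^esub> x) \<oplus>\<^bsub>quotient_module M N\<^esub> (N +>\<^bsub>M\<^esub> y) = N +>\<^bsub>M\<^esub> (x \<oplus>\<^bsub>M\<^esub> y)"
  using M.a_coset_add[OF submodule_additive_subgroup[OF N]] by (simp add: quotient_module_def)

lemma quotient_module_smult:
  assumes "a \<in> carrier R" "x \<in> carrier M"
  shows "a \<odot>\<^bsub>quotient_module M N\<^esub> (N +>\<^bsub>M\<^esub> x) = N +>\<^bsub>M\<^esub> (a \<odot>\<^bsub>M\<^esub> x)"
proof -
  have "(\<Union>y\<in>N +>\<^bsub>M\<^esub> x. N +>\<^bsub>M\<^esub> (a \<odot>\<^bsub>M\<^esub> y)) = N +>\<^bsub>M\<^esub> (a \<odot>\<^bsub>M\<^esub> x)"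
    by (rule M.a_coset_UN[OF submodule_additive_subgroup[OF N]])
      (use assms submodule.smult_closed[OF N] in \<open>auto simp: smult_minus_distrib[symmetric]\<close>)
  then show ?thesis by (simp add: quotient_module_def)
qed

lemma quotient_is_module: "module R (quotient_module M N)" (is "module R ?Q")
proof -
  note sel = quotient_module_sel quotient_module_add quotient_module_smult
  have "abelian_group ?Q"
  proof (rule abelian_groupI)
    show "\<zero>\<^bsub>?Q\<^esub> \<in> carrier ?Q"
      using M.a_coset_zero[OF submodule_additive_subgroup[OF N]] by (force simp: sel)
    show "\<zero>\<^bsub>?Q\<^esub> \<oplus>\<^bsub>?Q\<^esub> x = x" if x: "x \<in> carrier ?Q" for x
    proof -
      obtain y where y: "y \<in> carrier M" "x = N +>\<^bsub>M\<^esub> y" using x by (auto simp: sel)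
      have z: "\<zero>\<^bsub>?Q\<^esub> = N +>\<^bsub>M\<^esub> \<zero>\<^bsub>M\<^esub>"
        using M.a_coset_zero[OF submodule_additive_subgroup[OF N]] by (simp add: sel)
      show ?thesis unfolding z y(2) using y(1) by (simp add: quotient_module_add)
    qed
    show "\<exists>y\<in>carrier ?Q. y \<oplus>\<^bsub>?Q\<^esub> x = \<zero>\<^bsub>?Q\<^esub>" if x: "x \<in> carrier ?Q" for x
    proof -
      obtain y where y: "y \<in> carrier M" "x = N +>\<^bsub>M\<^esub> y" using x by (auto simp: sel)
      then have "(N +>\<^bsub>M\<^esub> \<ominus>\<^bsub>M\<^esub> y) \<oplus>\<^bsub>?Q\<^esub> x = \<zero>\<^bsub>?Q\<^esub>"
        using M.a_coset_zero[OF submodule_additive_subgroup[OF N]] by (simp add: sel M.l_neg)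
      then show ?thesis using y by (auto simp: sel)
    qed
  qed (auto simp: sel M.a_ac)
  then show ?thesis
    by (intro moduleI) (auto simp: sel R.is_cring smult_l_distr smult_r_distr smult_assoc1)
qed

lemma quotient_module_proj_hom: "(\<lambda>x. N +>\<^bsub>M\<^esub> x) \<in> mod_hom R M (quotient_module M N)"
  by (rule mod_homI) (auto simp: quotient_module_sel quotient_module_add quotient_module_smult)

lemma quotient_module_zero_iff: "x \<in> carrier M \<Longrightarrow> N +>\<^bsub>M\<^esub> x = \<zero>\<^bsub>quotient_module M N\<^esub> \<longleftrightarrow> x \<in> N"
  using M.a_coset_eq_iff[OF submodule_additive_subgroup[OF N], of x "\<zero>\<^bsub>M\<^esub>"]
    M.a_coset_zero[OF submodule_additive_subgroup[OF N]]
  by (simp add: quotient_module_sel M.minus_zero_right)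

end

end

text \<open>Ring and carrier may shrink together: with \<open>R' = R\<close> this yields the module
  of cocycles, with the degree zero ring a graded component.\<close>

lemma module_restrict:
  fixes M (structure)
  assumes "module R M" "cring R'" "carrier R' \<subseteq> carrier R" "\<one>\<^bsub>R'\<^esub> = \<one>\<^bsub>R\<^esub>"
    "\<And>a b. a \<in> carrier R' \<Longrightarrow> b \<in> carrier R' \<Longrightarrow> a \<oplus>\<^bsub>R'\<^esub> b = a \<oplus>\<^bsub>R\<^esub> b"
    "\<And>a b. a \<in> carrier R' \<Longrightarrow> b \<in> carrier R' \<Longrightarrow> a \<otimes>\<^bsub>R'\<^esub> b = a \<otimes>\<^bsub>R\<^esub> b"
    and S: "additive_subgroup S M" "\<And>a x. a \<in> carrier R' \<Longrightarrow> x \<in> S \<Longrightarrow> a \<odot> x \<in> S"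
  shows "module R' (M\<lparr>carrier := S\<rparr>)"
proof -
  interpret M: module R M by fact
  interpret S: additive_subgroup S M by fact
  have S': "x \<in> carrier M" if "x \<in> S" for x using that by (rule S.a_Hcarr)
  have "abelian_group (M\<lparr>carrier := S\<rparr>)"
  proof (rule abelian_groupI)
    show "\<exists>y\<in>carrier (M\<lparr>carrier := S\<rparr>). y \<oplus>\<^bsub>M\<lparr>carrier := S\<rparr>\<^esub> x = \<zero>\<^bsub>M\<lparr>carrier := S\<rparr>\<^esub>"
      if "x \<in> carrier (M\<lparr>carrier := S\<rparr>)" for x
      using that S' by (intro bexI[of _ "\<ominus> x"]) (auto simp: M.l_neg)
  qed (auto simp: S' M.a_ac)
  then show ?thesis
    using assms(3)
    by (intro moduleI)
      (auto simp: S' S(2) assms(2,4-6) M.smult_l_distr M.smult_r_distr M.smult_assoc1 subsetD)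
qed

text \<open>Both maps are additive and agree on homogeneous elements, hence everywhere.\<close>

lemma proj_graded_sum:
  assumes R: "graded_ring R \<A>" and M: "proj_graded R \<A> M \<pi>" and x: "x \<in> carrier M"
  shows "gproj M (\<lambda>n. {x \<in> carrier M. \<pi> n x = x}) n x = \<pi> n x"
proof -
  note D = proj_gradedD[OF M]
  interpret M: direct_sum M "\<lambda>n. {x \<in> carrier M. \<pi> n x = x}"
    by (rule graded_moduleD(2)[OF proj_graded_imp_graded_module[OF R M]])
  let ?G = "gproj M (\<lambda>n. {x \<in> carrier M. \<pi> n x = x})"
  interpret p: additive_map M M "\<pi> n" by (rule D)
  have "additive_subgroup {y \<in> carrier M. \<pi> n y \<ominus>\<^bsub>M\<^esub> ?G n y \<in> {\<zero>\<^bsub>M\<^esub>}} M"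
  proof -
    interpret q: additive_map M M "?G n" by (rule M.pr_additive_map)
    interpret d: additive_map M M "\<lambda>y. \<pi> n y \<ominus>\<^bsub>M\<^esub> ?G n y"
      by unfold_locales (auto simp: M.minus_add_distrib)
    show ?thesis by (rule d.additive_subgroup_vimage) (auto intro!: M.additive_subgroupI')
  qed
  then have "x \<in> {y \<in> carrier M. \<pi> n y \<ominus>\<^bsub>M\<^esub> ?G n y \<in> {\<zero>\<^bsub>M\<^esub>}}"
  proof (rule M.pr_mem_imp_mem)
    fix k
    have k: "?G k x \<in> carrier M" "\<pi> k (?G k x) = ?G k x" using M.pr_props(1)[OF x, of k] by auto
    have 1: "\<pi> n (?G k x) = (if n = k then ?G k x else \<zero>\<^bsub>M\<^esub>)"
      using D(4)[OF k(1), of n k] k(2) by simp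
    have 2: "?G n (?G k x) = (if n = k then ?G k x else \<zero>\<^bsub>M\<^esub>)"
      by (rule M.pr_homogeneous[OF M.pr_props(1)[OF x]])
    show "?G k x \<in> {y \<in> carrier M. \<pi> n y \<ominus>\<^bsub>M\<^esub> ?G n y \<in> {\<zero>\<^bsub>M\<^esub>}}"
      using k(1) 1 2 by (auto simp: M.minus_eq M.r_neg)
  qed (rule x)
  then show ?thesis using x M.minus_eq_zero_iff by auto
qed

lemma proj_graded_mem:
  assumes R: "graded_ring R \<A>" and M: "proj_graded R \<A> M \<pi>"
    and N: "additive_subgroup N M" and x: "x \<in> carrier M" "\<And>n. \<pi> n x \<in> N"
  shows "x \<in> N"
  by (rule direct_sum.pr_mem_imp_mem[OF graded_moduleD(2)[OF proj_graded_imp_graded_module[OF R M]] N])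
    (use x proj_graded_sum[OF R M] in auto)

section \<open>Gradings of quotients\<close>

definition quotient_proj ::
  "('a, 'b, 'm) module_scheme \<Rightarrow> 'b set \<Rightarrow> (int \<Rightarrow> 'b \<Rightarrow> 'b) \<Rightarrow> int \<Rightarrow> 'b set \<Rightarrow> 'b set"
  where "quotient_proj M N \<pi> n C = (\<Union>x\<in>C. N +>\<^bsub>M\<^esub> \<pi> n x)"

lemma quotient_proj_graded:
  assumes R: "graded_ring R \<A>" and M: "proj_graded R \<A> M \<pi>"
    and N: "submodule N R M" and hom: "\<And>n x. x \<in> N \<Longrightarrow> \<pi> n x \<in> N"
  shows "proj_graded R \<A> (quotient_module M N) (quotient_proj M N \<pi>)"
    and "x \<in> carrier M \<Longrightarrow> quotient_proj M N \<pi> n (N +>\<^bsub>M\<^esub> x) = N +>\<^bsub>M\<^esub> \<pi> n x"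
proof -
  note D = proj_gradedD[OF M]
  interpret M: module R M by (rule D)
  note Ns = submodule_additive_subgroup[OF N]
  show q: "quotient_proj M N \<pi> n (N +>\<^bsub>M\<^esub> x) = N +>\<^bsub>M\<^esub> \<pi> n x" if "x \<in> carrier M" for x n
  proof -
    interpret p: additive_map M M "\<pi> n" by (rule D)
    show ?thesis unfolding quotient_proj_def
    proof (rule M.a_coset_UN[OF Ns that])
      fix y assume "y \<in> carrier M" "y \<ominus>\<^bsub>M\<^esub> x \<in> N"
      then show "\<pi> n y \<ominus>\<^bsub>M\<^esub> \<pi> n x \<in> N" using hom[of "y \<ominus>\<^bsub>M\<^esub> x" n] that by simp
    qed simp
  qed
  note sel = quotient_module_sel(1) M.quotient_module_add[OF N] M.quotient_module_smult[OF N]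
    M.quotient_module_zero_iff[OF N]
  have z: "N +>\<^bsub>M\<^esub> \<zero>\<^bsub>M\<^esub> = \<zero>\<^bsub>quotient_module M N\<^esub>"
    using sel(4)[of "\<zero>\<^bsub>M\<^esub>"] additive_subgroup.zero_closed[OF Ns] by simp
  show "proj_graded R \<A> (quotient_module M N) (quotient_proj M N \<pi>)"
    unfolding proj_graded_def
  proof (intro conjI allI ballI impI)
    show "module R (quotient_module M N)" by (rule M.quotient_is_module[OF N])
    fix C assume "C \<in> carrier (quotient_module M N)"
    then obtain x where x: "x \<in> carrier M" "C = N +>\<^bsub>M\<^esub> x" by (auto simp: sel(1))
    show "quotient_proj M N \<pi> n C \<in> carrier (quotient_module M N)" for n
      unfolding x(2) q[OF x(1)] sel(1) by (rule imageI, rule D(2), rule x(1))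
    show "quotient_proj M N \<pi> m (quotient_proj M N \<pi> n C) =
        (if m = n then quotient_proj M N \<pi> n C else \<zero>\<^bsub>quotient_module M N\<^esub>)" for m n
      unfolding x(2) q[OF x(1)] q[OF D(2)[OF x(1)]] D(4)[OF x(1)] using z by simp
    show "finite {n. quotient_proj M N \<pi> n C \<noteq> \<zero>\<^bsub>quotient_module M N\<^esub>}"
    proof (rule finite_subset[OF _ D(5)[OF x(1)]])
      have "\<pi> n x \<noteq> \<zero>\<^bsub>M\<^esub>" if "N +>\<^bsub>M\<^esub> \<pi> n x \<noteq> \<zero>\<^bsub>quotient_module M N\<^esub>" for n
        using that z by metis
      then show "{n. quotient_proj M N \<pi> n C \<noteq> \<zero>\<^bsub>quotient_module M N\<^esub>} \<subseteq> {n. \<pi> n x \<noteq> \<zero>\<^bsub>M\<^esub>}"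
        unfolding x(2) q[OF x(1)] by blast
    qed
    show "C = \<zero>\<^bsub>quotient_module M N\<^esub>" if "\<forall>n. quotient_proj M N \<pi> n C = \<zero>\<^bsub>quotient_module M N\<^esub>"
    proof -
      have "\<pi> n x \<in> N" for n
        using spec[OF that, of n] x sel(4)[OF D(2)[OF x(1)], of n] by (simp add: q)
      then have "x \<in> N" by (rule proj_graded_mem[OF R M Ns x(1)])
      then show ?thesis using x sel(4)[OF x(1)] by simp
    qed
    show "quotient_proj M N \<pi> n (C \<oplus>\<^bsub>quotient_module M N\<^esub> C') =
        quotient_proj M N \<pi> n C \<oplus>\<^bsub>quotient_module M N\<^esub> quotient_proj M N \<pi> n C'"
      if C': "C' \<in> carrier (quotient_module M N)" for n C'
    proof -
      obtain y where y: "y \<in> carrier M" "C' = N +>\<^bsub>M\<^esub> y" using C' by (auto simp: sel(1))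
      show ?thesis unfolding x(2) y(2) using x(1) y(1) D(2,3) by (simp add: q sel(2))
    qed
    show "quotient_proj M N \<pi> (int m + n) (a \<odot>\<^bsub>quotient_module M N\<^esub> C) =
        a \<odot>\<^bsub>quotient_module M N\<^esub> quotient_proj M N \<pi> n C" if "a \<in> \<A> m" for m n a
      unfolding x(2)
      using x(1) D(2) D(7)[OF that x(1)] direct_sum.sub[OF graded_ringD(2)[OF R] that]
      by (simp add: q sel(3))
  qed
qed

section \<open>Adjoining a free generator\<close>

definition adjoin_module ::
  "('a, 'r) ring_scheme \<Rightarrow> ('a, 'b, 'm) module_scheme \<Rightarrow> ('a, 'b \<times> 'a) module"
  where "adjoin_module R M = \<lparr>carrier = carrier M \<times> carrier R, monoid.mult = undefined,
    monoid.one = undefined, ring.zero = (\<zero>\<^bsub>M\<^esub>, \<zero>\<^bsub>R\<^esub>),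
    ring.add = (\<lambda>p q. (fst p \<oplus>\<^bsub>M\<^esub> fst q, snd p \<oplus>\<^bsub>R\<^esub> snd q)),
    smult = (\<lambda>a p. (a \<odot>\<^bsub>M\<^esub> fst p, a \<otimes>\<^bsub>R\<^esub> snd p))\<rparr>"

lemma adjoin_module_sel [simp]:
  "carrier (adjoin_module R M) = carrier M \<times> carrier R"
  "\<zero>\<^bsub>adjoin_module R M\<^esub> = (\<zero>\<^bsub>M\<^esub>, \<zero>\<^bsub>R\<^esub>)"
  "p \<oplus>\<^bsub>adjoin_module R M\<^esub> q = (fst p \<oplus>\<^bsub>M\<^esub> fst q, snd p \<oplus>\<^bsub>R\<^esub> snd q)"
  "a \<odot>\<^bsub>adjoin_module R M\<^esub> p = (a \<odot>\<^bsub>M\<^esub> fst p, a \<otimes>\<^bsub>R\<^esub> snd p)"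
  by (simp_all add: adjoin_module_def)

lemma (in module) adjoin_is_module: "module R (adjoin_module R M)"
proof -
  have "abelian_group (adjoin_module R M)"
  proof (rule abelian_groupI)
    show "\<exists>y\<in>carrier (adjoin_module R M). y \<oplus>\<^bsub>adjoin_module R M\<^esub> x = \<zero>\<^bsub>adjoin_module R M\<^esub>"
      if "x \<in> carrier (adjoin_module R M)" for x
      using that by (intro bexI[of _ "(\<ominus>\<^bsub>M\<^esub> fst x, \<ominus>\<^bsub>R\<^esub> snd x)"]) (auto simp: M.l_neg R.l_neg)
  qed (auto simp: M.a_ac R.a_ac)
  then show ?thesis
    by (intro moduleI)
      (auto simp: R.is_cring smult_l_distr smult_r_distr smult_assoc1 R.l_distr R.r_distr R.m_assoc)
qed

lemma (in module) adjoin_minus: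
  assumes "x \<in> carrier M" "y \<in> carrier M" "a \<in> carrier R" "b \<in> carrier R"
  shows "(x, a) \<ominus>\<^bsub>adjoin_module R M\<^esub> (y, b) = (x \<ominus>\<^bsub>M\<^esub> y, a \<ominus> b)"
proof -
  interpret P: module R "adjoin_module R M" by (rule adjoin_is_module)
  have "\<ominus>\<^bsub>adjoin_module R M\<^esub> (y, b) = (\<ominus>\<^bsub>M\<^esub> y, \<ominus> b)"
    by (rule P.minus_equality) (use assms in \<open>auto simp: M.l_neg R.l_neg\<close>)
  then show ?thesis by (simp add: P.minus_eq M.minus_eq R.minus_eq)
qed

lemma (in graded_cring) adjoin_proj_graded:
  assumes "proj_graded R \<A> M \<pi>"
  shows "proj_graded R \<A> (adjoin_module R M) (\<lambda>k p. (\<pi> k (fst p), ipr (k - n) (snd p)))"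
proof -
  note D = proj_gradedD[OF assms]
  interpret M: module R M by (rule D)
  show ?thesis unfolding proj_graded_def
  proof (intro conjI allI ballI impI)
    show "module R (adjoin_module R M)" by (rule M.adjoin_is_module)
    fix p assume p: "p \<in> carrier (adjoin_module R M)"
    then obtain x r where xr: "x \<in> carrier M" "r \<in> carrier R" "p = (x, r)" by auto
    show "finite {k. (\<pi> k (fst p), ipr (k - n) (snd p)) \<noteq> \<zero>\<^bsub>adjoin_module R M\<^esub>}"
    proof (rule finite_subset)
      show "{k. (\<pi> k (fst p), ipr (k - n) (snd p)) \<noteq> \<zero>\<^bsub>adjoin_module R M\<^esub>}
          \<subseteq> {k. \<pi> k x \<noteq> \<zero>\<^bsub>M\<^esub>} \<union> (\<lambda>k. k + n) ` {k. ipr k r \<noteq> \<zero>}"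
      proof
        fix k assume "k \<in> {k. (\<pi> k (fst p), ipr (k - n) (snd p)) \<noteq> \<zero>\<^bsub>adjoin_module R M\<^esub>}"
        then have "\<pi> k x \<noteq> \<zero>\<^bsub>M\<^esub> \<or> k - n \<in> {k. ipr k r \<noteq> \<zero>}" using xr by auto
        moreover have "k = (k - n) + n" by simp
        ultimately show "k \<in> {k. \<pi> k x \<noteq> \<zero>\<^bsub>M\<^esub>} \<union> (\<lambda>k. k + n) ` {k. ipr k r \<noteq> \<zero>}" by blast
      qed
    qed (use D(5)[OF xr(1)] ipr_props(3)[OF xr(2)] in simp)
    show "p = \<zero>\<^bsub>adjoin_module R M\<^esub>"
      if z: "\<forall>k. (\<pi> k (fst p), ipr (k - n) (snd p)) = \<zero>\<^bsub>adjoin_module R M\<^esub>"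
    proof -
      have "ipr k r = \<zero>" for k using spec[OF z, of "k + n"] xr by simp
      moreover have "\<pi> k x = \<zero>\<^bsub>M\<^esub>" for k using spec[OF z, of k] xr by simp
      ultimately show ?thesis using D(6)[OF xr(1)] ipr_props(4)[OF xr(2)] xr by simp
    qed
    show "(\<pi> (int m + k) (fst (a \<odot>\<^bsub>adjoin_module R M\<^esub> p)), ipr (int m + k - n) (snd (a \<odot>\<^bsub>adjoin_module R M\<^esub> p)))
        = a \<odot>\<^bsub>adjoin_module R M\<^esub> (\<pi> k (fst p), ipr (k - n) (snd p))" if "a \<in> \<A> m" for a m k
      using D(7)[OF that xr(1)] ipr_props(6)[OF xr(2) that, of "k - n"] xr by (simp add: algebra_simps)
  qed (auto simp: D(2,3,4) ipr_props)
qed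

section \<open>Transport of structure along an injection\<close>

definition transport_module ::
  "('a, 'b, 'm) module_scheme \<Rightarrow> ('b \<Rightarrow> 'c) \<Rightarrow> ('a, 'c) module"
  where "transport_module M b = (let g = inv_into (carrier M) b in
    \<lparr>carrier = b ` carrier M, monoid.mult = undefined, monoid.one = undefined, ring.zero = b \<zero>\<^bsub>M\<^esub>,
    ring.add = (\<lambda>u v. b (g u \<oplus>\<^bsub>M\<^esub> g v)), smult = (\<lambda>a u. b (a \<odot>\<^bsub>M\<^esub> g u))\<rparr>)"

definition transport_proj ::
  "('a, 'b, 'm) module_scheme \<Rightarrow> ('b \<Rightarrow> 'c) \<Rightarrow> (int \<Rightarrow> 'b \<Rightarrow> 'b) \<Rightarrow> int \<Rightarrow> 'c \<Rightarrow> 'c"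
  where "transport_proj M b \<pi> n u = b (\<pi> n (inv_into (carrier M) b u))"

lemma transport_sel:
  "carrier (transport_module M b) = b ` carrier M" "\<zero>\<^bsub>transport_module M b\<^esub> = b \<zero>\<^bsub>M\<^esub>"
  "inj_on b (carrier M) \<Longrightarrow> x \<in> carrier M \<Longrightarrow> y \<in> carrier M
    \<Longrightarrow> b x \<oplus>\<^bsub>transport_module M b\<^esub> b y = b (x \<oplus>\<^bsub>M\<^esub> y)"
  "inj_on b (carrier M) \<Longrightarrow> x \<in> carrier M \<Longrightarrow> a \<odot>\<^bsub>transport_module M b\<^esub> b x = b (a \<odot>\<^bsub>M\<^esub> x)"
  "inj_on b (carrier M) \<Longrightarrow> x \<in> carrier M \<Longrightarrow> transport_proj M b \<pi> n (b x) = b (\<pi> n x)"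
  by (simp_all add: transport_module_def transport_proj_def Let_def)

lemma transport_proj_graded:
  assumes R: "graded_ring R \<A>" and M: "proj_graded R \<A> M \<pi>" and b: "inj_on b (carrier M)"
  shows "proj_graded R \<A> (transport_module M b) (transport_proj M b \<pi>)" (is "proj_graded R \<A> ?T ?\<pi>")
proof -
  note D = proj_gradedD[OF M]
  interpret M: module R M by (rule D)
  note sel = transport_sel(1,2) transport_sel(3-5)[OF b]
  have eq: "b x = b y \<longleftrightarrow> x = y" if "x \<in> carrier M" "y \<in> carrier M" for x y
    using b that by (auto dest: inj_onD)
  have "abelian_group ?T"
  proof (rule abelian_groupI)
    show "\<exists>y\<in>carrier ?T. y \<oplus>\<^bsub>?T\<^esub> u = \<zero>\<^bsub>?T\<^esub>" if u: "u \<in> carrier ?T" for u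
    proof -
      obtain x where x: "x \<in> carrier M" "u = b x" using u by (auto simp: sel)
      then have "b (\<ominus>\<^bsub>M\<^esub> x) \<oplus>\<^bsub>?T\<^esub> u = \<zero>\<^bsub>?T\<^esub>" by (simp add: sel M.l_neg)
      then show ?thesis using x by (auto simp: sel)
    qed
  qed (auto simp: sel M.a_ac)
  then have "module R ?T"
    by (intro moduleI) (auto simp: sel M.R.is_cring M.smult_l_distr M.smult_r_distr M.smult_assoc1)
  moreover have "?\<pi> m (?\<pi> n u) = (if m = n then ?\<pi> n u else \<zero>\<^bsub>?T\<^esub>)" if "u \<in> carrier ?T" for m n u
    using that D(2,4) by (auto simp: sel)
  moreover have "finite {n. ?\<pi> n u \<noteq> \<zero>\<^bsub>?T\<^esub>}" if u: "u \<in> carrier ?T" for u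
  proof -
    obtain x where x: "x \<in> carrier M" "u = b x" using u by (auto simp: sel)
    then have "{n. ?\<pi> n u \<noteq> \<zero>\<^bsub>?T\<^esub>} = {n. \<pi> n x \<noteq> \<zero>\<^bsub>M\<^esub>}" using D(2) by (auto simp: sel eq)
    then show ?thesis using D(5) x by simp
  qed
  moreover have "u = \<zero>\<^bsub>?T\<^esub>" if "u \<in> carrier ?T" "\<forall>n. ?\<pi> n u = \<zero>\<^bsub>?T\<^esub>" for u
    using that D(2,6) by (auto simp: sel eq)
  moreover have "?\<pi> (int m + n) (a \<odot>\<^bsub>?T\<^esub> u) = a \<odot>\<^bsub>?T\<^esub> ?\<pi> n u" if "a \<in> \<A> m" "u \<in> carrier ?T" for a m n u
    using that D(2) D(7)[OF that(1)] direct_sum.sub[OF graded_ringD(2)[OF R] that(1)] by (auto simp: sel)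
  ultimately show ?thesis
    using D(2,3) unfolding proj_graded_def by (auto simp: sel)
qed

section \<open>Graded injective modules and Baer's criterion\<close>

lemma (in cring) ideal_criterion:
  assumes "I \<subseteq> carrier R" "\<zero> \<in> I" "\<And>a b. a \<in> I \<Longrightarrow> b \<in> I \<Longrightarrow> a \<oplus> b \<in> I"
    and mult: "\<And>r a. r \<in> carrier R \<Longrightarrow> a \<in> I \<Longrightarrow> r \<otimes> a \<in> I"
  shows "ideal I R"
proof (rule idealI)
  show "ring R" by (rule ring_axioms)
  have "\<ominus> a \<in> I" if "a \<in> I" for a
    using mult[of "\<ominus> \<one>" a] that assms(1) by (auto simp: l_minus)
  then show "subgroup I (add_monoid R)"
    using assms by (auto simp: subgroup_def a_inv_def)
  show "a \<otimes> x \<in> I" "x \<otimes> a \<in> I" if "a \<in> I" "x \<in> carrier R" for a x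
    using mult[OF that(2,1)] that assms(1) by (auto simp: m_comm subsetD)
qed

context graded_cring begin

lemma ipr_additive_map: "additive_map R R (ipr k)"
  by unfold_locales (simp_all add: ipr_props)

lemma proj_smult_homogeneous:
  assumes M: "proj_graded R \<A> M \<pi>" and x: "x \<in> carrier M" "\<pi> n x = x" and a: "a \<in> carrier R"
  shows "\<pi> (k + n) (a \<odot>\<^bsub>M\<^esub> x) = ipr k a \<odot>\<^bsub>M\<^esub> x"
proof -
  let ?M = "\<lambda>n. {x \<in> carrier M. \<pi> n x = x}"
  note D = proj_gradedD[OF M]
  interpret M: module R M by (rule D)
  have dM: "direct_sum M ?M" by (rule graded_moduleD(2)[OF proj_graded_imp_graded_module[OF gr M]])
  have T: "additive_map R M (\<lambda>a. a \<odot>\<^bsub>M\<^esub> x)"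
    by unfold_locales (use x in \<open>auto simp: M.smult_l_distr\<close>)
  have T': "b \<odot>\<^bsub>M\<^esub> x \<in> ?M (int m + n)" if "b \<in> \<A> m" for b m
    using D(7)[OF that x(1), of n] x ds.sub[OF that] by simp
  have inj: "inj (\<lambda>m. int m + n)" by (simp add: inj_on_def)
  have G: "gproj M ?M (k + n) (a \<odot>\<^bsub>M\<^esub> x) = \<pi> (k + n) (a \<odot>\<^bsub>M\<^esub> x)"
    using proj_graded_sum[OF gr M] x a by simp
  show ?thesis
  proof (cases "k \<ge> 0")
    case True
    have "gproj M ?M (int (nat k) + n) (a \<odot>\<^bsub>M\<^esub> x) = ds.pr (nat k) a \<odot>\<^bsub>M\<^esub> x"
      using direct_sum_pr_map(1)[OF ds.direct_sum_axioms dM T inj T' a, of "nat k"] by simp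
    then show ?thesis using True G by (simp add: ipr_def)
  next
    case False
    have "gproj M ?M (k + n) (a \<odot>\<^bsub>M\<^esub> x) = \<zero>\<^bsub>M\<^esub>"
      by (rule direct_sum_pr_map(2)[OF ds.direct_sum_axioms dM T inj T' a]) (use False in auto)
    then show ?thesis using False G x by (simp add: ipr_def)
  qed
qed

text \<open>A homomorphism of degree \<open>n\<close> from a homogeneous ideal, in other words a
  degree-preserving homomorphism from a shift of \<open>I\<close>.\<close>

definition ideal_hom ::
  "('a, 'c, 'd) module_scheme \<Rightarrow> (int \<Rightarrow> 'c \<Rightarrow> 'c) \<Rightarrow> int \<Rightarrow> 'a set \<Rightarrow> ('a \<Rightarrow> 'c) \<Rightarrow> bool"
  where "ideal_hom M \<pi> n I f \<longleftrightarrow> ideal I R \<and> (\<forall>a\<in>I. \<forall>k. ipr k a \<in> I) \<and>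
    (\<forall>a\<in>I. f a \<in> carrier M) \<and> (\<forall>a\<in>I. \<forall>b\<in>I. f (a \<oplus> b) = f a \<oplus>\<^bsub>M\<^esub> f b) \<and>
    (\<forall>r\<in>carrier R. \<forall>a\<in>I. f (r \<otimes> a) = r \<odot>\<^bsub>M\<^esub> f a) \<and>
    (\<forall>a\<in>I. \<forall>k. \<pi> (k + n) (f a) = f (ipr k a))"

definition baer :: "('a, 'c, 'd) module_scheme \<Rightarrow> (int \<Rightarrow> 'c \<Rightarrow> 'c) \<Rightarrow> bool"
  where "baer M \<pi> \<longleftrightarrow> (\<forall>n I f. ideal_hom M \<pi> n I f \<longrightarrow>
    (\<exists>e\<in>carrier M. \<pi> n e = e \<and> (\<forall>a\<in>I. f a = a \<odot>\<^bsub>M\<^esub> e)))"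

text \<open>Baer's argument, with partial extensions encoded as graphs. A graph that is closed under
  addition, scalars and components is single-valued as soon as it is so at zero, and all these
  closure conditions survive unions of chains, so Zorn's lemma for inclusion applies.\<close>

lemma baer_imp_graded_injective:
  assumes E: "proj_graded R \<A> E \<pi>" and baer: "baer E \<pi>"
  shows "graded_injective_module R \<A> E (\<lambda>n. {x \<in> carrier E. \<pi> n x = x})"
proof -
  let ?E = "\<lambda>n. {x \<in> carrier E. \<pi> n x = x}"
  note DE = proj_gradedD[OF E]
  interpret E: module R E by (rule DE)
  have gE: "graded_module R \<A> E ?E" by (rule proj_graded_imp_graded_module[OF gr E])
  have "\<exists>h\<in>graded_hom R B \<H> E ?E. \<forall>x\<in>carrier A. h (u x) = f x"
    if gA: "graded_module R \<A> A \<G>" and gB: "graded_module R \<A> B \<H>"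
      and u: "u \<in> graded_hom R A \<G> B \<H>" and inj: "inj_on u (carrier A)"
      and f: "f \<in> graded_hom R A \<G> E ?E"
    for A :: "('a, 'a) module" and \<G> and B :: "('a, 'a) module" and \<H> u f
  proof -
    interpret A: module R A by (rule graded_moduleD(1)[OF gA])
    interpret B: module R B by (rule graded_moduleD(1)[OF gB])
    interpret dB: direct_sum B \<H> by (rule graded_moduleD(2)[OF gB])
    interpret dA: direct_sum A \<G> by (rule graded_moduleD(2)[OF gA])
    have pB: "proj_graded R \<A> B dB.pr" by (rule proj_graded_gproj[OF gr gB])
    have fm: "f \<in> mod_hom R A E" and um: "u \<in> mod_hom R A B"
      using f u by (auto simp: graded_hom_def)
    interpret f: additive_map A E f
      by (rule mod_hom_additive_map[OF A.module_axioms E.module_axioms fm])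
    interpret u: additive_map A B u
      by (rule mod_hom_additive_map[OF A.module_axioms B.module_axioms um])
    have f_pr: "f (dA.pr n x) = \<pi> n (f x)" if "x \<in> carrier A" for n x
      using graded_hom_pr[OF gA gE f that, of n] proj_graded_sum[OF gr E, of "f x" n] that by simp
    have u_pr: "u (dA.pr n x) = dB.pr n (u x)" if "x \<in> carrier A" for n x
      by (rule graded_hom_pr[OF gA gB u that])
    define good where "good G \<longleftrightarrow> G \<subseteq> carrier B \<times> carrier E \<and>
        (\<forall>x y x' y'. (x, y) \<in> G \<longrightarrow> (x', y') \<in> G \<longrightarrow> (x \<oplus>\<^bsub>B\<^esub> x', y \<oplus>\<^bsub>E\<^esub> y') \<in> G) \<and>
        (\<forall>a x y. a \<in> carrier R \<longrightarrow> (x, y) \<in> G \<longrightarrow> (a \<odot>\<^bsub>B\<^esub> x, a \<odot>\<^bsub>E\<^esub> y) \<in> G) \<and>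
        (\<forall>n x y. (x, y) \<in> G \<longrightarrow> (dB.pr n x, \<pi> n y) \<in> G) \<and>
        (\<forall>y. (\<zero>\<^bsub>B\<^esub>, y) \<in> G \<longrightarrow> y = \<zero>\<^bsub>E\<^esub>) \<and>
        (\<forall>x\<in>carrier A. (u x, f x) \<in> G)" for G
    have goodD: "good G \<Longrightarrow> G \<subseteq> carrier B \<times> carrier E"
      "good G \<Longrightarrow> (x, y) \<in> G \<Longrightarrow> (x', y') \<in> G \<Longrightarrow> (x \<oplus>\<^bsub>B\<^esub> x', y \<oplus>\<^bsub>E\<^esub> y') \<in> G"
      "good G \<Longrightarrow> a \<in> carrier R \<Longrightarrow> (x, y) \<in> G \<Longrightarrow> (a \<odot>\<^bsub>B\<^esub> x, a \<odot>\<^bsub>E\<^esub> y) \<in> G"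
      "good G \<Longrightarrow> (x, y) \<in> G \<Longrightarrow> (dB.pr n x, \<pi> n y) \<in> G"
      "good G \<Longrightarrow> (\<zero>\<^bsub>B\<^esub>, y) \<in> G \<Longrightarrow> y = \<zero>\<^bsub>E\<^esub>"
      "good G \<Longrightarrow> z \<in> carrier A \<Longrightarrow> (u z, f z) \<in> G" for G x y x' y' a n z
      unfolding good_def by (elim conjE; assumption | elim conjE, simp)+
    have "good {(u x, f x) |x. x \<in> carrier A}"
      unfolding good_def
    proof (intro conjI allI impI ballI subsetI)
      fix y assume "(\<zero>\<^bsub>B\<^esub>, y) \<in> {(u x, f x) |x. x \<in> carrier A}"
      then obtain x where x: "x \<in> carrier A" "u x = \<zero>\<^bsub>B\<^esub>" "y = f x" by auto
      then have "x = \<zero>\<^bsub>A\<^esub>" using inj_onD[OF inj, of x "\<zero>\<^bsub>A\<^esub>"] by simp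
      then show "y = \<zero>\<^bsub>E\<^esub>" using x by simp
    next
      fix x y x' y'
      assume "(x, y) \<in> {(u x, f x) |x. x \<in> carrier A}" "(x', y') \<in> {(u x, f x) |x. x \<in> carrier A}"
      then obtain z z' where "z \<in> carrier A" "z' \<in> carrier A" "x = u z" "y = f z" "x' = u z'" "y' = f z'"
        by auto
      then show "(x \<oplus>\<^bsub>B\<^esub> x', y \<oplus>\<^bsub>E\<^esub> y') \<in> {(u x, f x) |x. x \<in> carrier A}"
        by (auto intro!: exI[of _ "z \<oplus>\<^bsub>A\<^esub> z'"])
    next
      fix a x y
      assume a: "a \<in> carrier R" and "(x, y) \<in> {(u x, f x) |x. x \<in> carrier A}"
      then obtain z where "z \<in> carrier A" "x = u z" "y = f z" by auto
      then show "(a \<odot>\<^bsub>B\<^esub> x, a \<odot>\<^bsub>E\<^esub> y) \<in> {(u x, f x) |x. x \<in> carrier A}"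
        using a by (auto intro!: exI[of _ "a \<odot>\<^bsub>A\<^esub> z"] simp: mod_homD[OF um] mod_homD[OF fm])
    next
      fix n x y
      assume "(x, y) \<in> {(u x, f x) |x. x \<in> carrier A}"
      then obtain z where "z \<in> carrier A" "x = u z" "y = f z" by auto
      then show "(dB.pr n x, \<pi> n y) \<in> {(u x, f x) |x. x \<in> carrier A}"
        by (auto intro!: exI[of _ "dA.pr n z"] simp: f_pr u_pr)
    qed auto
    then have ne: "Collect good \<noteq> {}" by blast
    have ch: "\<Union>C \<in> Collect good" if C: "C \<noteq> {}" "subset.chain (Collect good) C" for C
    proof -
      have g: "good G" if "G \<in> C" for G using C(2) that by (auto simp: subset.chain_def)
      have two: "\<exists>G\<in>C. p \<in> G \<and> q \<in> G" if pq: "p \<in> \<Union>C" "q \<in> \<Union>C" for p q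
      proof -
        obtain G where G: "G \<in> C" "p \<in> G" using pq(1) by blast
        obtain H where H: "H \<in> C" "q \<in> H" using pq(2) by blast
        have "G \<subseteq> H \<or> H \<subseteq> G"
          using C(2) G(1) H(1) by (auto simp: subset.chain_def)
        then show ?thesis using G H by blast
      qed
      have "good (\<Union>C)" unfolding good_def
      proof (intro conjI allI impI ballI)
        show "\<Union>C \<subseteq> carrier B \<times> carrier E" using goodD(1)[OF g] by blast
        show "(x \<oplus>\<^bsub>B\<^esub> x', y \<oplus>\<^bsub>E\<^esub> y') \<in> \<Union>C" if xy: "(x, y) \<in> \<Union>C" "(x', y') \<in> \<Union>C" for x y x' y'
        proof -
          obtain G where "G \<in> C" "(x, y) \<in> G" "(x', y') \<in> G" using two[OF xy] by blast
          then show ?thesis using goodD(2)[OF g] by blast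
        qed
        show "(a \<odot>\<^bsub>B\<^esub> x, a \<odot>\<^bsub>E\<^esub> y) \<in> \<Union>C" if "a \<in> carrier R" "(x, y) \<in> \<Union>C" for a x y
          using that goodD(3)[OF g] by blast
        show "(dB.pr n x, \<pi> n y) \<in> \<Union>C" if "(x, y) \<in> \<Union>C" for n x y
          using that goodD(4)[OF g] by blast
        show "y = \<zero>\<^bsub>E\<^esub>" if "(\<zero>\<^bsub>B\<^esub>, y) \<in> \<Union>C" for y
          using that goodD(5)[OF g] by blast
        show "(u x, f x) \<in> \<Union>C" if "x \<in> carrier A" for x
          using that goodD(6)[OF g] C(1) by blast
      qed
      then show ?thesis by simp
    qed
    obtain G where G: "good G" and max: "\<And>H. good H \<Longrightarrow> G \<subseteq> H \<Longrightarrow> H = G"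
      using subset_Zorn_nonempty[OF ne ch] by auto
    have Gc: "x \<in> carrier B" "y \<in> carrier E" if "(x, y) \<in> G" for x y using goodD(1)[OF G] that by blast+
    note Gadd = goodD(2)[OF G] and Gs = goodD(3)[OF G] and Gpr = goodD(4)[OF G]
      and G0 = goodD(5)[OF G] and Gu = goodD(6)[OF G]
    have Gz: "(\<zero>\<^bsub>B\<^esub>, \<zero>\<^bsub>E\<^esub>) \<in> G" using Gu[of "\<zero>\<^bsub>A\<^esub>"] by simp
    have Gminus: "(\<ominus>\<^bsub>B\<^esub> x, \<ominus>\<^bsub>E\<^esub> y) \<in> G" if "(x, y) \<in> G" for x y
      using Gs[of "\<ominus> \<one>", OF _ that] Gc[OF that] by (simp add: B.smult_l_minus E.smult_l_minus)
    have fn: "y = y'" if "(x, y) \<in> G" "(x, y') \<in> G" for x y y'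
    proof -
      have "(x \<oplus>\<^bsub>B\<^esub> \<ominus>\<^bsub>B\<^esub> x, y \<oplus>\<^bsub>E\<^esub> \<ominus>\<^bsub>E\<^esub> y') \<in> G" by (intro Gadd Gminus that)
      then have "y \<ominus>\<^bsub>E\<^esub> y' = \<zero>\<^bsub>E\<^esub>" using G0 Gc that by (simp add: B.r_neg E.minus_eq)
      then show ?thesis using Gc that E.minus_eq_zero_iff by blast
    qed
    \<comment> \<open>Only homogeneous \<open>b\<close> are adjoined: then the ideal of all
      \<open>a\<close> with \<open>a b\<close> in the domain is homogeneous and
      \<open>\<phi>\<close>, which maps \<open>a\<close> to the value at \<open>a b\<close>, has
      degree \<open>n\<close>, as \<open>baer\<close> demands.\<close>
    have hom_dom: "\<exists>y. (b, y) \<in> G" if b: "b \<in> \<H> n" for b n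
    proof -
      have bc: "b \<in> carrier B" by (rule dB.sub[OF b])
      have bn: "dB.pr n b = b" using bc b by (simp add: dB.pr_eq_self_iff)
      define I where "I = {a \<in> carrier R. \<exists>y. (a \<odot>\<^bsub>B\<^esub> b, y) \<in> G}"
      define \<phi> where "\<phi> a = (THE y. (a \<odot>\<^bsub>B\<^esub> b, y) \<in> G)" for a
      have \<phi>: "\<phi> a = y" if "(a \<odot>\<^bsub>B\<^esub> b, y) \<in> G" for a y
        unfolding \<phi>_def by (rule the_equality) (use that fn in blast)+
      have \<phi>G: "(a \<odot>\<^bsub>B\<^esub> b, \<phi> a) \<in> G" if "a \<in> I" for a
        using that \<phi> by (auto simp: I_def)
      have Iadd: "((a \<oplus> a') \<odot>\<^bsub>B\<^esub> b, \<phi> a \<oplus>\<^bsub>E\<^esub> \<phi> a') \<in> G" if "a \<in> I" "a' \<in> I" for a a'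
        using Gadd[OF \<phi>G[OF that(1)] \<phi>G[OF that(2)]] that bc by (simp add: I_def B.smult_l_distr)
      have Imul: "((r \<otimes> a) \<odot>\<^bsub>B\<^esub> b, r \<odot>\<^bsub>E\<^esub> \<phi> a) \<in> G" if "r \<in> carrier R" "a \<in> I" for r a
        using Gs[OF that(1) \<phi>G[OF that(2)]] that bc by (simp add: I_def B.smult_assoc1)
      have Ipr: "(ipr k a \<odot>\<^bsub>B\<^esub> b, \<pi> (k + n) (\<phi> a)) \<in> G" if "a \<in> I" for k a
        using Gpr[OF \<phi>G[OF that], of "k + n"] proj_smult_homogeneous[OF pB bc bn, of a k] that
        by (simp add: I_def)
      have "ideal_hom E \<pi> n I \<phi>" unfolding ideal_hom_def
      proof (intro conjI ballI allI)
        show "ideal I R"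
        proof (rule ideal_criterion)
          show "\<zero> \<in> I" using Gz bc by (auto simp: I_def)
          show "a \<oplus> a' \<in> I" if "a \<in> I" "a' \<in> I" for a a'
            using Iadd[OF that] that by (auto simp: I_def)
          show "r \<otimes> a \<in> I" if "r \<in> carrier R" "a \<in> I" for r a
            using Imul[OF that] that by (auto simp: I_def)
        qed (auto simp: I_def)
        show "ipr k a \<in> I" if "a \<in> I" for a k
          using Ipr[OF that, of k] that ipr_props(1) by (auto simp: I_def)
        show "\<phi> a \<in> carrier E" if "a \<in> I" for a using Gc(2)[OF \<phi>G[OF that]] .
        show "\<phi> (a \<oplus> a') = \<phi> a \<oplus>\<^bsub>E\<^esub> \<phi> a'" if "a \<in> I" "a' \<in> I" for a a'
          by (rule \<phi>[OF Iadd[OF that]])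
        show "\<phi> (r \<otimes> a) = r \<odot>\<^bsub>E\<^esub> \<phi> a" if "r \<in> carrier R" "a \<in> I" for r a
          by (rule \<phi>[OF Imul[OF that]])
        show "\<pi> (k + n) (\<phi> a) = \<phi> (ipr k a)" if "a \<in> I" for a k
          by (rule \<phi>[OF Ipr[OF that], symmetric])
      qed
      then obtain e where e: "e \<in> carrier E" "\<pi> n e = e" "\<And>a. a \<in> I \<Longrightarrow> \<phi> a = a \<odot>\<^bsub>E\<^esub> e"
        using baer unfolding baer_def by blast
      define G' where "G' = {(x \<oplus>\<^bsub>B\<^esub> a \<odot>\<^bsub>B\<^esub> b, y \<oplus>\<^bsub>E\<^esub> a \<odot>\<^bsub>E\<^esub> e) |x y a. (x, y) \<in> G \<and> a \<in> carrier R}"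
      have G'I: "(x \<oplus>\<^bsub>B\<^esub> a \<odot>\<^bsub>B\<^esub> b, y \<oplus>\<^bsub>E\<^esub> a \<odot>\<^bsub>E\<^esub> e) \<in> G'" if "(x, y) \<in> G" "a \<in> carrier R" for x y a
        using that unfolding G'_def by blast
      have sub: "G \<subseteq> G'"
      proof
        fix p assume "p \<in> G"
        then show "p \<in> G'" using G'I[of "fst p" "snd p" \<zero>] Gc[of "fst p" "snd p"] bc e by simp
      qed
      have "good G'" unfolding good_def
      proof (intro conjI allI impI ballI)
        show "G' \<subseteq> carrier B \<times> carrier E" using Gc bc e(1) by (auto simp: G'_def)
        show "(u x, f x) \<in> G'" if "x \<in> carrier A" for x using Gu[OF that] sub by blast
      next
        fix p q p' q' assume "(p, q) \<in> G'" "(p', q') \<in> G'"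
        then obtain x y a x' y' a' where *: "(x, y) \<in> G" "(x', y') \<in> G" "a \<in> carrier R" "a' \<in> carrier R"
          "p = x \<oplus>\<^bsub>B\<^esub> a \<odot>\<^bsub>B\<^esub> b" "q = y \<oplus>\<^bsub>E\<^esub> a \<odot>\<^bsub>E\<^esub> e"
          "p' = x' \<oplus>\<^bsub>B\<^esub> a' \<odot>\<^bsub>B\<^esub> b" "q' = y' \<oplus>\<^bsub>E\<^esub> a' \<odot>\<^bsub>E\<^esub> e"
          unfolding G'_def by blast
        have "p \<oplus>\<^bsub>B\<^esub> p' = (x \<oplus>\<^bsub>B\<^esub> x') \<oplus>\<^bsub>B\<^esub> (a \<oplus> a') \<odot>\<^bsub>B\<^esub> b"
          "q \<oplus>\<^bsub>E\<^esub> q' = (y \<oplus>\<^bsub>E\<^esub> y') \<oplus>\<^bsub>E\<^esub> (a \<oplus> a') \<odot>\<^bsub>E\<^esub> e"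
          using * Gc[OF *(1)] Gc[OF *(2)] bc e(1)
          by (simp_all add: B.smult_l_distr E.smult_l_distr B.a_ac E.a_ac)
        then show "(p \<oplus>\<^bsub>B\<^esub> p', q \<oplus>\<^bsub>E\<^esub> q') \<in> G'"
          using G'I[OF Gadd[OF *(1,2)], of "a \<oplus> a'"] * by simp
      next
        fix r p q assume r: "r \<in> carrier R" and "(p, q) \<in> G'"
        then obtain x y a where *: "(x, y) \<in> G" "a \<in> carrier R"
          "p = x \<oplus>\<^bsub>B\<^esub> a \<odot>\<^bsub>B\<^esub> b" "q = y \<oplus>\<^bsub>E\<^esub> a \<odot>\<^bsub>E\<^esub> e"
          unfolding G'_def by blast
        have "r \<odot>\<^bsub>B\<^esub> p = r \<odot>\<^bsub>B\<^esub> x \<oplus>\<^bsub>B\<^esub> (r \<otimes> a) \<odot>\<^bsub>B\<^esub> b" "r \<odot>\<^bsub>E\<^esub> q = r \<odot>\<^bsub>E\<^esub> y \<oplus>\<^bsub>E\<^esub> (r \<otimes> a) \<odot>\<^bsub>E\<^esub> e"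
          using * r Gc[OF *(1)] bc e(1)
          by (simp_all add: B.smult_r_distr E.smult_r_distr B.smult_assoc1 E.smult_assoc1)
        then show "(r \<odot>\<^bsub>B\<^esub> p, r \<odot>\<^bsub>E\<^esub> q) \<in> G'"
          using G'I[OF Gs[OF r *(1)], of "r \<otimes> a"] * r by simp
      next
        fix k p q assume "(p, q) \<in> G'"
        then obtain x y a where *: "(x, y) \<in> G" "a \<in> carrier R"
          "p = x \<oplus>\<^bsub>B\<^esub> a \<odot>\<^bsub>B\<^esub> b" "q = y \<oplus>\<^bsub>E\<^esub> a \<odot>\<^bsub>E\<^esub> e"
          unfolding G'_def by blast
        have k: "k = (k - n) + n" by simp
        have "dB.pr k (a \<odot>\<^bsub>B\<^esub> b) = ipr (k - n) a \<odot>\<^bsub>B\<^esub> b" "\<pi> k (a \<odot>\<^bsub>E\<^esub> e) = ipr (k - n) a \<odot>\<^bsub>E\<^esub> e"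
          using proj_smult_homogeneous[OF pB bc bn *(2), of "k - n"]
            proj_smult_homogeneous[OF E e(1,2) *(2), of "k - n"] by simp_all
        then have "dB.pr k p = dB.pr k x \<oplus>\<^bsub>B\<^esub> ipr (k - n) a \<odot>\<^bsub>B\<^esub> b"
          "\<pi> k q = \<pi> k y \<oplus>\<^bsub>E\<^esub> ipr (k - n) a \<odot>\<^bsub>E\<^esub> e"
          using * Gc[OF *(1)] bc e(1) by (simp_all add: dB.pr_add DE(3))
        then show "(dB.pr k p, \<pi> k q) \<in> G'"
          using G'I[OF Gpr[OF *(1)], of "ipr (k - n) a"] ipr_props(1)[OF *(2)] by simp
      next
        \<comment> \<open>Single-valuedness at zero: here \<open>a b\<close> is the negative of
          \<open>x\<close>, so \<open>a\<close> lies in \<open>I\<close>, and \<open>e\<close> was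
          chosen so that \<open>\<phi> a = a e\<close>.\<close>
        fix q assume "(\<zero>\<^bsub>B\<^esub>, q) \<in> G'"
        then obtain x y a where *: "(x, y) \<in> G" "a \<in> carrier R"
          "x \<oplus>\<^bsub>B\<^esub> a \<odot>\<^bsub>B\<^esub> b = \<zero>\<^bsub>B\<^esub>" "q = y \<oplus>\<^bsub>E\<^esub> a \<odot>\<^bsub>E\<^esub> e"
          unfolding G'_def by auto
        have "a \<odot>\<^bsub>B\<^esub> b = \<ominus>\<^bsub>B\<^esub> x"
          using B.minus_equality[of "a \<odot>\<^bsub>B\<^esub> b" x] * Gc[OF *(1)] bc by (simp add: B.a_comm)
        then have 1: "(a \<odot>\<^bsub>B\<^esub> b, \<ominus>\<^bsub>E\<^esub> y) \<in> G" using Gminus[OF *(1)] by simp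
        then have "a \<in> I" using *(2) by (auto simp: I_def)
        then have "\<ominus>\<^bsub>E\<^esub> y = a \<odot>\<^bsub>E\<^esub> e" using \<phi>[OF 1] e(3) by simp
        then show "q = \<zero>\<^bsub>E\<^esub>" using * Gc[OF *(1)] by (simp add: E.r_neg flip: \<open>\<ominus>\<^bsub>E\<^esub> y = a \<odot>\<^bsub>E\<^esub> e\<close>)
      qed
      then have "G' = G" using max sub by blast
      then show ?thesis using G'I[OF Gz, of \<one>] bc e(1) by auto
    qed
    have dom: "\<exists>y. (b, y) \<in> G" if b: "b \<in> carrier B" for b
    proof -
      have "additive_subgroup {b \<in> carrier B. \<exists>y. (b, y) \<in> G} B"
        by (rule B.additive_subgroupI') (use Gz Gadd Gminus in blast)+
      then have "b \<in> {b \<in> carrier B. \<exists>y. (b, y) \<in> G}"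
        by (rule dB.pr_mem_imp_mem) (use b hom_dom[OF dB.pr_props(1)[OF b]] in auto)
      then show ?thesis by simp
    qed
    define h where "h b = (THE y. (b, y) \<in> G)" for b
    have h: "h b = y" if "(b, y) \<in> G" for b y
      unfolding h_def by (rule the_equality) (use that fn in blast)+
    have hG: "(b, h b) \<in> G" if "b \<in> carrier B" for b using dom[OF that] h by auto
    have "h \<in> mod_hom R B E"
    proof (rule mod_homI)
      show "h x \<in> carrier E" if "x \<in> carrier B" for x using Gc(2)[OF hG[OF that]] .
      show "h (x \<oplus>\<^bsub>B\<^esub> y) = h x \<oplus>\<^bsub>E\<^esub> h y" if "x \<in> carrier B" "y \<in> carrier B" for x y
        by (rule h[OF Gadd[OF hG[OF that(1)] hG[OF that(2)]]])
      show "h (a \<odot>\<^bsub>B\<^esub> x) = a \<odot>\<^bsub>E\<^esub> h x" if "a \<in> carrier R" "x \<in> carrier B" for a x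
        by (rule h[OF Gs[OF that(1) hG[OF that(2)]]])
    qed
    moreover have "h x \<in> ?E n" if "x \<in> \<H> n" for x n
    proof -
      have x: "x \<in> carrier B" by (rule dB.sub[OF that])
      have "dB.pr n x = x" using x that by (simp add: dB.pr_eq_self_iff)
      then have "(x, \<pi> n (h x)) \<in> G" using Gpr[OF hG[OF x], of n] by simp
      then show ?thesis using h[of x "\<pi> n (h x)"] Gc(2)[OF hG[OF x]] by simp
    qed
    ultimately have "h \<in> graded_hom R B \<H> E ?E" by (auto simp: graded_hom_def)
    moreover have "h (u x) = f x" if "x \<in> carrier A" for x by (rule h[OF Gu[OF that]])
    ultimately show ?thesis by blast
  qed
  then show ?thesis unfolding graded_injective_module_def using gE by blast
qed

end

section \<open>Embedding into a graded injective module\<close>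

text \<open>The carrier of \<open>M\<close> is literally a subset, not merely embedded, so that
  chains of extensions have unions.\<close>

definition extends ::
  "('a, 'r) ring_scheme \<Rightarrow> ('a, 'u, 'm) module_scheme \<Rightarrow> (int \<Rightarrow> 'u \<Rightarrow> 'u) \<Rightarrow>
    ('a, 'u, 'n) module_scheme \<Rightarrow> (int \<Rightarrow> 'u \<Rightarrow> 'u) \<Rightarrow> bool"
  where "extends R M \<pi> N \<rho> \<longleftrightarrow> carrier M \<subseteq> carrier N \<and>
    (\<forall>x\<in>carrier M. \<forall>y\<in>carrier M. x \<oplus>\<^bsub>N\<^esub> y = x \<oplus>\<^bsub>M\<^esub> y) \<and>
    (\<forall>a\<in>carrier R. \<forall>x\<in>carrier M. a \<odot>\<^bsub>N\<^esub> x = a \<odot>\<^bsub>M\<^esub> x) \<and>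
    (\<forall>n. \<forall>x\<in>carrier M. \<rho> n x = \<pi> n x)"

lemma extendsD:
  assumes "extends R M \<pi> N \<rho>"
  shows "x \<in> carrier M \<Longrightarrow> x \<in> carrier N"
    and "x \<in> carrier M \<Longrightarrow> y \<in> carrier M \<Longrightarrow> x \<oplus>\<^bsub>N\<^esub> y = x \<oplus>\<^bsub>M\<^esub> y"
    and "a \<in> carrier R \<Longrightarrow> x \<in> carrier M \<Longrightarrow> a \<odot>\<^bsub>N\<^esub> x = a \<odot>\<^bsub>M\<^esub> x"
    and "x \<in> carrier M \<Longrightarrow> \<rho> n x = \<pi> n x"
  using assms unfolding extends_def by auto

lemma extends_refl: "extends R M \<pi> M \<pi>"
  by (simp add: extends_def)

lemma extends_trans: "extends R M \<pi> N \<rho> \<Longrightarrow> extends R N \<rho> P \<sigma> \<Longrightarrow> extends R M \<pi> P \<sigma>"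
  unfolding extends_def by (simp add: subset_iff)

lemma extends_zero:
  assumes "extends R M \<pi> N \<rho>" "module R M" "module R N"
  shows "\<zero>\<^bsub>N\<^esub> = \<zero>\<^bsub>M\<^esub>"
proof -
  interpret M: module R M by fact
  interpret N: module R N by fact
  have "\<zero>\<^bsub>M\<^esub> \<oplus>\<^bsub>N\<^esub> \<zero>\<^bsub>M\<^esub> = \<zero>\<^bsub>M\<^esub>" using extendsD(2)[OF assms(1), of "\<zero>\<^bsub>M\<^esub>" "\<zero>\<^bsub>M\<^esub>"] by simp
  then show ?thesis using extendsD(1)[OF assms(1) M.M.zero_closed] N.M.add.l_cancel_one by simp
qed

text \<open>The operations as one set of tagged triples. Extension of modules becomes inclusion of
  sets, which is the order for which Zorn's lemma is applied.\<close>

definition module_graph ::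
  "('a, 'r) ring_scheme \<Rightarrow> ('a, 'u, 'm) module_scheme \<Rightarrow> (int \<Rightarrow> 'u \<Rightarrow> 'u) \<Rightarrow>
    (('u \<times> 'u \<times> 'u) + ('a \<times> 'u \<times> 'u) + (int \<times> 'u \<times> 'u)) set"
  where "module_graph R M \<pi> = {Inl (x, y, x \<oplus>\<^bsub>M\<^esub> y) |x y. x \<in> carrier M \<and> y \<in> carrier M} \<union>
    {Inr (Inl (a, x, a \<odot>\<^bsub>M\<^esub> x)) |a x. a \<in> carrier R \<and> x \<in> carrier M} \<union>
    {Inr (Inr (n, x, \<pi> n x)) |n x. x \<in> carrier M}"

lemma module_graph_mem [simp]:
  "Inl (x, y, z) \<in> module_graph R M \<pi> \<longleftrightarrow> x \<in> carrier M \<and> y \<in> carrier M \<and> z = x \<oplus>\<^bsub>M\<^esub> y"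
  "Inr (Inl (a, x, z)) \<in> module_graph R M \<pi> \<longleftrightarrow> a \<in> carrier R \<and> x \<in> carrier M \<and> z = a \<odot>\<^bsub>M\<^esub> x"
  "Inr (Inr (n, x, z)) \<in> module_graph R M \<pi> \<longleftrightarrow> x \<in> carrier M \<and> z = \<pi> n x"
  by (auto simp: module_graph_def)

lemma module_graph_subset_iff:
  "module_graph R M \<pi> \<subseteq> module_graph R N \<rho> \<longleftrightarrow> extends R M \<pi> N \<rho>"
proof
  assume sub: "module_graph R M \<pi> \<subseteq> module_graph R N \<rho>"
  have *: "x \<in> carrier N \<and> \<rho> n x = \<pi> n x" if "x \<in> carrier M" for n x
    using subsetD[OF sub, of "Inr (Inr (n, x, \<pi> n x))"] that by simp
  moreover have "x \<oplus>\<^bsub>N\<^esub> y = x \<oplus>\<^bsub>M\<^esub> y" if "x \<in> carrier M" "y \<in> carrier M" for x y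
    using subsetD[OF sub, of "Inl (x, y, x \<oplus>\<^bsub>M\<^esub> y)"] that by simp
  moreover have "a \<odot>\<^bsub>N\<^esub> x = a \<odot>\<^bsub>M\<^esub> x" if "a \<in> carrier R" "x \<in> carrier M" for a x
    using subsetD[OF sub, of "Inr (Inl (a, x, a \<odot>\<^bsub>M\<^esub> x))"] that by simp
  ultimately show "extends R M \<pi> N \<rho>" unfolding extends_def by blast
next
  assume "extends R M \<pi> N \<rho>"
  then show "module_graph R M \<pi> \<subseteq> module_graph R N \<rho>"
    unfolding extends_def module_graph_def by auto
qed

text \<open>The operations on the union are computed in any member of the chain that contains the
  operands. Members extend one another, so the choice does not matter, and every axiom involves only
  finitely many elements, which lie in a common member.\<close>

lemma chain_union_proj_graded:
  fixes \<C> :: "(('a, 'u) module \<times> (int \<Rightarrow> 'u \<Rightarrow> 'u)) set"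
  assumes R: "graded_ring R \<A>"
    and ne: "\<C> \<noteq> {}" and pg: "\<And>M \<pi>. (M, \<pi>) \<in> \<C> \<Longrightarrow> proj_graded R \<A> M \<pi>"
    and chain: "\<And>M \<pi> N \<rho>. (M, \<pi>) \<in> \<C> \<Longrightarrow> (N, \<rho>) \<in> \<C> \<Longrightarrow> extends R M \<pi> N \<rho> \<or> extends R N \<rho> M \<pi>"
  obtains U :: "('a, 'u) module" and \<upsilon> where "proj_graded R \<A> U \<upsilon>"
    "carrier U = (\<Union>(M, \<pi>)\<in>\<C>. carrier M)"
    "\<And>M \<pi>. (M, \<pi>) \<in> \<C> \<Longrightarrow> extends R M \<pi> U \<upsilon>"
proof -
  define U where "U = (\<Union>(M, \<pi>)\<in>\<C>. carrier M)"
  have modl: "module R M" if "(M, \<pi>) \<in> \<C>" for M \<pi> using proj_gradedD(1)[OF pg[OF that]] .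
  have two: "\<exists>M \<pi>. (M, \<pi>) \<in> \<C> \<and> x \<in> carrier M \<and> y \<in> carrier M" if xy: "x \<in> U" "y \<in> U" for x y
  proof -
    obtain M \<pi> where M: "(M, \<pi>) \<in> \<C>" "x \<in> carrier M" using xy(1) by (auto simp: U_def)
    obtain N \<rho> where N: "(N, \<rho>) \<in> \<C>" "y \<in> carrier N" using xy(2) by (auto simp: U_def)
    show ?thesis using chain[OF M(1) N(1)] M N extendsD(1) by meson
  qed
  have three: "\<exists>M \<pi>. (M, \<pi>) \<in> \<C> \<and> x \<in> carrier M \<and> y \<in> carrier M \<and> z \<in> carrier M"
    if xyz: "x \<in> U" "y \<in> U" "z \<in> U" for x y z
  proof -
    obtain M \<pi> where M: "(M, \<pi>) \<in> \<C>" "x \<in> carrier M" "y \<in> carrier M" using two[OF xyz(1,2)] by auto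
    obtain N \<rho> where N: "(N, \<rho>) \<in> \<C>" "z \<in> carrier N" using xyz(3) by (auto simp: U_def)
    show ?thesis using chain[OF M(1) N(1)] M N extendsD(1) by meson
  qed
  define ad where "ad x y = (SOME z. \<exists>M \<pi>. (M, \<pi>) \<in> \<C> \<and> x \<in> carrier M \<and> y \<in> carrier M \<and> z = x \<oplus>\<^bsub>M\<^esub> y)" for x y
  define sm where "sm a x = (SOME z. \<exists>M \<pi>. (M, \<pi>) \<in> \<C> \<and> x \<in> carrier M \<and> z = a \<odot>\<^bsub>M\<^esub> x)" for a x
  define pj where "pj n x = (SOME z. \<exists>M \<pi>. (M, \<pi>) \<in> \<C> \<and> x \<in> carrier M \<and> z = \<pi> n x)" for n :: int and x
  have ad: "ad x y = x \<oplus>\<^bsub>M\<^esub> y" if M: "(M, \<pi>) \<in> \<C>" "x \<in> carrier M" "y \<in> carrier M" for M \<pi> x y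
  proof -
    have "\<exists>N \<rho>. (N, \<rho>) \<in> \<C> \<and> x \<in> carrier N \<and> y \<in> carrier N \<and> ad x y = x \<oplus>\<^bsub>N\<^esub> y"
      unfolding ad_def by (rule someI_ex) (use M in blast)
    then obtain N \<rho> where N: "(N, \<rho>) \<in> \<C>" "x \<in> carrier N" "y \<in> carrier N" "ad x y = x \<oplus>\<^bsub>N\<^esub> y" by blast
    show ?thesis using chain[OF M(1) N(1)] extendsD(2) M(2,3) N(2,3,4) by metis
  qed
  have sm: "sm a x = a \<odot>\<^bsub>M\<^esub> x" if M: "(M, \<pi>) \<in> \<C>" "x \<in> carrier M" "a \<in> carrier R" for M \<pi> a x
  proof -
    have "\<exists>N \<rho>. (N, \<rho>) \<in> \<C> \<and> x \<in> carrier N \<and> sm a x = a \<odot>\<^bsub>N\<^esub> x"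
      unfolding sm_def by (rule someI_ex) (use M in blast)
    then obtain N \<rho> where N: "(N, \<rho>) \<in> \<C>" "x \<in> carrier N" "sm a x = a \<odot>\<^bsub>N\<^esub> x" by blast
    show ?thesis using chain[OF M(1) N(1)] extendsD(3) M(2,3) N(2,3) by metis
  qed
  have pj: "pj n x = \<pi> n x" if M: "(M, \<pi>) \<in> \<C>" "x \<in> carrier M" for M \<pi> n x
  proof -
    have "\<exists>N \<rho>. (N, \<rho>) \<in> \<C> \<and> x \<in> carrier N \<and> pj n x = \<rho> n x"
      unfolding pj_def by (rule someI_ex) (use M in blast)
    then obtain N \<rho> where N: "(N, \<rho>) \<in> \<C>" "x \<in> carrier N" "pj n x = \<rho> n x" by blast
    show ?thesis using chain[OF M(1) N(1)] extendsD(4) M(2) N(2,3) by metis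
  qed
  obtain M0 \<pi>0 where M0: "(M0, \<pi>0) \<in> \<C>" using ne by auto
  define V :: "('a, 'u) module" where "V = \<lparr>carrier = U, monoid.mult = undefined, monoid.one = undefined,
    ring.zero = \<zero>\<^bsub>M0\<^esub>, ring.add = ad, smult = sm\<rparr>"
  have V [simp]: "carrier V = U" "\<zero>\<^bsub>V\<^esub> = \<zero>\<^bsub>M0\<^esub>" "x \<oplus>\<^bsub>V\<^esub> y = ad x y" "a \<odot>\<^bsub>V\<^esub> x = sm a x" for x y a
    by (simp_all add: V_def)
  have zero: "\<zero>\<^bsub>M0\<^esub> = \<zero>\<^bsub>M\<^esub>" if "(M, \<pi>) \<in> \<C>" for M \<pi>
    using chain[OF M0 that] extends_zero[OF _ modl[OF M0] modl[OF that]]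
      extends_zero[OF _ modl[OF that] modl[OF M0]] by metis
  have inU: "x \<in> U" if "(M, \<pi>) \<in> \<C>" "x \<in> carrier M" for M \<pi> x using that by (auto simp: U_def)
  have "abelian_group V"
  proof (rule abelian_groupI)
    fix x y z assume "x \<in> carrier V" "y \<in> carrier V" "z \<in> carrier V"
    then obtain M \<pi> where M: "(M, \<pi>) \<in> \<C>" "x \<in> carrier M" "y \<in> carrier M" "z \<in> carrier M"
      using three unfolding V(1) by blast
    interpret M: module R M by (rule modl[OF M(1)])
    show "x \<oplus>\<^bsub>V\<^esub> y \<oplus>\<^bsub>V\<^esub> z = x \<oplus>\<^bsub>V\<^esub> (y \<oplus>\<^bsub>V\<^esub> z)"
      using M by (simp add: ad[OF M(1)] M.a_assoc)
  next
    fix x y assume "x \<in> carrier V" "y \<in> carrier V"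
    then obtain M \<pi> where M: "(M, \<pi>) \<in> \<C>" "x \<in> carrier M" "y \<in> carrier M"
      using two unfolding V(1) by blast
    interpret M: module R M by (rule modl[OF M(1)])
    show "x \<oplus>\<^bsub>V\<^esub> y \<in> carrier V" "x \<oplus>\<^bsub>V\<^esub> y = y \<oplus>\<^bsub>V\<^esub> x"
      using M inU[OF M(1)] by (simp_all add: ad[OF M(1)] M.a_comm)
  next
    fix x assume "x \<in> carrier V"
    then obtain M \<pi> where M: "(M, \<pi>) \<in> \<C>" "x \<in> carrier M" using two unfolding V(1) by blast
    interpret M: module R M by (rule modl[OF M(1)])
    show "\<zero>\<^bsub>V\<^esub> \<oplus>\<^bsub>V\<^esub> x = x" using M by (simp add: zero[OF M(1)] ad[OF M(1)])
    show "\<exists>y\<in>carrier V. y \<oplus>\<^bsub>V\<^esub> x = \<zero>\<^bsub>V\<^esub>"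
      using M inU[OF M(1)] by (intro bexI[of _ "\<ominus>\<^bsub>M\<^esub> x"]) (simp_all add: zero[OF M(1)] ad[OF M(1)] M.l_neg)
  next
    interpret M: module R M0 by (rule modl[OF M0])
    show "\<zero>\<^bsub>V\<^esub> \<in> carrier V" using inU[OF M0] by simp
  qed
  moreover have "a \<odot>\<^bsub>V\<^esub> x \<in> carrier V \<and> (a \<oplus>\<^bsub>R\<^esub> b) \<odot>\<^bsub>V\<^esub> x = a \<odot>\<^bsub>V\<^esub> x \<oplus>\<^bsub>V\<^esub> b \<odot>\<^bsub>V\<^esub> x
      \<and> (a \<otimes>\<^bsub>R\<^esub> b) \<odot>\<^bsub>V\<^esub> x = a \<odot>\<^bsub>V\<^esub> (b \<odot>\<^bsub>V\<^esub> x) \<and> \<one>\<^bsub>R\<^esub> \<odot>\<^bsub>V\<^esub> x = x"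
    if ab: "a \<in> carrier R" "b \<in> carrier R" and x: "x \<in> carrier V" for a b x
  proof -
    obtain M \<pi> where M: "(M, \<pi>) \<in> \<C>" "x \<in> carrier M" using x two unfolding V(1) by blast
    interpret M: module R M by (rule modl[OF M(1)])
    show ?thesis
      using M(2) ab inU[OF M(1)] by (simp add: sm[OF M(1)] ad[OF M(1)] M.smult_l_distr M.smult_assoc1)
  qed
  moreover have "a \<odot>\<^bsub>V\<^esub> (x \<oplus>\<^bsub>V\<^esub> y) = a \<odot>\<^bsub>V\<^esub> x \<oplus>\<^bsub>V\<^esub> a \<odot>\<^bsub>V\<^esub> y"
    if a: "a \<in> carrier R" and xy: "x \<in> carrier V" "y \<in> carrier V" for a x y
  proof -
    obtain M \<pi> where M: "(M, \<pi>) \<in> \<C>" "x \<in> carrier M" "y \<in> carrier M" using xy two unfolding V(1) by blast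
    interpret M: module R M by (rule modl[OF M(1)])
    show ?thesis
      using M(2,3) a by (simp add: sm[OF M(1)] ad[OF M(1)] M.smult_r_distr)
  qed
  ultimately have mV: "module R V"
    using graded_ringD(1)[OF R] cring.cring_simprules(6)[OF graded_ringD(1)[OF R]]
    by (intro moduleI) blast+
  have "proj_graded R \<A> V pj" unfolding proj_graded_def
  proof (intro conjI allI ballI impI)
    show "module R V" by (rule mV)
    fix x assume "x \<in> carrier V"
    then obtain M \<pi> where M: "(M, \<pi>) \<in> \<C>" "x \<in> carrier M" using two unfolding V(1) by blast
    note D = proj_gradedD[OF pg[OF M(1)]]
    show "pj n x \<in> carrier V" for n using inU[OF M(1)] D(2)[OF M(2)] by (simp add: pj[OF M])
    show "pj m (pj n x) = (if m = n then pj n x else \<zero>\<^bsub>V\<^esub>)" for m n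
      using pj[OF M(1) D(2)[OF M(2)], of m n] D(4)[OF M(2), of m n]
      by (simp add: pj[OF M] zero[OF M(1)])
    show "finite {n. pj n x \<noteq> \<zero>\<^bsub>V\<^esub>}" using D(5)[OF M(2)] by (simp add: pj[OF M] zero[OF M(1)])
    show "x = \<zero>\<^bsub>V\<^esub>" if "\<forall>n. pj n x = \<zero>\<^bsub>V\<^esub>"
      using D(6)[OF M(2)] that by (simp add: pj[OF M] zero[OF M(1)])
    show "pj (int m + n) (a \<odot>\<^bsub>V\<^esub> x) = a \<odot>\<^bsub>V\<^esub> pj n x" if "a \<in> \<A> m" for m n a
    proof -
      have a: "a \<in> carrier R" by (rule direct_sum.sub[OF graded_ringD(2)[OF R] that])
      interpret M: module R M by (rule modl[OF M(1)])
      show ?thesis using D(7)[OF that M(2), of n] a D(2)[OF M(2)] M(2)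
        by (simp add: pj[OF M(1)] sm[OF M(1)])
    qed
    show "pj n (x \<oplus>\<^bsub>V\<^esub> y) = pj n x \<oplus>\<^bsub>V\<^esub> pj n y" if y: "y \<in> carrier V" for n y
    proof -
      obtain N \<rho> where N: "(N, \<rho>) \<in> \<C>" "x \<in> carrier N" "y \<in> carrier N"
        using two \<open>x \<in> carrier V\<close> y unfolding V(1) by blast
      interpret N: module R N by (rule modl[OF N(1)])
      show ?thesis using proj_gradedD(2,3)[OF pg[OF N(1)]] N(2,3)
        by (simp add: pj[OF N(1)] ad[OF N(1)])
    qed
  qed
  moreover have "extends R M \<pi> V pj" if "(M, \<pi>) \<in> \<C>" for M \<pi>
    unfolding extends_def using inU[OF that] ad[OF that] sm[OF that] pj[OF that] by auto
  ultimately show thesis using that[of V pj] by (simp add: U_def)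
qed

section \<open>Injective codes in an infinite type\<close>

fun list_code :: "('u \<times> 'u \<Rightarrow> 'u) \<Rightarrow> 'u \<Rightarrow> 'u list \<Rightarrow> 'u"
  where "list_code w z [] = z" | "list_code w z (x # xs) = w (x, list_code w z xs)"

text \<open>The end of a list carries no mark in its code, hence the assumption on lengths; a full
  code has to record the length separately.\<close>

lemma list_code_inj:
  assumes "inj w" "length xs = length ys" "list_code w z xs = list_code w z ys"
  shows "xs = ys"
  using assms(2,3) by (induction rule: list_induct2) (auto dest!: injD[OF assms(1)])

text \<open>The pairing \<open>w\<close> comes from cardinal arithmetic, as an infinite set is as
  large as its square. All other codes are built from \<open>w\<close> and an embedding
  \<open>\<nu>\<close> of the natural numbers, where \<open>\<nu> 0\<close> and
  \<open>\<nu> 1\<close> serve as tags that keep cases apart.\<close>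

lemma infinite_codes:
  assumes "infinite (UNIV :: 'u set)" and i: "inj (i :: 'a \<Rightarrow> 'u)"
  obtains w :: "'u \<times> 'u \<Rightarrow> 'u" and \<kappa> :: "'u + (int \<times> ('a \<times> 'u) list) \<times> 'u \<Rightarrow> 'u" where "inj w" "inj \<kappa>"
proof -
  have "|(UNIV :: 'u set) \<times> (UNIV :: 'u set)| \<le>o |UNIV :: 'u set|"
    by (rule ordIso_imp_ordLeq[OF card_of_Times_same_infinite[OF assms(1)]])
  then obtain w :: "'u \<times> 'u \<Rightarrow> 'u" where w: "inj w" by (auto simp flip: card_of_ordLeq)
  have w_eq: "w p = w q \<longleftrightarrow> p = q" for p q using w by (auto dest: injD)
  obtain \<nu> :: "nat \<Rightarrow> 'u" where \<nu>: "inj \<nu>" using infinite_countable_subset[OF assms(1)] by auto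
  have \<nu>_eq: "\<nu> p = \<nu> q \<longleftrightarrow> p = q" for p q using \<nu> by (auto dest: injD)
  define cd where "cd k = (if k \<ge> 0 then w (\<nu> 0, \<nu> (nat k)) else w (\<nu> 1, \<nu> (nat (- k))))" for k :: int
  have cd_eq: "cd k = cd l \<longleftrightarrow> k = l" for k l by (auto simp: cd_def w_eq \<nu>_eq)
  define lc where "lc ps = w (\<nu> (length ps), list_code w (\<nu> 0) (map (\<lambda>(a, x). w (i a, x)) ps))"
    for ps :: "('a \<times> 'u) list"
  have lc_eq: "lc ps = lc qs \<longleftrightarrow> ps = qs" for ps qs
  proof
    assume "lc ps = lc qs"
    then have "map (\<lambda>(a, x). w (i a, x)) ps = map (\<lambda>(a, x). w (i a, x)) qs"
      by (intro list_code_inj[OF w]) (auto simp: lc_def w_eq \<nu>_eq)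
    moreover have "inj (\<lambda>(a, x). w (i a, x))"
      using i by (auto simp: inj_on_def w_eq)
    ultimately show "ps = qs" by (simp add: inj_map_eq_map)
  qed simp
  define \<kappa> where "\<kappa> c = (case c of Inl u \<Rightarrow> w (\<nu> 0, u)
    | Inr ((n, ps), u) \<Rightarrow> w (\<nu> 1, w (cd n, w (lc ps, u))))" for c
  have "inj \<kappa>"
    by (rule injI) (auto simp: \<kappa>_def w_eq \<nu>_eq cd_eq lc_eq split: sum.splits)
  then show thesis using that w by blast
qed

context graded_cring begin

text \<open>\<open>Q\<close> is the pushout of \<open>f\<close> and the inclusion of
  \<open>I\<close> into the ring, namely the sum of \<open>M\<close> and \<open>R\<close> modulo all
  \<open>(f a, \<ominus> a)\<close>, and \<open>e\<close> is the class of the new generator.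
  \<open>M\<close> still embeds, since an element \<open>(x, \<zero>)\<close> among the relations
  belongs to \<open>a = \<zero>\<close>. The surjection \<open>q\<close> is returned because it
  bounds the size of \<open>Q\<close>.\<close>

lemma adjoin_solution:
  fixes M :: "('a, 'u) module"
  assumes M: "proj_graded R \<A> M \<pi>" and f: "ideal_hom M \<pi> n I f"
  obtains Q :: "('a, ('u \<times> 'a) set) module" and \<sigma> \<iota> q e
  where "proj_graded R \<A> Q \<sigma>" "\<iota> \<in> mod_hom R M Q" "inj_on \<iota> (carrier M)"
    "\<And>k x. x \<in> carrier M \<Longrightarrow> \<sigma> k (\<iota> x) = \<iota> (\<pi> k x)"
    "carrier Q = q ` (carrier M \<times> carrier R)"
    "e \<in> carrier Q" "\<sigma> n e = e" "\<And>a. a \<in> I \<Longrightarrow> \<iota> (f a) = a \<odot>\<^bsub>Q\<^esub> e"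
proof -
  note D = proj_gradedD[OF M]
  interpret M: module R M by (rule D)
  let ?P = "adjoin_module R M" and ?\<pi> = "\<lambda>k p. (\<pi> k (fst p), ipr (k - n) (snd p))"
  interpret P: module R ?P by (rule M.adjoin_is_module)
  have pP: "proj_graded R \<A> ?P ?\<pi>" by (rule adjoin_proj_graded[OF M])
  have I: "ideal I R" and hI: "\<And>a k. a \<in> I \<Longrightarrow> ipr k a \<in> I" and fc: "\<And>a. a \<in> I \<Longrightarrow> f a \<in> carrier M"
    and fa: "\<And>a b. a \<in> I \<Longrightarrow> b \<in> I \<Longrightarrow> f (a \<oplus> b) = f a \<oplus>\<^bsub>M\<^esub> f b"
    and fm: "\<And>r a. r \<in> carrier R \<Longrightarrow> a \<in> I \<Longrightarrow> f (r \<otimes> a) = r \<odot>\<^bsub>M\<^esub> f a"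
    and fp: "\<And>a k. a \<in> I \<Longrightarrow> \<pi> (k + n) (f a) = f (ipr k a)"
    using f unfolding ideal_hom_def by blast+
  interpret I: ideal I R by (rule I)
  have f0: "f \<zero> = \<zero>\<^bsub>M\<^esub>" using fm[of \<zero> \<zero>] fc[of \<zero>] by simp
  define N where "N = {(f a, \<ominus> a) |a. a \<in> I}"
  have Nmem: "(f a, \<ominus> a) \<in> N" if "a \<in> I" for a using that by (auto simp: N_def)
  have N: "submodule N R ?P"
  proof (rule submoduleI')
    show "additive_subgroup N ?P"
    proof (rule P.additive_subgroupI')
      show "N \<subseteq> carrier ?P" using fc I.Icarr by (auto simp: N_def)
      show "\<zero>\<^bsub>?P\<^esub> \<in> N" using Nmem[of \<zero>] f0 by simp
      fix p assume "p \<in> N"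
      then obtain a where a: "a \<in> I" "p = (f a, \<ominus> a)" by (auto simp: N_def)
      show "p \<oplus>\<^bsub>?P\<^esub> q \<in> N" if q: "q \<in> N" for q
      proof -
        obtain b where b: "b \<in> I" "q = (f b, \<ominus> b)" using q by (auto simp: N_def)
        show ?thesis using Nmem[of "a \<oplus> b"] a b I.Icarr fa by (simp add: minus_add)
      qed
      have "\<ominus>\<^bsub>?P\<^esub> p = (\<ominus> \<one>) \<odot>\<^bsub>?P\<^esub> p"
        using a fc I.Icarr by (subst P.smult_l_minus) (auto simp: simp del: adjoin_module_sel(4))
      also have "\<dots> = (f (\<ominus> a), \<ominus> (\<ominus> a))"
        using a fm[of "\<ominus> \<one>" a] I.Icarr by (simp add: l_minus)
      finally show "\<ominus>\<^bsub>?P\<^esub> p \<in> N" using Nmem[of "\<ominus> a"] a by simp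
    qed
    show "r \<odot>\<^bsub>?P\<^esub> p \<in> N" if r: "r \<in> carrier R" and p: "p \<in> N" for r p
    proof -
      obtain a where a: "a \<in> I" "p = (f a, \<ominus> a)" using p by (auto simp: N_def)
      then show ?thesis using Nmem[of "r \<otimes> a"] r fm I.I_l_closed I.Icarr by (simp add: r_minus)
    qed
  qed
  note Ns = submodule_additive_subgroup[OF N]
  have hom: "?\<pi> k p \<in> N" if p: "p \<in> N" for k p
  proof -
    obtain a where a: "a \<in> I" "p = (f a, \<ominus> a)" using p by (auto simp: N_def)
    have "ipr (k - n) (\<ominus> a) = \<ominus> ipr (k - n) a"
      using additive_map.a_inv[OF ipr_additive_map] a(1) I.Icarr by blast
    then show ?thesis using Nmem[OF hI[OF a(1), of "k - n"]] fp[OF a(1), of "k - n"] a by simp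
  qed
  let ?Q = "quotient_module ?P N" and ?\<sigma> = "quotient_proj ?P N ?\<pi>"
  define q where "q p = N +>\<^bsub>?P\<^esub> p" for p
  note Q = quotient_proj_graded[OF gr pP N hom, folded q_def]
  have qadd: "q p \<oplus>\<^bsub>?Q\<^esub> q p' = q (p \<oplus>\<^bsub>?P\<^esub> p')" if "p \<in> carrier ?P" "p' \<in> carrier ?P" for p p'
    using P.quotient_module_add[OF N that] by (simp add: q_def)
  have qsm: "a \<odot>\<^bsub>?Q\<^esub> q p = q (a \<odot>\<^bsub>?P\<^esub> p)" if "a \<in> carrier R" "p \<in> carrier ?P" for a p
    using P.quotient_module_smult[OF N that] by (simp add: q_def)
  have qeq: "q p = q p' \<longleftrightarrow> p \<ominus>\<^bsub>?P\<^esub> p' \<in> N" if "p \<in> carrier ?P" "p' \<in> carrier ?P" for p p'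
    using P.a_coset_eq_iff[OF Ns that] by (simp add: q_def)
  have qc: "carrier ?Q = q ` carrier ?P" by (simp add: quotient_module_sel q_def)
  show thesis
  proof (rule that[of ?Q ?\<sigma> "\<lambda>x. q (x, \<zero>)" q "q (\<zero>\<^bsub>M\<^esub>, \<one>)"])
    show "proj_graded R \<A> ?Q ?\<sigma>" by (rule Q)
    show "(\<lambda>x. q (x, \<zero>)) \<in> mod_hom R M ?Q"
      by (rule mod_homI) (simp_all add: qc qadd qsm)
    show "inj_on (\<lambda>x. q (x, \<zero>)) (carrier M)"
    proof (rule inj_onI)
      fix x y assume xy: "x \<in> carrier M" "y \<in> carrier M" "q (x, \<zero>) = q (y, \<zero>)"
      then have "(x \<ominus>\<^bsub>M\<^esub> y, \<zero>) \<in> N"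
        using qeq[of "(x, \<zero>)" "(y, \<zero>)"] by (simp add: M.adjoin_minus minus_eq r_neg)
      then obtain a where a: "a \<in> I" "x \<ominus>\<^bsub>M\<^esub> y = f a" "\<ominus> a = \<zero>"
        unfolding N_def by force
      then have "a = \<zero>" using I.Icarr[OF a(1)] minus_minus[of a] by simp
      then show "x = y" using a(2) f0 M.minus_eq_zero_iff[OF xy(1,2)] by simp
    qed
    show "?\<sigma> k (q (x, \<zero>)) = q (\<pi> k x, \<zero>)" if "x \<in> carrier M" for k x
      using Q(2)[of "(x, \<zero>)" k] that additive_map.zero[OF ipr_additive_map] by simp
    show "carrier ?Q = q ` (carrier M \<times> carrier R)" by (simp add: qc)
    show "q (\<zero>\<^bsub>M\<^esub>, \<one>) \<in> carrier ?Q" by (simp add: qc)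
    show "?\<sigma> n (q (\<zero>\<^bsub>M\<^esub>, \<one>)) = q (\<zero>\<^bsub>M\<^esub>, \<one>)"
      using Q(2)[of "(\<zero>\<^bsub>M\<^esub>, \<one>)" n] additive_map.zero[OF D(8)] by (simp add: ipr_one)
    show "q (f a, \<zero>) = a \<odot>\<^bsub>?Q\<^esub> q (\<zero>\<^bsub>M\<^esub>, \<one>)" if a: "a \<in> I" for a
    proof -
      have ac: "a \<in> carrier R" "f a \<in> carrier M" using a I.Icarr fc by auto
      then have "(f a, \<zero>) \<ominus>\<^bsub>?P\<^esub> (\<zero>\<^bsub>M\<^esub>, a) = (f a, \<ominus> a)"
        by (simp add: M.adjoin_minus M.minus_zero_right) (simp add: minus_eq)
      then have "q (f a, \<zero>) = q (\<zero>\<^bsub>M\<^esub>, a)"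
        using Nmem[OF a] qeq[of "(f a, \<zero>)" "(\<zero>\<^bsub>M\<^esub>, a)"] ac by simp
      then show ?thesis using ac by (simp add: qsm)
    qed
  qed
qed

theorem baer_embedding:
  fixes L :: "('a, 'l, 'm) module_scheme" and j :: "'l \<Rightarrow> 'u" and i :: "'a \<Rightarrow> 'u"
  assumes noeth: "noetherian_ring R" and L: "proj_graded R \<A> L \<tau>"
    and j: "inj_on j (carrier L)" and inf: "infinite (UNIV :: 'u set)" and i: "inj i"
  obtains E :: "('a, 'u) module" and \<pi> \<eta> where "proj_graded R \<A> E \<pi>" "baer E \<pi>"
    "\<eta> \<in> mod_hom R L E" "inj_on \<eta> (carrier L)" "\<And>n x. x \<in> carrier L \<Longrightarrow> \<eta> (\<tau> n x) = \<pi> n (\<eta> x)"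
proof -
  obtain w :: "'u \<times> 'u \<Rightarrow> 'u" and \<kappa>0 :: "'u + (int \<times> ('a \<times> 'u) list) \<times> 'u \<Rightarrow> 'u"
    where w: "inj w" and \<kappa>0: "inj \<kappa>0" using infinite_codes[OF inf i] by blast
  have w_eq: "w p = w q \<longleftrightarrow> p = q" for p q using w by (auto dest: injD)
  have \<kappa>0_eq: "\<kappa>0 p = \<kappa>0 q \<longleftrightarrow> p = q" for p q using \<kappa>0 by (auto dest: injD)
  define b0 where "b0 x = \<kappa>0 (Inl (j x))" for x
  define \<kappa> where "\<kappa> c u = \<kappa>0 (Inr (c, u))" for c u
  have \<kappa>_eq: "\<kappa> c u = \<kappa> c' u' \<longleftrightarrow> c = c' \<and> u = u'" for c u c' u' by (simp add: \<kappa>_def \<kappa>0_eq)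
  have b0: "inj_on b0 (carrier L)" using j by (auto simp: inj_on_def b0_def \<kappa>0_eq)
  define L0 where "L0 = transport_module L b0"
  define \<tau>0 where "\<tau>0 = transport_proj L b0 \<tau>"
  have L0: "proj_graded R \<A> L0 \<tau>0"
    unfolding L0_def \<tau>0_def by (rule transport_proj_graded[OF gr L b0])
  have L0c: "carrier L0 = b0 ` carrier L" by (simp add: L0_def transport_sel)
  have \<kappa>L0: "\<kappa> c u \<notin> carrier L0" for c u
    unfolding L0c b0_def \<kappa>_def using \<kappa>0_eq by blast
  text \<open>A code lists a degree together with pairs \<open>(a, x)\<close>; it is solved by \<open>e\<close> if \<open>x = a e\<close> throughout.
    The elements adjoined for a code \<open>c\<close> are named \<open>\<kappa> c u\<close>, so an unsolved code leaves room for its solution.\<close>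
  define solved where "solved M \<pi> = {(n, ps). \<exists>e\<in>carrier M. \<pi> n e = e \<and> (\<forall>(a, x)\<in>set ps. a \<in> carrier R \<and> x = a \<odot>\<^bsub>M\<^esub> e)}"
    for M :: "('a, 'u) module" and \<pi> :: "int \<Rightarrow> 'u \<Rightarrow> 'u"
  have solved_mono: "solved M \<pi> \<subseteq> solved N \<rho>" if "extends R M \<pi> N \<rho>" for M \<pi> N \<rho>
  proof
    fix c assume "c \<in> solved M \<pi>"
    then obtain n ps e where c: "c = (n, ps)" and e: "e \<in> carrier M" "\<pi> n e = e"
      "\<And>a x. (a, x) \<in> set ps \<Longrightarrow> a \<in> carrier R \<and> x = a \<odot>\<^bsub>M\<^esub> e"
      unfolding solved_def by blast
    have "e \<in> carrier N" "\<rho> n e = e" using extendsD(1,4)[OF that e(1)] e(2) by simp_all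
    moreover have "a \<in> carrier R \<and> x = a \<odot>\<^bsub>N\<^esub> e" if "(a, x) \<in> set ps" for a x
      using e(3)[OF that] extendsD(3)[OF \<open>extends R M \<pi> N \<rho>\<close> _ e(1)] by simp
    ultimately show "c \<in> solved N \<rho>" unfolding solved_def c by blast
  qed
  define good where "good M \<pi> \<longleftrightarrow> proj_graded R \<A> M \<pi> \<and> extends R L0 \<tau>0 M \<pi> \<and>
      carrier M \<subseteq> carrier L0 \<union> {\<kappa> c u |c u. c \<in> solved M \<pi>}" for M :: "('a, 'u) module" and \<pi>
  define SS where "SS = {module_graph R M \<pi> |M \<pi>. good M \<pi>}"
  have "good L0 \<tau>0" using L0 by (auto simp: good_def extends_refl)
  then have ne: "SS \<noteq> {}" by (auto simp: SS_def)
  have ch: "\<Union>KK \<in> SS" if KK: "KK \<noteq> {}" "subset.chain SS KK" for KK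
  proof -
    define \<C> where "\<C> = {(M, \<pi>). good M \<pi> \<and> module_graph R M \<pi> \<in> KK}"
    have rep: "\<exists>M \<pi>. (M, \<pi>) \<in> \<C> \<and> s = module_graph R M \<pi>" if "s \<in> KK" for s
      using KK(2) that unfolding subset.chain_def SS_def \<C>_def by blast
    have Cne: "\<C> \<noteq> {}" using rep KK(1) by blast
    have Cpg: "proj_graded R \<A> M \<pi>" if "(M, \<pi>) \<in> \<C>" for M \<pi> using that by (auto simp: \<C>_def good_def)
    have Cch: "extends R M \<pi> N \<rho> \<or> extends R N \<rho> M \<pi>" if "(M, \<pi>) \<in> \<C>" "(N, \<rho>) \<in> \<C>" for M \<pi> N \<rho>
    proof -
      have "module_graph R M \<pi> \<subseteq> module_graph R N \<rho> \<or> module_graph R N \<rho> \<subseteq> module_graph R M \<pi>"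
        using KK(2) that unfolding subset.chain_def \<C>_def by blast
      then show ?thesis by (simp add: module_graph_subset_iff)
    qed
    have "\<exists>(U :: ('a, 'u) module) \<upsilon>. proj_graded R \<A> U \<upsilon> \<and> carrier U = (\<Union>(M, \<pi>)\<in>\<C>. carrier M) \<and>
        (\<forall>M \<pi>. (M, \<pi>) \<in> \<C> \<longrightarrow> extends R M \<pi> U \<upsilon>)"
    proof (rule chain_union_proj_graded[OF gr Cne])
      show "proj_graded R \<A> M \<pi>" if "(M, \<pi>) \<in> \<C>" for M \<pi> by (rule Cpg[OF that])
      show "extends R M \<pi> N \<rho> \<or> extends R N \<rho> M \<pi>" if "(M, \<pi>) \<in> \<C>" "(N, \<rho>) \<in> \<C>" for M \<pi> N \<rho>
        by (rule Cch[OF that])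
    qed blast
    then obtain U :: "('a, 'u) module" and \<upsilon> where U: "proj_graded R \<A> U \<upsilon>"
      "carrier U = (\<Union>(M, \<pi>)\<in>\<C>. carrier M)" "\<And>M \<pi>. (M, \<pi>) \<in> \<C> \<Longrightarrow> extends R M \<pi> U \<upsilon>"
      by blast
    have "good U \<upsilon>" unfolding good_def
    proof (intro conjI)
      show "proj_graded R \<A> U \<upsilon>" by (rule U)
      obtain M \<pi> where M: "(M, \<pi>) \<in> \<C>" using Cne by auto
      then show "extends R L0 \<tau>0 U \<upsilon>"
        using extends_trans[OF _ U(3)[OF M], of L0 \<tau>0] by (auto simp: \<C>_def good_def)
      show "carrier U \<subseteq> carrier L0 \<union> {\<kappa> c u |c u. c \<in> solved U \<upsilon>}"
      proof
        fix x assume "x \<in> carrier U"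
        then obtain M \<pi> where M: "(M, \<pi>) \<in> \<C>" "x \<in> carrier M" using U(2) by auto
        then have "x \<in> carrier L0 \<union> {\<kappa> c u |c u. c \<in> solved M \<pi>}" by (auto simp: \<C>_def good_def)
        then show "x \<in> carrier L0 \<union> {\<kappa> c u |c u. c \<in> solved U \<upsilon>}"
          using solved_mono[OF U(3)[OF M(1)]] by blast
      qed
    qed
    moreover have "\<Union>KK = module_graph R U \<upsilon>"
    proof
      show "\<Union>KK \<subseteq> module_graph R U \<upsilon>"
      proof
        fix z assume "z \<in> \<Union>KK"
        then obtain s where s: "s \<in> KK" "z \<in> s" by blast
        obtain M \<pi> where "(M, \<pi>) \<in> \<C>" "s = module_graph R M \<pi>" using rep[OF s(1)] by blast
        then show "z \<in> module_graph R U \<upsilon>" using U(3) s(2) module_graph_subset_iff by blast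
      qed
      have *: "z \<in> \<Union>KK" if "(M, \<pi>) \<in> \<C>" "z \<in> module_graph R M \<pi>" for z M \<pi>
        using that by (auto simp: \<C>_def)
      have pair: "\<exists>M \<pi>. (M, \<pi>) \<in> \<C> \<and> x \<in> carrier M \<and> y \<in> carrier M"
        if xy: "x \<in> carrier U" "y \<in> carrier U" for x y
      proof -
        obtain M \<pi> where M: "(M, \<pi>) \<in> \<C>" "x \<in> carrier M" using xy(1) U(2) by auto
        obtain N \<rho> where N: "(N, \<rho>) \<in> \<C>" "y \<in> carrier N" using xy(2) U(2) by auto
        show ?thesis using Cch[OF M(1) N(1)] M N extendsD(1) by meson
      qed
      show "module_graph R U \<upsilon> \<subseteq> \<Union>KK"
      proof
        fix z assume "z \<in> module_graph R U \<upsilon>"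
        then consider (add) x y where "z = Inl (x, y, x \<oplus>\<^bsub>U\<^esub> y)" "x \<in> carrier U" "y \<in> carrier U"
          | (sm) a x where "z = Inr (Inl (a, x, a \<odot>\<^bsub>U\<^esub> x))" "a \<in> carrier R" "x \<in> carrier U"
          | (pj) n x where "z = Inr (Inr (n, x, \<upsilon> n x))" "x \<in> carrier U"
          unfolding module_graph_def by blast
        then show "z \<in> \<Union>KK"
        proof cases
          case add
          obtain M \<pi> where M: "(M, \<pi>) \<in> \<C>" "x \<in> carrier M" "y \<in> carrier M" using pair[OF add(2,3)] by blast
          show ?thesis by (rule *[OF M(1)]) (use add M extendsD(2)[OF U(3)[OF M(1)]] in simp)
        next
          case sm
          obtain M \<pi> where M: "(M, \<pi>) \<in> \<C>" "x \<in> carrier M" using pair[OF sm(3,3)] by blast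
          show ?thesis by (rule *[OF M(1)]) (use sm M extendsD(3)[OF U(3)[OF M(1)]] in simp)
        next
          case pj
          obtain M \<pi> where M: "(M, \<pi>) \<in> \<C>" "x \<in> carrier M" using pair[OF pj(2,2)] by blast
          show ?thesis by (rule *[OF M(1)]) (use pj M extendsD(4)[OF U(3)[OF M(1)]] in simp)
        qed
      qed
    qed
    ultimately show ?thesis unfolding SS_def by blast
  qed
  obtain S where S: "S \<in> SS" and max: "\<And>T. T \<in> SS \<Longrightarrow> S \<subseteq> T \<Longrightarrow> T = S"
    using subset_Zorn_nonempty[OF ne ch] by blast
  obtain M \<pi> where M: "good M \<pi>" "S = module_graph R M \<pi>" using S by (auto simp: SS_def)
  have maxM: "extends R N \<rho> M \<pi>" if "good N \<rho>" "extends R M \<pi> N \<rho>" for N \<rho>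
  proof -
    have "module_graph R N \<rho> = S"
      by (rule max) (use that M(2) in \<open>auto simp: SS_def module_graph_subset_iff\<close>)
    then show ?thesis using M(2) by (simp flip: module_graph_subset_iff)
  qed
  have pM: "proj_graded R \<A> M \<pi>" and eM: "extends R L0 \<tau>0 M \<pi>"
    and cM: "carrier M \<subseteq> carrier L0 \<union> {\<kappa> c u |c u. c \<in> solved M \<pi>}"
    using M(1) by (auto simp: good_def)
  interpret M: module R M by (rule proj_gradedD(1)[OF pM])
  have "\<exists>e\<in>carrier M. \<pi> n e = e \<and> (\<forall>a\<in>I. f a = a \<odot>\<^bsub>M\<^esub> e)" if f: "ideal_hom M \<pi> n I f" for n I f
  proof -
    have I: "ideal I R" and fc: "\<And>a. a \<in> I \<Longrightarrow> f a \<in> carrier M"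
      and fa: "\<And>a b. a \<in> I \<Longrightarrow> b \<in> I \<Longrightarrow> f (a \<oplus> b) = f a \<oplus>\<^bsub>M\<^esub> f b"
      and fm: "\<And>r a. r \<in> carrier R \<Longrightarrow> a \<in> I \<Longrightarrow> f (r \<otimes> a) = r \<odot>\<^bsub>M\<^esub> f a"
      using f unfolding ideal_hom_def by blast+
    interpret I: ideal I R by (rule I)
    obtain G where G: "G \<subseteq> carrier R" "finite G" "I = Idl G"
      using noetherian_ring.finetely_gen[OF noeth I] by blast
    obtain gs where gs: "set gs = G" using finite_list[OF G(2)] by blast
    have GI: "G \<subseteq> I" using genideal_self[OF G(1)] G(3) by simp
    define ps where "ps = map (\<lambda>a. (a, f a)) gs"
    have ps: "set ps = (\<lambda>a. (a, f a)) ` G" by (simp add: ps_def gs)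
    have "(n, ps) \<in> solved M \<pi>"
    proof (rule ccontr)
      assume ns: "(n, ps) \<notin> solved M \<pi>"
      \<comment> \<open>As the problem is unsolved, none of the names
        \<open>\<kappa> (n, ps) u\<close> is in use. The pushout fits into the type, with
        \<open>M\<close> left in place and only the new elements renamed.\<close>
      have \<kappa>M: "\<kappa> (n, ps) u \<notin> carrier M" for u using cM ns \<kappa>L0 by (auto simp: \<kappa>_eq)
      obtain Q :: "('a, ('u \<times> 'a) set) module" and \<sigma> \<iota> q e
        where Q: "proj_graded R \<A> Q \<sigma>" "\<iota> \<in> mod_hom R M Q" "inj_on \<iota> (carrier M)"
        "\<And>k x. x \<in> carrier M \<Longrightarrow> \<sigma> k (\<iota> x) = \<iota> (\<pi> k x)" "carrier Q = q ` (carrier M \<times> carrier R)"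
        "e \<in> carrier Q" "\<sigma> n e = e" "\<And>a. a \<in> I \<Longrightarrow> \<iota> (f a) = a \<odot>\<^bsub>Q\<^esub> e"
        by (rule adjoin_solution[OF pM f]) (rule that; assumption)
      define g where "g C = (let p = inv_into (carrier M \<times> carrier R) q C in w (fst p, i (snd p)))" for C
      have g_eq: "C = C'" if "g C = g C'" "C \<in> carrier Q" "C' \<in> carrier Q" for C C'
      proof -
        have "inv_into (carrier M \<times> carrier R) q C = inv_into (carrier M \<times> carrier R) q C'"
          using that(1) injD[OF i] by (auto simp: g_def Let_def w_eq prod_eq_iff)
        then show ?thesis using that(2,3) Q(5) by (metis inv_into_injective)
      qed
      define b where "b C = (if C \<in> \<iota> ` carrier M then inv_into (carrier M) \<iota> C else \<kappa> (n, ps) (g C))" for C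
      have b\<iota>: "b (\<iota> x) = x" if "x \<in> carrier M" for x using that Q(3) by (simp add: b_def)
      have binj: "inj_on b (carrier Q)"
      proof (rule inj_onI)
        fix C C' assume C: "C \<in> carrier Q" "C' \<in> carrier Q" "b C = b C'"
        have bM: "b D \<in> carrier M \<longleftrightarrow> D \<in> \<iota> ` carrier M" for D
          using \<kappa>M by (auto simp: b_def inv_into_into)
        show "C = C'"
        proof (cases "C \<in> \<iota> ` carrier M")
          case True
          then have "C' \<in> \<iota> ` carrier M" using bM[of C] bM[of C'] C(3) by simp
          then show ?thesis using True C(3) b\<iota> by auto
        next
          case False
          then have "C' \<notin> \<iota> ` carrier M" using bM[of C] bM[of C'] C(3) by simp
          then show ?thesis using False C g_eq by (simp add: b_def \<kappa>_eq)
        qed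
      qed
      define N where "N = transport_module Q b"
      define \<rho> where "\<rho> = transport_proj Q b \<sigma>"
      have pN: "proj_graded R \<A> N \<rho>"
        unfolding N_def \<rho>_def by (rule transport_proj_graded[OF gr Q(1) binj])
      have \<iota>c: "\<iota> x \<in> carrier Q" if "x \<in> carrier M" for x using mod_homD(1)[OF Q(2) that] .
      have ext: "extends R M \<pi> N \<rho>" unfolding extends_def
      proof (intro conjI ballI allI subsetI)
        fix x assume x: "x \<in> carrier M"
        show "x \<in> carrier N" using imageI[OF \<iota>c[OF x], of b] b\<iota>[OF x] by (simp add: N_def transport_sel)
        show "x \<oplus>\<^bsub>N\<^esub> y = x \<oplus>\<^bsub>M\<^esub> y" if y: "y \<in> carrier M" for y
          using transport_sel(3)[OF binj \<iota>c[OF x] \<iota>c[OF y]] x y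
          by (simp add: b\<iota> N_def flip: mod_homD(2)[OF Q(2)])
        show "a \<odot>\<^bsub>N\<^esub> x = a \<odot>\<^bsub>M\<^esub> x" if a: "a \<in> carrier R" for a
          using transport_sel(4)[OF binj \<iota>c[OF x], of a] x a
          by (simp add: b\<iota> N_def flip: mod_homD(3)[OF Q(2)])
        show "\<rho> k x = \<pi> k x" for k
          using transport_sel(5)[OF binj \<iota>c[OF x], of \<sigma> k] x Q(4)[OF x] proj_gradedD(2)[OF pM x]
          by (simp add: b\<iota> \<rho>_def)
      qed
      have sol: "(n, ps) \<in> solved N \<rho>" unfolding solved_def
      proof (intro CollectI case_prodI bexI[of _ "b e"] conjI ballI)
        show "b e \<in> carrier N" using Q(6) by (simp add: N_def transport_sel)
        show "\<rho> n (b e) = b e" using transport_sel(5)[OF binj Q(6), of \<sigma> n] Q(7) by (simp add: \<rho>_def)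
        fix p assume "p \<in> set ps"
        then obtain a where a: "a \<in> G" "p = (a, f a)" using ps by auto
        then have aI: "a \<in> I" using GI by blast
        have "f a = a \<odot>\<^bsub>N\<^esub> b e"
          using transport_sel(4)[OF binj Q(6), of a] Q(8)[OF aI] b\<iota>[OF fc[OF aI]]
          by (simp add: N_def)
        then show "case p of (a, x) \<Rightarrow> a \<in> carrier R \<and> x = a \<odot>\<^bsub>N\<^esub> b e" using a I.Icarr[OF aI] by simp
      qed
      have "good N \<rho>" unfolding good_def
      proof (intro conjI subsetI)
        show "proj_graded R \<A> N \<rho>" by (rule pN)
        show "extends R L0 \<tau>0 N \<rho>" by (rule extends_trans[OF eM ext])
        fix z assume "z \<in> carrier N"
        then obtain C where C: "C \<in> carrier Q" "z = b C" by (auto simp: N_def transport_sel)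
        show "z \<in> carrier L0 \<union> {\<kappa> c u |c u. c \<in> solved N \<rho>}"
        proof (cases "C \<in> \<iota> ` carrier M")
          case True
          then have "z \<in> carrier M" using C b\<iota> by auto
          then show ?thesis using cM solved_mono[OF ext] by blast
        next
          case False
          then have "z = \<kappa> (n, ps) (g C)" using C by (simp add: b_def)
          then show ?thesis using sol by blast
        qed
      qed
      then have "(n, ps) \<in> solved M \<pi>" using solved_mono[OF maxM[OF _ ext]] sol by blast
      then show False using ns by simp
    qed
    then obtain e where e: "e \<in> carrier M" "\<pi> n e = e" "\<And>a. a \<in> G \<Longrightarrow> f a = a \<odot>\<^bsub>M\<^esub> e"
      unfolding solved_def by (auto simp: ps)
    \<comment> \<open>The list \<open>ps\<close> records \<open>f\<close> on generators only; the
      \<open>a\<close> with \<open>f a = a e\<close> form an ideal, so \<open>e\<close> is correct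
      on all of \<open>I\<close>.\<close>
    have "ideal {a \<in> I. f a = a \<odot>\<^bsub>M\<^esub> e} R"
    proof (rule ideal_criterion)
      show "\<zero> \<in> {a \<in> I. f a = a \<odot>\<^bsub>M\<^esub> e}" using fm[of \<zero> \<zero>] fc[of \<zero>] e(1) by simp
      show "a \<oplus> a' \<in> {a \<in> I. f a = a \<odot>\<^bsub>M\<^esub> e}" if "a \<in> {a \<in> I. f a = a \<odot>\<^bsub>M\<^esub> e}" "a' \<in> {a \<in> I. f a = a \<odot>\<^bsub>M\<^esub> e}" for a a'
        using that e(1) I.Icarr by (auto simp: fa M.smult_l_distr)
      show "r \<otimes> a \<in> {a \<in> I. f a = a \<odot>\<^bsub>M\<^esub> e}" if "r \<in> carrier R" "a \<in> {a \<in> I. f a = a \<odot>\<^bsub>M\<^esub> e}" for r a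
        using that e(1) I.Icarr I.I_l_closed by (auto simp: fm M.smult_assoc1)
    qed (use I.Icarr in auto)
    then have "I \<subseteq> {a \<in> I. f a = a \<odot>\<^bsub>M\<^esub> e}"
      unfolding G(3) by (rule genideal_minimal) (use GI e(3) G(3) in auto)
    then show ?thesis using e(1,2) by blast
  qed
  then have bM: "baer M \<pi>" unfolding baer_def by blast
  show thesis
  proof (rule that[of M \<pi> b0])
    have L0M: "b0 x \<in> carrier L0" if "x \<in> carrier L" for x using that by (simp add: L0c)
    show "b0 \<in> mod_hom R L M"
    proof (rule mod_homI)
      show "b0 x \<in> carrier M" if "x \<in> carrier L" for x using extendsD(1)[OF eM L0M[OF that]] .
      show "b0 (x \<oplus>\<^bsub>L\<^esub> y) = b0 x \<oplus>\<^bsub>M\<^esub> b0 y" if "x \<in> carrier L" "y \<in> carrier L" for x y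
        using extendsD(2)[OF eM L0M[OF that(1)] L0M[OF that(2)]] transport_sel(3)[OF b0 that]
        by (simp add: L0_def)
      show "b0 (a \<odot>\<^bsub>L\<^esub> x) = a \<odot>\<^bsub>M\<^esub> b0 x" if "a \<in> carrier R" "x \<in> carrier L" for a x
        using extendsD(3)[OF eM that(1) L0M[OF that(2)]] transport_sel(4)[OF b0 that(2)]
        by (simp add: L0_def)
    qed
    show "b0 (\<tau> n x) = \<pi> n (b0 x)" if "x \<in> carrier L" for n x
      using extendsD(4)[OF eM L0M[OF that]] transport_sel(5)[OF b0 that, of \<tau> n]
      by (simp add: \<tau>0_def)
  qed (use pM bM b0 in auto)
qed

end

section \<open>Existence of injective resolutions\<close>

lemma (in abelian_group) carrier_additive_subgroup: "additive_subgroup (carrier G) G"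
  by (rule additive_subgroupI') auto

lemma mod_hom_image_submodule:
  assumes "module R M" "module R N" "f \<in> mod_hom R M N"
  shows "submodule (f ` carrier M) R N"
proof (rule submoduleI')
  interpret f: additive_map M N f by (rule mod_hom_additive_map[OF assms])
  interpret M: module R M by fact
  show "additive_subgroup (f ` carrier M) N"
    by (rule f.additive_subgroup_image[OF f.G.carrier_additive_subgroup])
  show "a \<odot>\<^bsub>N\<^esub> x \<in> f ` carrier M" if "a \<in> carrier R" "x \<in> f ` carrier M" for a x
    using that by (auto simp flip: mod_homD(3)[OF assms(3)])
qed

lemma graded_injective_moduleD:
  fixes A B :: "('a, 'a) module"
  assumes "graded_injective_module R \<A> E \<E>" "graded_module R \<A> A \<G>" "graded_module R \<A> B \<H>"
    "u \<in> graded_hom R A \<G> B \<H>" "inj_on u (carrier A)" "f \<in> graded_hom R A \<G> E \<E>"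
  shows "\<exists>h\<in>graded_hom R B \<H> E \<E>. \<forall>x\<in>carrier A. h (u x) = f x"
  using conjunct2[OF assms(1)[unfolded graded_injective_module_def], rule_format, of A \<G> B \<H> u f]
    assms(2-) by simp

lemma graded_injective_resolutionD:
  assumes "graded_injective_resolution R \<A> L \<L> E \<E> \<eta> d"
  shows "graded_injective_module R \<A> (E k) (\<E> k)" and "\<eta> \<in> mod_hom R L (E 0)" and "inj_on \<eta> (carrier L)"
    and "\<eta> ` carrier L = mod_kernel (E 0) (E 1) (d 0)" and "d k \<in> mod_hom R (E k) (E (Suc k))"
    and "d k ` carrier (E k) = mod_kernel (E (Suc k)) (E (Suc (Suc k))) (d (Suc k))"
    and "x \<in> \<L> n \<Longrightarrow> \<eta> x \<in> \<E> 0 n" and "d k \<in> graded_hom R (E k) (\<E> k) (E (Suc k)) (\<E> (Suc k))"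
    and "y \<in> \<E> k n \<Longrightarrow> d k y \<in> \<E> (Suc k) n"
proof -
  have 1: "\<forall>i. graded_injective_module R \<A> (E i) (\<E> i)" "exact_coresolution R L E \<eta> d"
    "\<eta> \<in> graded_hom R L \<L> (E 0) (\<E> 0)" "\<forall>i. d i \<in> graded_hom R (E i) (\<E> i) (E (Suc i)) (\<E> (Suc i))"
    using assms by (simp_all add: graded_injective_resolution_def)
  show "graded_injective_module R \<A> (E k) (\<E> k)" using 1(1) by simp
  show "\<eta> \<in> mod_hom R L (E 0)" "inj_on \<eta> (carrier L)" "\<eta> ` carrier L = mod_kernel (E 0) (E 1) (d 0)"
    "d k \<in> mod_hom R (E k) (E (Suc k))"
    "d k ` carrier (E k) = mod_kernel (E (Suc k)) (E (Suc (Suc k))) (d (Suc k))"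
    using 1(2) by (simp_all add: exact_coresolution_def)
  show "\<eta> x \<in> \<E> 0 n" if "x \<in> \<L> n" using 1(3) that by (auto simp: graded_hom_def)
  show dk: "d k \<in> graded_hom R (E k) (\<E> k) (E (Suc k)) (\<E> (Suc k))" using 1(4) by simp
  show "d k y \<in> \<E> (Suc k) n" if "y \<in> \<E> k n" using dk that by (auto simp: graded_hom_def)
qed

context graded_cring begin

lemma baer_embedding_quotient:
  fixes E :: "('a, 'u) module" and i :: "'a \<Rightarrow> 'u"
  assumes noeth: "noetherian_ring R" and inf: "infinite (UNIV :: 'u set)" and i: "inj i"
    and E: "proj_graded R \<A> E \<pi>" and K: "submodule K R E" "\<And>n x. x \<in> K \<Longrightarrow> \<pi> n x \<in> K"
  shows "\<exists>(E' :: ('a, 'u) module) \<pi>' d. proj_graded R \<A> E' \<pi>' \<and> baer E' \<pi>' \<and> d \<in> mod_hom R E E' \<and>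
    mod_kernel E E' d = K \<and> (\<forall>x\<in>carrier E. \<forall>n. d (\<pi> n x) = \<pi>' n (d x))"
proof -
  note D = proj_gradedD[OF E]
  interpret E: module R E by (rule D)
  let ?Q = "quotient_module E K" and ?\<sigma> = "quotient_proj E K \<pi>"
  have Q: "proj_graded R \<A> ?Q ?\<sigma>" by (rule quotient_proj_graded(1)[OF gr E K])
  have Q2: "?\<sigma> n (K +>\<^bsub>E\<^esub> x) = K +>\<^bsub>E\<^esub> \<pi> n x" if "x \<in> carrier E" for n x
    by (rule quotient_proj_graded(2)[OF gr E K that])
  interpret Q: module R ?Q by (rule proj_gradedD(1)[OF Q])
  define q where "q x = K +>\<^bsub>E\<^esub> x" for x
  have Qc: "carrier ?Q = q ` carrier E" by (simp add: quotient_module_sel q_def)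
  \<comment> \<open>Elements of the quotient are sets of elements of \<open>E\<close>. Choosing
    representatives brings them back into the type \<open>'u\<close>, so one type suffices for the
    whole resolution.\<close>
  have jq: "inj_on (inv_into (carrier E) q) (carrier ?Q)" unfolding Qc by (rule inj_on_inv_into) simp
  obtain E' :: "('a, 'u) module" and \<pi>' \<eta> where E': "proj_graded R \<A> E' \<pi>'" "baer E' \<pi>'"
    "\<eta> \<in> mod_hom R ?Q E'" "inj_on \<eta> (carrier ?Q)" "\<And>n x. x \<in> carrier ?Q \<Longrightarrow> \<eta> (?\<sigma> n x) = \<pi>' n (\<eta> x)"
    by (rule baer_embedding[OF noeth Q jq inf i]) (rule that; assumption)
  interpret E': module R E' by (rule proj_gradedD(1)[OF E'(1)])
  interpret \<eta>: additive_map ?Q E' \<eta> by (rule mod_hom_additive_map[OF Q.module_axioms E'.module_axioms E'(3)])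
  have qhom: "q \<in> mod_hom R E ?Q" unfolding q_def by (rule E.quotient_module_proj_hom[OF K(1)])
  have qc: "q x \<in> carrier ?Q" if "x \<in> carrier E" for x by (rule mod_homD(1)[OF qhom that])
  show ?thesis
  proof (intro exI conjI ballI allI)
    show "proj_graded R \<A> E' \<pi>'" "baer E' \<pi>'" by fact+
    show "(\<lambda>x. \<eta> (q x)) \<in> mod_hom R E E'"
      by (rule mod_homI) (simp_all add: qc mod_homD[OF qhom] mod_homD[OF E'(3)])
    have "\<eta> (q x) = \<zero>\<^bsub>E'\<^esub> \<longleftrightarrow> x \<in> K" if x: "x \<in> carrier E" for x
    proof -
      have "\<eta> (q x) = \<zero>\<^bsub>E'\<^esub> \<longleftrightarrow> q x = \<zero>\<^bsub>?Q\<^esub>"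
        using inj_onD[OF E'(4) _ qc[OF x] Q.M.zero_closed] \<eta>.zero by metis
      then show ?thesis using E.quotient_module_zero_iff[OF K(1) x] by (simp add: q_def)
    qed
    then show "mod_kernel E E' (\<lambda>x. \<eta> (q x)) = K"
      using additive_subgroup.a_Hcarr[OF submodule_additive_subgroup[OF K(1)]]
      by (auto simp: mod_kernel_def)
    show "\<eta> (q (\<pi> n x)) = \<pi>' n (\<eta> (q x))" if x: "x \<in> carrier E" for x n
      using E'(5)[OF qc[OF x], of n] Q2[OF x, of n] by (simp add: q_def)
  qed
qed

lemma homogeneous_image:
  assumes M: "proj_graded R \<A> M \<alpha>" and N: "proj_graded R \<A> N \<rho>" and f: "f \<in> mod_hom R M N"
    and c: "\<And>n x. x \<in> carrier M \<Longrightarrow> f (\<alpha> n x) = \<rho> n (f x)"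
  shows "submodule (f ` carrier M) R N" and "x \<in> f ` carrier M \<Longrightarrow> \<rho> n x \<in> f ` carrier M"
proof -
  show "submodule (f ` carrier M) R N"
    by (rule mod_hom_image_submodule[OF proj_gradedD(1)[OF M] proj_gradedD(1)[OF N] f])
  show "\<rho> n x \<in> f ` carrier M" if "x \<in> f ` carrier M"
  proof -
    obtain y where "y \<in> carrier M" "x = f y" using \<open>x \<in> f ` carrier M\<close> by blast
    then show ?thesis using c[of y n] proj_gradedD(2)[OF M, of y n] by (metis imageI)
  qed
qed

text \<open>Dependent choice on triples \<open>(E, \<pi>, K)\<close>, where \<open>K\<close> is the
  image of the preceding map and is to become the kernel of the next one. The clause for
  \<open>k = 0\<close> in \<open>ok\<close> ties the sequence to \<open>\<eta>\<close>.\<close>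

theorem graded_injective_resolution_exists:
  fixes L :: "('a, 'x, 'm) module_scheme" and i :: "'a \<Rightarrow> 'u" and j :: "'x \<Rightarrow> 'u"
  assumes noeth: "noetherian_ring R" and inf: "infinite (UNIV :: 'u set)" and i: "inj i" and j: "inj j"
    and L: "proj_graded R \<A> L \<tau>"
  shows "\<exists>(E :: nat \<Rightarrow> ('a, 'u) module) \<E> \<eta> d.
    graded_injective_resolution R \<A> L (\<lambda>n. {x \<in> carrier L. \<tau> n x = x}) E \<E> \<eta> d"
proof -
  have jL: "inj_on j (carrier L)" using j by (rule inj_on_subset) simp
  obtain E0 :: "('a, 'u) module" and \<pi>0 \<eta> where E0: "proj_graded R \<A> E0 \<pi>0" "baer E0 \<pi>0"
    "\<eta> \<in> mod_hom R L E0" "inj_on \<eta> (carrier L)" "\<And>n x. x \<in> carrier L \<Longrightarrow> \<eta> (\<tau> n x) = \<pi>0 n (\<eta> x)"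
    by (rule baer_embedding[OF noeth L jL inf i]) (rule that; assumption)
  define ok where "ok k s \<longleftrightarrow> (case s of (E, \<pi>, K) \<Rightarrow> proj_graded R \<A> E \<pi> \<and> baer E \<pi> \<and> submodule K R E \<and>
      (\<forall>n. \<forall>x\<in>K. \<pi> n x \<in> K) \<and> (k = 0 \<longrightarrow> E = E0 \<and> \<pi> = \<pi>0 \<and> K = \<eta> ` carrier L))"
    for k :: nat and s :: "('a, 'u) module \<times> (int \<Rightarrow> 'u \<Rightarrow> 'u) \<times> 'u set"
  define rel where "rel s s' d \<longleftrightarrow> (case s of (E, \<pi>, K) \<Rightarrow> case s' of (E', \<pi>', K') \<Rightarrow>
      d \<in> mod_hom R E E' \<and> mod_kernel E E' d = K \<and> d ` carrier E = K' \<and>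
      (\<forall>x\<in>carrier E. \<forall>n. d (\<pi> n x) = \<pi>' n (d x)))"
    for s s' :: "('a, 'u) module \<times> (int \<Rightarrow> 'u \<Rightarrow> 'u) \<times> 'u set" and d
  have ok0: "ok 0 (E0, \<pi>0, \<eta> ` carrier L)"
    unfolding ok_def prod.case
  proof (intro conjI allI ballI impI refl)
    show "submodule (\<eta> ` carrier L) R E0" by (rule homogeneous_image(1)[OF L E0(1,3)]) (rule E0(5))
    show "\<pi>0 n x \<in> \<eta> ` carrier L" if "x \<in> \<eta> ` carrier L" for n x
      by (rule homogeneous_image(2)[OF L E0(1,3)]) (rule E0(5), assumption, rule that)
  qed (fact E0(1,2))+
  have step: "\<exists>s'. ok (Suc k) s' \<and> (\<exists>d. rel s s' d)" if s: "ok k s"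
    for k and s :: "('a, 'u) module \<times> (int \<Rightarrow> 'u \<Rightarrow> 'u) \<times> 'u set"
  proof -
    obtain E \<pi> K where s_eq: "s = (E, \<pi>, K)" by (rule prod_cases3)
    have E: "proj_graded R \<A> E \<pi>" and K: "submodule K R E" "\<And>n x. x \<in> K \<Longrightarrow> \<pi> n x \<in> K"
      using s unfolding ok_def s_eq prod.case by blast+
    obtain E' :: "('a, 'u) module" and \<pi>' d where E': "proj_graded R \<A> E' \<pi>'" "baer E' \<pi>'" "d \<in> mod_hom R E E'"
      "mod_kernel E E' d = K" "\<And>n x. x \<in> carrier E \<Longrightarrow> d (\<pi> n x) = \<pi>' n (d x)"
      using baer_embedding_quotient[OF noeth inf i E K] by blast
    have "ok (Suc k) (E', \<pi>', d ` carrier E)"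
      unfolding ok_def prod.case
    proof (intro conjI allI ballI impI)
      show "submodule (d ` carrier E) R E'" by (rule homogeneous_image(1)[OF E E'(1,3)]) (rule E'(5))
      show "\<pi>' n x \<in> d ` carrier E" if "x \<in> d ` carrier E" for n x
        by (rule homogeneous_image(2)[OF E E'(1,3)]) (rule E'(5), assumption, rule that)
    qed (use E' in simp_all)
    moreover have "rel s (E', \<pi>', d ` carrier E) d"
      unfolding rel_def s_eq prod.case using E'(3,4,5) by blast
    ultimately show ?thesis by blast
  qed
  have "\<exists>S. \<forall>k. ok k (S k) \<and> (\<exists>d. rel (S k) (S (Suc k)) d)"
    by (rule dependent_nat_choice) (use ok0 step in blast)+
  then obtain S where S: "\<And>k. ok k (S k)" "\<And>k. \<exists>d. rel (S k) (S (Suc k)) d" by blast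
  obtain d where d: "\<And>k. rel (S k) (S (Suc k)) (d k)" using S(2) by metis
  define E where "E k = fst (S k)" for k
  define \<pi> where "\<pi> k = fst (snd (S k))" for k
  define \<E> where "\<E> k n = {x \<in> carrier (E k). \<pi> k n x = x}" for k n
  have pE: "proj_graded R \<A> (E k) (\<pi> k)" "baer (E k) (\<pi> k)" for k
    using S(1)[of k] by (auto simp: ok_def E_def \<pi>_def split: prod.splits)
  have S0: "S 0 = (E0, \<pi>0, \<eta> ` carrier L)" using S(1)[of 0] by (auto simp: ok_def split: prod.splits)
  have dk: "d k \<in> mod_hom R (E k) (E (Suc k))" "mod_kernel (E k) (E (Suc k)) (d k) = snd (snd (S k))"
    "d k ` carrier (E k) = snd (snd (S (Suc k)))"
    "\<And>n x. x \<in> carrier (E k) \<Longrightarrow> d k (\<pi> k n x) = \<pi> (Suc k) n (d k x)" for k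
    using d[of k] by (auto simp: rel_def E_def \<pi>_def split: prod.splits)
  have "graded_injective_resolution R \<A> L (\<lambda>n. {x \<in> carrier L. \<tau> n x = x}) E \<E> \<eta> d"
    unfolding graded_injective_resolution_def exact_coresolution_def
  proof (intro conjI allI)
    show "graded_injective_module R \<A> (E k) (\<E> k)" for k
      unfolding \<E>_def by (rule baer_imp_graded_injective[OF pE])
    show "\<eta> \<in> mod_hom R L (E 0)" using E0(3) by (simp add: E_def S0)
    show "inj_on \<eta> (carrier L)" by fact
    show "\<eta> ` carrier L = mod_kernel (E 0) (E 1) (d 0)" using dk(2)[of 0] by (simp add: S0)
    show "d k \<in> mod_hom R (E k) (E (Suc k))" for k by (rule dk)
    show "d k ` carrier (E k) = mod_kernel (E (Suc k)) (E (Suc (Suc k))) (d (Suc k))" for k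
      using dk(3)[of k] dk(2)[of "Suc k"] by simp
    show "\<eta> \<in> graded_hom R L (\<lambda>n. {x \<in> carrier L. \<tau> n x = x}) (E 0) (\<E> 0)"
      using E0(3) mod_homD(1)[OF E0(3)] E0(5)
      by (auto simp: graded_hom_def \<E>_def E_def \<pi>_def S0) metis
    show "d k \<in> graded_hom R (E k) (\<E> k) (E (Suc k)) (\<E> (Suc k))" for k
      using dk(1) mod_homD(1)[OF dk(1)] dk(4)
      by (auto simp: graded_hom_def \<E>_def) metis
  qed
  then show ?thesis by blast
qed

text \<open>The choice operator yields a resolution because one exists in exactly this type: lists
  form an infinite type, and singleton lists embed ring elements and module elements into
  it.\<close>

lemma chosen_graded_resolution:
  fixes L :: "('a, 'x, 'm) module_scheme"
  assumes noeth: "noetherian_ring R" and L: "graded_module R \<A> L \<L>"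
  obtains E \<E> d \<eta> where "chosen_graded_resolution R \<A> L \<L> = (E, \<E>, d)"
    "graded_injective_resolution R \<A> L \<L> E \<E> \<eta> d"
proof -
  interpret L: direct_sum L \<L> by (rule graded_moduleD(2)[OF L])
  have eq: "(\<lambda>n. {x \<in> carrier L. gproj L \<L> n x = x}) = \<L>"
    using L.pr_eq_self_iff L.sub by (intro ext) auto
  have inf: "infinite (UNIV :: ('a \<times> 'x) list set)" by (rule infinite_UNIV_listI)
  have inj: "inj (\<lambda>a :: 'a. [(a, undefined :: 'x)])" "inj (\<lambda>x :: 'x. [(undefined :: 'a, x)])"
    by (auto simp: inj_def)
  obtain E :: "nat \<Rightarrow> ('a, ('a \<times> 'x) list) module" and \<E> \<eta> d
    where "graded_injective_resolution R \<A> L \<L> E \<E> \<eta> d"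
    using graded_injective_resolution_exists[OF noeth inf inj proj_graded_gproj[OF gr L]]
    unfolding eq by blast
  then have "\<exists>t :: (nat \<Rightarrow> ('a, ('a \<times> 'x) list) module) \<times> (nat \<Rightarrow> int \<Rightarrow> ('a \<times> 'x) list set) \<times>
      (nat \<Rightarrow> ('a \<times> 'x) list \<Rightarrow> ('a \<times> 'x) list).
      case t of (E, \<E>, d) \<Rightarrow> \<exists>\<eta>. graded_injective_resolution R \<A> L \<L> E \<E> \<eta> d" by auto
  then have "case chosen_graded_resolution R \<A> L \<L> of (E, \<E>, d) \<Rightarrow>
      \<exists>\<eta>. graded_injective_resolution R \<A> L \<L> E \<E> \<eta> d"
    unfolding chosen_graded_resolution_def by (rule someI_ex)
  then show thesis using that by (auto split: prod.splits)
qed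

end

text \<open>The ungraded case is the degree zero part of the graded one, for rings concentrated in degree zero.\<close>

definition trivial_grading :: "('b, 'm) ring_scheme \<Rightarrow> 'i::zero \<Rightarrow> 'b set"
  where "trivial_grading G n = (if n = 0 then carrier G else {\<zero>\<^bsub>G\<^esub>})"

lemma (in cring) trivial_graded_ring: "graded_ring R (trivial_grading R)"
proof -
  have "\<exists>!f :: nat \<Rightarrow> 'a. (\<forall>i. f i \<in> trivial_grading R i) \<and> finite {i. f i \<noteq> \<zero>} \<and> x = (\<Oplus> i \<in> {i. f i \<noteq> \<zero>}. f i)"
    if x: "x \<in> carrier R" for x
  proof (rule ex1I[of _ "\<lambda>i::nat. if i = 0 then x else \<zero>"])
    have "{i::nat. (if i = 0 then x else \<zero>) \<noteq> \<zero>} = (if x = \<zero> then {} else {0})" by auto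
    then show "(\<forall>i::nat. (if i = 0 then x else \<zero>) \<in> trivial_grading R i) \<and>
        finite {i::nat. (if i = 0 then x else \<zero>) \<noteq> \<zero>} \<and>
        x = (\<Oplus> i \<in> {i::nat. (if i = 0 then x else \<zero>) \<noteq> \<zero>}. if i = 0 then x else \<zero>)"
      using x by (auto simp: trivial_grading_def)
    fix f :: "nat \<Rightarrow> 'a"
    assume f: "(\<forall>i. f i \<in> trivial_grading R i) \<and> finite {i. f i \<noteq> \<zero>} \<and> x = (\<Oplus> i \<in> {i. f i \<noteq> \<zero>}. f i)"
    have fi: "f i \<in> trivial_grading R i" for i using f by blast
    have z: "f i = \<zero>" if "i \<noteq> 0" for i using fi[of i] that by (simp add: trivial_grading_def)
    have f0: "f 0 \<in> carrier R" using fi[of 0] by (simp add: trivial_grading_def)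
    have "{i. f i \<noteq> \<zero>} = (if f 0 = \<zero> then {} else {0})"
    proof (rule Set.set_eqI)
      show "i \<in> {i. f i \<noteq> \<zero>} \<longleftrightarrow> i \<in> (if f 0 = \<zero> then {} else {0})" for i
        using z[of i] by (cases "i = 0") auto
    qed
    then have "x = f 0" using f f0 by (simp split: if_splits)
    then show "f = (\<lambda>i. if i = 0 then x else \<zero>)"
      using z by (intro ext) simp
  qed
  moreover have "additive_subgroup (trivial_grading R i) R" for i :: nat
    by (rule additive_subgroupI') (auto simp: trivial_grading_def)
  ultimately show ?thesis
    unfolding graded_ring_def internal_direct_sum_def
    using is_cring by (auto simp: trivial_grading_def)
qed

lemma trivial_proj_graded:
  assumes "module R M"
  shows "proj_graded R (trivial_grading R) M (\<lambda>n x. if n = 0 then x else \<zero>\<^bsub>M\<^esub>)"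
proof -
  interpret M: module R M by fact
  have "(if int m + n = 0 then a \<odot>\<^bsub>M\<^esub> x else \<zero>\<^bsub>M\<^esub>) = a \<odot>\<^bsub>M\<^esub> (if n = 0 then x else \<zero>\<^bsub>M\<^esub>)"
    if "a \<in> trivial_grading R m" "x \<in> carrier M" for m a x and n :: int
    using that by (auto simp: trivial_grading_def split: if_splits)
  moreover have "finite {n::int. (if n = 0 then x else \<zero>\<^bsub>M\<^esub>) \<noteq> \<zero>\<^bsub>M\<^esub>}" for x
    by (rule finite_subset[of _ "{0}"]) auto
  ultimately show ?thesis unfolding proj_graded_def using assms
    by (auto split: if_splits)
qed

lemma chosen_resolution:
  fixes R :: "('a, 'r) ring_scheme" and L :: "('a, 'x, 'm) module_scheme"
  assumes R: "cring R" and noeth: "noetherian_ring R" and L: "module R L"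
  obtains E d \<eta> where "chosen_resolution R L = (E, d)" "injective_resolution R L E \<eta> d"
proof -
  interpret R: cring R by fact
  interpret graded_cring R "trivial_grading R" by unfold_locales (rule R.trivial_graded_ring)
  interpret L: module R L by fact
  let ?\<T> = "trivial_grading R" and ?\<tau> = "\<lambda>(n::int) x. if n = 0 then x else \<zero>\<^bsub>L\<^esub>"
  have inf: "infinite (UNIV :: ('a \<times> 'x) list set)" by (rule infinite_UNIV_listI)
  have inj: "inj (\<lambda>a :: 'a. [(a, undefined :: 'x)])" "inj (\<lambda>x :: 'x. [(undefined :: 'a, x)])"
    by (auto simp: inj_def)
  obtain E :: "nat \<Rightarrow> ('a, ('a \<times> 'x) list) module" and \<E> \<eta> d
    where res: "graded_injective_resolution R ?\<T> L (\<lambda>n. {x \<in> carrier L. ?\<tau> n x = x}) E \<E> \<eta> d"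
    using graded_injective_resolution_exists[OF noeth inf inj trivial_proj_graded[OF L]] by blast
  have gi: "graded_injective_module R ?\<T> (E k) (\<E> k)" for k
    by (rule graded_injective_resolutionD(1)[OF res])
  have gm: "graded_module R ?\<T> (E k) (\<E> k)" for k
    using gi[of k] by (simp add: graded_injective_module_def)
  have mE: "module R (E k)" for k by (rule graded_moduleD(1)[OF gm])
  have ds: "direct_sum (E k) (\<E> k)" for k by (rule graded_moduleD(2)[OF gm])
  have Ec: "x \<in> carrier (E k)" if "x \<in> \<E> k 0" for x k by (rule direct_sum.sub[OF ds that])
  have sm: "a \<odot>\<^bsub>E k\<^esub> x \<in> \<E> k 0" if "a \<in> carrier R" "x \<in> \<E> k 0" for a x k
    using graded_moduleD(3)[OF gm, of a 0 x k 0] that by (simp add: trivial_grading_def)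
  define E' where "E' k = (E k)\<lparr>carrier := \<E> k 0\<rparr>" for k
  have mE': "module R (E' k)" for k
    unfolding E'_def
    by (rule module_restrict[OF mE R]) (use sm direct_sum.subgroup[OF ds] in auto)
  note res = graded_injective_resolutionD[OF res]
  note \<eta> = res(2-4) and dm = res(5) and ex = res(6) and d0 = res(9)[where n = 0]
  have \<eta>0: "\<eta> x \<in> \<E> 0 0" if "x \<in> carrier L" for x
    using res(7)[of x 0] that by simp
  have "injective_resolution R L E' \<eta> d"
    unfolding injective_resolution_def exact_coresolution_def
  proof (intro conjI allI)
    show "injective_module R (E' k)" for k unfolding injective_module_def
    proof (intro conjI allI impI mE')
      fix A B :: "('a, 'a) module" and u f
      assume "module R A \<and> module R B \<and> u \<in> mod_hom R A B \<and> inj_on u (carrier A) \<and> f \<in> mod_hom R A (E' k)"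
      then have A: "module R A" and B: "module R B" and u: "u \<in> mod_hom R A B" "inj_on u (carrier A)"
        and f: "f \<in> mod_hom R A (E' k)" by auto
      interpret A: module R A by fact
      interpret B: module R B by fact
      interpret u: additive_map A B u by (rule mod_hom_additive_map[OF A B u(1)])
      \<comment> \<open>Test modules are placed in degree zero. Every homomorphism between them is
        then graded, and a graded extension takes its values in the degree zero part of
        \<open>E k\<close>.\<close>
      let ?G = "\<lambda>(M :: ('a, 'a) module) (n::int). {x \<in> carrier M. (if n = 0 then x else \<zero>\<^bsub>M\<^esub>) = x}"
      have fE: "f \<in> mod_hom R A (E k)"
        by (rule mod_homI) (use mod_homD[OF f] Ec in \<open>auto simp: E'_def\<close>)
      interpret f: additive_map A "E k" f by (rule mod_hom_additive_map[OF A mE fE])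
      have "graded_module R ?\<T> A (?G A)" "graded_module R ?\<T> B (?G B)"
        by (rule proj_graded_imp_graded_module[OF gr trivial_proj_graded], fact)+
      moreover have "u \<in> graded_hom R A (?G A) B (?G B)"
        using u(1) u.zero by (auto simp: graded_hom_def split: if_splits)
      moreover have "f \<in> graded_hom R A (?G A) (E k) (\<E> k)"
      proof -
        have "f x \<in> \<E> k n" if "x \<in> ?G A n" for x n
          using that mod_homD(1)[OF f, of x] additive_subgroup.zero_closed[OF direct_sum.subgroup[OF ds]]
          by (auto simp: E'_def split: if_splits)
        then show ?thesis using fE unfolding graded_hom_def by blast
      qed
      ultimately obtain h where h: "h \<in> graded_hom R B (?G B) (E k) (\<E> k)" "\<And>x. x \<in> carrier A \<Longrightarrow> h (u x) = f x"
        using graded_injective_moduleD[OF gi[of k] _ _ _ u(2)] by blast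
      have hm: "h \<in> mod_hom R B (E k)" and h0: "h ` ?G B 0 \<subseteq> \<E> k 0"
        using h(1) unfolding graded_hom_def by blast+
      have "?G B 0 = carrier B" by simp
      then have "h x \<in> \<E> k 0" if "x \<in> carrier B" for x
        using h0 that by blast
      then have "h \<in> mod_hom R B (E' k)"
        by (intro mod_homI) (simp_all add: E'_def mod_homD[OF hm])
      then show "\<exists>h\<in>mod_hom R B (E' k). \<forall>x\<in>carrier A. h (u x) = f x" using h(2) by blast
    qed
    show "\<eta> \<in> mod_hom R L (E' 0)"
      by (rule mod_homI) (use \<eta>0 mod_homD[OF \<eta>(1)] in \<open>auto simp: E'_def\<close>)
    show "inj_on \<eta> (carrier L)" by fact
    have "mod_kernel (E' 0) (E' 1) (d 0) = mod_kernel (E 0) (E 1) (d 0) \<inter> \<E> 0 0"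
      using Ec by (auto simp: mod_kernel_def E'_def)
    then show "\<eta> ` carrier L = mod_kernel (E' 0) (E' 1) (d 0)" using \<eta>(3) \<eta>0 by blast
    show "d k \<in> mod_hom R (E' k) (E' (Suc k))" for k
      by (rule mod_homI) (use d0 Ec mod_homD[OF dm] in \<open>auto simp: E'_def\<close>)
    show "d k ` carrier (E' k) = mod_kernel (E' (Suc k)) (E' (Suc (Suc k))) (d (Suc k))" for k
    proof
      show "d k ` carrier (E' k) \<subseteq> mod_kernel (E' (Suc k)) (E' (Suc (Suc k))) (d (Suc k))"
        using ex[of k] d0 Ec by (auto simp: mod_kernel_def E'_def)
      show "mod_kernel (E' (Suc k)) (E' (Suc (Suc k))) (d (Suc k)) \<subseteq> d k ` carrier (E' k)"
      proof
        fix y assume "y \<in> mod_kernel (E' (Suc k)) (E' (Suc (Suc k))) (d (Suc k))"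
        then have y: "y \<in> \<E> (Suc k) 0" "y \<in> mod_kernel (E (Suc k)) (E (Suc (Suc k))) (d (Suc k))"
          using Ec by (auto simp: mod_kernel_def E'_def)
        then obtain x where x: "x \<in> carrier (E k)" "y = d k x" using ex[of k] by auto
        have "d k (gproj (E k) (\<E> k) 0 x) = y"
          using graded_hom_pr[OF gm gm res(8) x(1), of 0] direct_sum.pr_homogeneous[OF ds y(1), of 0] x(2) by simp
        moreover have "gproj (E k) (\<E> k) 0 x \<in> \<E> k 0" by (rule direct_sum.pr_props(1)[OF ds x(1)])
        ultimately show "y \<in> d k ` carrier (E' k)" by (auto simp: E'_def)
      qed
    qed
  qed
  then have "\<exists>t :: (nat \<Rightarrow> ('a, ('a \<times> 'x) list) module) \<times> (nat \<Rightarrow> ('a \<times> 'x) list \<Rightarrow> ('a \<times> 'x) list).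
      case t of (E, d) \<Rightarrow> \<exists>\<eta>. injective_resolution R L E \<eta> d" by auto
  then have "case chosen_resolution R L of (E, d) \<Rightarrow> \<exists>\<eta>. injective_resolution R L E \<eta> d"
    unfolding chosen_resolution_def by (rule someI_ex)
  then show thesis using that by (auto split: prod.splits)
qed

section \<open>Relative acyclicity\<close>

text \<open>For \<open>D\<close>-stable subgroups \<open>A\<close> of \<open>B\<close> this is
  exactness of the quotient complex B/A, expressed by representatives.\<close>

definition rel_acyclic :: "('b, 'm) ring_scheme \<Rightarrow> ('b \<Rightarrow> 'b) \<Rightarrow> 'b set \<Rightarrow> 'b set \<Rightarrow> bool"
  where "rel_acyclic G D A B \<longleftrightarrow> (\<forall>c\<in>B. D c \<in> A \<longrightarrow> (\<exists>b\<in>B. c \<ominus>\<^bsub>G\<^esub> D b \<in> A))"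

lemma rel_acyclicD: "rel_acyclic G D A B \<Longrightarrow> c \<in> B \<Longrightarrow> D c \<in> A \<Longrightarrow> \<exists>b\<in>B. c \<ominus>\<^bsub>G\<^esub> D b \<in> A"
  by (simp add: rel_acyclic_def)

locale differential = additive_map G G D for G (structure) and D +
  assumes diff_diff: "c \<in> carrier G \<Longrightarrow> D (D c) = \<zero>"
begin

text \<open>The sequence of B/A, C/A, C/B: exactness of the outer two gives the middle one. A
  relative cocycle in \<open>C\<close> is first corrected into \<open>B\<close>, then into
  \<open>A\<close>.\<close>

lemma rel_acyclic_trans:
  assumes A: "additive_subgroup A G" and B: "additive_subgroup B G" and C: "additive_subgroup C G"
    and sub: "A \<subseteq> B" "B \<subseteq> C" and AB: "rel_acyclic G D A B" and BC: "rel_acyclic G D B C"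
  shows "rel_acyclic G D A C"
  unfolding rel_acyclic_def
proof (intro ballI impI)
  interpret B: additive_subgroup B G by fact
  interpret C: additive_subgroup C G by fact
  fix c assume c: "c \<in> C" "D c \<in> A"
  obtain b1 where b1: "b1 \<in> C" "c \<ominus> D b1 \<in> B" using rel_acyclicD[OF BC c(1)] c(2) sub by blast
  have cc: "c \<in> carrier G" "b1 \<in> carrier G" using c b1 C.a_Hcarr by auto
  have "D (c \<ominus> D b1) = D c" using cc by (simp add: diff_diff G.minus_zero_right)
  then obtain b2 where b2: "b2 \<in> B" "(c \<ominus> D b1) \<ominus> D b2 \<in> A"
    using rel_acyclicD[OF AB b1(2)] c(2) by auto
  have b2c: "b2 \<in> carrier G" using b2 B.a_Hcarr by auto
  have eq: "c \<ominus> D (b1 \<oplus> b2) = (c \<ominus> D b1) \<ominus> D b2"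
    using cc b2c by (simp add: G.minus_eq G.minus_add G.a_assoc)
  have "b1 \<oplus> b2 \<in> C" using b1(1) b2(1) sub by blast
  then show "\<exists>b\<in>C. c \<ominus> D b \<in> A" using b2(2) unfolding eq[symmetric] by blast
qed

text \<open>The same sequence: exactness of B/A and C/A gives C/B. If \<open>D c\<close> lies in
  \<open>B\<close>, it is a cocycle there, so it agrees with some \<open>D b\<close> modulo
  \<open>A\<close>, and \<open>c \<ominus> b\<close> is a relative cocycle for
  \<open>A\<close>.\<close>

lemma rel_acyclic_quotient:
  assumes A: "additive_subgroup A G" and B: "additive_subgroup B G" and C: "additive_subgroup C G"
    and sub: "A \<subseteq> B" "B \<subseteq> C" and AB: "rel_acyclic G D A B" and AC: "rel_acyclic G D A C"
  shows "rel_acyclic G D B C"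
  unfolding rel_acyclic_def
proof (intro ballI impI)
  interpret A: additive_subgroup A G by fact
  interpret B: additive_subgroup B G by fact
  interpret C: additive_subgroup C G by fact
  fix c assume c: "c \<in> C" "D c \<in> B"
  have cc: "c \<in> carrier G" using c C.a_Hcarr by auto
  have "D (D c) \<in> A" using diff_diff[OF cc] A.zero_closed by simp
  then obtain b where b: "b \<in> B" "D c \<ominus> D b \<in> A" using rel_acyclicD[OF AB c(2)] by blast
  have bc: "b \<in> carrier G" using b B.a_Hcarr by auto
  have cb: "c \<ominus> b \<in> C" using additive_subgroup_minus[OF G.abelian_group_axioms C c(1)] b(1) sub by blast
  have "D (c \<ominus> b) \<in> A" using b cc bc by simp
  then obtain e where e: "e \<in> C" "(c \<ominus> b) \<ominus> D e \<in> A" using rel_acyclicD[OF AC cb] by blast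
  have ec: "e \<in> carrier G" using e C.a_Hcarr by auto
  have "(c \<ominus> b) \<ominus> D e = (c \<ominus> D e) \<ominus> b"
    using cc bc ec by (simp add: G.minus_eq G.a_ac)
  then have "(c \<ominus> D e) \<ominus> b \<in> B" using e(2) sub by auto
  then have "c \<ominus> D e \<in> B" by (rule G.mem_of_minus_mem[OF B _ b(1), rotated]) (use cc ec in simp)
  then show "\<exists>b\<in>C. c \<ominus> D b \<in> B" using e(1) by blast
qed

text \<open>Second isomorphism theorem: as \<open>C\<close> is the sum of \<open>A\<close> and
  \<open>B\<close>, the complex C/A is B modulo the intersection.\<close>

lemma rel_acyclic_sum:
  assumes A: "additive_subgroup A G" and B: "additive_subgroup B G" and C: "additive_subgroup C G"
    and sub: "A \<subseteq> C" "B \<subseteq> C" and D: "\<And>x. x \<in> A \<Longrightarrow> D x \<in> A" "\<And>x. x \<in> B \<Longrightarrow> D x \<in> B"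
    and sum: "\<And>c. c \<in> C \<Longrightarrow> \<exists>a\<in>A. \<exists>b\<in>B. c = a \<oplus> b"
    and AB: "rel_acyclic G D (A \<inter> B) B"
  shows "rel_acyclic G D A C"
  unfolding rel_acyclic_def
proof (intro ballI impI)
  interpret A: additive_subgroup A G by fact
  interpret B: additive_subgroup B G by fact
  fix c assume c: "c \<in> C" "D c \<in> A"
  obtain a b where ab: "a \<in> A" "b \<in> B" "c = a \<oplus> b" using sum[OF c(1)] by blast
  have abc: "a \<in> carrier G" "b \<in> carrier G" using ab A.a_Hcarr B.a_Hcarr by auto
  have "D c = D b \<oplus> D a" using abc ab(3) by (simp add: G.a_comm)
  then have "D b = D c \<ominus> D a" using abc by (simp add: G.minus_eq G.a_assoc G.r_neg)
  then have "D b \<in> A \<inter> B"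
    using additive_subgroup_minus[OF G.abelian_group_axioms A c(2) D(1)[OF ab(1)]] D(2)[OF ab(2)] by simp
  then obtain e where e: "e \<in> B" "b \<ominus> D e \<in> A \<inter> B" using rel_acyclicD[OF AB ab(2)] by blast
  have ec: "e \<in> carrier G" using e B.a_Hcarr by auto
  have eq: "c \<ominus> D e = a \<oplus> (b \<ominus> D e)" using abc ec ab(3) by (simp add: G.minus_eq G.a_assoc)
  have "a \<oplus> (b \<ominus> D e) \<in> A" using e(2) ab(1) by blast
  then show "\<exists>b\<in>C. c \<ominus> D b \<in> A" using e(1) sub unfolding eq[symmetric] by blast
qed

end


section \<open>The Koszul complex\<close>

text \<open>A Koszul cochain of \<open>E\<close> with respect to \<open>r 0, \<dots>, r (t - 1)\<close> is a function on the finite sets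
  \<open>S \<subseteq> {..<t}\<close>, all cohomological degrees \<open>card S\<close> being treated at once. The recursion exhibits the
  complex for \<open>Suc t\<close> as the cone of multiplication by \<open>r t\<close> on the one for \<open>t\<close>: the cochain
  \<open>c\<close> splits into its values at \<open>S\<close> and at \<open>insert t S\<close>. The homotopy \<open>koszul_htpy E i t\<close> shows
  that \<open>r i\<close> acts as zero on cohomology.\<close>

fun koszul_diff ::
  "('a, 'e, 'm) module_scheme \<Rightarrow> (nat \<Rightarrow> 'a) \<Rightarrow> nat \<Rightarrow> (nat set \<Rightarrow> 'e) \<Rightarrow> nat set \<Rightarrow> 'e"
  where
    "koszul_diff E r 0 c = (\<lambda>S. \<zero>\<^bsub>E\<^esub>)"
  | "koszul_diff E r (Suc t) c = (\<lambda>S. if t \<in> S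
      then r t \<odot>\<^bsub>E\<^esub> c (S - {t}) \<ominus>\<^bsub>E\<^esub> koszul_diff E r t (\<lambda>U. c (insert t U)) (S - {t})
      else koszul_diff E r t c S)"

fun koszul_htpy ::
  "('a, 'e, 'm) module_scheme \<Rightarrow> nat \<Rightarrow> nat \<Rightarrow> (nat set \<Rightarrow> 'e) \<Rightarrow> nat set \<Rightarrow> 'e"
  where
    "koszul_htpy E i 0 c = (\<lambda>S. \<zero>\<^bsub>E\<^esub>)"
  | "koszul_htpy E i (Suc t) c = (\<lambda>S. if t = i then (if t \<in> S then \<zero>\<^bsub>E\<^esub> else c (insert t S))
      else if t \<in> S then \<ominus>\<^bsub>E\<^esub> koszul_htpy E i t (\<lambda>U. c (insert t U)) (S - {t})
      else koszul_htpy E i t c S)"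

definition fun_module :: "('a, 'e, 'm) module_scheme \<Rightarrow> ('a, 's \<Rightarrow> 'e) module"
  where "fun_module E = \<lparr>carrier = {c. \<forall>S. c S \<in> carrier E}, monoid.mult = undefined,
    monoid.one = undefined, ring.zero = (\<lambda>_. \<zero>\<^bsub>E\<^esub>), ring.add = (\<lambda>c c' S. c S \<oplus>\<^bsub>E\<^esub> c' S),
    smult = (\<lambda>a c S. a \<odot>\<^bsub>E\<^esub> c S)\<rparr>"

lemma fun_module_sel [simp]:
  "carrier (fun_module E) = {c. \<forall>S. c S \<in> carrier E}"
  "\<zero>\<^bsub>fun_module E\<^esub> = (\<lambda>_. \<zero>\<^bsub>E\<^esub>)"
  "c \<oplus>\<^bsub>fun_module E\<^esub> c' = (\<lambda>S. c S \<oplus>\<^bsub>E\<^esub> c' S)"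
  "a \<odot>\<^bsub>fun_module E\<^esub> c = (\<lambda>S. a \<odot>\<^bsub>E\<^esub> c S)"
  by (simp_all add: fun_module_def)

lemma (in module) fun_module_is_module: "module R (fun_module M)"
proof -
  have "abelian_group (fun_module M)"
  proof (rule abelian_groupI)
    show "\<exists>y\<in>carrier (fun_module M). y \<oplus>\<^bsub>fun_module M\<^esub> c = \<zero>\<^bsub>fun_module M\<^esub>"
      if "c \<in> carrier (fun_module M)" for c
      using that by (intro bexI[of _ "\<lambda>S. \<ominus>\<^bsub>M\<^esub> c S"]) (auto simp: M.l_neg)
  qed (auto simp: M.a_ac)
  then show ?thesis
    by (intro moduleI) (auto simp: R.is_cring smult_l_distr smult_r_distr smult_assoc1)
qed

lemma (in module) fun_module_a_inv:
  assumes "\<And>S. c S \<in> carrier M"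
  shows "\<ominus>\<^bsub>fun_module M\<^esub> c = (\<lambda>S. \<ominus>\<^bsub>M\<^esub> c S)"
proof -
  interpret F: module R "fun_module M" by (rule fun_module_is_module)
  show ?thesis by (rule F.minus_equality) (use assms in \<open>auto simp: M.l_neg\<close>)
qed

lemma (in module) fun_module_minus:
  assumes "\<And>S. c S \<in> carrier M" "\<And>S. c' S \<in> carrier M"
  shows "c \<ominus>\<^bsub>fun_module M\<^esub> c' = (\<lambda>S. c S \<ominus>\<^bsub>M\<^esub> c' S)"
  using fun_module_a_inv[of c'] assms by (simp add: a_minus_def)

locale koszul = module R E for R (structure) and E (structure) +
  fixes r :: "nat \<Rightarrow> 'a"
  assumes r_closed [simp]: "r i \<in> carrier R"
begin

abbreviation kd where "kd \<equiv> koszul_diff E r"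
abbreviation kh where "kh \<equiv> koszul_htpy E"

lemma kd_closed: "(\<And>S. c S \<in> carrier E) \<Longrightarrow> kd t c S \<in> carrier E"
  by (induction t arbitrary: c S) auto

text \<open>Locality is what allows the cone formula to be inserted under \<open>insert t U\<close>:
  it takes its simple form only for \<open>U\<close> not containing \<open>t\<close>, and these are
  the only sets consulted.\<close>

lemma kd_cong: "(\<And>U. U \<subseteq> S \<Longrightarrow> c U = c' U) \<Longrightarrow> kd t c S = kd t c' S"
proof (induction t arbitrary: c c' S)
  case (Suc t)
  show ?case
  proof (cases "t \<in> S")
    case True
    have "kd t (\<lambda>U. c (insert t U)) (S - {t}) = kd t (\<lambda>U. c' (insert t U)) (S - {t})"
      by (rule Suc.IH, rule Suc.prems) (use True in auto)
    moreover have "c (S - {t}) = c' (S - {t})" by (rule Suc.prems) auto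
    ultimately show ?thesis using True by simp
  next
    case False
    then show ?thesis using Suc.IH[OF Suc.prems] by simp
  qed
qed simp

lemma kd_zero: "(\<And>U. U \<subseteq> S \<Longrightarrow> c U = \<zero>\<^bsub>E\<^esub>) \<Longrightarrow> kd t c S = \<zero>\<^bsub>E\<^esub>"
proof (induction t arbitrary: c S)
  case (Suc t)
  show ?case
  proof (cases "t \<in> S")
    case True
    have "kd t (\<lambda>U. c (insert t U)) (S - {t}) = \<zero>\<^bsub>E\<^esub>"
      by (rule Suc.IH, rule Suc.prems) (use True in auto)
    moreover have "c (S - {t}) = \<zero>\<^bsub>E\<^esub>" by (rule Suc.prems) auto
    ultimately show ?thesis using True by (simp add: minus_zero_right)
  next
    case False
    then show ?thesis using Suc.IH[OF Suc.prems] by simp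
  qed
qed simp

lemma kd_add:
  assumes "\<And>S. c S \<in> carrier E" "\<And>S. c' S \<in> carrier E"
  shows "kd t (\<lambda>S. c S \<oplus>\<^bsub>E\<^esub> c' S) S = kd t c S \<oplus>\<^bsub>E\<^esub> kd t c' S"
  using assms
proof (induction t arbitrary: c c' S)
  case (Suc t)
  show ?case
    using Suc.prems Suc.IH[of "\<lambda>U. c (insert t U)" "\<lambda>U. c' (insert t U)"] Suc.IH[of c c']
      kd_closed[of "\<lambda>U. c (insert t U)"] kd_closed[of "\<lambda>U. c' (insert t U)"]
    by (simp add: smult_r_distr minus_add_distrib)
qed simp

lemma kd_smult:
  assumes "\<And>S. c S \<in> carrier E" "a \<in> carrier R"
  shows "kd t (\<lambda>S. a \<odot>\<^bsub>E\<^esub> c S) S = a \<odot>\<^bsub>E\<^esub> kd t c S"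
  using assms
proof (induction t arbitrary: c S)
  case (Suc t)
  show ?case
    using Suc.prems Suc.IH[of "\<lambda>U. c (insert t U)"] Suc.IH[of c]
      kd_closed[of "\<lambda>U. c (insert t U)"]
    by (simp add: smult_minus_distrib smult_lcomm)
qed simp

lemma kd_additive_map: "additive_map (fun_module E) (fun_module E) (kd t)"
proof -
  interpret F: module R "fun_module E" by (rule fun_module_is_module)
  show ?thesis by unfold_locales (auto simp: kd_closed kd_add)
qed

lemma kd_minus:
  assumes "\<And>S. c S \<in> carrier E" "\<And>S. c' S \<in> carrier E"
  shows "kd t (\<lambda>S. c S \<ominus>\<^bsub>E\<^esub> c' S) S = kd t c S \<ominus>\<^bsub>E\<^esub> kd t c' S"
proof -
  interpret D: additive_map "fun_module E" "fun_module E" "kd t" by (rule kd_additive_map)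
  have "kd t (c \<ominus>\<^bsub>fun_module E\<^esub> c') = kd t c \<ominus>\<^bsub>fun_module E\<^esub> kd t c'"
    by (rule D.minus) (use assms in auto)
  then show ?thesis using assms by (simp add: fun_module_minus kd_closed)
qed

text \<open>Off \<open>t\<close> this is the induction hypothesis. On sets containing
  \<open>t\<close>, multiplication by \<open>r t\<close> commutes with the smaller differential, and
  the two mixed terms cancel because of the minus sign in the cone.\<close>

lemma kd_kd:
  assumes "\<And>S. c S \<in> carrier E"
  shows "kd t (kd t c) S = \<zero>\<^bsub>E\<^esub>"
  using assms
proof (induction t arbitrary: c S)
  case (Suc t)
  note c = Suc.prems
  let ?c' = "\<lambda>U. c (insert t U)"
  have c': "?c' U \<in> carrier E" for U using c by simp
  show ?case
  proof (cases "t \<in> S")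
    case False
    have "kd t (kd (Suc t) c) S = kd t (kd t c) S"
      by (rule kd_cong) (use False in auto)
    then show ?thesis using False Suc.IH[OF c] by simp
  next
    case True
    let ?V = "S - {t}"
    have "kd t (\<lambda>U. kd (Suc t) c (insert t U)) ?V = kd t (\<lambda>U. r t \<odot>\<^bsub>E\<^esub> c U \<ominus>\<^bsub>E\<^esub> kd t ?c' U) ?V"
    proof (rule kd_cong)
      fix U assume "U \<subseteq> ?V"
      then have "insert t U - {t} = U" by auto
      then show "kd (Suc t) c (insert t U) = r t \<odot>\<^bsub>E\<^esub> c U \<ominus>\<^bsub>E\<^esub> kd t ?c' U" by simp
    qed
    also have "\<dots> = kd t (\<lambda>U. r t \<odot>\<^bsub>E\<^esub> c U) ?V \<ominus>\<^bsub>E\<^esub> kd t (kd t ?c') ?V"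
      by (rule kd_minus) (use c c' in \<open>auto simp: kd_closed\<close>)
    also have "\<dots> = r t \<odot>\<^bsub>E\<^esub> kd t c ?V"
      using Suc.IH[of ?c', OF c'] c by (simp add: kd_smult minus_zero_right kd_closed)
    finally have "kd t (\<lambda>U. kd (Suc t) c (insert t U)) ?V = r t \<odot>\<^bsub>E\<^esub> kd t c ?V" .
    then show ?thesis using True c by (simp add: minus_eq r_neg kd_closed)
  qed
qed simp

lemma kd_differential: "differential (fun_module E) (kd t)"
  using kd_additive_map by (simp add: differential_def differential_axioms_def kd_kd fun_eq_iff)

lemma kd_hom:
  assumes E': "module R E'" and f: "f \<in> mod_hom R E E'" and "\<And>S. c S \<in> carrier E"
  shows "f (kd t c S) = koszul_diff E' r t (\<lambda>S. f (c S)) S"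
  using assms(3)
proof (induction t arbitrary: c S)
  interpret f: additive_map E E' f by (rule mod_hom_additive_map[OF module_axioms E' f])
  case 0 show ?case by simp
next
  interpret f: additive_map E E' f by (rule mod_hom_additive_map[OF module_axioms E' f])
  case (Suc t)
  show ?case
    using Suc.prems Suc.IH[of c] Suc.IH[of "\<lambda>U. c (insert t U)"] kd_closed[of "\<lambda>U. c (insert t U)"]
    by (simp add: mod_homD(3)[OF f])
qed

text \<open>A separate subgroup \<open>P S\<close> is allowed for every set because the degree of
  \<open>c S\<close> will depend on the size of \<open>S\<close>. The recursion passes to the family
  of sets that contain \<open>t\<close>.\<close>

lemma kd_mem:
  assumes "\<And>S. additive_subgroup (P S) E"
    and "\<And>i S x. i < t \<Longrightarrow> i \<notin> S \<Longrightarrow> x \<in> P S \<Longrightarrow> r i \<odot>\<^bsub>E\<^esub> x \<in> P (insert i S)"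
    and "\<And>U. U \<subseteq> S \<Longrightarrow> c U \<in> P U"
  shows "kd t c S \<in> P S"
  using assms
proof (induction t arbitrary: c P S)
  case 0 then show ?case by (simp add: additive_subgroup.zero_closed)
next
  case (Suc t)
  show ?case
  proof (cases "t \<in> S")
    case False
    have "kd t c S \<in> P S" by (rule Suc.IH) (use Suc.prems in auto)
    then show ?thesis using False by simp
  next
    case True
    let ?V = "S - {t}"
    have S: "insert t ?V = S" using True by auto
    have "kd t (\<lambda>U. c (insert t U)) ?V \<in> (\<lambda>U. if t \<in> U then {\<zero>\<^bsub>E\<^esub>} else P (insert t U)) ?V"
    proof (rule Suc.IH)
      show "additive_subgroup (if t \<in> U then {\<zero>\<^bsub>E\<^esub>} else P (insert t U)) E" for U
        using Suc.prems(1) by (auto intro!: additive_subgroupI')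
      show "r i \<odot>\<^bsub>E\<^esub> x \<in> (if t \<in> insert i U then {\<zero>\<^bsub>E\<^esub>} else P (insert t (insert i U)))"
        if "i < t" "i \<notin> U" "x \<in> (if t \<in> U then {\<zero>\<^bsub>E\<^esub>} else P (insert t U))" for i U x
        using that Suc.prems(2)[of i "insert t U" x] by (auto simp: insert_commute split: if_splits)
      show "c (insert t U) \<in> (if t \<in> U then {\<zero>\<^bsub>E\<^esub>} else P (insert t U))" if "U \<subseteq> ?V" for U
        using that Suc.prems(3)[of "insert t U"] True by auto
    qed
    then have "kd t (\<lambda>U. c (insert t U)) ?V \<in> P S" using S by simp
    moreover have "r t \<odot>\<^bsub>E\<^esub> c ?V \<in> P S"
      using Suc.prems(2)[of t ?V "c ?V"] Suc.prems(3)[of ?V] S by auto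
    ultimately show ?thesis
      using True additive_subgroup_minus[OF abelian_group_axioms Suc.prems(1)] by simp
  qed
qed

lemma kh_cong: "(\<And>U. U \<subseteq> insert i S \<Longrightarrow> c U = c' U) \<Longrightarrow> kh i t c S = kh i t c' S"
proof (induction t arbitrary: c c' S)
  case (Suc t)
  have 1: "kh i t (\<lambda>U. c (insert t U)) (S - {t}) = kh i t (\<lambda>U. c' (insert t U)) (S - {t})" if "t \<in> S"
    by (rule Suc.IH, rule Suc.prems) (use that in auto)
  have 2: "kh i t c S = kh i t c' S" by (rule Suc.IH, rule Suc.prems)
  have 3: "c (insert i S) = c' (insert i S)" by (rule Suc.prems) simp
  from 1 2 3 show ?case by simp
qed simp

text \<open>The homotopy is contraction with the \<open>i\<close>-th basis vector, so up to sign it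
  only reads off \<open>c (insert i S)\<close>. For membership in subgroups the sign is
  irrelevant.\<close>

lemma kh_val:
  "kh i t c S = \<zero>\<^bsub>E\<^esub> \<or> i \<notin> S \<and> (kh i t c S = c (insert i S) \<or> kh i t c S = \<ominus>\<^bsub>E\<^esub> c (insert i S))"
  if "\<And>S. c S \<in> carrier E"
  using that
proof (induction t arbitrary: c S)
  case (Suc t)
  consider "t = i" | "t \<noteq> i" "t \<notin> S" | "t \<noteq> i" "t \<in> S" by blast
  then show ?case
  proof cases
    case 3
    have S: "insert t (insert i (S - {t})) = insert i S" using 3 by auto
    have z: "\<ominus>\<^bsub>E\<^esub> \<zero>\<^bsub>E\<^esub> = \<zero>\<^bsub>E\<^esub>" by (rule minus_equality) simp_all
    from Suc.IH[of "\<lambda>U. c (insert t U)" "S - {t}"] Suc.prems 3 show ?thesis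
      by (auto simp: S z)
  qed (use Suc in auto)
qed simp

lemma kh_closed: "(\<And>S. c S \<in> carrier E) \<Longrightarrow> kh i t c S \<in> carrier E"
  using kh_val[of c i t S] by auto

lemma kh_add:
  assumes "\<And>S. c S \<in> carrier E" "\<And>S. c' S \<in> carrier E"
  shows "kh i t (\<lambda>S. c S \<oplus>\<^bsub>E\<^esub> c' S) S = kh i t c S \<oplus>\<^bsub>E\<^esub> kh i t c' S"
  using assms
proof (induction t arbitrary: c c' S)
  case (Suc t)
  show ?case
    using Suc.prems Suc.IH[of "\<lambda>U. c (insert t U)" "\<lambda>U. c' (insert t U)"] Suc.IH[of c c']
      kh_closed[of "\<lambda>U. c (insert t U)"] kh_closed[of "\<lambda>U. c' (insert t U)"]
    by (simp add: minus_add)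
qed simp

lemma kh_smult:
  assumes "\<And>S. c S \<in> carrier E" "a \<in> carrier R"
  shows "kh i t (\<lambda>S. a \<odot>\<^bsub>E\<^esub> c S) S = a \<odot>\<^bsub>E\<^esub> kh i t c S"
  using assms
proof (induction t arbitrary: c S)
  case (Suc t)
  show ?case
    using Suc.prems Suc.IH[of "\<lambda>U. c (insert t U)"] Suc.IH[of c] kh_closed[of "\<lambda>U. c (insert t U)"]
    by (simp add: smult_r_minus)
qed simp

lemma kh_minus:
  assumes "\<And>S. c S \<in> carrier E" "\<And>S. c' S \<in> carrier E"
  shows "kh i t (\<lambda>S. c S \<ominus>\<^bsub>E\<^esub> c' S) S = kh i t c S \<ominus>\<^bsub>E\<^esub> kh i t c' S"
proof -
  interpret F: module R "fun_module E" by (rule fun_module_is_module)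
  interpret D: additive_map "fun_module E" "fun_module E" "kh i t"
    by unfold_locales (auto simp: kh_closed kh_add)
  have "kh i t (c \<ominus>\<^bsub>fun_module E\<^esub> c') = kh i t c \<ominus>\<^bsub>fun_module E\<^esub> kh i t c'"
    by (rule D.minus) (use assms in auto)
  then show ?thesis using assms by (simp add: fun_module_minus kh_closed)
qed

text \<open>For \<open>i = t\<close> this is read off the cone. For \<open>i < t\<close> the
  homotopy is the one of the smaller complex on both halves, with a minus sign on the half
  containing \<open>t\<close>; owing to this sign the terms with \<open>r t\<close> cancel.\<close>

lemma kd_kh:
  assumes "\<And>S. c S \<in> carrier E" "i < t"
  shows "kd t (kh i t c) S \<oplus>\<^bsub>E\<^esub> kh i t (kd t c) S = r i \<odot>\<^bsub>E\<^esub> c S"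
  using assms
proof (induction t arbitrary: c S)
  case (Suc t)
  note c = Suc.prems(1)
  let ?c' = "\<lambda>U. c (insert t U)"
  have c': "?c' U \<in> carrier E" for U using c by simp
  show ?case
  proof (cases "i = t")
    case True
    show ?thesis
    proof (cases "t \<in> S")
      case tS: True
      have "kd t (\<lambda>U. kh i (Suc t) c (insert t U)) (S - {t}) = \<zero>\<^bsub>E\<^esub>"
        by (rule kd_zero) (simp add: True)
      moreover have "insert t (S - {t}) = S" using tS by auto
      ultimately show ?thesis using True tS c by (simp add: minus_zero_right)
    next
      case tS: False
      have "kd t (kh i (Suc t) c) S = kd t ?c' S"
        by (rule kd_cong) (use True tS in auto)
      moreover have "insert t S - {t} = S" using tS by auto
      ultimately show ?thesis using True tS c c' minus_add_cancel(2)
        by (simp add: kd_closed)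
    qed
  next
    case False
    then have it: "i < t" using Suc.prems(2) by simp
    show ?thesis
    proof (cases "t \<in> S")
      case tS: False
      have "kd t (kh i (Suc t) c) S = kd t (kh i t c) S"
        by (rule kd_cong) (use False tS in auto)
      moreover have "kh i t (kd (Suc t) c) S = kh i t (kd t c) S"
        by (rule kh_cong) (use False tS in auto)
      ultimately show ?thesis using False tS Suc.IH[of c S, OF c it] by simp
    next
      case tS: True
      let ?V = "S - {t}"
      have S: "insert t ?V = S" using tS by auto
      interpret D: additive_map "fun_module E" "fun_module E" "kd t" by (rule kd_additive_map)
      have neg: "kd t (\<lambda>U. \<ominus>\<^bsub>E\<^esub> kh i t ?c' U) = (\<lambda>U. \<ominus>\<^bsub>E\<^esub> kd t (kh i t ?c') U)"
        using D.a_inv[of "kh i t ?c'"] c' by (simp add: fun_module_a_inv kh_closed kd_closed)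
      have "kd t (\<lambda>U. kh i (Suc t) c (insert t U)) ?V = kd t (\<lambda>U. \<ominus>\<^bsub>E\<^esub> kh i t ?c' U) ?V"
      proof (rule kd_cong)
        fix U assume "U \<subseteq> ?V"
        then have "insert t U - {t} = U" by auto
        then show "kh i (Suc t) c (insert t U) = \<ominus>\<^bsub>E\<^esub> kh i t ?c' U" using False by simp
      qed
      then have 1: "kd (Suc t) (kh i (Suc t) c) S = r t \<odot>\<^bsub>E\<^esub> kh i t c ?V \<oplus>\<^bsub>E\<^esub> kd t (kh i t ?c') ?V"
        using False tS c c' by (simp add: neg minus_eq kd_closed kh_closed)
      have "kh i t (\<lambda>U. kd (Suc t) c (insert t U)) ?V = kh i t (\<lambda>U. r t \<odot>\<^bsub>E\<^esub> c U \<ominus>\<^bsub>E\<^esub> kd t ?c' U) ?V"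
      proof (rule kh_cong)
        fix U assume "U \<subseteq> insert i ?V"
        then have "insert t U - {t} = U" using False by auto
        then show "kd (Suc t) c (insert t U) = r t \<odot>\<^bsub>E\<^esub> c U \<ominus>\<^bsub>E\<^esub> kd t ?c' U" by simp
      qed
      also have "\<dots> = r t \<odot>\<^bsub>E\<^esub> kh i t c ?V \<ominus>\<^bsub>E\<^esub> kh i t (kd t ?c') ?V"
        using c c' by (simp add: kh_minus kh_smult kd_closed)
      finally have 2: "kh i (Suc t) (kd (Suc t) c) S =
          kh i t (kd t ?c') ?V \<ominus>\<^bsub>E\<^esub> r t \<odot>\<^bsub>E\<^esub> kh i t c ?V"
        using False tS c c' by (simp add: minus_eq minus_add kh_closed kd_closed a_comm)
      have "kd (Suc t) (kh i (Suc t) c) S \<oplus>\<^bsub>E\<^esub> kh i (Suc t) (kd (Suc t) c) S =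
          kd t (kh i t ?c') ?V \<oplus>\<^bsub>E\<^esub> kh i t (kd t ?c') ?V"
        unfolding 1 2 using c c' by (simp add: minus_eq a_ac r_neg1 r_neg2 kh_closed kd_closed)
      also have "\<dots> = r i \<odot>\<^bsub>E\<^esub> c S" using Suc.IH[of ?c' ?V, OF c' it] S by simp
      finally show ?thesis .
    qed
  qed
qed simp

end

subsection \<open>Koszul cochains of graded subgroups\<close>

definition graded_family :: "('a, 'e, 'm) module_scheme \<Rightarrow> (nat \<Rightarrow> 'a) \<Rightarrow> nat \<Rightarrow> (int \<Rightarrow> 'e set) \<Rightarrow> bool"
  where "graded_family E r t A \<longleftrightarrow> (\<forall>n. additive_subgroup (A n) E) \<and>
    (\<forall>i<t. \<forall>n. \<forall>x\<in>A n. r i \<odot>\<^bsub>E\<^esub> x \<in> A (n + 1))"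

lemma graded_familyD:
  assumes "graded_family E r t A"
  shows "additive_subgroup (A n) E" and "i < t \<Longrightarrow> x \<in> A n \<Longrightarrow> r i \<odot>\<^bsub>E\<^esub> x \<in> A (n + 1)"
  using assms by (auto simp: graded_family_def)

text \<open>With the value at \<open>S\<close> in degree \<open>n + card S\<close>, the Koszul
  differential preserves \<open>n\<close>, so the complex splits into strands, one for each integer
  \<open>n\<close>.\<close>

definition cochain_part :: "('a, 'e, 'm) module_scheme \<Rightarrow> nat \<Rightarrow> (int \<Rightarrow> 'e set) \<Rightarrow> int \<Rightarrow> nat set \<Rightarrow> 'e set"
  where "cochain_part E t A n S = (if S \<subseteq> {..<t} then A (n + int (card S)) else {\<zero>\<^bsub>E\<^esub>})"

definition cochains :: "('a, 'e, 'm) module_scheme \<Rightarrow> nat \<Rightarrow> (int \<Rightarrow> 'e set) \<Rightarrow> int \<Rightarrow> (nat set \<Rightarrow> 'e) set"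
  where "cochains E t A n = {c. \<forall>S. c S \<in> cochain_part E t A n S}"

text \<open>Exactness of strand \<open>n\<close> of the Koszul complex of the graded group
  B/A.\<close>

definition koszul_acyclic ::
  "('a, 'e, 'm) module_scheme \<Rightarrow> (nat \<Rightarrow> 'a) \<Rightarrow> nat \<Rightarrow> (int \<Rightarrow> 'e set) \<Rightarrow> (int \<Rightarrow> 'e set) \<Rightarrow> int \<Rightarrow> bool"
  where "koszul_acyclic E r t A B n \<longleftrightarrow>
    rel_acyclic (fun_module E) (koszul_diff E r t) (cochains E t A n) (cochains E t B n)"

lemma cochainsD: "c \<in> cochains E t A n \<Longrightarrow> c S \<in> cochain_part E t A n S"
  by (simp add: cochains_def)

lemma cochainsI: "(\<And>S. c S \<in> cochain_part E t A n S) \<Longrightarrow> c \<in> cochains E t A n"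
  by (simp add: cochains_def)

lemma cochains_mono:
  assumes "\<And>n. A n \<subseteq> B n" shows "cochains E t A n \<subseteq> cochains E t B n"
proof -
  have "cochain_part E t A n S \<subseteq> cochain_part E t B n S" for S
    using assms by (simp add: cochain_part_def)
  then show ?thesis unfolding cochains_def by blast
qed

lemma cochains_Int: "cochains E t (\<lambda>n. A n \<inter> B n) n = cochains E t A n \<inter> cochains E t B n"
  unfolding cochains_def cochain_part_def by (auto split: if_splits)

context koszul begin

context
  fixes t A assumes A: "graded_family E r t A"
begin

lemma cochain_part_subgroup: "additive_subgroup (cochain_part E t A n S) E"
  using graded_familyD(1)[OF A] by (auto simp: cochain_part_def intro!: additive_subgroupI')

lemma cochain_part_mult_insert:
  assumes "i < t" "i \<notin> S" "x \<in> cochain_part E t A n S"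
  shows "r i \<odot>\<^bsub>E\<^esub> x \<in> cochain_part E t A n (insert i S)"
proof (cases "S \<subseteq> {..<t}")
  case True
  then have "finite S" using finite_subset by blast
  then have "n + int (card (insert i S)) = (n + int (card S)) + 1" using assms(2) by (simp add: algebra_simps)
  then show ?thesis
    using graded_familyD(2)[OF A assms(1), of x "n + int (card S)"] assms True
    by (simp add: cochain_part_def algebra_simps)
qed (use assms in \<open>auto simp: cochain_part_def\<close>)

lemma cochains_carrier: "c \<in> cochains E t A n \<Longrightarrow> c S \<in> carrier E"
  using additive_subgroup.a_Hcarr[OF cochain_part_subgroup] by (auto simp: cochains_def)

lemma cochains_subgroup: "additive_subgroup (cochains E t A n) (fun_module E)"
proof -
  interpret F: module R "fun_module E" by (rule fun_module_is_module)
  note s = cochain_part_subgroup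
  show ?thesis
  proof (rule F.additive_subgroupI')
    show "cochains E t A n \<subseteq> carrier (fun_module E)" using cochains_carrier by auto
    show "\<zero>\<^bsub>fun_module E\<^esub> \<in> cochains E t A n"
      using additive_subgroup.zero_closed[OF s] by (auto simp: cochains_def)
    show "c \<oplus>\<^bsub>fun_module E\<^esub> c' \<in> cochains E t A n" if "c \<in> cochains E t A n" "c' \<in> cochains E t A n" for c c'
      using that additive_subgroup.a_closed[OF s] by (auto simp: cochains_def)
    show "\<ominus>\<^bsub>fun_module E\<^esub> c \<in> cochains E t A n" if "c \<in> cochains E t A n" for c
      using that additive_subgroup.a_inv_closed[OF s] cochains_carrier[OF that]
      by (auto simp: cochains_def fun_module_a_inv)
  qed
qed

lemma cochains_kd: "c \<in> cochains E t A n \<Longrightarrow> kd t c \<in> cochains E t A n"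
  by (rule cochainsI, rule kd_mem[OF cochain_part_subgroup cochain_part_mult_insert cochainsD])

lemma cochain_part_shift:
  "S \<subseteq> {..<t} \<Longrightarrow> i < t \<Longrightarrow> i \<notin> S \<Longrightarrow> cochain_part E t A n (insert i S) = cochain_part E t A (n + 1) S"
proof -
  assume *: "S \<subseteq> {..<t}" "i < t" "i \<notin> S"
  then have "finite S" using finite_subset by blast
  then show ?thesis using * by (simp add: cochain_part_def algebra_simps)
qed

text \<open>Contraction keeps the degree of the values but takes one element out of the set, so it
  raises the strand by one, exactly as multiplication by \<open>r i\<close> does.\<close>

lemma cochains_kh:
  assumes c: "c \<in> cochains E t A n" and i: "i < t"
  shows "kh i t c \<in> cochains E t A (n + 1)"
proof -
  have "kh i t c S \<in> cochain_part E t A (n + 1) S" for S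
  proof -
    note s = cochain_part_subgroup[of "n + 1" S]
    have ci: "c (insert i S) \<in> cochain_part E t A n (insert i S)" using c by (simp add: cochains_def)
    have "c (insert i S) \<in> cochain_part E t A (n + 1) S" if "i \<notin> S"
    proof (cases "S \<subseteq> {..<t}")
      case True then show ?thesis using ci cochain_part_shift[OF True i that] by simp
    qed (use ci i in \<open>auto simp: cochain_part_def\<close>)
    then show ?thesis
      using kh_val[of c i t S, OF cochains_carrier[OF c]] additive_subgroup.zero_closed[OF s]
        additive_subgroup.a_inv_closed[OF s] by metis
  qed
  then show ?thesis by (simp add: cochains_def)
qed

lemma cochains_mult:
  assumes c: "c \<in> cochains E t A n" and i: "i < t"
  shows "(\<lambda>S. r i \<odot>\<^bsub>E\<^esub> c S) \<in> cochains E t A (n + 1)"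
proof -
  have "r i \<odot>\<^bsub>E\<^esub> c S \<in> cochain_part E t A (n + 1) S" for S
  proof (cases "S \<subseteq> {..<t}")
    case True
    then have "c S \<in> A (n + int (card S))" using cochainsD[OF c, of S] by (simp add: cochain_part_def)
    from graded_familyD(2)[OF A i this] show ?thesis using True by (simp add: cochain_part_def algebra_simps)
  next
    case False
    then have "c S = \<zero>\<^bsub>E\<^esub>" using cochainsD[OF c, of S] by (simp add: cochain_part_def)
    then show ?thesis using False by (simp add: cochain_part_def)
  qed
  then show ?thesis by (simp add: cochains_def)
qed

end

lemma koszul_acyclic_trans:
  assumes A: "graded_family E r t A" and B: "graded_family E r t B" and C: "graded_family E r t C"
    and "\<And>n. A n \<subseteq> B n" "\<And>n. B n \<subseteq> C n"
    and "koszul_acyclic E r t A B n" "koszul_acyclic E r t B C n"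
  shows "koszul_acyclic E r t A C n"
  using differential.rel_acyclic_trans[OF kd_differential cochains_subgroup[OF A]
      cochains_subgroup[OF B] cochains_subgroup[OF C] cochains_mono cochains_mono] assms(4-)
  unfolding koszul_acyclic_def by blast

lemma koszul_acyclic_quotient:
  assumes A: "graded_family E r t A" and B: "graded_family E r t B" and C: "graded_family E r t C"
    and "\<And>n. A n \<subseteq> B n" "\<And>n. B n \<subseteq> C n"
    and "koszul_acyclic E r t A B n" "koszul_acyclic E r t A C n"
  shows "koszul_acyclic E r t B C n"
  using differential.rel_acyclic_quotient[OF kd_differential cochains_subgroup[OF A]
      cochains_subgroup[OF B] cochains_subgroup[OF C] cochains_mono cochains_mono] assms(4-)
  unfolding koszul_acyclic_def by blast

lemma koszul_acyclic_sum:
  assumes A: "graded_family E r t A" and B: "graded_family E r t B" and C: "graded_family E r t C"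
    and sub: "\<And>n. A n \<subseteq> C n" "\<And>n. B n \<subseteq> C n"
    and sum: "\<And>n c. c \<in> C n \<Longrightarrow> \<exists>a\<in>A n. \<exists>b\<in>B n. c = a \<oplus>\<^bsub>E\<^esub> b"
    and acyc: "koszul_acyclic E r t (\<lambda>n. A n \<inter> B n) B n"
  shows "koszul_acyclic E r t A C n"
  unfolding koszul_acyclic_def
proof (rule differential.rel_acyclic_sum[OF kd_differential])
  show "rel_acyclic (fun_module E) (kd t) (cochains E t A n \<inter> cochains E t B n) (cochains E t B n)"
    using acyc by (simp add: koszul_acyclic_def cochains_Int)
  fix c assume c: "c \<in> cochains E t C n"
  have "\<exists>a b. a \<in> cochain_part E t A n S \<and> b \<in> cochain_part E t B n S \<and> c S = a \<oplus>\<^bsub>E\<^esub> b" for S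
  proof (cases "S \<subseteq> {..<t}")
    case True
    then show ?thesis using cochainsD[OF c, of S] sum[of "c S" "n + int (card S)"]
      by (auto simp: cochain_part_def)
  next
    case False
    then show ?thesis using cochainsD[OF c, of S] by (simp add: cochain_part_def)
  qed
  then obtain a b where ab: "\<And>S. a S \<in> cochain_part E t A n S" "\<And>S. b S \<in> cochain_part E t B n S"
    "\<And>S. c S = a S \<oplus>\<^bsub>E\<^esub> b S" by metis
  have "c = a \<oplus>\<^bsub>fun_module E\<^esub> b" using ab(3) by auto
  moreover have "a \<in> cochains E t A n" "b \<in> cochains E t B n" using ab by (auto simp: cochains_def)
  ultimately show "\<exists>a\<in>cochains E t A n. \<exists>b\<in>cochains E t B n. c = a \<oplus>\<^bsub>fun_module E\<^esub> b" by blast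
qed (rule cochains_subgroup[OF A] cochains_subgroup[OF B] cochains_subgroup[OF C]
    cochains_mono[OF sub(1)] cochains_mono[OF sub(2)] | erule cochains_kd[OF A] cochains_kd[OF B])+

text \<open>\<open>A\<close> is the preimage of \<open>A'\<close> in \<open>C\<close>, so relations
  modulo \<open>A'\<close> among images of \<open>C\<close> can be verified on preimages. Cochains
  are lifted value by value, and the differential commutes with \<open>d\<close>.\<close>

lemma koszul_acyclic_map:
  assumes E': "module R E'" and d: "d \<in> mod_hom R E E'" and C: "graded_family E r t C"
    and A: "\<And>n. A n = {x \<in> C n. d x \<in> A' n}" and C': "\<And>n. C' n = d ` C n"
    and acyc: "koszul_acyclic E r t A C n"
  shows "koszul_acyclic E' r t A' C' n"
  unfolding koszul_acyclic_def rel_acyclic_def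
proof (intro ballI impI)
  interpret d: additive_map E E' d by (rule mod_hom_additive_map[OF module_axioms E' d])
  interpret E': koszul R E' r by (intro koszul.intro E' koszul_axioms.intro) simp
  have zd: "\<zero>\<^bsub>E'\<^esub> \<in> A' n" if "\<zero>\<^bsub>E\<^esub> \<in> A n" for n using that A by simp
  fix c' assume c': "c' \<in> cochains E' t C' n" "koszul_diff E' r t c' \<in> cochains E' t A' n"
  have "\<exists>x. x \<in> cochain_part E t C n S \<and> c' S = d x" for S
    using cochainsD[OF c'(1), of S] C' d.zero by (auto simp: cochain_part_def split: if_splits)
  then obtain c where c: "\<And>S. c S \<in> cochain_part E t C n S" "\<And>S. c' S = d (c S)" by metis
  then have cC: "c \<in> cochains E t C n" by (simp add: cochains_def)
  note cc = cochains_carrier[OF C cC]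
  have dc: "d (kd t c S) = koszul_diff E' r t c' S" for S
    using kd_hom[of E' d c t S, OF E' d cc] unfolding c(2)[symmetric] by simp
  have "kd t c \<in> cochains E t A n"
  proof -
    have "kd t c S \<in> cochain_part E t A n S" for S
      using cochainsD[OF cochains_kd[OF C cC], of S] cochainsD[OF c'(2), of S] dc[of S]
      by (simp add: cochain_part_def A split: if_splits)
    then show ?thesis by (simp add: cochains_def)
  qed
  then obtain b where b: "b \<in> cochains E t C n" "c \<ominus>\<^bsub>fun_module E\<^esub> kd t b \<in> cochains E t A n"
    using rel_acyclicD[OF acyc[unfolded koszul_acyclic_def] cC] by blast
  note bc = cochains_carrier[OF C b(1)]
  have b': "c S \<ominus>\<^bsub>E\<^esub> kd t b S \<in> cochain_part E t A n S" for S
    using b(2) cc bc by (simp add: fun_module_minus kd_closed cochains_def)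
  let ?b = "\<lambda>S. d (b S)"
  have "?b \<in> cochains E' t C' n"
  proof (rule cochainsI)
    show "d (b S) \<in> cochain_part E' t C' n S" for S
      using cochainsD[OF b(1), of S] C' by (simp add: cochain_part_def split: if_splits)
  qed
  moreover have "c' S \<ominus>\<^bsub>E'\<^esub> koszul_diff E' r t ?b S \<in> cochain_part E' t A' n S" for S
  proof -
    have "c' S \<ominus>\<^bsub>E'\<^esub> koszul_diff E' r t ?b S = d (c S \<ominus>\<^bsub>E\<^esub> kd t b S)"
      using kd_hom[of E' d b t S, OF E' d bc] cc bc by (simp add: c(2) kd_closed)
    then show ?thesis using b'[of S] by (simp add: cochain_part_def A split: if_splits)
  qed
  moreover have "c' S \<in> carrier E'" "koszul_diff E' r t ?b S \<in> carrier E'" for S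
    using cc bc by (auto simp: c(2) intro!: E'.kd_closed)
  ultimately show "\<exists>b\<in>cochains E' t C' n. c' \<ominus>\<^bsub>fun_module E'\<^esub> koszul_diff E' r t b \<in> cochains E' t A' n"
    by (intro bexI[of _ ?b]) (simp_all add: E'.fun_module_minus cochains_def)
qed

text \<open>Here \<open>r i\<close> is an isomorphism of B/A, yet it is homotopic to zero.
  Explicitly, \<open>c\<close> is \<open>r i c'\<close> modulo \<open>A\<close> with
  \<open>c'\<close> in strand \<open>n - 1\<close>; injectivity makes \<open>c'\<close> a relative
  cocycle, and the homotopy formula exhibits \<open>r i c'\<close> as the coboundary of
  \<open>kh i t c'\<close> modulo \<open>A\<close>.\<close>

lemma koszul_acyclic_bijective:
  assumes A: "graded_family E r t A" and B: "graded_family E r t B" and sub: "\<And>n. A n \<subseteq> B n" and i: "i < t"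
    and inj: "\<And>n x. x \<in> B n \<Longrightarrow> r i \<odot>\<^bsub>E\<^esub> x \<in> A (n + 1) \<Longrightarrow> x \<in> A n"
    and surj: "\<And>n y. y \<in> B (n + 1) \<Longrightarrow> \<exists>x\<in>B n. y \<ominus>\<^bsub>E\<^esub> r i \<odot>\<^bsub>E\<^esub> x \<in> A (n + 1)"
  shows "koszul_acyclic E r t A B n"
  unfolding koszul_acyclic_def rel_acyclic_def
proof (intro ballI impI)
  fix c assume c: "c \<in> cochains E t B n" "kd t c \<in> cochains E t A n"
  note cc = cochains_carrier[OF B c(1)]
  have "\<exists>x. x \<in> cochain_part E t B (n - 1) S \<and> c S \<ominus>\<^bsub>E\<^esub> r i \<odot>\<^bsub>E\<^esub> x \<in> cochain_part E t A n S" for S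
  proof (cases "S \<subseteq> {..<t}")
    case True
    then have "c S \<in> B (n - 1 + int (card S) + 1)"
      using cochainsD[OF c(1), of S] by (simp add: cochain_part_def)
    from surj[OF this] True show ?thesis by (auto simp: cochain_part_def)
  next
    case False
    then have "c S = \<zero>\<^bsub>E\<^esub>" using cochainsD[OF c(1), of S] by (simp add: cochain_part_def)
    then show ?thesis using False by (auto simp: cochain_part_def minus_zero_right)
  qed
  then obtain c' where c': "\<And>S. c' S \<in> cochain_part E t B (n - 1) S"
    "\<And>S. c S \<ominus>\<^bsub>E\<^esub> r i \<odot>\<^bsub>E\<^esub> c' S \<in> cochain_part E t A n S" by metis
  have c'B: "c' \<in> cochains E t B (n - 1)" using c'(1) by (simp add: cochains_def)
  note c'c = cochains_carrier[OF B c'B]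
  let ?rc = "\<lambda>S. r i \<odot>\<^bsub>E\<^esub> c' S"
  have rest: "(\<lambda>S. c S \<ominus>\<^bsub>E\<^esub> ?rc S) \<in> cochains E t A n" using c'(2) by (simp add: cochains_def)
  have rkd: "r i \<odot>\<^bsub>E\<^esub> kd t c' S \<in> cochain_part E t A n S" for S
  proof -
    have "kd t c S \<ominus>\<^bsub>E\<^esub> r i \<odot>\<^bsub>E\<^esub> kd t c' S \<in> cochain_part E t A n S"
      using cochains_kd[OF A rest] cc c'c by (simp add: cochains_def kd_minus kd_smult)
    moreover have "kd t c S \<in> cochain_part E t A n S" using c(2) by (simp add: cochains_def)
    ultimately show ?thesis
      using mem_of_minus_mem[OF cochain_part_subgroup[OF A]] minus_mem_sym[OF cochain_part_subgroup[OF A]]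
        kd_closed[OF cc] kd_closed[OF c'c] by (meson r_closed smult_closed)
  qed
  have "kd t c' S \<in> cochain_part E t A (n - 1) S" for S
  proof (cases "S \<subseteq> {..<t}")
    case True
    then have "r i \<odot>\<^bsub>E\<^esub> kd t c' S \<in> A ((n - 1 + int (card S)) + 1)" using rkd[of S] by (simp add: cochain_part_def)
    moreover have "kd t c' S \<in> B (n - 1 + int (card S))"
      using cochainsD[OF cochains_kd[OF B c'B], of S] True by (simp add: cochain_part_def)
    ultimately show ?thesis using inj True by (simp add: cochain_part_def)
  next
    case False
    then show ?thesis using cochainsD[OF cochains_kd[OF B c'B], of S] by (simp add: cochain_part_def)
  qed
  then have kdA: "kd t c' \<in> cochains E t A (n - 1)" by (simp add: cochains_def)
  let ?b = "kh i t c'"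
  have bB: "?b \<in> cochains E t B n" using cochains_kh[OF B c'B i] by simp
  have hA: "kh i t (kd t c') \<in> cochains E t A n" using cochains_kh[OF A kdA i] by simp
  have "c S \<ominus>\<^bsub>E\<^esub> kd t ?b S \<in> cochain_part E t A n S" for S
  proof -
    have 1: "kd t ?b S \<oplus>\<^bsub>E\<^esub> kh i t (kd t c') S = ?rc S" by (rule kd_kh[OF c'c i])
    have cl: "kd t ?b S \<in> carrier E" "kh i t (kd t c') S \<in> carrier E"
      using c'c by (auto intro!: kd_closed kh_closed)
    have "c S \<ominus>\<^bsub>E\<^esub> kd t ?b S = (c S \<ominus>\<^bsub>E\<^esub> ?rc S) \<oplus>\<^bsub>E\<^esub> kh i t (kd t c') S"
      unfolding 1[symmetric] using cl cc by (simp add: minus_eq minus_add a_assoc l_neg)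
    then show ?thesis
      using c'(2)[of S] hA additive_subgroup.a_closed[OF cochain_part_subgroup[OF A]]
      by (simp add: cochains_def)
  qed
  then show "\<exists>b\<in>cochains E t B n. c \<ominus>\<^bsub>fun_module E\<^esub> kd t b \<in> cochains E t A n"
    using bB cc kd_closed[OF cochains_carrier[OF B bB]]
    by (intro bexI[of _ ?b]) (simp_all add: fun_module_minus cochains_def)
qed

section \<open>Koszul cohomology in degrees zero and one\<close>

lemma kd_empty: "(\<And>S. c S \<in> carrier E) \<Longrightarrow> kd t c {} = \<zero>\<^bsub>E\<^esub>"
  by (induction t) auto

lemma kd_singleton: "(\<And>S. c S \<in> carrier E) \<Longrightarrow> i < t \<Longrightarrow> kd t c {i} = r i \<odot>\<^bsub>E\<^esub> c {}"
proof (induction t)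
  case (Suc t)
  then show ?case
    using kd_empty[of "\<lambda>U. c (insert t U)"] by (cases "i = t") (auto simp: minus_zero_right)
qed simp

lemma kd_supported_empty:
  assumes A: "graded_family E r t A" and x: "x \<in> carrier E" "\<And>i. i < t \<Longrightarrow> r i \<odot>\<^bsub>E\<^esub> x \<in> A (n + 1)"
    and "s \<le> t"
  shows "kd s (\<lambda>S. if S = {} then x else \<zero>\<^bsub>E\<^esub>) S \<in> cochain_part E t A n S"
  using assms(4)
proof (induction s arbitrary: S)
  case 0 then show ?case using additive_subgroup.zero_closed[OF cochain_part_subgroup[OF A]] by simp
next
  case (Suc s)
  show ?case
  proof (cases "s \<in> S")
    case True
    have "kd s (\<lambda>U. if insert s U = {} then x else \<zero>\<^bsub>E\<^esub>) (S - {s}) = \<zero>\<^bsub>E\<^esub>" by (rule kd_zero) simp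
    moreover have "r s \<odot>\<^bsub>E\<^esub> (if S - {s} = {} then x else \<zero>\<^bsub>E\<^esub>) \<in> cochain_part E t A n S"
    proof (cases "S = {s}")
      case True then show ?thesis using x(2)[of s] Suc.prems by (simp add: cochain_part_def)
    next
      case False
      then have "S - {s} \<noteq> {}" using True by auto
      then show ?thesis using additive_subgroup.zero_closed[OF cochain_part_subgroup[OF A]] by simp
    qed
    ultimately show ?thesis using True x(1) by (auto simp: minus_zero_right)
  next
    case False then show ?thesis using Suc by simp
  qed
qed

text \<open>Exactness at the first place, for the cochain with value \<open>x\<close> at the empty
  set. Every coboundary vanishes at the empty set, so being a coboundary modulo \<open>A\<close>
  forces \<open>x\<close> into \<open>A\<close>.\<close>

lemma koszul_acyclic_socle:
  assumes A: "graded_family E r t A" and B: "graded_family E r t B" and acyc: "koszul_acyclic E r t A B n"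
    and x: "x \<in> B n" "\<And>i. i < t \<Longrightarrow> r i \<odot>\<^bsub>E\<^esub> x \<in> A (n + 1)"
  shows "x \<in> A n"
proof -
  have xc: "x \<in> carrier E" by (rule additive_subgroup.a_Hcarr[OF graded_familyD(1)[OF B] x(1)])
  let ?c = "\<lambda>S :: nat set. if S = {} then x else \<zero>\<^bsub>E\<^esub>"
  have c: "?c \<in> cochains E t B n"
    using x(1) additive_subgroup.zero_closed[OF cochain_part_subgroup[OF B]]
    by (auto simp: cochains_def) (simp add: cochain_part_def)
  moreover have "kd t ?c \<in> cochains E t A n"
    using kd_supported_empty[OF A xc x(2) order_refl] by (simp add: cochains_def)
  ultimately obtain b where b: "b \<in> cochains E t B n" "?c \<ominus>\<^bsub>fun_module E\<^esub> kd t b \<in> cochains E t A n"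
    using rel_acyclicD[OF acyc[unfolded koszul_acyclic_def]] by blast
  note bc = cochains_carrier[OF B b(1)]
  have "?c \<ominus>\<^bsub>fun_module E\<^esub> kd t b = (\<lambda>S. ?c S \<ominus>\<^bsub>E\<^esub> kd t b S)"
    using xc bc by (intro fun_module_minus) (auto simp: kd_closed)
  then have "?c {} \<ominus>\<^bsub>E\<^esub> kd t b {} \<in> cochain_part E t A n {}"
    using cochainsD[OF b(2), of "{}"] by simp
  then show ?thesis using bc xc by (simp add: kd_empty minus_zero_right cochain_part_def)
qed

text \<open>The recursion is on \<open>s\<close>, so partial differentials are treated. Among sets
  containing \<open>s\<close>, a nonzero value can occur only at \<open>{i, s}\<close> with
  \<open>i < s\<close>, where it is the expression in \<open>ry\<close>.\<close>

lemma kd_supported_singletons: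
  assumes A: "graded_family E r t A" and y: "\<And>i. i < t \<Longrightarrow> y i \<in> carrier E"
    and ry: "\<And>i k. i < t \<Longrightarrow> k < t \<Longrightarrow> r k \<odot>\<^bsub>E\<^esub> y i \<ominus>\<^bsub>E\<^esub> r i \<odot>\<^bsub>E\<^esub> y k \<in> A (n + 2)"
    and "s \<le> t" "S \<subseteq> {..<s}"
  shows "kd s (\<lambda>S. if \<exists>i<t. S = {i} then y (the_elem S) else \<zero>\<^bsub>E\<^esub>) S \<in> A (n + int (card S))"
  using assms(4,5)
proof (induction s arbitrary: S)
  case 0 then show ?case using additive_subgroup.zero_closed[OF graded_familyD(1)[OF A]] by simp
next
  case (Suc s)
  let ?c = "\<lambda>S. if \<exists>i<t. S = {i} then y (the_elem S) else \<zero>\<^bsub>E\<^esub>"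
  show ?case
  proof (cases "s \<in> S")
    case False
    then have "S \<subseteq> {..<s}" using Suc.prems(2) by (auto simp: less_Suc_eq)
    then show ?thesis using Suc False by simp
  next
    case True
    let ?V = "S - {s}"
    have st: "s < t" using Suc.prems by simp
    have "kd s (\<lambda>U. ?c (insert s U)) ?V = kd s (\<lambda>U. if U = {} then y s else \<zero>\<^bsub>E\<^esub>) ?V"
    proof (rule kd_cong)
      fix U assume "U \<subseteq> ?V"
      then have "insert s U = {i} \<longleftrightarrow> U = {} \<and> i = s" for i by auto
      then show "?c (insert s U) = (if U = {} then y s else \<zero>\<^bsub>E\<^esub>)" using st by auto
    qed
    then have eq: "kd (Suc s) ?c S = r s \<odot>\<^bsub>E\<^esub> ?c ?V \<ominus>\<^bsub>E\<^esub> kd s (\<lambda>U. if U = {} then y s else \<zero>\<^bsub>E\<^esub>) ?V"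
      using True by simp
    have zero: "kd s' (\<lambda>U. if U = {} then y s else \<zero>\<^bsub>E\<^esub>) V = \<zero>\<^bsub>E\<^esub>" if "\<forall>i. V \<noteq> {i}" for V s'
      using that
    proof (induction s' arbitrary: V)
      case (Suc s')
      have "kd s' (\<lambda>U. if insert s' U = {} then y s else \<zero>\<^bsub>E\<^esub>) (V - {s'}) = \<zero>\<^bsub>E\<^esub>" by (rule kd_zero) simp
      moreover have "V - {s'} \<noteq> {}" if "s' \<in> V" using that Suc.prems by auto
      ultimately show ?case using Suc by (auto simp: minus_zero_right)
    qed simp
    show ?thesis
    proof (cases "\<exists>i. ?V = {i}")
      case False
      then show ?thesis
        using eq zero[of ?V s] additive_subgroup.zero_closed[OF graded_familyD(1)[OF A]]
        by (auto simp: minus_zero_right)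
    next
      case True
      then obtain i where i: "?V = {i}" by blast
      have "i \<in> S - {s}" using i by simp
      then have "i \<noteq> s" "i < Suc s" using Suc.prems(2) by auto
      moreover have "S = {i, s}" using i \<open>s \<in> S\<close> by blast
      ultimately have S: "S = {i, s}" "i \<noteq> s" "i < s" "i < t" using st by auto
      have zc: "(if U = {} then y s else \<zero>\<^bsub>E\<^esub>) \<in> carrier E" for U :: "nat set" using y[OF st] by auto
      have 1: "kd s (\<lambda>U. if U = {} then y s else \<zero>\<^bsub>E\<^esub>) {i} = r i \<odot>\<^bsub>E\<^esub> y s"
        using kd_singleton[of "\<lambda>U. if U = {} then y s else \<zero>\<^bsub>E\<^esub>", OF zc S(3)] by simp
      have 2: "?c {i} = y i" using S(4) by auto
      have "kd (Suc s) ?c S = r s \<odot>\<^bsub>E\<^esub> y i \<ominus>\<^bsub>E\<^esub> r i \<odot>\<^bsub>E\<^esub> y s"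
        unfolding eq i 1 2 by (rule refl)
      moreover have "n + int (card S) = n + 2" using S by simp
      ultimately show ?thesis using ry[OF S(4) st] by (simp only:)
    qed
  qed
qed

text \<open>Exactness at the second place, for the cochain with value \<open>y i\<close> at
  \<open>{i}\<close>. The witness \<open>x\<close> is the value at the empty set of the cochain that
  bounds it.\<close>

lemma koszul_acyclic_cocycle:
  assumes A: "graded_family E r t A" and B: "graded_family E r t B" and sub: "\<And>n. A n \<subseteq> B n"
    and acyc: "koszul_acyclic E r t A B n"
    and y: "\<And>i. i < t \<Longrightarrow> y i \<in> B (n + 1)"
    and ry: "\<And>i k. i < t \<Longrightarrow> k < t \<Longrightarrow> r k \<odot>\<^bsub>E\<^esub> y i \<ominus>\<^bsub>E\<^esub> r i \<odot>\<^bsub>E\<^esub> y k \<in> A (n + 2)"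
  shows "\<exists>x\<in>B n. \<forall>i<t. y i \<ominus>\<^bsub>E\<^esub> r i \<odot>\<^bsub>E\<^esub> x \<in> A (n + 1)"
proof -
  have yc: "y i \<in> carrier E" if "i < t" for i
    by (rule additive_subgroup.a_Hcarr[OF graded_familyD(1)[OF B] y[OF that]])
  let ?c = "\<lambda>S. if \<exists>i<t. S = {i} then y (the_elem S) else \<zero>\<^bsub>E\<^esub>"
  have "?c S \<in> cochain_part E t B n S" for S
  proof (cases "\<exists>i<t. S = {i}")
    case True then show ?thesis using y by (auto simp: cochain_part_def)
  next
    case False
    show ?thesis unfolding if_not_P[OF False] by (rule additive_subgroup.zero_closed[OF cochain_part_subgroup[OF B]])
  qed
  then have c: "?c \<in> cochains E t B n" unfolding cochains_def by blast
  note cc = cochains_carrier[OF B c]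
  have "kd t ?c S \<in> cochain_part E t A n S" for S
  proof (cases "S \<subseteq> {..<t}")
    case True then show ?thesis
      using kd_supported_singletons[OF A yc ry order_refl True] by (simp add: cochain_part_def)
  next
    case False
    have "kd t ?c S \<in> cochain_part E t B n S" using cochains_kd[OF B c] unfolding cochains_def by blast
    then show ?thesis using False by (simp add: cochain_part_def)
  qed
  then have "kd t ?c \<in> cochains E t A n" unfolding cochains_def by blast
  then obtain b where b: "b \<in> cochains E t B n" "?c \<ominus>\<^bsub>fun_module E\<^esub> kd t b \<in> cochains E t A n"
    using rel_acyclicD[OF acyc[unfolded koszul_acyclic_def] c] by blast
  note bc = cochains_carrier[OF B b(1)]
  have kb: "kd t b S \<in> carrier E" for S by (rule kd_closed[OF bc])
  have diff: "?c \<ominus>\<^bsub>fun_module E\<^esub> kd t b = (\<lambda>S. ?c S \<ominus>\<^bsub>E\<^esub> kd t b S)"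
    by (rule fun_module_minus[OF cc kb])
  have "y i \<ominus>\<^bsub>E\<^esub> r i \<odot>\<^bsub>E\<^esub> b {} \<in> A (n + 1)" if "i < t" for i
  proof -
    have "?c {i} \<ominus>\<^bsub>E\<^esub> kd t b {i} \<in> cochain_part E t A n {i}"
      using b(2) unfolding diff cochains_def by blast
    then show ?thesis using that by (simp add: kd_singleton[OF bc that] cochain_part_def)
  qed
  moreover have "b {} \<in> cochain_part E t B n {}" using b(1) unfolding cochains_def by blast
  ultimately show ?thesis by (auto simp: cochain_part_def)
qed

end

section \<open>Descending chains\<close>

text \<open>\<open>K\<close> will be the degree zero part of the ring: these are the submodules over
  it of a module over the whole ring.\<close>

definition stable_subgroup :: "('a, 'e, 'm) module_scheme \<Rightarrow> 'a set \<Rightarrow> 'e set \<Rightarrow> bool"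
  where "stable_subgroup M K Y \<longleftrightarrow> additive_subgroup Y M \<and> (\<forall>a\<in>K. \<forall>x\<in>Y. a \<odot>\<^bsub>M\<^esub> x \<in> Y)"

text \<open>P/Q is artinian, expressed by subgroups between \<open>Q\<close> and
  \<open>P\<close>.\<close>

definition dcc :: "('a, 'e, 'm) module_scheme \<Rightarrow> 'a set \<Rightarrow> 'e set \<Rightarrow> 'e set \<Rightarrow> bool"
  where "dcc M K Q P \<longleftrightarrow> (\<forall>Y :: nat \<Rightarrow> 'e set.
    (\<forall>s. stable_subgroup M K (Y s) \<and> Q \<subseteq> Y s \<and> Y s \<subseteq> P \<and> Y (Suc s) \<subseteq> Y s) \<longrightarrow>
    (\<exists>s0. \<forall>s\<ge>s0. Y s = Y s0))"

lemma dccD: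
  assumes "dcc M K Q P" "\<And>s. stable_subgroup M K (Y s)" "\<And>s. Q \<subseteq> Y s" "\<And>s. Y s \<subseteq> P"
    "\<And>s. Y (Suc s) \<subseteq> Y s"
  shows "\<exists>s0. \<forall>s\<ge>s0. Y s = Y s0"
  using assms(1)[unfolded dcc_def, rule_format, of Y] assms(2-5) by blast

lemma stable_subgroupD:
  assumes "stable_subgroup M K Y"
  shows "additive_subgroup Y M" and "a \<in> K \<Longrightarrow> x \<in> Y \<Longrightarrow> a \<odot>\<^bsub>M\<^esub> x \<in> Y"
  using assms by (auto simp: stable_subgroup_def)

context module begin

lemma stable_subgroup_closed:
  assumes "stable_subgroup M K Y"
  shows "\<zero>\<^bsub>M\<^esub> \<in> Y" and "x \<in> Y \<Longrightarrow> x \<in> carrier M"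
    and "x \<in> Y \<Longrightarrow> y \<in> Y \<Longrightarrow> x \<oplus>\<^bsub>M\<^esub> y \<in> Y" and "x \<in> Y \<Longrightarrow> \<ominus>\<^bsub>M\<^esub> x \<in> Y"
    and "x \<in> Y \<Longrightarrow> y \<in> Y \<Longrightarrow> x \<ominus>\<^bsub>M\<^esub> y \<in> Y"
  using stable_subgroupD(1)[OF assms]
  by (auto simp: additive_subgroup.zero_closed additive_subgroup.a_Hcarr additive_subgroup.a_closed
      additive_subgroup.a_inv_closed additive_subgroup_minus[OF abelian_group_axioms])

lemma stable_subgroupI:
  assumes "Y \<subseteq> carrier M" "\<zero>\<^bsub>M\<^esub> \<in> Y" "\<And>x y. x \<in> Y \<Longrightarrow> y \<in> Y \<Longrightarrow> x \<oplus>\<^bsub>M\<^esub> y \<in> Y"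
    "\<And>x. x \<in> Y \<Longrightarrow> \<ominus>\<^bsub>M\<^esub> x \<in> Y" "\<And>a x. a \<in> K \<Longrightarrow> x \<in> Y \<Longrightarrow> a \<odot>\<^bsub>M\<^esub> x \<in> Y"
  shows "stable_subgroup M K Y"
  unfolding stable_subgroup_def using assms by (auto intro: additive_subgroupI')

text \<open>The intersections of \<open>Y s\<close> with \<open>N\<close> and the sums
  \<open>W s\<close> of \<open>Y s\<close> and \<open>N\<close> become stationary. From then on,
  nested members of the chain with equal intersection and equal sum coincide.\<close>

lemma dcc_extension:
  assumes Q: "stable_subgroup M K Q" and N: "stable_subgroup M K N" and P: "stable_subgroup M K P"
    and K: "K \<subseteq> carrier R" and sub: "Q \<subseteq> N" "N \<subseteq> P" and QN: "dcc M K Q N" and NP: "dcc M K N P"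
  shows "dcc M K Q P"
  unfolding dcc_def
proof (intro allI impI)
  fix Y :: "nat \<Rightarrow> 'c set"
  assume "\<forall>s. stable_subgroup M K (Y s) \<and> Q \<subseteq> Y s \<and> Y s \<subseteq> P \<and> Y (Suc s) \<subseteq> Y s"
  then have Y: "\<And>s. stable_subgroup M K (Y s)" "\<And>s. Q \<subseteq> Y s" "\<And>s. Y s \<subseteq> P" "\<And>s. Y (Suc s) \<subseteq> Y s"
    by auto
  note YD = stable_subgroup_closed[OF Y(1)] and ND = stable_subgroup_closed[OF N]
  have st: "stable_subgroup M K (Y s \<inter> N)" for s
    by (rule stable_subgroupI)
      (auto simp: YD ND stable_subgroupD(2)[OF Y(1)] stable_subgroupD(2)[OF N])
  have "Q \<subseteq> Y s \<inter> N" "Y s \<inter> N \<subseteq> N" "Y (Suc s) \<inter> N \<subseteq> Y s \<inter> N" for s using Y sub by blast+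
  then have "\<exists>s1. \<forall>s\<ge>s1. Y s \<inter> N = Y s1 \<inter> N"
    by (intro dccD[OF QN] st)
  then obtain s1 where s1: "\<And>s. s \<ge> s1 \<Longrightarrow> Y s \<inter> N = Y s1 \<inter> N" by blast
  define W where "W s = {x \<in> carrier M. \<exists>y\<in>Y s. x \<ominus>\<^bsub>M\<^esub> y \<in> N}" for s
  have WI: "x \<in> W s" if "x \<in> carrier M" "y \<in> Y s" "x \<ominus>\<^bsub>M\<^esub> y \<in> N" for x y s
    using that by (auto simp: W_def)
  have stW: "stable_subgroup M K (W s)" for s
  proof (rule stable_subgroupI)
    show "\<zero>\<^bsub>M\<^esub> \<in> W s" by (rule WI[of _ "\<zero>\<^bsub>M\<^esub>"]) (auto simp: YD ND minus_zero_right)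
    fix x assume "x \<in> W s"
    then obtain y where x: "x \<in> carrier M" and y: "y \<in> Y s" "x \<ominus>\<^bsub>M\<^esub> y \<in> N" by (auto simp: W_def)
    have yc: "y \<in> carrier M" using YD(2)[OF y(1)] .
    have "\<ominus>\<^bsub>M\<^esub> x \<ominus>\<^bsub>M\<^esub> \<ominus>\<^bsub>M\<^esub> y = \<ominus>\<^bsub>M\<^esub> (x \<ominus>\<^bsub>M\<^esub> y)" using x yc by (simp add: minus_eq minus_add)
    then show "\<ominus>\<^bsub>M\<^esub> x \<in> W s" using WI[of "\<ominus>\<^bsub>M\<^esub> x" "\<ominus>\<^bsub>M\<^esub> y"] x YD(4)[OF y(1)] ND(4)[OF y(2)] by simp
    show "a \<odot>\<^bsub>M\<^esub> x \<in> W s" if a: "a \<in> K" for a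
    proof -
      have ac: "a \<in> carrier R" using a K by auto
      show ?thesis
        using WI[of "a \<odot>\<^bsub>M\<^esub> x" "a \<odot>\<^bsub>M\<^esub> y"] x yc ac stable_subgroupD(2)[OF Y(1) a y(1)]
          stable_subgroupD(2)[OF N a y(2)] by (simp add: smult_minus_distrib)
    qed
    show "x \<oplus>\<^bsub>M\<^esub> x' \<in> W s" if x': "x' \<in> W s" for x'
    proof -
      obtain y' where x'c: "x' \<in> carrier M" and y': "y' \<in> Y s" "x' \<ominus>\<^bsub>M\<^esub> y' \<in> N" using x' by (auto simp: W_def)
      show ?thesis
        using WI[of "x \<oplus>\<^bsub>M\<^esub> x'" "y \<oplus>\<^bsub>M\<^esub> y'"] x x'c yc YD(2)[OF y'(1)] YD(3)[OF y(1) y'(1)] ND(3)[OF y(2) y'(2)]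
        by (simp add: minus_add_distrib)
    qed
  qed (auto simp: W_def)
  have NW: "N \<subseteq> W s" for s
  proof
    fix x assume "x \<in> N"
    then show "x \<in> W s" using WI[of x "\<zero>\<^bsub>M\<^esub>"] ND(2) YD(1) by (simp add: minus_zero_right)
  qed
  have WP: "W s \<subseteq> P" for s
  proof
    fix x assume "x \<in> W s"
    then obtain y where "x \<in> carrier M" "y \<in> Y s" "x \<ominus>\<^bsub>M\<^esub> y \<in> N" by (auto simp: W_def)
    then show "x \<in> P" using mem_of_minus_mem[OF stable_subgroupD(1)[OF P], of x y] Y(3) sub(2) by blast
  qed
  have "W (Suc s) \<subseteq> W s" for s using Y(4) unfolding W_def by blast
  then have "\<exists>s2. \<forall>s\<ge>s2. W s = W s2" by (intro dccD[OF NP] stW NW WP)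
  then obtain s2 where s2: "\<And>s. s \<ge> s2 \<Longrightarrow> W s = W s2" by blast
  have dec: "Y s' \<subseteq> Y s" if "s \<le> s'" for s s' using lift_Suc_antimono_le[of Y, OF Y(4) that] .
  have "Y s = Y (max s1 s2)" if s: "s \<ge> max s1 s2" for s
  proof
    show "Y s \<subseteq> Y (max s1 s2)" by (rule dec[OF s])
    show "Y (max s1 s2) \<subseteq> Y s"
    proof
      fix x assume x: "x \<in> Y (max s1 s2)"
      then have "x \<in> W (max s1 s2)" using WI[of x x "max s1 s2"] YD(2) ND(1) by (simp add: minus_eq r_neg)
      then have "x \<in> W s" using s2[of s] s2[of "max s1 s2"] s by simp
      then obtain y where y: "y \<in> Y s" "x \<ominus>\<^bsub>M\<^esub> y \<in> N" by (auto simp: W_def)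
      have "x \<ominus>\<^bsub>M\<^esub> y \<in> Y (max s1 s2)" using YD(5)[OF x] dec[OF s] y(1) by blast
      then have "x \<ominus>\<^bsub>M\<^esub> y \<in> Y s" using y(2) s1[of s] s1[of "max s1 s2"] s by auto
      then show "x \<in> Y s" using mem_of_minus_mem[OF stable_subgroupD(1)[OF Y(1)] YD(2)[OF x] y(1)] by blast
    qed
  qed
  then show "\<exists>s0. \<forall>s\<ge>s0. Y s = Y s0" by blast
qed

lemma dcc_refl: "dcc M K Q Q"
proof -
  have "\<exists>s0. \<forall>s\<ge>s0. Y s = Y s0" if "\<forall>s. Q \<subseteq> Y s \<and> Y s \<subseteq> Q" for Y :: "nat \<Rightarrow> 'c set"
    using that by blast
  then show ?thesis unfolding dcc_def by blast
qed

text \<open>A finite product of artinian quotients: coordinates are released one at a time from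
  \<open>Q\<close> to \<open>P\<close>, and evaluation at the new coordinate reduces each step to a
  single factor.\<close>

lemma dcc_functions:
  fixes P Q :: "'s \<Rightarrow> 'c set"
  assumes K: "K \<subseteq> carrier R" and P: "\<And>S. stable_subgroup M K (P S)" and Q: "\<And>S. stable_subgroup M K (Q S)"
    and sub: "\<And>S. Q S \<subseteq> P S" and fin: "finite F" and dcc: "\<And>S. S \<in> F \<Longrightarrow> dcc M K (Q S) (P S)"
    and eq: "\<And>S. S \<notin> F \<Longrightarrow> P S = Q S"
  shows "dcc (fun_module M) K {c. \<forall>S. c S \<in> Q S} {c. \<forall>S. c S \<in> P S}"
proof -
  interpret F: module R "fun_module M :: ('a, 's \<Rightarrow> 'c) module" by (rule fun_module_is_module)
  have stF: "stable_subgroup (fun_module M) K {c. \<forall>S. c S \<in> T S}"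
    if T: "\<And>S. stable_subgroup M K (T S)" for T :: "'s \<Rightarrow> 'c set"
  proof -
    note TD = stable_subgroup_closed[OF T]
    show ?thesis
    proof (rule F.stable_subgroupI)
      show "\<ominus>\<^bsub>fun_module M\<^esub> c \<in> {c. \<forall>S. c S \<in> T S}" if "c \<in> {c. \<forall>S. c S \<in> T S}" for c
      proof -
        have "\<ominus>\<^bsub>fun_module M\<^esub> c = (\<lambda>S. \<ominus>\<^bsub>M\<^esub> c S)" by (rule fun_module_a_inv, rule TD(2)) (use that in blast)
        then show ?thesis using that TD by simp
      qed
      show "{c. \<forall>S. c S \<in> T S} \<subseteq> carrier (fun_module M)"
      proof
        fix c assume "c \<in> {c. \<forall>S. c S \<in> T S}"
        then have "c S \<in> carrier M" for S using TD(2)[of "c S" S] by blast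
        then show "c \<in> carrier (fun_module M)" by simp
      qed
    qed (use TD(1,3) stable_subgroupD(2)[OF T] in simp_all)
  qed
  define PG where "PG G S = (if S \<in> G then P S else Q S)" for G S
  have stPG: "stable_subgroup M K (PG G S)" for G S using P Q by (simp add: PG_def)
  have main: "dcc (fun_module M) K {c. \<forall>S. c S \<in> Q S} {c. \<forall>S. c S \<in> PG G S}" if "finite G" "G \<subseteq> F" for G
    using that
  proof (induction G rule: finite_induct)
    case empty then show ?case by (simp add: PG_def F.dcc_refl)
  next
    case (insert S0 G)
    let ?N = "{c. \<forall>S. c S \<in> PG G S}" and ?P = "{c. \<forall>S. c S \<in> PG (insert S0 G) S}"
    have NP: "dcc (fun_module M) K ?N ?P" unfolding dcc_def
    proof (intro allI impI)
      fix Y :: "nat \<Rightarrow> ('s \<Rightarrow> 'c) set"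
      assume "\<forall>s. stable_subgroup (fun_module M) K (Y s) \<and> ?N \<subseteq> Y s \<and> Y s \<subseteq> ?P \<and> Y (Suc s) \<subseteq> Y s"
      then have Y: "\<And>s. stable_subgroup (fun_module M) K (Y s)" "\<And>s. ?N \<subseteq> Y s" "\<And>s. Y s \<subseteq> ?P"
        "\<And>s. Y (Suc s) \<subseteq> Y s" by auto
      note YD = F.stable_subgroup_closed[OF Y(1)]
      define V where "V s = (\<lambda>c. c S0) ` Y s" for s
      have VI: "c S0 \<in> V s" if "c \<in> Y s" for c s using that by (auto simp: V_def)
      have Yc: "c S \<in> carrier M" if "c \<in> Y s" for c s S using YD(2)[OF that] by simp
      have stV: "stable_subgroup M K (V s)" for s
      proof (rule stable_subgroupI)
        show "V s \<subseteq> carrier M" using Yc by (auto simp: V_def)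
        show "\<zero>\<^bsub>M\<^esub> \<in> V s" using VI[OF YD(1)] by simp
        fix x assume "x \<in> V s"
        then obtain c where c: "c \<in> Y s" "x = c S0" by (auto simp: V_def)
        have "\<ominus>\<^bsub>fun_module M\<^esub> c = (\<lambda>S. \<ominus>\<^bsub>M\<^esub> c S)" by (rule fun_module_a_inv) (use Yc[OF c(1)] in auto)
        then show "\<ominus>\<^bsub>M\<^esub> x \<in> V s" using VI[OF YD(4)[OF c(1)]] c by simp
        show "a \<odot>\<^bsub>M\<^esub> x \<in> V s" if "a \<in> K" for a
          using VI[OF stable_subgroupD(2)[OF Y(1) that c(1)]] c by simp
        show "x \<oplus>\<^bsub>M\<^esub> y \<in> V s" if y: "y \<in> V s" for y
        proof -
          obtain c' where c': "c' \<in> Y s" "y = c' S0" using y by (auto simp: V_def)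
          then show ?thesis using VI[OF YD(3)[OF c(1) c'(1)]] c by simp
        qed
      qed
      have QV: "Q S0 \<subseteq> V s" for s
      proof
        fix x assume x: "x \<in> Q S0"
        let ?c = "\<lambda>S. if S = S0 then x else \<zero>\<^bsub>M\<^esub>"
        have "?c S \<in> PG G S" for S
        proof (cases "S = S0")
          case True then show ?thesis using x insert.hyps by (simp add: PG_def)
        next
          case False then show ?thesis using stable_subgroup_closed(1)[OF stPG[of G S]] by simp
        qed
        then have "?c \<in> Y s" by (intro subsetD[OF Y(2)] CollectI allI)
        then show "x \<in> V s" using VI[of ?c s] by simp
      qed
      have VP: "V s \<subseteq> P S0" for s
      proof
        fix x assume "x \<in> V s"
        then obtain c where c: "c \<in> Y s" "x = c S0" by (auto simp: V_def)
        then have "c S0 \<in> PG (insert S0 G) S0" using Y(3) by blast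
        then show "x \<in> P S0" using c by (simp add: PG_def)
      qed
      have dS0: "dcc M K (Q S0) (P S0)" by (rule dcc) (use insert.prems in blast)
      have "V (Suc s) \<subseteq> V s" for s unfolding V_def by (rule image_mono[OF Y(4)])
      then have "\<exists>s0. \<forall>s\<ge>s0. V s = V s0" by (intro dccD[OF dS0] stV QV VP)
      then obtain s0 where s0: "\<And>s. s \<ge> s0 \<Longrightarrow> V s = V s0" by blast
      have dec: "Y s' \<subseteq> Y s" if "s \<le> s'" for s s' using lift_Suc_antimono_le[of Y, OF Y(4) that] .
      have "Y s = Y s0" if s: "s \<ge> s0" for s
      proof
        show "Y s \<subseteq> Y s0" by (rule dec[OF s])
        show "Y s0 \<subseteq> Y s"
        proof
          fix c assume c: "c \<in> Y s0"
          then have "c S0 \<in> V s" using VI s0[OF s] by simp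
          then obtain c' where c': "c' \<in> Y s" "c' S0 = c S0" by (auto simp: V_def)
          have diff: "c \<ominus>\<^bsub>fun_module M\<^esub> c' = (\<lambda>S. c S \<ominus>\<^bsub>M\<^esub> c' S)"
            by (rule fun_module_minus) (use Yc[OF c] Yc[OF c'(1)] in auto)
          have "c S \<ominus>\<^bsub>M\<^esub> c' S \<in> PG G S" for S
          proof (cases "S = S0")
            case True
            then show ?thesis using c'(2) Yc[OF c] stable_subgroup_closed(1)[OF stPG]
              by (simp add: minus_eq r_neg)
          next
            case False
            have "PG (insert S0 G) S = PG G S" using False by (simp add: PG_def)
            then have "c S \<in> PG G S" "c' S \<in> PG G S" using Y(3) c c'(1) by blast+
            then show ?thesis using stable_subgroup_closed(5)[OF stPG] by blast
          qed
          then have "c \<ominus>\<^bsub>fun_module M\<^esub> c' \<in> Y s" unfolding diff by (intro subsetD[OF Y(2)] CollectI allI)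
          then show "c \<in> Y s"
            using F.mem_of_minus_mem[OF stable_subgroupD(1)[OF Y(1)] YD(2)[OF c] c'(1)] by blast
        qed
      qed
      then show "\<exists>s0. \<forall>s\<ge>s0. Y s = Y s0" by blast
    qed
    have QN: "dcc (fun_module M) K {c. \<forall>S. c S \<in> Q S} ?N" by (rule insert.IH) (use insert.prems in blast)
    have QN_sub: "{c. \<forall>S. c S \<in> Q S} \<subseteq> ?N"
      using sub by (intro Collect_mono) (auto simp: PG_def)
    have NP_sub: "?N \<subseteq> ?P"
      using sub by (intro Collect_mono) (auto simp: PG_def)
    have stQ: "stable_subgroup (fun_module M) K {c. \<forall>S. c S \<in> Q S}" by (rule stF) (rule Q)
    have stN: "stable_subgroup (fun_module M) K ?N" by (rule stF) (rule stPG)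
    have stP: "stable_subgroup (fun_module M) K ?P" by (rule stF) (rule stPG)
    show ?case by (rule F.dcc_extension[of K _ ?N ?P, OF stQ stN stP K QN_sub NP_sub QN NP])
  qed
  have "PG F = P" by (rule ext) (simp add: PG_def eq)
  then show ?thesis using main[OF fin] by simp
qed

text \<open>This is dual to Hilbert's basis theorem, for the graded group \<open>P/Q\<close>; the index \<open>m\<close> is the negative
  of the degree, up to a shift. With \<open>T = r t\<close> and \<open>U/Q\<close> the kernel of \<open>T\<close>, the induction hypothesis
  for \<open>r 0, \<dots>, r (t - 1)\<close> applies to the modules \<open>V k s\<close> of elements of \<open>U\<close> which modulo \<open>Q\<close> have the form
  \<open>T\<^sup>k y\<close> with \<open>y \<in> Y s\<close>. They play the role of the ideals of leading coefficients.\<close>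

lemma dcc_families:
  fixes P Q :: "nat \<Rightarrow> 'c set" and r :: "nat \<Rightarrow> 'a" and t :: nat
  assumes K: "K \<subseteq> carrier R" and r: "\<And>i. r i \<in> carrier R"
    and P: "\<And>m. stable_subgroup M K (P m)" and Q: "\<And>m. stable_subgroup M K (Q m)" and QP: "\<And>m. Q m \<subseteq> P m"
    and rP: "\<And>i m x. i < t \<Longrightarrow> x \<in> P (Suc m) \<Longrightarrow> r i \<odot>\<^bsub>M\<^esub> x \<in> P m"
    and rQ: "\<And>i m x. i < t \<Longrightarrow> x \<in> Q (Suc m) \<Longrightarrow> r i \<odot>\<^bsub>M\<^esub> x \<in> Q m"
    and soc: "\<And>m x. x \<in> P (Suc m) \<Longrightarrow> (\<And>i. i < t \<Longrightarrow> r i \<odot>\<^bsub>M\<^esub> x \<in> Q m) \<Longrightarrow> x \<in> Q (Suc m)"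
    and dcc: "dcc M K (Q 0) (P 0)"
    and Y: "\<And>s m. stable_subgroup M K (Y s m)" and QY: "\<And>s m. Q m \<subseteq> Y s m" and YP: "\<And>s m. Y s m \<subseteq> P m"
    and Ydec: "\<And>s m. Y (Suc s) m \<subseteq> Y s m"
    and rY: "\<And>i s m x. i < t \<Longrightarrow> x \<in> Y s (Suc m) \<Longrightarrow> r i \<odot>\<^bsub>M\<^esub> x \<in> Y s m"
  shows "\<exists>s0. \<forall>s\<ge>s0. \<forall>m. Y s m = Y s0 m"
  using P QP rP soc dcc Y QY YP Ydec rY rQ
proof (induction t arbitrary: P Y)
  case (0 P Y)
  have "\<exists>s0. \<forall>s\<ge>s0. Y s 0 = Y s0 0" by (rule dccD[OF 0(5)]) (rule 0(6) 0(7) 0(8) 0(9))+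
  then obtain s0 where s0: "\<And>s. s \<ge> s0 \<Longrightarrow> Y s 0 = Y s0 0" by blast
  \<comment> \<open>With no multiplications left, the socle condition says that \<open>P\<close> and
    \<open>Q\<close> agree except at index 0.\<close>
  have "P (Suc m) \<subseteq> Q (Suc m)" for m using 0(4)[of _ m] by blast
  then have "Y s (Suc m) = Q (Suc m)" for s m using 0(7)[of "Suc m" s] 0(8)[of s "Suc m"] by blast
  then have "Y s m = Y s0 m" if "s \<ge> s0" for s m using s0[OF that] by (cases m) auto
  then show ?case by blast
next
  case (Suc t P Y)
  note P = Suc.prems(1) and QP = Suc.prems(2) and rP = Suc.prems(3) and soc = Suc.prems(4)
    and dcc = Suc.prems(5) and Y = Suc.prems(6) and QY = Suc.prems(7) and YP = Suc.prems(8)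
    and Ydec = Suc.prems(9) and rY = Suc.prems(10) and rQ = Suc.prems(11)
  note PD = stable_subgroup_closed[OF P] and QD = stable_subgroup_closed[OF Q]
    and YD = stable_subgroup_closed[OF Y]
  define T where "T k x = (r t [^] k) \<odot>\<^bsub>M\<^esub> x" for k :: nat and x
  have rk: "r t [^] k \<in> carrier R" for k :: nat using r by simp
  have T0: "T 0 x = x" if "x \<in> carrier M" for x using that by (simp add: T_def)
  have TS: "T (Suc k) x = r t \<odot>\<^bsub>M\<^esub> T k x" "T (Suc k) x = T k (r t \<odot>\<^bsub>M\<^esub> x)" if "x \<in> carrier M" for k x
    using that r rk[of k] smult_assoc1[OF rk r] smult_assoc1[OF r rk]
    by (simp_all add: T_def R.m_comm)
  have Tc: "T k x \<in> carrier M" if "x \<in> carrier M" for k x using that rk by (simp add: T_def)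
  interpret T: additive_map M M "T k" for k
    unfolding T_def by (rule module_smult_additive_map[OF module_axioms rk])
  have Tcomm: "T k (a \<odot>\<^bsub>M\<^esub> x) = a \<odot>\<^bsub>M\<^esub> T k x" if "a \<in> carrier R" "x \<in> carrier M" for k a x
    using that rk by (simp add: T_def smult_lcomm)
  have TQ: "T k y \<in> Q m" if "y \<in> Q (m + k)" for k y m
    using that
  proof (induction k arbitrary: y)
    case (Suc k)
    then show ?case using TS(2)[OF QD(2)[OF Suc.prems]] rQ[of t y "m + k"] by simp
  qed (simp add: T0 QD)
  have TY: "T k y \<in> Y s m" if "y \<in> Y s (m + k)" for k y s m
    using that
  proof (induction k arbitrary: y)
    case (Suc k)
    then show ?case using TS(2)[OF YD(2)[OF Suc.prems]] rY[of t y s "m + k"] by simp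
  qed (simp add: T0 YD)
  \<comment> \<open>At index 0, where multiplication by \<open>r t\<close> would leave the family,
    no condition is imposed: \<open>U 0\<close> is all of \<open>P 0\<close>.\<close>
  define U where "U m = {x \<in> P m. \<forall>k. m = Suc k \<longrightarrow> r t \<odot>\<^bsub>M\<^esub> x \<in> Q k}" for m
  have U0: "U 0 = P 0" by (simp add: U_def)
  have UP: "U m \<subseteq> P m" for m by (auto simp: U_def)
  have stU: "stable_subgroup M K (U m)" for m
  proof (rule stable_subgroupI)
    show "U m \<subseteq> carrier M" using PD(2) by (auto simp: U_def)
    show "\<zero>\<^bsub>M\<^esub> \<in> U m" using PD(1) QD(1) r by (simp add: U_def)
    fix x assume x: "x \<in> U m"
    then have xc: "x \<in> carrier M" using PD(2) by (auto simp: U_def)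
    show "x \<oplus>\<^bsub>M\<^esub> y \<in> U m" if "y \<in> U m" for y
      using x that PD(2,3) QD(3) r by (auto simp: U_def smult_r_distr)
    show "\<ominus>\<^bsub>M\<^esub> x \<in> U m" using x PD(2,4) QD(4) r by (auto simp: U_def smult_r_minus)
    show "a \<odot>\<^bsub>M\<^esub> x \<in> U m" if a: "a \<in> K" for a
      using x a K r xc stable_subgroupD(2)[OF P a] stable_subgroupD(2)[OF Q a]
      by (auto simp: U_def smult_lcomm[of "r t" a x] subsetD)
  qed
  note UD = stable_subgroup_closed[OF stU]
  have QU: "Q m \<subseteq> U m" for m using QP rQ by (auto simp: U_def)
  have rU: "r i \<odot>\<^bsub>M\<^esub> x \<in> U m" if i: "i < t" and x: "x \<in> U (Suc m)" for i x m
  proof -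
    have "x \<in> P (Suc m)" "r t \<odot>\<^bsub>M\<^esub> x \<in> Q m" using x by (auto simp: U_def)
    then show ?thesis using rP[of i x m] rQ[of i "r t \<odot>\<^bsub>M\<^esub> x"] i PD(2) r
      by (auto simp: U_def smult_lcomm[of "r t" "r i" x])
  qed
  have socU: "x \<in> Q (Suc m)" if "x \<in> U (Suc m)" "\<And>i. i < t \<Longrightarrow> r i \<odot>\<^bsub>M\<^esub> x \<in> Q m" for x m
    by (rule soc) (use that in \<open>auto simp: U_def less_Suc_eq\<close>)
  define V where "V k s m = {x \<in> carrier M. \<exists>y\<in>Y s (m + k). T k y \<in> U m \<and> x \<ominus>\<^bsub>M\<^esub> T k y \<in> Q m}" for k s m
  have VI: "x \<in> V k s m" if "x \<in> carrier M" "y \<in> Y s (m + k)" "T k y \<in> U m" "x \<ominus>\<^bsub>M\<^esub> T k y \<in> Q m" for x y k s m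
    using that by (auto simp: V_def)
  have stV: "stable_subgroup M K (V k s m)" for k s m
  proof (rule stable_subgroupI)
    show "\<zero>\<^bsub>M\<^esub> \<in> V k s m" by (rule VI[of _ "\<zero>\<^bsub>M\<^esub>"]) (auto simp: YD UD QD minus_zero_right)
    fix x assume "x \<in> V k s m"
    then obtain y where x: "x \<in> carrier M" and y: "y \<in> Y s (m + k)" "T k y \<in> U m" "x \<ominus>\<^bsub>M\<^esub> T k y \<in> Q m"
      by (auto simp: V_def)
    have yc: "y \<in> carrier M" using YD(2)[OF y(1)] .
    have "\<ominus>\<^bsub>M\<^esub> x \<ominus>\<^bsub>M\<^esub> \<ominus>\<^bsub>M\<^esub> T k y = \<ominus>\<^bsub>M\<^esub> (x \<ominus>\<^bsub>M\<^esub> T k y)"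
      using x Tc[OF yc] by (simp add: minus_eq minus_add)
    then show "\<ominus>\<^bsub>M\<^esub> x \<in> V k s m"
      using x yc YD(4)[OF y(1)] UD(4)[OF y(2)] QD(4)[OF y(3)] by (intro VI[of _ "\<ominus>\<^bsub>M\<^esub> y"]) simp_all
    show "a \<odot>\<^bsub>M\<^esub> x \<in> V k s m" if a: "a \<in> K" for a
    proof -
      have ac: "a \<in> carrier R" using a K by auto
      show ?thesis
        using x yc Tc[OF yc] ac stable_subgroupD(2)[OF Y a y(1)] stable_subgroupD(2)[OF stU a y(2)]
          stable_subgroupD(2)[OF Q a y(3)]
        by (intro VI[of _ "a \<odot>\<^bsub>M\<^esub> y"]) (simp_all add: smult_minus_distrib Tcomm)
    qed
    show "x \<oplus>\<^bsub>M\<^esub> x' \<in> V k s m" if x': "x' \<in> V k s m" for x'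
    proof -
      obtain y' where x'c: "x' \<in> carrier M" and y': "y' \<in> Y s (m + k)" "T k y' \<in> U m" "x' \<ominus>\<^bsub>M\<^esub> T k y' \<in> Q m"
        using x' by (auto simp: V_def)
      have y'c: "y' \<in> carrier M" using YD(2)[OF y'(1)] .
      show ?thesis
        using x x'c yc y'c Tc[OF yc] Tc[OF y'c] YD(3)[OF y(1) y'(1)] UD(3)[OF y(2) y'(2)] QD(3)[OF y(3) y'(3)]
        by (intro VI[of _ "y \<oplus>\<^bsub>M\<^esub> y'"]) (simp_all add: minus_add_distrib)
    qed
  qed (auto simp: V_def)
  have QV: "Q m \<subseteq> V k s m" for k s m
  proof
    fix x assume "x \<in> Q m"
    then show "x \<in> V k s m"
      by (intro VI[of _ "\<zero>\<^bsub>M\<^esub>"]) (simp_all add: QD YD UD minus_zero_right)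
  qed
  have VU: "V k s m \<subseteq> U m" for k s m
  proof
    fix x assume "x \<in> V k s m"
    then obtain y where "x \<in> carrier M" "T k y \<in> U m" "x \<ominus>\<^bsub>M\<^esub> T k y \<in> Q m" by (auto simp: V_def)
    then show "x \<in> U m" using mem_of_minus_mem[OF stable_subgroupD(1)[OF stU]] QU by blast
  qed
  have Vs: "V k (Suc s) m \<subseteq> V k s m" for k s m using Ydec by (auto simp: V_def)
  have Vk: "V (Suc k) s m \<subseteq> V k s m" for k s m
  proof
    fix x assume "x \<in> V (Suc k) s m"
    then obtain y where x: "x \<in> carrier M" and y: "y \<in> Y s (Suc (m + k))" "T (Suc k) y \<in> U m" "x \<ominus>\<^bsub>M\<^esub> T (Suc k) y \<in> Q m"
      by (auto simp: V_def)
    then show "x \<in> V k s m"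
      using TS(2)[OF YD(2)[OF y(1)], of k] rY[of t y s "m + k"] by (intro VI[of x "r t \<odot>\<^bsub>M\<^esub> y"]) simp_all
  qed
  have rV: "r i \<odot>\<^bsub>M\<^esub> x \<in> V k s m" if i: "i < t" and x: "x \<in> V k s (Suc m)" for i x k s m
  proof -
    obtain y where xc: "x \<in> carrier M" and y: "y \<in> Y s (Suc (m + k))" "T k y \<in> U (Suc m)" "x \<ominus>\<^bsub>M\<^esub> T k y \<in> Q (Suc m)"
      using x by (auto simp: V_def)
    have yc: "y \<in> carrier M" using YD(2)[OF y(1)] .
    show ?thesis
      using rY[of i y s "m + k"] i y(1) rU[OF i y(2)] rQ[OF less_SucI[OF i] y(3)] xc yc Tc[OF yc] r
      by (intro VI[of _ "r i \<odot>\<^bsub>M\<^esub> y"]) (simp_all add: Tcomm smult_minus_distrib)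
  qed
  have IH: "\<exists>s0. \<forall>s\<ge>s0. \<forall>m. W s m = W s0 m"
    if W: "\<And>s m. stable_subgroup M K (W s m)" "\<And>s m. Q m \<subseteq> W s m" "\<And>s m. W s m \<subseteq> U m"
      "\<And>s m. W (Suc s) m \<subseteq> W s m" "\<And>i s m x. i < t \<Longrightarrow> x \<in> W s (Suc m) \<Longrightarrow> r i \<odot>\<^bsub>M\<^esub> x \<in> W s m" for W
  proof (rule Suc.IH[of U W])
    show "dcc M K (Q 0) (U 0)" using dcc U0 by simp
  qed (fact stU QU rU W rQ[OF less_SucI] | erule socU, blast)+
  \<comment> \<open>\<open>V k s\<close> decreases in both \<open>k\<close> and \<open>s\<close>.
    Once the diagonal is stationary from \<open>c\<close> on, all \<open>V k s\<close> with
    \<open>k\<close> and \<open>s\<close> at least \<open>c\<close> are equal, and only the finitely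
    many \<open>k\<close> below \<open>c\<close> need bounds of their own.\<close>
  have "\<exists>s0. \<forall>s\<ge>s0. \<forall>m. V s s m = V s0 s0 m"
  proof (rule IH)
    show "V (Suc s) (Suc s) m \<subseteq> V s s m" for s m using Vs Vk by blast
  qed (fact stV QV VU rV)+
  then obtain c where c: "\<And>s m. s \<ge> c \<Longrightarrow> V s s m = V c c m" by blast
  have "\<exists>s0. \<forall>s\<ge>s0. \<forall>m. V k s m = V k s0 m" for k
    by (rule IH) (fact stV QV VU rV Vs)+
  then obtain f where f: "\<And>k s m. s \<ge> f k \<Longrightarrow> V k s m = V k (f k) m" by metis
  obtain b where b: "\<And>k. k < c \<Longrightarrow> f k \<le> b"
    using finite_nat_set_iff_bounded_le[of "f ` {..<c}"] by auto
  define s0 where "s0 = max b c"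
  have Vsdec: "V k s' m \<subseteq> V k s m" if "s \<le> s'" for k s s' m
    using lift_Suc_antimono_le[of "\<lambda>s. V k s m", OF Vs that] .
  have Vkdec: "V k' s m \<subseteq> V k s m" if "k \<le> k'" for k k' s m
    using lift_Suc_antimono_le[of "\<lambda>k. V k s m", OF Vk that] .
  have Vc: "V k s m = V c c m" if "k \<ge> c" "s \<ge> c" for k s m
  proof
    show "V k s m \<subseteq> V c c m" using Vsdec[OF that(2), of k m] Vkdec[OF that(1), of c m] by blast
    have "V (max k s) (max k s) m \<subseteq> V k s m"
      using Vsdec[of s "max k s" "max k s" m] Vkdec[of k "max k s" s m] by auto
    then show "V c c m \<subseteq> V k s m" using c[of "max k s" m] that by auto
  qed
  have Veq: "V k s m = V k s0 m" if "s \<ge> s0" for k s m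
  proof (cases "k < c")
    case True
    then show ?thesis using f[of k s m] f[of k s0 m] b[OF True] that by (simp add: s0_def)
  next
    case False
    then show ?thesis using Vc[of k s m] Vc[of k s0 m] that by (simp add: s0_def)
  qed
  have Yanti: "Y s' m \<subseteq> Y s m" if "s \<le> s'" for s s' m
    using lift_Suc_antimono_le[of "\<lambda>s. Y s m", OF Ydec that] .
  have "Y s m = Y s0 m" if s: "s \<ge> s0" for s m
  proof
    show "Y s m \<subseteq> Y s0 m" by (rule Yanti[OF s])
    \<comment> \<open>Induction on \<open>k\<close>: the leading term of \<open>y\<close> is also
      that of some \<open>z\<close> in \<open>Y s\<close>. The difference then has its
      \<open>k\<close>-th multiple in \<open>U (Suc n)\<close>, one step closer to the case
      \<open>k = 0\<close>.\<close>
    have claim: "y \<in> Y s (n + k)" if "y \<in> Y s0 (n + k)" "T k y \<in> U n" for k n y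
      using that
    proof (induction k arbitrary: n y)
      case (0 n y)
      have yc: "y \<in> carrier M" using YD(2)[OF 0(1)] .
      have "y \<in> V 0 s0 n"
        by (rule VI[of y y]) (use 0 yc QD(1) in \<open>auto simp: T0 minus_eq r_neg\<close>)
      then have "y \<in> V 0 s n" using Veq[OF s] by simp
      then obtain z where z: "z \<in> Y s n" "y \<ominus>\<^bsub>M\<^esub> z \<in> Q n" using YD(2) by (auto simp: V_def T0)
      then show ?case using mem_of_minus_mem[OF stable_subgroupD(1)[OF Y] yc z(1)] QY by auto
    next
      case (Suc k n y)
      have yc: "y \<in> carrier M" using YD(2)[OF Suc.prems(1)] .
      have "T (Suc k) y \<in> V (Suc k) s0 n"
        by (rule VI[of _ y]) (use Suc.prems yc QD(1) Tc[OF yc, of "Suc k"] in \<open>auto simp: minus_eq r_neg simp del: T.closed\<close>)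
      then have "T (Suc k) y \<in> V (Suc k) s n" using Veq[OF s] by simp
      then obtain z where z: "z \<in> Y s (n + Suc k)" "T (Suc k) y \<ominus>\<^bsub>M\<^esub> T (Suc k) z \<in> Q n"
        by (auto simp: V_def)
      have zc: "z \<in> carrier M" using YD(2)[OF z(1)] .
      let ?w = "y \<ominus>\<^bsub>M\<^esub> z"
      have wc: "?w \<in> carrier M" using yc zc by simp
      have w: "?w \<in> Y s0 (Suc n + k)" using YD(5)[OF Suc.prems(1)] Yanti[OF s] z(1) by auto
      have "r t \<odot>\<^bsub>M\<^esub> T k ?w \<in> Q n"
        using z(2) TS(1)[OF wc, of k] yc zc by simp
      moreover have "T k ?w \<in> P (Suc n)" using TY[OF w] YP by blast
      ultimately have "T k ?w \<in> U (Suc n)" by (simp add: U_def)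
      from Suc.IH[OF w this] have "?w \<in> Y s (n + Suc k)" by simp
      then show ?case by (rule mem_of_minus_mem[OF stable_subgroupD(1)[OF Y] yc z(1)])
    qed
    show "Y s0 m \<subseteq> Y s m"
    proof
      fix y assume y: "y \<in> Y s0 m"
      \<comment> \<open>After \<open>m\<close> multiplications index 0 is reached, where
        \<open>U\<close> equals \<open>P\<close>; hence the claim applies to every
        \<open>y\<close>.\<close>
      have "T m y \<in> P 0" using TY[of y s0 0 m] y YP by auto
      then show "y \<in> Y s m" using claim[of y 0 m] y U0 by simp
    qed
  qed
  then show ?case by blast
qed

end

subsection \<open>Koszul acyclicity from descending chains\<close>

lemma (in abelian_group) add_minus_cancel_left:
  "x \<in> carrier G \<Longrightarrow> y \<in> carrier G \<Longrightarrow> (x \<oplus> y) \<ominus> x = y"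
  by (subst a_comm) (simp_all add: minus_eq a_assoc r_neg)

context koszul begin

lemma cochain_part_stable:
  assumes "\<And>n. stable_subgroup E K (A n)" "K \<subseteq> carrier R"
  shows "stable_subgroup E K (cochain_part E t A n S)"
  using assms by (auto simp: cochain_part_def intro!: stable_subgroupI)

lemma cochains_stable:
  assumes A: "graded_family E r t A" and "\<And>n. stable_subgroup E K (A n)" "K \<subseteq> carrier R"
  shows "stable_subgroup (fun_module E) K (cochains E t A n)"
  using cochains_subgroup[OF A] stable_subgroupD(2)[OF cochain_part_stable[of K A, OF assms(2,3)]]
  by (auto simp: stable_subgroup_def cochains_def)

text \<open>Since \<open>r i\<close> is homotopic to zero, the modules \<open>Y s m\<close> below, which consist of cocycles for
  \<open>s \<le> m\<close> and of coboundaries otherwise, are compatible with multiplication by the \<open>r i\<close>. A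
  descending chain of such families is stationary, so cocycles are coboundaries for large \<open>m\<close>.\<close>

lemma koszul_acyclic_artinian:
  assumes A: "graded_family E r t A" and B: "graded_family E r t B" and sub: "\<And>n. A n \<subseteq> B n"
    and K: "K \<subseteq> carrier R" and stA: "\<And>n. stable_subgroup E K (A n)" and stB: "\<And>n. stable_subgroup E K (B n)"
    and soc: "\<And>n x. n \<le> n0 \<Longrightarrow> x \<in> B n \<Longrightarrow> (\<And>i. i < t \<Longrightarrow> r i \<odot>\<^bsub>E\<^esub> x \<in> A (n + 1)) \<Longrightarrow> x \<in> A n"
    and dcc: "\<And>n. n \<le> n0 \<Longrightarrow> dcc E K (A n) (B n)"
  shows "\<exists>n1. \<forall>n\<le>n1. koszul_acyclic E r t A B n"
proof -
  interpret F: module R "fun_module E :: ('a, nat set \<Rightarrow> 'c) module" by (rule fun_module_is_module)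
  interpret D: differential "fun_module E" "kd t" by (rule kd_differential)
  \<comment> \<open>A cochain of strand \<open>N m\<close> has its values in degrees up to
    \<open>N m + t\<close>; subtracting \<open>t\<close> keeps all of them at or below
    \<open>n0\<close>.\<close>
  define N where "N m = n0 - int t - int m" for m
  have N1: "N (Suc m) + 1 = N m" for m by (simp add: N_def)
  define P where "P m = cochains E t B (N m)" for m
  define Q where "Q m = cochains E t A (N m)" for m
  define Z where "Z m = {c \<in> P m. kd t c \<in> Q m}" for m
  define W where "W m = {c \<in> P m. \<exists>b\<in>P m. c \<ominus>\<^bsub>fun_module E\<^esub> kd t b \<in> Q m}" for m
  define Y where "Y s m = (if s \<le> m then Z m else W m)" for s m
  have stP: "stable_subgroup (fun_module E) K (P m)" for m
    unfolding P_def by (rule cochains_stable[OF B stB K])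
  have stQ: "stable_subgroup (fun_module E) K (Q m)" for m
    unfolding Q_def by (rule cochains_stable[OF A stA K])
  note PD = F.stable_subgroup_closed[OF stP] and QD = F.stable_subgroup_closed[OF stQ]
  have Pc: "c S \<in> carrier E" if "c \<in> P m" for c S m using PD(2)[OF that] by simp
  have kdP: "kd t c \<in> P m" if "c \<in> P m" for c m using that cochains_kd[OF B] by (simp add: P_def)
  have kdQ: "kd t c \<in> Q m" if "c \<in> Q m" for c m using that cochains_kd[OF A] by (simp add: Q_def)
  have QP: "Q m \<subseteq> P m" for m unfolding P_def Q_def by (rule cochains_mono[OF sub])
  have kds: "kd t (a \<odot>\<^bsub>fun_module E\<^esub> c) = a \<odot>\<^bsub>fun_module E\<^esub> kd t c"
    if "a \<in> carrier R" "c \<in> carrier (fun_module E)" for a c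
    using that by (auto simp: kd_smult)
  have stZ: "stable_subgroup (fun_module E) K (Z m)" for m
  proof (rule F.stable_subgroupI)
    show "Z m \<subseteq> carrier (fun_module E)" unfolding Z_def using PD(2) by blast
    show "\<zero>\<^bsub>fun_module E\<^esub> \<in> Z m" unfolding Z_def using PD(1) QD(1) D.zero by simp
    fix c assume "c \<in> Z m"
    then have c: "c \<in> P m" "kd t c \<in> Q m" unfolding Z_def by blast+
    note cc = PD(2)[OF c(1)]
    show "\<ominus>\<^bsub>fun_module E\<^esub> c \<in> Z m"
      using PD(4)[OF c(1)] QD(4)[OF c(2)] unfolding Z_def mem_Collect_eq D.a_inv[OF cc] by blast
    show "a \<odot>\<^bsub>fun_module E\<^esub> c \<in> Z m" if a: "a \<in> K" for a
      using stable_subgroupD(2)[OF stP a c(1)] stable_subgroupD(2)[OF stQ a c(2)]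
      unfolding Z_def mem_Collect_eq kds[OF subsetD[OF K a] cc] by blast
    show "c \<oplus>\<^bsub>fun_module E\<^esub> c' \<in> Z m" if "c' \<in> Z m" for c'
    proof -
      have c': "c' \<in> P m" "kd t c' \<in> Q m" using that unfolding Z_def by blast+
      show ?thesis using PD(3)[OF c(1) c'(1)] QD(3)[OF c(2) c'(2)]
        unfolding Z_def mem_Collect_eq D.add[OF cc PD(2)[OF c'(1)]] by blast
    qed
  qed
  have WI: "c \<in> W m" if "c \<in> P m" "b \<in> P m" "c \<ominus>\<^bsub>fun_module E\<^esub> kd t b \<in> Q m" for c b m
    using that unfolding W_def by blast
  have stW: "stable_subgroup (fun_module E) K (W m)" for m
  proof (rule F.stable_subgroupI)
    show "W m \<subseteq> carrier (fun_module E)" unfolding W_def using PD(2) by blast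
    show "\<zero>\<^bsub>fun_module E\<^esub> \<in> W m"
      by (rule WI[OF PD(1) PD(1)]) (simp del: fun_module_sel add: F.minus_zero_right QD(1))
    fix c assume "c \<in> W m"
    then obtain b where c: "c \<in> P m" and b: "b \<in> P m" "c \<ominus>\<^bsub>fun_module E\<^esub> kd t b \<in> Q m"
      unfolding W_def by blast
    note cc = PD(2)[OF c] PD(2)[OF b(1)]
    have "\<ominus>\<^bsub>fun_module E\<^esub> c \<ominus>\<^bsub>fun_module E\<^esub> \<ominus>\<^bsub>fun_module E\<^esub> kd t b
        = \<ominus>\<^bsub>fun_module E\<^esub> (c \<ominus>\<^bsub>fun_module E\<^esub> kd t b)"
      using cc D.closed by (simp del: fun_module_sel add: F.minus_eq F.minus_add)
    then show "\<ominus>\<^bsub>fun_module E\<^esub> c \<in> W m"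
      using cc QD(4)[OF b(2)]
      by (intro WI[OF PD(4)[OF c] PD(4)[OF b(1)]]) (simp del: fun_module_sel)
    show "a \<odot>\<^bsub>fun_module E\<^esub> c \<in> W m" if a: "a \<in> K" for a
      using cc stable_subgroupD(2)[OF stQ a b(2)] subsetD[OF K a]
      by (intro WI[OF stable_subgroupD(2)[OF stP a c] stable_subgroupD(2)[OF stP a b(1)]])
        (simp del: fun_module_sel add: kds F.smult_minus_distrib)
    show "c \<oplus>\<^bsub>fun_module E\<^esub> c' \<in> W m" if c'W: "c' \<in> W m" for c'
    proof -
      obtain b' where c': "c' \<in> P m" and b': "b' \<in> P m" "c' \<ominus>\<^bsub>fun_module E\<^esub> kd t b' \<in> Q m"
        using c'W unfolding W_def by blast
      show ?thesis
        using cc PD(2)[OF c'] PD(2)[OF b'(1)] QD(3)[OF b(2) b'(2)]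
        by (intro WI[OF PD(3)[OF c c'] PD(3)[OF b(1) b'(1)]])
          (simp del: fun_module_sel add: F.minus_add_distrib)
    qed
  qed
  have QW: "Q m \<subseteq> W m" for m
  proof
    fix c assume c: "c \<in> Q m"
    then show "c \<in> W m" using QP[of m] QD(2)[OF c]
      by (intro WI[OF _ PD(1)]) (auto simp del: fun_module_sel simp: F.minus_zero_right)
  qed
  have WZ: "W m \<subseteq> Z m" for m
  proof
    fix c assume "c \<in> W m"
    then obtain b where c: "c \<in> P m" and b: "b \<in> P m" "c \<ominus>\<^bsub>fun_module E\<^esub> kd t b \<in> Q m"
      unfolding W_def by blast
    note cc = PD(2)[OF c] PD(2)[OF b(1)]
    have "kd t (c \<ominus>\<^bsub>fun_module E\<^esub> kd t b) = kd t c"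
      using cc D.diff_diff[OF cc(2)] by (simp del: fun_module_sel add: F.minus_zero_right)
    then have "kd t c \<in> Q m" using kdQ[OF b(2)] by simp
    then show "c \<in> Z m" using c unfolding Z_def by blast
  qed
  have rZ: "r i \<odot>\<^bsub>fun_module E\<^esub> c \<in> W m" if i: "i < t" and "c \<in> Z (Suc m)" for i c m
  proof -
    have c: "c \<in> P (Suc m)" "kd t c \<in> Q (Suc m)" using that(2) unfolding Z_def by auto
    note cc = Pc[OF c(1)]
    have rc: "r i \<odot>\<^bsub>fun_module E\<^esub> c \<in> P m"
      using cochains_mult[OF B _ i, of c "N (Suc m)"] c(1) by (simp add: P_def N1)
    have h: "kh i t c \<in> P m"
      using cochains_kh[OF B _ i, of c "N (Suc m)"] c(1) by (simp add: P_def N1)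
    have hk: "kh i t (kd t c) \<in> Q m"
      using cochains_kh[OF A _ i, of "kd t c" "N (Suc m)"] c(2) by (simp add: Q_def N1)
    note hkc = PD(2)[OF kdP[OF h]] QD(2)[OF hk]
    have eq: "r i \<odot>\<^bsub>fun_module E\<^esub> c = kd t (kh i t c) \<oplus>\<^bsub>fun_module E\<^esub> kh i t (kd t c)"
      using kd_kh[of c, OF cc i] by (simp add: fun_eq_iff)
    have "r i \<odot>\<^bsub>fun_module E\<^esub> c \<ominus>\<^bsub>fun_module E\<^esub> kd t (kh i t c) = kh i t (kd t c)"
      unfolding eq by (rule F.add_minus_cancel_left[OF hkc])
    then show ?thesis using WI[OF rc h] hk by presburger
  qed
  have "\<exists>s0. \<forall>s\<ge>s0. \<forall>m. Y s m = Y s0 m"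
  proof (rule F.dcc_families[of K r P Q t Y])
    show "stable_subgroup (fun_module E) K (Y s m)" for s m using stZ stW by (simp add: Y_def)
    show "Q m \<subseteq> Y s m" for s m using QW WZ by (auto simp: Y_def)
    show "Y s m \<subseteq> P m" for s m by (auto simp: Y_def Z_def W_def)
    show "Y (Suc s) m \<subseteq> Y s m" for s m using WZ by (auto simp: Y_def)
    show "r i \<odot>\<^bsub>fun_module E\<^esub> c \<in> Y s m" if "i < t" "c \<in> Y s (Suc m)" for i s m c
    proof -
      have "c \<in> Z (Suc m)" using that(2) WZ by (auto simp: Y_def split: if_splits)
      then have "r i \<odot>\<^bsub>fun_module E\<^esub> c \<in> W m" by (rule rZ[OF that(1)])
      then show ?thesis using WZ unfolding Y_def by auto
    qed
    show "r i \<odot>\<^bsub>fun_module E\<^esub> c \<in> P m" if "i < t" "c \<in> P (Suc m)" for i m c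
      using cochains_mult[OF B _ that(1), of c "N (Suc m)"] that(2) by (simp add: P_def N1)
    show "r i \<odot>\<^bsub>fun_module E\<^esub> c \<in> Q m" if "i < t" "c \<in> Q (Suc m)" for i m c
      using cochains_mult[OF A _ that(1), of c "N (Suc m)"] that(2) by (simp add: Q_def N1)
    show "c \<in> Q (Suc m)" if c: "c \<in> P (Suc m)" and rc: "\<And>i. i < t \<Longrightarrow> r i \<odot>\<^bsub>fun_module E\<^esub> c \<in> Q m" for m c
      unfolding Q_def
    proof (rule cochainsI)
      fix S
      have cP: "c S \<in> cochain_part E t B (N (Suc m)) S" using c cochainsD by (simp add: P_def)
      show "c S \<in> cochain_part E t A (N (Suc m)) S"
      proof (cases "S \<subseteq> {..<t}")
        case True
        have "card S \<le> t" using card_mono[OF _ True] by simp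
        then have "N (Suc m) + int (card S) \<le> n0" by (simp add: N_def)
        moreover have "r i \<odot>\<^bsub>E\<^esub> c S \<in> A (N (Suc m) + int (card S) + 1)" if "i < t" for i
          using cochainsD[OF rc[OF that, unfolded Q_def], of S] True by (simp add: cochain_part_def N_def algebra_simps)
        ultimately have "c S \<in> A (N (Suc m) + int (card S))"
          using soc cP True by (simp add: cochain_part_def)
        then show ?thesis using True by (simp add: cochain_part_def)
      qed (use cP in \<open>simp add: cochain_part_def\<close>)
    qed
    show "dcc (fun_module E) K (Q 0) (P 0)" unfolding P_def Q_def cochains_def
    proof (rule dcc_functions[OF K])
      show "cochain_part E t A (N 0) S \<subseteq> cochain_part E t B (N 0) S" for S
        using sub by (simp add: cochain_part_def)
      show "dcc E K (cochain_part E t A (N 0) S) (cochain_part E t B (N 0) S)" if "S \<in> Pow {..<t}" for S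
      proof -
        have "card S \<le> t" using that card_mono[of "{..<t}" S] by simp
        then show ?thesis using that dcc by (simp add: cochain_part_def N_def)
      qed
      show "stable_subgroup E K (cochain_part E t A (N 0) S)" for S by (rule cochain_part_stable[OF stA K])
      show "stable_subgroup E K (cochain_part E t B (N 0) S)" for S by (rule cochain_part_stable[OF stB K])
    qed (auto simp: cochain_part_def)
  qed (fact K r_closed stP stQ QP)+
  then obtain s0 where s0: "\<And>s m. s \<ge> s0 \<Longrightarrow> Y s m = Y s0 m" by blast
  have "koszul_acyclic E r t A B n" if "n \<le> N s0" for n
  proof -
    define m where "m = nat (n0 - int t - n)"
    have m: "N m = n" "m \<ge> s0" using that by (auto simp: m_def N_def)
    \<comment> \<open>The family \<open>Y s0\<close> shows cocycles at index \<open>m\<close>, as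
      \<open>m\<close> is at least \<open>s0\<close>, whereas \<open>Y (Suc m)\<close> shows
      coboundaries there.\<close>
    have "Z m = W m" using s0[of "Suc m" m] s0[of s0 m] m by (simp add: Y_def)
    moreover have "c \<in> Z m" if "c \<in> P m" "kd t c \<in> Q m" for c using that unfolding Z_def by blast
    ultimately have "\<exists>b\<in>P m. c \<ominus>\<^bsub>fun_module E\<^esub> kd t b \<in> Q m" if "c \<in> P m" "kd t c \<in> Q m" for c
      using that unfolding W_def by blast
    then show ?thesis unfolding koszul_acyclic_def rel_acyclic_def by (simp add: P_def Q_def m)
  qed
  then show ?thesis by blast
qed

end

section \<open>Extending homomorphisms from ideals\<close>

text \<open>Its carrier lies in the type of ring elements, where the test modules in the definition
  of injectivity live.\<close>

definition ideal_module :: "('a, 'r) ring_scheme \<Rightarrow> 'a set \<Rightarrow> ('a, 'a) module"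
  where "ideal_module R I = \<lparr>carrier = I, monoid.mult = undefined, monoid.one = undefined,
    ring.zero = \<zero>\<^bsub>R\<^esub>, ring.add = ring.add R, smult = monoid.mult R\<rparr>"

lemma ideal_module_sel [simp]:
  "carrier (ideal_module R I) = I" "\<zero>\<^bsub>ideal_module R I\<^esub> = \<zero>\<^bsub>R\<^esub>"
  "x \<oplus>\<^bsub>ideal_module R I\<^esub> y = x \<oplus>\<^bsub>R\<^esub> y" "a \<odot>\<^bsub>ideal_module R I\<^esub> x = a \<otimes>\<^bsub>R\<^esub> x"
  by (simp_all add: ideal_module_def)

lemma (in cring) ideal_module_is_module:
  assumes I: "ideal I R" shows "module R (ideal_module R I)"
proof -
  interpret I: ideal I R by fact
  have "abelian_group (ideal_module R I)"
  proof (rule abelian_groupI)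
    show "\<exists>y\<in>carrier (ideal_module R I). y \<oplus>\<^bsub>ideal_module R I\<^esub> x = \<zero>\<^bsub>ideal_module R I\<^esub>"
      if "x \<in> carrier (ideal_module R I)" for x
      using that by (intro bexI[of _ "\<ominus> x"]) (auto simp: l_neg I.a_Hcarr)
  qed (auto simp: I.a_Hcarr a_ac)
  then show ?thesis
    by (intro moduleI) (auto simp: is_cring l_distr r_distr m_assoc I.a_Hcarr I.I_l_closed)
qed

lemma (in cring) injective_module_baer:
  assumes E: "injective_module R E" and I: "ideal I R" and f: "f \<in> mod_hom R (ideal_module R I) E"
  shows "\<exists>e\<in>carrier E. \<forall>a\<in>I. f a = a \<odot>\<^bsub>E\<^esub> e"
proof -
  interpret I: ideal I R by fact
  have "(\<lambda>a. a) \<in> mod_hom R (ideal_module R I) (ideal_module R (carrier R))"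
    by (rule mod_homI) (auto simp: I.a_Hcarr)
  moreover have "inj_on (\<lambda>a. a) (carrier (ideal_module R I))" by (simp add: inj_on_def)
  ultimately have "\<exists>h\<in>mod_hom R (ideal_module R (carrier R)) E. \<forall>x\<in>carrier (ideal_module R I). h x = f x"
    using E[unfolded injective_module_def, THEN conjunct2, rule_format,
      of "ideal_module R I" "ideal_module R (carrier R)" "\<lambda>a. a" f]
      f ideal_module_is_module[OF I] ideal_module_is_module[OF oneideal] by blast
  then obtain h where h: "h \<in> mod_hom R (ideal_module R (carrier R)) E" "\<And>a. a \<in> I \<Longrightarrow> h a = f a" by auto
  have "f a = a \<odot>\<^bsub>E\<^esub> h \<one>" if "a \<in> I" for a
    using mod_homD(3)[OF h(1), of a \<one>] h(2)[OF that] I.a_Hcarr[OF that] by simp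
  moreover have "h \<one> \<in> carrier E" using mod_homD(1)[OF h(1), of \<one>] by simp
  ultimately show ?thesis by blast
qed

context graded_cring begin

lemma ideal_module_proj_graded:
  assumes I: "ideal I R" and hom: "\<And>a k. a \<in> I \<Longrightarrow> ipr k a \<in> I"
  shows "proj_graded R \<A> (ideal_module R I) (\<lambda>n. ipr (n - d))"
proof -
  interpret I: ideal I R by fact
  note c = I.a_Hcarr
  have inj: "inj (\<lambda>n. n - d :: int)" by (simp add: inj_on_def)
  show ?thesis unfolding proj_graded_def ideal_module_sel
  proof (intro conjI allI ballI impI)
    show "module R (ideal_module R I)" by (rule ideal_module_is_module[OF I])
    fix a assume a: "a \<in> I"
    show "ipr (n - d) a \<in> I" for n by (rule hom[OF a])
    show "finite {n. ipr (n - d) a \<noteq> \<zero>}"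
      using finite_vimageI[OF ipr_props(3)[OF c[OF a]] inj] by (simp add: vimage_def)
    show "ipr (m - d) (ipr (n - d) a) = (if m = n then ipr (n - d) a else \<zero>)" for m n
      using ipr_props(2)[OF c[OF a], of "m - d" "n - d"] by simp
    show "ipr (n - d) (a \<oplus> b) = ipr (n - d) a \<oplus> ipr (n - d) b" if "b \<in> I" for b n
      by (rule ipr_props(5)[OF c[OF a] c[OF that]])
    show "a = \<zero>" if *: "\<forall>n. ipr (n - d) a = \<zero>"
    proof (rule ipr_props(4)[OF c[OF a]])
      show "ipr k a = \<zero>" for k using *[rule_format, of "k + d"] by simp
    qed
  next
    fix a b and m :: nat and n assume "b \<in> \<A> m" "a \<in> I"
    then show "ipr (int m + n - d) (b \<otimes> a) = b \<otimes> ipr (n - d) a"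
      using ipr_props(6)[OF c[of a], of b m "n - d"] by (simp add: algebra_simps)
  qed
qed

text \<open>Ideal and ring are shifted alike so that \<open>\<one>\<close> has degree
  \<open>d\<close>. An extension to the ring is then determined by its homogeneous value at
  \<open>\<one>\<close>.\<close>

lemma graded_injective_module_baer:
  assumes E: "graded_injective_module R \<A> E \<E>" and I: "ideal I R" and hom: "\<And>a k. a \<in> I \<Longrightarrow> ipr k a \<in> I"
    and f: "f \<in> mod_hom R (ideal_module R I) E"
    and deg: "\<And>a k. a \<in> I \<Longrightarrow> ipr k a = a \<Longrightarrow> f a \<in> \<E> (k + d)"
  shows "\<exists>e\<in>\<E> d. \<forall>a\<in>I. f a = a \<odot>\<^bsub>E\<^esub> e"
proof -
  interpret I: ideal I R by fact
  let ?A = "ideal_module R I" and ?B = "ideal_module R (carrier R)"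
  let ?G = "\<lambda>n. {x \<in> carrier ?A. ipr (n - d) x = x}" and ?H = "\<lambda>n. {x \<in> carrier ?B. ipr (n - d) x = x}"
  have A: "graded_module R \<A> ?A ?G"
    by (rule proj_graded_imp_graded_module[OF gr ideal_module_proj_graded[OF I hom]])
  have B: "graded_module R \<A> ?B ?H"
    by (rule proj_graded_imp_graded_module[OF gr ideal_module_proj_graded[OF oneideal ipr_props(1)]])
  have u: "(\<lambda>a. a) \<in> graded_hom R ?A ?G ?B ?H"
    unfolding graded_hom_def by (auto intro!: mod_homI simp: I.a_Hcarr)
  have "f a \<in> \<E> n" if "a \<in> ?G n" for a n using deg[of a "n - d"] that by auto
  then have "f \<in> graded_hom R ?A ?G E \<E>" unfolding graded_hom_def using f by blast
  moreover have "inj_on (\<lambda>a. a) (carrier ?A)" by (simp add: inj_on_def)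
  ultimately have "\<exists>h \<in> graded_hom R ?B ?H E \<E>. \<forall>x \<in> carrier ?A. h x = f x"
    by (intro graded_injective_moduleD[OF E A B u])
  then obtain h where h: "h \<in> graded_hom R ?B ?H E \<E>" "\<And>a. a \<in> I \<Longrightarrow> h a = f a" by auto
  have hm: "h \<in> mod_hom R ?B E" and hd: "\<And>x n. x \<in> ?H n \<Longrightarrow> h x \<in> \<E> n"
    using h(1) by (auto simp: graded_hom_def)
  have "f a = a \<odot>\<^bsub>E\<^esub> h \<one>" if "a \<in> I" for a
    using mod_homD(3)[OF hm, of a \<one>] h(2)[OF that] I.a_Hcarr[OF that] by simp
  moreover have "h \<one> \<in> \<E> d" by (rule hd) (simp add: ipr_one)
  ultimately show ?thesis by blast
qed

end

section \<open>Annihilators\<close>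

lemma (in module) annihilator_ideal:
  assumes "x \<in> carrier M" shows "ideal {a \<in> carrier R. a \<odot>\<^bsub>M\<^esub> x = \<zero>\<^bsub>M\<^esub>} R"
  by (rule R.ideal_criterion) (use assms in \<open>auto simp: smult_l_distr smult_assoc1\<close>)

lemma (in module) annihilator_stationary:
  assumes "noetherian_ring R" "s \<in> carrier R" "x \<in> carrier M"
  obtains k :: nat where "\<And>a. a \<in> carrier R \<Longrightarrow> a \<odot>\<^bsub>M\<^esub> ((s [^] Suc k) \<odot>\<^bsub>M\<^esub> x) = \<zero>\<^bsub>M\<^esub>
    \<Longrightarrow> a \<odot>\<^bsub>M\<^esub> ((s [^] k) \<odot>\<^bsub>M\<^esub> x) = \<zero>\<^bsub>M\<^esub>"
proof -
  let ?N = "\<lambda>k :: nat. {a \<in> carrier R. a \<odot>\<^bsub>M\<^esub> ((s [^] k) \<odot>\<^bsub>M\<^esub> x) = \<zero>\<^bsub>M\<^esub>}"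
  have s: "s [^] k \<in> carrier R" for k :: nat using assms by simp
  have eq: "(s [^] Suc k) \<odot>\<^bsub>M\<^esub> x = s \<odot>\<^bsub>M\<^esub> ((s [^] k) \<odot>\<^bsub>M\<^esub> x)" for k :: nat
    using assms s[of k] by (simp add: R.m_comm[of _ s] smult_assoc1)
  have "a \<odot>\<^bsub>M\<^esub> ((s [^] Suc k) \<odot>\<^bsub>M\<^esub> x) = s \<odot>\<^bsub>M\<^esub> (a \<odot>\<^bsub>M\<^esub> ((s [^] k) \<odot>\<^bsub>M\<^esub> x))"
    if "a \<in> carrier R" for a k
    unfolding eq by (rule smult_lcomm) (use that assms s in simp_all)
  then have "?N k \<subseteq> ?N (Suc k)" for k using assms(2) by (simp add: Collect_mono_iff del: R.nat_pow_Suc)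
  then have mono: "?N k \<subseteq> ?N l" if "k \<le> l" for k l by (rule lift_Suc_mono_le[OF _ that])
  have "?N k \<subseteq> ?N l \<or> ?N l \<subseteq> ?N k" for k l
    using mono[of k l] mono[of l k] nat_le_linear[of k l] by blast
  moreover have "ideal (?N k) R" for k by (rule annihilator_ideal[OF smult_closed[OF s assms(3)]])
  ultimately have "subset.chain {I. ideal I R} (range ?N)"
    by (intro subset.chainI) blast+
  then have "\<Union>(range ?N) \<in> range ?N"
    by (intro noetherian_ring.ideal_chain_is_trivial[OF assms(1)]) auto
  then obtain k where "\<Union>(range ?N) = ?N k" by (rule imageE)
  then have "?N (Suc k) \<subseteq> ?N k" by blast
  then show ?thesis by (intro that[of k]) blast
qed

lemma (in graded_cring) graded_module_ipr_smult:
  assumes M: "graded_module R \<A> M \<M>" and x: "x \<in> \<M> n" and a: "a \<in> carrier R"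
  shows "ipr k a \<odot>\<^bsub>M\<^esub> x \<in> \<M> (k + n)"
proof (cases "k \<ge> 0")
  case True
  then show ?thesis using graded_moduleD(3)[OF M ds.pr_props(1)[OF a, of "nat k"] x] by (simp add: ipr_def)
next
  case False
  interpret M: module R M by (rule graded_moduleD(1)[OF M])
  interpret d: direct_sum M \<M> by (rule graded_moduleD(2)[OF M])
  show ?thesis using False d.sub[OF x] additive_subgroup.zero_closed[OF d.subgroup] by (simp add: ipr_def)
qed

section \<open>Torsion in graded injective modules\<close>

text \<open>Torsion for each of the first \<open>i\<close> generators separately. It interpolates
  between the whole module for \<open>i = 0\<close> and the torsion submodule for all generators, so
  that one generator can be treated at a time.\<close>

definition power_torsion ::
  "('a, 'r) ring_scheme \<Rightarrow> ('a, 'e, 'm) module_scheme \<Rightarrow> (int \<Rightarrow> 'e set) \<Rightarrow> (nat \<Rightarrow> 'a) \<Rightarrow> nat \<Rightarrow> int \<Rightarrow> 'e set"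
  where "power_torsion R E \<E> r i n =
    {e \<in> \<E> n. \<forall>l<i. \<exists>k :: nat. (r l [^]\<^bsub>R\<^esub> k) \<odot>\<^bsub>E\<^esub> e = \<zero>\<^bsub>E\<^esub>}"

lemma power_torsionD:
  assumes "x \<in> power_torsion R E \<E> r i n"
  shows "x \<in> \<E> n" and "l < i \<Longrightarrow> \<exists>k :: nat. (r l [^]\<^bsub>R\<^esub> k) \<odot>\<^bsub>E\<^esub> x = \<zero>\<^bsub>E\<^esub>"
  using assms by (auto simp: power_torsion_def)

lemma (in abelian_group) minus_minus_cancel_left:
  assumes "z \<in> carrier G" "a \<in> carrier G" "b \<in> carrier G"
  shows "(z \<ominus> b) \<ominus> (z \<ominus> a) = a \<ominus> b"
proof -
  have "z \<ominus> b = (z \<ominus> a) \<oplus> (a \<ominus> b)"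
    using assms a_assoc[of "z \<ominus> a" a "\<ominus> b"] minus_add_cancel(1)[of z a] by (simp add: minus_eq)
  then show ?thesis using assms by (simp add: add_minus_cancel_left)
qed

lemma (in module) power_kill_mono:
  assumes "s \<in> carrier R" "x \<in> carrier M" "(s [^] k) \<odot>\<^bsub>M\<^esub> x = \<zero>\<^bsub>M\<^esub>" "k \<le> (l :: nat)"
  shows "(s [^] l) \<odot>\<^bsub>M\<^esub> x = \<zero>\<^bsub>M\<^esub>"
proof -
  have "s [^] l = s [^] (l - k) \<otimes> s [^] k" using assms by (simp add: R.nat_pow_mult)
  then show ?thesis using assms by (simp add: smult_assoc1)
qed

lemma (in module) power_torsion_subgroup:
  assumes r: "\<And>l. r l \<in> carrier R" and A: "additive_subgroup (\<E> n) M"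
  shows "additive_subgroup (power_torsion R M \<E> r i n) M"
proof (rule additive_subgroupI')
  interpret A: additive_subgroup "\<E> n" M by fact
  show "power_torsion R M \<E> r i n \<subseteq> carrier M" using A.a_Hcarr by (auto simp: power_torsion_def)
  show "\<zero>\<^bsub>M\<^esub> \<in> power_torsion R M \<E> r i n" using r A.zero_closed by (simp add: power_torsion_def)
  show "\<ominus>\<^bsub>M\<^esub> x \<in> power_torsion R M \<E> r i n" if x: "x \<in> power_torsion R M \<E> r i n" for x
  proof -
    have "x \<in> \<E> n" using x by (simp add: power_torsion_def)
    note xc = A.a_Hcarr[OF this]
    have "\<exists>k :: nat. (r l [^] k) \<odot>\<^bsub>M\<^esub> \<ominus>\<^bsub>M\<^esub> x = \<zero>\<^bsub>M\<^esub>" if l: "l < i" for l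
    proof -
      obtain k :: nat where "(r l [^] k) \<odot>\<^bsub>M\<^esub> x = \<zero>\<^bsub>M\<^esub>" using power_torsionD(2)[OF x l] by blast
      then have "(r l [^] k) \<odot>\<^bsub>M\<^esub> \<ominus>\<^bsub>M\<^esub> x = \<zero>\<^bsub>M\<^esub>" using r xc by (simp add: smult_r_minus)
      then show ?thesis by blast
    qed
    then show ?thesis using \<open>x \<in> \<E> n\<close> by (simp add: power_torsion_def)
  qed
  show "x \<oplus>\<^bsub>M\<^esub> y \<in> power_torsion R M \<E> r i n"
    if x: "x \<in> power_torsion R M \<E> r i n" and y: "y \<in> power_torsion R M \<E> r i n" for x y
  proof -
    have xy: "x \<in> \<E> n" "y \<in> \<E> n" using x y by (auto simp: power_torsion_def)
    note c = A.a_Hcarr[OF xy(1)] A.a_Hcarr[OF xy(2)]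
    have "\<exists>k :: nat. (r l [^] k) \<odot>\<^bsub>M\<^esub> (x \<oplus>\<^bsub>M\<^esub> y) = \<zero>\<^bsub>M\<^esub>" if l: "l < i" for l
    proof -
      obtain k k' :: nat where k: "(r l [^] k) \<odot>\<^bsub>M\<^esub> x = \<zero>\<^bsub>M\<^esub>" "(r l [^] k') \<odot>\<^bsub>M\<^esub> y = \<zero>\<^bsub>M\<^esub>"
        using power_torsionD(2)[OF x l] power_torsionD(2)[OF y l] by blast
      have "(r l [^] max k k') \<odot>\<^bsub>M\<^esub> (x \<oplus>\<^bsub>M\<^esub> y) = \<zero>\<^bsub>M\<^esub>"
        using power_kill_mono[OF r c(1) k(1), of "max k k'"] power_kill_mono[OF r c(2) k(2), of "max k k'"] r c
        by (simp add: smult_r_distr)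
      then show ?thesis by blast
    qed
    then show ?thesis using A.a_closed[OF xy] by (simp add: power_torsion_def)
  qed
qed

lemma (in koszul) koszul_acyclic_refl:
  assumes A: "graded_family E r t A"
  shows "koszul_acyclic E r t A A n"
  unfolding koszul_acyclic_def rel_acyclic_def
proof (intro ballI impI bexI)
  interpret F: module R "fun_module E :: ('a, nat set \<Rightarrow> 'c) module" by (rule fun_module_is_module)
  interpret D: differential "fun_module E" "kd t" by (rule kd_differential)
  fix c assume c: "c \<in> cochains E t A n"
  show "\<zero>\<^bsub>fun_module E\<^esub> \<in> cochains E t A n" by (rule additive_subgroup.zero_closed[OF cochains_subgroup[OF A]])
  show "c \<ominus>\<^bsub>fun_module E\<^esub> kd t \<zero>\<^bsub>fun_module E\<^esub> \<in> cochains E t A n"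
    using c additive_subgroup.a_Hcarr[OF cochains_subgroup[OF A] c]
    by (simp del: fun_module_sel add: F.minus_zero_right)
qed

context graded_cring begin

text \<open>The element \<open>x\<close> with \<open>s x = y\<close> up to torsion is the value at \<open>1\<close> of an extension to \<open>R\<close> of the
  homomorphism \<open>s\<^sup>k\<^sup>+\<^sup>1 a + u \<mapsto> a s\<^sup>k y\<close>, where \<open>u y = 0\<close>; it is well defined as soon as the
  annihilators of \<open>s\<^sup>k y\<close> and \<open>s\<^sup>k\<^sup>+\<^sup>1 y\<close> agree.\<close>

lemma divide_up_to_torsion:
  assumes noeth: "noetherian_ring R" and E: "graded_injective_module R \<A> E \<E>"
    and s: "s \<in> \<A> 1" and y: "y \<in> \<E> (n + 1)"
  obtains x and k :: nat where "x \<in> \<E> n" "(s [^] k) \<odot>\<^bsub>E\<^esub> (y \<ominus>\<^bsub>E\<^esub> s \<odot>\<^bsub>E\<^esub> x) = \<zero>\<^bsub>E\<^esub>"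
    "\<And>a. a \<in> carrier R \<Longrightarrow> a \<odot>\<^bsub>E\<^esub> y = \<zero>\<^bsub>E\<^esub> \<Longrightarrow> a \<odot>\<^bsub>E\<^esub> x = \<zero>\<^bsub>E\<^esub>"
proof -
  have gE: "graded_module R \<A> E \<E>" using E by (simp add: graded_injective_module_def)
  interpret E: module R E by (rule graded_moduleD(1)[OF gE])
  interpret dE: direct_sum E \<E> by (rule graded_moduleD(2)[OF gE])
  have sc: "s \<in> carrier R" by (rule ds.sub[OF s])
  have yc: "y \<in> carrier E" by (rule dE.sub[OF y])
  have sk: "s [^] k \<in> carrier R" for k :: nat using sc by simp
  have skd: "s [^] k \<in> \<A> k" for k :: nat
  proof (induction k)
    case (Suc k) then show ?case using deg_mult[OF Suc s] by simp
  qed (simp add: one_deg0)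
  obtain k :: nat where k: "\<And>a. a \<in> carrier R \<Longrightarrow> a \<odot>\<^bsub>E\<^esub> ((s [^] Suc k) \<odot>\<^bsub>E\<^esub> y) = \<zero>\<^bsub>E\<^esub>
      \<Longrightarrow> a \<odot>\<^bsub>E\<^esub> ((s [^] k) \<odot>\<^bsub>E\<^esub> y) = \<zero>\<^bsub>E\<^esub>"
    by (rule E.annihilator_stationary[OF noeth sc yc]) blast
  define p where "p = s [^] Suc k"
  define y' where "y' = (s [^] k) \<odot>\<^bsub>E\<^esub> y"
  have pc: "p \<in> carrier R" and pd: "p \<in> \<A> (Suc k)" unfolding p_def by (rule sk skd)+
  have y'c: "y' \<in> carrier E" using sk yc by (simp add: y'_def)
  have y'd: "y' \<in> \<E> (int k + (n + 1))" unfolding y'_def by (rule graded_moduleD(3)[OF gE skd y])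
  \<comment> \<open>Adding the annihilator of \<open>y\<close> to the ideal and sending it to zero
    forces \<open>x\<close> to be killed by everything that kills \<open>y\<close>. So
    \<open>x\<close> inherits the torsion of \<open>y\<close> for the generators treated
    before.\<close>
  define Q where "Q = {a \<in> carrier R. a \<odot>\<^bsub>E\<^esub> y = \<zero>\<^bsub>E\<^esub>}"
  have Q: "ideal Q R" unfolding Q_def by (rule E.annihilator_ideal[OF yc])
  have Qs: "additive_subgroup Q R" by (rule ideal.axioms(1)[OF Q])
  have Qhom: "ipr l a \<in> Q" if "a \<in> Q" for a l
  proof -
    have a: "a \<in> carrier R" "a \<odot>\<^bsub>E\<^esub> y = \<zero>\<^bsub>E\<^esub>" using that by (simp_all add: Q_def)
    have "dE.pr (n + 1) y = y" using dE.pr_eq_self_iff[OF yc] y by blast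
    then have "dE.pr (l + (n + 1)) (a \<odot>\<^bsub>E\<^esub> y) = ipr l a \<odot>\<^bsub>E\<^esub> y"
      by (rule proj_smult_homogeneous[OF proj_graded_gproj[OF gr gE] yc _ a(1)])
    then have "ipr l a \<odot>\<^bsub>E\<^esub> y = \<zero>\<^bsub>E\<^esub>"
      unfolding a(2) additive_map.zero[OF dE.pr_additive_map] by (rule sym)
    then show ?thesis using ipr_props(1)[OF a(1)] by (simp add: Q_def)
  qed
  define rep where "rep z a \<longleftrightarrow> a \<in> carrier R \<and> z \<ominus> p \<otimes> a \<in> Q" for z a
  have well: "a \<odot>\<^bsub>E\<^esub> y' = b \<odot>\<^bsub>E\<^esub> y'" if "z \<in> carrier R" "rep z a" "rep z b" for z a b
  proof -
    have ab: "a \<in> carrier R" "b \<in> carrier R" using that by (auto simp: rep_def)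
    have "(z \<ominus> p \<otimes> b) \<ominus> (z \<ominus> p \<otimes> a) \<in> Q"
      using that additive_subgroup_minus[OF is_abelian_group Qs] by (auto simp: rep_def)
    also have "(z \<ominus> p \<otimes> b) \<ominus> (z \<ominus> p \<otimes> a) = p \<otimes> (a \<ominus> b)"
      using ab pc that(1) by (subst minus_minus_cancel_left) (simp_all add: minus_eq r_distr r_minus)
    finally have "(p \<otimes> (a \<ominus> b)) \<odot>\<^bsub>E\<^esub> y = \<zero>\<^bsub>E\<^esub>" by (simp add: Q_def)
    then have "(a \<ominus> b) \<odot>\<^bsub>E\<^esub> (p \<odot>\<^bsub>E\<^esub> y) = \<zero>\<^bsub>E\<^esub>"
      using ab pc yc by (simp add: m_comm[of p] E.smult_assoc1)
    then have "(a \<ominus> b) \<odot>\<^bsub>E\<^esub> y' = \<zero>\<^bsub>E\<^esub>" using k[of "a \<ominus> b"] ab by (simp add: p_def y'_def)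
    then have "a \<odot>\<^bsub>E\<^esub> y' \<ominus>\<^bsub>E\<^esub> b \<odot>\<^bsub>E\<^esub> y' = \<zero>\<^bsub>E\<^esub>"
      using ab y'c by (simp add: minus_eq E.minus_eq E.smult_l_distr E.smult_l_minus)
    then show ?thesis using ab y'c by (simp add: E.minus_eq_zero_iff)
  qed
  define I where "I = {z \<in> carrier R. \<exists>a. rep z a}"
  define f where "f z = (SOME a. rep z a) \<odot>\<^bsub>E\<^esub> y'" for z
  have f: "f z = a \<odot>\<^bsub>E\<^esub> y'" if "z \<in> carrier R" "rep z a" for z a
    unfolding f_def by (rule well[OF that(1) someI[of "rep z", OF that(2)] that(2)])
  have rep_add: "rep (z \<oplus> w) (a \<oplus> b)" if "z \<in> carrier R" "w \<in> carrier R" "rep z a" "rep w b" for z w a b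
  proof -
    have ab: "a \<in> carrier R" "b \<in> carrier R" using that by (auto simp: rep_def)
    have "(z \<oplus> w) \<ominus> p \<otimes> (a \<oplus> b) = (z \<ominus> p \<otimes> a) \<oplus> (w \<ominus> p \<otimes> b)"
      using ab that(1,2) pc by (simp add: r_distr minus_add_distrib)
    then show ?thesis using that(3,4) ab by (simp add: rep_def additive_subgroup.a_closed[OF Qs])
  qed
  have rep_mult: "rep (c \<otimes> z) (c \<otimes> a)" if "z \<in> carrier R" "c \<in> carrier R" "rep z a" for z c a
  proof -
    have a: "a \<in> carrier R" using that by (auto simp: rep_def)
    have "c \<otimes> z \<ominus> p \<otimes> (c \<otimes> a) = c \<otimes> (z \<ominus> p \<otimes> a)"
      using a that(1,2) pc by (simp add: minus_eq r_distr r_minus m_lcomm[of p c a])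
    then show ?thesis using that(2,3) a by (simp add: rep_def ideal.I_l_closed[OF Q])
  qed
  have rep_ipr: "rep (ipr l z) (ipr (l - int (Suc k)) a)" if "z \<in> carrier R" "rep z a" for l z a
  proof -
    interpret i: additive_map R R "ipr l" by (rule ipr_additive_map)
    have a: "a \<in> carrier R" using that by (auto simp: rep_def)
    have "ipr l (z \<ominus> p \<otimes> a) = ipr l z \<ominus> ipr l (p \<otimes> a)" using that(1) a pc by simp
    also have "ipr l (p \<otimes> a) = p \<otimes> ipr (l - int (Suc k)) a"
      using ipr_props(6)[OF a pd, of "l - int (Suc k)"] by simp
    finally show ?thesis using Qhom[of "z \<ominus> p \<otimes> a" l] that(2) a by (simp add: rep_def ipr_props(1))
  qed
  have II: "z \<in> I" if "z \<in> carrier R" "rep z a" for z a using that unfolding I_def by blast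
  have IE: "\<exists>a. z \<in> carrier R \<and> a \<in> carrier R \<and> rep z a" if "z \<in> I" for z
    using that unfolding I_def rep_def by blast
  have Qrep: "rep u \<zero>" if "u \<in> Q" for u using that pc additive_subgroup.a_Hcarr[OF Qs that] by (simp add: rep_def minus_zero_right)
  have prep: "rep p \<one>" using pc by (simp add: rep_def minus_eq r_neg additive_subgroup.zero_closed[OF Qs])
  have ideal: "ideal I R"
  proof (rule ideal_criterion)
    show "I \<subseteq> carrier R" by (auto simp: I_def)
    show "\<zero> \<in> I" by (rule II[OF zero_closed Qrep[OF additive_subgroup.zero_closed[OF Qs]]])
    show "z \<oplus> w \<in> I" if "z \<in> I" "w \<in> I" for z w
      using IE[OF that(1)] IE[OF that(2)] II rep_add a_closed by meson
    show "c \<otimes> z \<in> I" if "c \<in> carrier R" "z \<in> I" for c z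
      using IE[OF that(2)] II rep_mult that(1) m_closed by meson
  qed
  have hom: "ipr l z \<in> I" if "z \<in> I" for z l
    using IE[OF that] II rep_ipr ipr_props(1) by meson
  have fm: "f \<in> mod_hom R (ideal_module R I) E"
  proof (rule mod_homI)
    show "f z \<in> carrier E" if "z \<in> carrier (ideal_module R I)" for z
      using IE[of z] that y'c f by auto
    show "f (z \<oplus>\<^bsub>ideal_module R I\<^esub> w) = f z \<oplus>\<^bsub>E\<^esub> f w"
      if zI: "z \<in> carrier (ideal_module R I)" and wI: "w \<in> carrier (ideal_module R I)" for z w
    proof -
      obtain a where a: "z \<in> carrier R" "a \<in> carrier R" "rep z a" using zI IE[of z] by auto
      obtain b where b: "w \<in> carrier R" "b \<in> carrier R" "rep w b" using wI IE[of w] by auto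
      show ?thesis
        using f[OF _ rep_add[OF a(1) b(1) a(3) b(3)]] f[OF a(1,3)] f[OF b(1,3)] a b y'c by (simp add: E.smult_l_distr)
    qed
    show "f (c \<odot>\<^bsub>ideal_module R I\<^esub> z) = c \<odot>\<^bsub>E\<^esub> f z"
      if c: "c \<in> carrier R" and zI: "z \<in> carrier (ideal_module R I)" for c z
    proof -
      obtain a where a: "z \<in> carrier R" "a \<in> carrier R" "rep z a" using zI IE[of z] by auto
      show ?thesis
        using f[OF _ rep_mult[OF a(1) c a(3)]] f[OF a(1,3)] a c y'c by (simp add: E.smult_assoc1)
    qed
  qed
  have "\<exists>e\<in>\<E> n. \<forall>a\<in>I. f a = a \<odot>\<^bsub>E\<^esub> e"
  proof (rule graded_injective_module_baer[OF E ideal hom fm])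
    fix z l assume z: "z \<in> I" "ipr l z = z"
    obtain a where a: "z \<in> carrier R" "a \<in> carrier R" "rep z a" using IE[OF z(1)] by blast
    have "f z = ipr (l - int (Suc k)) a \<odot>\<^bsub>E\<^esub> y'" using f[OF a(1)] rep_ipr[OF a(1,3), of l] z(2) by simp
    also have "\<dots> \<in> \<E> (l - int (Suc k) + (int k + (n + 1)))"
      by (rule graded_module_ipr_smult[OF gE y'd a(2)])
    also have "l - int (Suc k) + (int k + (n + 1)) = l + n" by simp
    finally show "f z \<in> \<E> (l + n)" .
  qed
  then obtain x where x: "x \<in> \<E> n" "\<And>a. a \<in> I \<Longrightarrow> f a = a \<odot>\<^bsub>E\<^esub> x" by blast
  have xc: "x \<in> carrier E" by (rule dE.sub[OF x(1)])
  have "p \<odot>\<^bsub>E\<^esub> x = y'" using x(2)[OF II[OF pc prep]] f[OF pc prep] y'c by simp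
  moreover have "p \<odot>\<^bsub>E\<^esub> x = (s [^] k) \<odot>\<^bsub>E\<^esub> (s \<odot>\<^bsub>E\<^esub> x)"
    unfolding p_def using sc xc by (simp add: E.smult_assoc1)
  ultimately have "(s [^] k) \<odot>\<^bsub>E\<^esub> (y \<ominus>\<^bsub>E\<^esub> s \<odot>\<^bsub>E\<^esub> x) = \<zero>\<^bsub>E\<^esub>"
    using sk sc xc yc by (simp add: E.smult_minus_distrib y'_def E.minus_eq_zero_iff)
  moreover have "a \<odot>\<^bsub>E\<^esub> x = \<zero>\<^bsub>E\<^esub>" if "a \<in> carrier R" "a \<odot>\<^bsub>E\<^esub> y = \<zero>\<^bsub>E\<^esub>" for a
  proof -
    have "a \<in> Q" using that by (simp add: Q_def)
    then show ?thesis using x(2)[OF II[OF that(1) Qrep]] f[OF that(1) Qrep] y'c by simp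
  qed
  ultimately show ?thesis using that[OF x(1)] by blast
qed

text \<open>Induction on \<open>i\<close> along the chain of torsion groups. On the quotient of
  level \<open>i\<close> by level \<open>Suc i\<close>, multiplication by \<open>r i\<close> is
  injective because \<open>x\<close> is killed by a power of \<open>r i\<close> if
  \<open>r i x\<close> is, and surjective by division up to torsion; so this quotient has an exact
  Koszul complex.\<close>

lemma koszul_acyclic_power_torsion:
  assumes noeth: "noetherian_ring R" and E: "graded_injective_module R \<A> E \<E>"
    and r: "\<And>i. r i \<in> \<A> 1" and it: "i \<le> t"
  shows "koszul_acyclic E r t (power_torsion R E \<E> r i) \<E> n"
proof -
  have gE: "graded_module R \<A> E \<E>" using E by (simp add: graded_injective_module_def)
  have rc: "r i \<in> carrier R" for i by (rule ds.sub[OF r])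
  interpret E: koszul R E r by (intro koszul.intro graded_moduleD(1)[OF gE] koszul_axioms.intro rc)
  interpret dE: direct_sum E \<E> by (rule graded_moduleD(2)[OF gE])
  let ?T = "power_torsion R E \<E> r"
  have rE: "r i \<odot>\<^bsub>E\<^esub> x \<in> \<E> (n + 1)" if "x \<in> \<E> n" for i x n
    using graded_moduleD(3)[OF gE r[of i] that] by (simp add: add.commute)
  have fam: "graded_family E r t (?T i)" for i
    unfolding graded_family_def
  proof (intro conjI allI ballI impI)
    show "additive_subgroup (?T i n) E" for n by (rule E.power_torsion_subgroup[OF rc dE.subgroup])
    fix j n x assume x: "x \<in> ?T i n"
    then have xE: "x \<in> \<E> n" by (simp add: power_torsion_def)
    have "\<exists>k :: nat. (r l [^] k) \<odot>\<^bsub>E\<^esub> (r j \<odot>\<^bsub>E\<^esub> x) = \<zero>\<^bsub>E\<^esub>" if l: "l < i" for l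
    proof -
      obtain k :: nat where "(r l [^] k) \<odot>\<^bsub>E\<^esub> x = \<zero>\<^bsub>E\<^esub>" using power_torsionD(2)[OF x l] by blast
      then have "(r l [^] k) \<odot>\<^bsub>E\<^esub> (r j \<odot>\<^bsub>E\<^esub> x) = \<zero>\<^bsub>E\<^esub>"
        using rc dE.sub[OF xE] by (simp add: E.smult_lcomm[of _ "r j"])
      then show ?thesis by blast
    qed
    then show "r j \<odot>\<^bsub>E\<^esub> x \<in> ?T i (n + 1)" using rE[OF xE] by (simp add: power_torsion_def)
  qed
  have T0: "?T 0 = \<E>" by (auto simp: power_torsion_def)
  show ?thesis using it
  proof (induction i)
    case 0
    show ?case using E.koszul_acyclic_refl[OF fam[of 0]] by (simp add: T0)
  next
    case (Suc i)
    have sub: "?T (Suc i) n \<subseteq> ?T i n" "?T i n \<subseteq> \<E> n" for n by (auto simp: power_torsion_def)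
    have "koszul_acyclic E r t (?T (Suc i)) (?T i) n"
    proof (rule E.koszul_acyclic_bijective[OF fam fam sub(1)])
      show "i < t" using Suc.prems by simp
      show "x \<in> ?T (Suc i) n" if x: "x \<in> ?T i n" and rx: "r i \<odot>\<^bsub>E\<^esub> x \<in> ?T (Suc i) (n + 1)" for n x
      proof -
        have xc: "x \<in> carrier E" by (rule dE.sub) (use sub(2) x in blast)
        obtain k :: nat where "(r i [^] k) \<odot>\<^bsub>E\<^esub> (r i \<odot>\<^bsub>E\<^esub> x) = \<zero>\<^bsub>E\<^esub>"
          using power_torsionD(2)[OF rx lessI] by blast
        then have "(r i [^] Suc k) \<odot>\<^bsub>E\<^esub> x = \<zero>\<^bsub>E\<^esub>" using rc xc by (simp add: E.smult_assoc1)
        then have "\<exists>k :: nat. (r i [^] k) \<odot>\<^bsub>E\<^esub> x = \<zero>\<^bsub>E\<^esub>" by blast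
        then show ?thesis using x by (auto simp: power_torsion_def less_Suc_eq)
      qed
      show "\<exists>x\<in>?T i n. y \<ominus>\<^bsub>E\<^esub> r i \<odot>\<^bsub>E\<^esub> x \<in> ?T (Suc i) (n + 1)" if y: "y \<in> ?T i (n + 1)" for n y
      proof -
        have yE: "y \<in> \<E> (n + 1)" using sub(2) y by blast
        obtain x and k :: nat where x: "x \<in> \<E> n" "(r i [^] k) \<odot>\<^bsub>E\<^esub> (y \<ominus>\<^bsub>E\<^esub> r i \<odot>\<^bsub>E\<^esub> x) = \<zero>\<^bsub>E\<^esub>"
          "\<And>a. a \<in> carrier R \<Longrightarrow> a \<odot>\<^bsub>E\<^esub> y = \<zero>\<^bsub>E\<^esub> \<Longrightarrow> a \<odot>\<^bsub>E\<^esub> x = \<zero>\<^bsub>E\<^esub>"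
          by (rule divide_up_to_torsion[OF noeth E r[of i] yE]) blast
        have "\<exists>k :: nat. (r l [^] k) \<odot>\<^bsub>E\<^esub> x = \<zero>\<^bsub>E\<^esub>" if l: "l < i" for l
        proof -
          obtain k :: nat where "(r l [^] k) \<odot>\<^bsub>E\<^esub> y = \<zero>\<^bsub>E\<^esub>" using power_torsionD(2)[OF y l] by blast
          then have "(r l [^] k) \<odot>\<^bsub>E\<^esub> x = \<zero>\<^bsub>E\<^esub>" using x(3) rc by simp
          then show ?thesis by blast
        qed
        then have xT: "x \<in> ?T i n" using x(1) by (simp add: power_torsion_def)
        have "y \<ominus>\<^bsub>E\<^esub> r i \<odot>\<^bsub>E\<^esub> x \<in> ?T i (n + 1)"
          by (rule additive_subgroup_minus[OF E.abelian_group_axioms graded_familyD(1)[OF fam] y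
              graded_familyD(2)[OF fam _ xT]]) (use Suc.prems in simp)
        then have "y \<ominus>\<^bsub>E\<^esub> r i \<odot>\<^bsub>E\<^esub> x \<in> ?T (Suc i) (n + 1)"
          using x(2) by (auto simp: power_torsion_def less_Suc_eq)
        then show ?thesis using xT by blast
      qed
    qed
    then show ?case
      using Suc fam[of 0] sub by (intro E.koszul_acyclic_trans[OF fam[of "Suc i"] fam[of i] fam[of 0, unfolded T0]]) simp_all
  qed
qed

end

section \<open>Torsion submodules\<close>

definition killed :: "('a, 'r) ring_scheme \<Rightarrow> 'a set \<Rightarrow> ('a, 'b, 'm) module_scheme \<Rightarrow> nat \<Rightarrow> 'b set"
  where "killed R I M N = {x \<in> carrier M. \<forall>a\<in>ideal_power R I N. a \<odot>\<^bsub>M\<^esub> x = \<zero>\<^bsub>M\<^esub>}"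

lemma torsion_submodule_eq: "torsion_submodule R I M = (\<Union>N. killed R I M N)"
  by (auto simp: torsion_submodule_def killed_def)

context module begin

context
  fixes I assumes I: "I \<subseteq> carrier R"
begin

lemma ideal_power_subset: "ideal_power R I N \<subseteq> carrier R"
proof (induction N)
  case (Suc N)
  have "a \<in> carrier R" if "a \<in> ideal_prod R I (ideal_power R I N)" for a
    using that by (induction a rule: ideal_prod.induct) (use I Suc in auto)
  then show ?case by (auto simp: ideal_power_def)
qed (simp add: ideal_power_def)

lemma killed_0: "killed R I M 0 = {\<zero>\<^bsub>M\<^esub>}"
  by (auto simp: killed_def ideal_power_def dest: bspec[of _ _ \<one>])

text \<open>Replaces computations in powers of an ideal by a recursion that strips off one factor;
  most later arguments on torsion are inductions along it.\<close>

lemma killed_Suc: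
  assumes x: "x \<in> carrier M"
  shows "x \<in> killed R I M (Suc N) \<longleftrightarrow> (\<forall>a\<in>I. a \<odot>\<^bsub>M\<^esub> x \<in> killed R I M N)"
proof
  let ?J = "ideal_power R I N"
  have J: "?J \<subseteq> carrier R" by (rule ideal_power_subset)
  have eq: "ideal_power R I (Suc N) = ideal_prod R I ?J" by (simp add: ideal_power_def)
  have comm: "b \<odot>\<^bsub>M\<^esub> (a \<odot>\<^bsub>M\<^esub> x) = (a \<otimes> b) \<odot>\<^bsub>M\<^esub> x" if "a \<in> I" "b \<in> ?J" for a b
    using that I J x by (auto simp: smult_assoc1[symmetric] R.m_comm subsetD)
  show "\<forall>a\<in>I. a \<odot>\<^bsub>M\<^esub> x \<in> killed R I M N" if "x \<in> killed R I M (Suc N)"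
  proof
    fix a assume a: "a \<in> I"
    have "b \<odot>\<^bsub>M\<^esub> (a \<odot>\<^bsub>M\<^esub> x) = \<zero>\<^bsub>M\<^esub>" if b: "b \<in> ?J" for b
      using comm[OF a b] ideal_prod.prod[OF a b, of R] \<open>x \<in> killed R I M (Suc N)\<close> by (simp add: killed_def eq)
    then show "a \<odot>\<^bsub>M\<^esub> x \<in> killed R I M N" using x a I by (auto simp: killed_def)
  qed
  show "x \<in> killed R I M (Suc N)" if *: "\<forall>a\<in>I. a \<odot>\<^bsub>M\<^esub> x \<in> killed R I M N"
  proof -
    have "c \<in> carrier R \<and> c \<odot>\<^bsub>M\<^esub> x = \<zero>\<^bsub>M\<^esub>" if "c \<in> ideal_prod R I ?J" for c
      using that
    proof (induction c rule: ideal_prod.induct)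
      case (prod a b)
      then show ?case using comm[of a b] * I J by (auto simp: killed_def)
    next
      case (sum a b)
      then show ?case using x by (simp add: smult_l_distr)
    qed
    then show ?thesis using x by (simp add: killed_def eq)
  qed
qed

lemma killed_subgroup: "additive_subgroup (killed R I M N) M"
  using subsetD[OF ideal_power_subset]
  by (intro additive_subgroupI') (auto simp: killed_def smult_r_distr smult_r_minus)

lemma killed_smult:
  assumes "x \<in> killed R I M N" "a \<in> carrier R"
  shows "a \<odot>\<^bsub>M\<^esub> x \<in> killed R I M N"
  using assms subsetD[OF ideal_power_subset] by (auto simp: killed_def smult_lcomm[of _ a])

lemma killed_carrier: "x \<in> killed R I M N \<Longrightarrow> x \<in> carrier M"
  by (simp add: killed_def)

lemma killed_Suc_mono: "killed R I M N \<subseteq> killed R I M (Suc N)"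
proof (induction N)
  case 0
  then show ?case using I by (auto simp: killed_0 killed_Suc subsetD)
next
  case (Suc N)
  then show ?case using killed_Suc[OF killed_carrier] killed_carrier by blast
qed

lemma killed_mono: "m \<le> n \<Longrightarrow> killed R I M m \<subseteq> killed R I M n"
  by (rule lift_Suc_mono_le[of "killed R I M", OF killed_Suc_mono])

lemma torsion_submodule_submodule: "submodule (torsion_submodule R I M) R M"
proof (rule submoduleI')
  show "additive_subgroup (torsion_submodule R I M) M"
  proof (rule additive_subgroupI')
    show "x \<oplus>\<^bsub>M\<^esub> y \<in> torsion_submodule R I M"
      if x: "x \<in> torsion_submodule R I M" and y: "y \<in> torsion_submodule R I M" for x y
    proof -
      obtain m n where "x \<in> killed R I M m" "y \<in> killed R I M n"
        using x y unfolding torsion_submodule_eq by blast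
      then have "x \<in> killed R I M (max m n)" "y \<in> killed R I M (max m n)"
        using killed_mono[of m "max m n"] killed_mono[of n "max m n"] by auto
      then have "x \<oplus>\<^bsub>M\<^esub> y \<in> killed R I M (max m n)"
        by (rule additive_subgroup.a_closed[OF killed_subgroup])
      then show ?thesis unfolding torsion_submodule_eq by blast
    qed
    show "\<zero>\<^bsub>M\<^esub> \<in> torsion_submodule R I M"
      unfolding torsion_submodule_eq using killed_0 by blast
    show "torsion_submodule R I M \<subseteq> carrier M" by (auto simp: torsion_submodule_def)
    show "\<ominus>\<^bsub>M\<^esub> x \<in> torsion_submodule R I M" if "x \<in> torsion_submodule R I M" for x
      using that additive_subgroup.a_inv_closed[OF killed_subgroup] unfolding torsion_submodule_eq by blast
  qed
  show "a \<odot>\<^bsub>M\<^esub> x \<in> torsion_submodule R I M" if "a \<in> carrier R" "x \<in> torsion_submodule R I M" for a x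
    using that killed_smult unfolding torsion_submodule_eq by blast
qed

text \<open>Finitely many generators have a common exponent \<open>N\<close>, and the
  \<open>a\<close> for which \<open>a x\<close> is killed by the \<open>N\<close>-th power form an
  ideal. Generation is phrased by \<open>gen\<close>, which asks of \<open>I\<close> only that it be
  a subset of the ring.\<close>

lemma torsion_of_generators:
  assumes "finite S" and gen: "\<And>K. ideal K R \<Longrightarrow> S \<subseteq> K \<Longrightarrow> I \<subseteq> K"
    and x: "x \<in> carrier M" "\<And>s. s \<in> S \<Longrightarrow> s \<odot>\<^bsub>M\<^esub> x \<in> torsion_submodule R I M" and S: "S \<subseteq> carrier R"
  shows "x \<in> torsion_submodule R I M"
proof -
  have "\<exists>N. \<forall>s\<in>S. s \<odot>\<^bsub>M\<^esub> x \<in> killed R I M N"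
    using assms(1) x(2)
  proof (induction S rule: finite_induct)
    case (insert s F)
    obtain m where m: "\<forall>s\<in>F. s \<odot>\<^bsub>M\<^esub> x \<in> killed R I M m" using insert by auto
    obtain n where n: "s \<odot>\<^bsub>M\<^esub> x \<in> killed R I M n"
      using insert.prems[of s] unfolding torsion_submodule_eq by blast
    have "\<forall>s\<in>insert s F. s \<odot>\<^bsub>M\<^esub> x \<in> killed R I M (max m n)"
      using m n killed_mono[of m "max m n"] killed_mono[of n "max m n"] by auto
    then show ?case by blast
  qed simp
  then obtain N where N: "\<And>s. s \<in> S \<Longrightarrow> s \<odot>\<^bsub>M\<^esub> x \<in> killed R I M N" by blast
  note KD = additive_subgroup.zero_closed[OF killed_subgroup] additive_subgroup.a_closed[OF killed_subgroup]
  have "ideal {a \<in> carrier R. a \<odot>\<^bsub>M\<^esub> x \<in> killed R I M N} R"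
    by (rule R.ideal_criterion) (use x(1) KD killed_smult in \<open>auto simp: smult_l_distr smult_assoc1\<close>)
  moreover have "S \<subseteq> {a \<in> carrier R. a \<odot>\<^bsub>M\<^esub> x \<in> killed R I M N}" using N S by blast
  ultimately have "I \<subseteq> {a \<in> carrier R. a \<odot>\<^bsub>M\<^esub> x \<in> killed R I M N}" by (rule gen)
  then have "x \<in> killed R I M (Suc N)" using killed_Suc[OF x(1)] by blast
  then show ?thesis unfolding torsion_submodule_eq by blast
qed

end

lemma mod_hom_killed:
  assumes N: "module R N" and f: "f \<in> mod_hom R M N" and I: "I \<subseteq> carrier R" and x: "x \<in> killed R I M n"
  shows "f x \<in> killed R I N n"
proof -
  interpret f: additive_map M N f by (rule mod_hom_additive_map[OF module_axioms N f])
  have "a \<odot>\<^bsub>N\<^esub> f x = f (a \<odot>\<^bsub>M\<^esub> x)" if "a \<in> ideal_power R I n" for a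
    using mod_homD(3)[OF f] subsetD[OF ideal_power_subset[OF I] that] x by (simp add: killed_def)
  then show ?thesis using x f.zero by (simp add: killed_def)
qed

lemma mod_hom_torsion:
  assumes "module R N" "f \<in> mod_hom R M N" "I \<subseteq> carrier R" "x \<in> torsion_submodule R I M"
  shows "f x \<in> torsion_submodule R I N"
  using mod_hom_killed[OF assms(1-3)] assms(4) unfolding torsion_submodule_eq by blast

end

section \<open>The irrelevant ideal, and vanishing in low degrees\<close>

context graded_cring begin

text \<open>The elements whose components of positive degree lie in \<open>K\<close> form a module over the ring
  generated by \<open>\<A> 0\<close> and \<open>S\<close>.\<close>

lemma irrelevant_ideal_subset:
  assumes S: "S \<subseteq> \<A> 1" "generate_ring R (\<A> 0 \<union> S) = carrier R" and K: "ideal K R" "S \<subseteq> K"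
  shows "irrelevant_ideal R \<A> \<subseteq> K"
proof -
  have Ks: "additive_subgroup K R" by (rule ideal.axioms(1)[OF K(1)])
  define W where "W = {a \<in> carrier R. \<forall>n. ds.pr (Suc n) a \<in> K}"
  interpret p: additive_map R R "ds.pr n" for n by (rule ds.pr_additive_map)
  have W: "additive_subgroup W R"
    by (rule additive_subgroupI')
      (auto simp: W_def additive_subgroup.zero_closed[OF Ks] additive_subgroup.a_closed[OF Ks]
        additive_subgroup.a_inv_closed[OF Ks])
  have Wc: "a \<in> carrier R" and WD: "ds.pr (Suc n) a \<in> K" if "a \<in> W" for a n
    using that by (simp_all add: W_def)
  have WI: "a \<in> W" if "a \<in> carrier R" "\<And>n. ds.pr (Suc n) a \<in> K" for a
    using that by (simp add: W_def)
  have "b \<in> carrier R \<and> (\<forall>a\<in>W. b \<otimes> a \<in> W)" if "b \<in> generate_ring R (\<A> 0 \<union> S)" for b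
    using that
  proof (induction b rule: generate_ring.induct)
    case one then show ?case using Wc by simp
  next
    case (incl b)
    show ?case
    proof (cases "b \<in> \<A> 0")
      case True
      have b: "b \<in> carrier R" by (rule ds.sub[OF True])
      have "b \<otimes> a \<in> W" if a: "a \<in> W" for a
      proof (rule WI)
        show "b \<otimes> a \<in> carrier R" using b Wc[OF a] by simp
        show "ds.pr (Suc n) (b \<otimes> a) \<in> K" for n
          using pr_mult(1)[OF True Wc[OF a], of "Suc n"] ideal.I_l_closed[OF K(1) WD[OF a] b] by simp
      qed
      then show ?thesis using b by blast
    next
      case False
      then have bS: "b \<in> S" using incl by simp
      then have b1: "b \<in> \<A> 1" using S(1) by blast
      have b: "b \<in> carrier R" by (rule ds.sub[OF b1])
      have "b \<otimes> a \<in> W" if a: "a \<in> W" for a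
      proof (rule WI)
        show "b \<otimes> a \<in> carrier R" using b Wc[OF a] by simp
        show "ds.pr (Suc n) (b \<otimes> a) \<in> K" for n
          using pr_mult(1)[OF b1 Wc[OF a], of n] ideal.I_r_closed[OF K(1) subsetD[OF K(2) bS] ds.pr_closed[OF Wc[OF a]]]
          by simp
      qed
      then show ?thesis using b by blast
    qed
  next
    case (a_inv b)
    then show ?case using additive_subgroup.a_inv_closed[OF W] Wc by (simp add: l_minus)
  next
    case (eng_add b c)
    then show ?case using additive_subgroup.a_closed[OF W] Wc by (simp add: l_distr)
  next
    case (eng_mult b c)
    then show ?case using Wc by (simp add: m_assoc)
  qed
  moreover have "\<one> \<in> W"
    using ds.pr_homogeneous[OF one_deg0] additive_subgroup.zero_closed[OF Ks] by (simp add: W_def)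
  ultimately have RW: "a \<in> W" if "a \<in> carrier R" for a
    using that S(2) r_one[of a] by metis
  have "(\<Oplus>n\<in>F. f n) \<in> K" if "finite F" "0 \<notin> F" "\<forall>n\<in>F. f n \<in> \<A> n" for F f
    using that
  proof (induction F rule: finite_induct)
    case empty then show ?case by (simp add: additive_subgroup.zero_closed[OF Ks])
  next
    case (insert n F)
    have fc: "f \<in> F \<rightarrow> carrier R" "f n \<in> carrier R" using insert.prems ds.sub by auto
    have "n > 0" using insert.prems(1) by (cases n) auto
    then obtain m where m: "n = Suc m" by (cases n) auto
    have "ds.pr n (f n) = f n" using ds.pr_homogeneous[of "f n" n n] insert.prems by simp
    moreover have "ds.pr n (f n) \<in> K" using RW[OF fc(2)] unfolding W_def m by blast
    ultimately have "f n \<in> K" by simp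
    then show ?case using insert fc by (simp add: additive_subgroup.a_closed[OF Ks])
  qed
  then show ?thesis unfolding irrelevant_ideal_def by blast
qed

lemma irrelevant_ideal_closed: "irrelevant_ideal R \<A> \<subseteq> carrier R"
  using ds.sub by (auto simp: irrelevant_ideal_def intro!: finsum_closed)

lemma degree_one_irrelevant: "\<A> 1 \<subseteq> irrelevant_ideal R \<A>"
proof
  fix a assume a: "a \<in> \<A> 1"
  then have "a = (\<Oplus>n\<in>{1 :: nat}. a)" using ds.sub by simp
  then show "a \<in> irrelevant_ideal R \<A>"
    using a unfolding irrelevant_ideal_def by (intro CollectI exI[of _ "{1 :: nat}"] exI[of _ "\<lambda>_. a"]) simp
qed

text \<open>Finitely many generators have finitely many nonzero components. The elements without
  components below a common bound form a submodule, because the ring has no negative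
  degrees.\<close>

lemma graded_module_bounded_below:
  assumes M: "graded_module R \<A> M \<M>" and fg: "finitely_generated_module R M"
  obtains n0 where "\<And>n. n < n0 \<Longrightarrow> \<M> n = {\<zero>\<^bsub>M\<^esub>}"
proof -
  interpret M: module R M by (rule graded_moduleD(1)[OF M])
  interpret d: direct_sum M \<M> by (rule graded_moduleD(2)[OF M])
  interpret p: additive_map M M "d.pr n" for n by (rule d.pr_additive_map)
  obtain S where S: "finite S" "S \<subseteq> carrier M" "\<Inter>{N. submodule N R M \<and> S \<subseteq> N} = carrier M"
    using fg by (auto simp: finitely_generated_module_def)
  let ?D = "\<Union>x\<in>S. {n. d.pr n x \<noteq> \<zero>\<^bsub>M\<^esub>}"
  define n0 where "n0 = Min (insert 0 ?D)"
  have "finite (insert 0 ?D)" using S d.pr_props(2) by blast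
  then have "n \<notin> ?D" if "n < n0" for n using Min_le[of "insert 0 ?D" n] that unfolding n0_def by auto
  then have n0: "d.pr n x = \<zero>\<^bsub>M\<^esub>" if "x \<in> S" "n < n0" for x n using that by blast
  define N where "N = {x \<in> carrier M. \<forall>n<n0. d.pr n x = \<zero>\<^bsub>M\<^esub>}"
  have N: "additive_subgroup N M" by (rule M.additive_subgroupI') (auto simp: N_def)
  have "a \<odot>\<^bsub>M\<^esub> x \<in> N" if a: "a \<in> carrier R" and x: "x \<in> N" for a x
  proof -
    have xc: "x \<in> carrier M" using x by (simp add: N_def)
    interpret m: additive_map R M "\<lambda>a. a \<odot>\<^bsub>M\<^esub> x"
      by unfold_locales (use xc in \<open>auto simp: M.smult_l_distr\<close>)
    have "a \<in> {a \<in> carrier R. a \<odot>\<^bsub>M\<^esub> x \<in> N}"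
    proof (rule ds.pr_mem_imp_mem[OF m.additive_subgroup_vimage[OF N] a])
      fix k
      have "d.pr n (ds.pr k a \<odot>\<^bsub>M\<^esub> x) = \<zero>\<^bsub>M\<^esub>" if "n < n0" for n
        using graded_module_pr_smult[OF gr M ds.pr_props(1)[OF a, of k] xc, of "n - int k"] x that a
        by (simp add: N_def)
      then show "ds.pr k a \<in> {a \<in> carrier R. a \<odot>\<^bsub>M\<^esub> x \<in> N}" using a xc by (simp add: N_def)
    qed
    then show ?thesis by blast
  qed
  then have "submodule N R M" by (rule submoduleI'[OF N])
  moreover have "S \<subseteq> N" using S(2) n0 by (auto simp: N_def)
  ultimately have cN: "carrier M \<subseteq> N" using S(3) by blast
  have "\<M> n = {\<zero>\<^bsub>M\<^esub>}" if n: "n < n0" for n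
  proof -
    have "x = \<zero>\<^bsub>M\<^esub>" if x: "x \<in> \<M> n" for x
      using subsetD[OF cN d.sub[OF x]] d.pr_homogeneous[OF x, of n] n by (simp add: N_def)
    then show ?thesis using additive_subgroup.zero_closed[OF d.subgroup] by blast
  qed
  then show ?thesis by (rule that)
qed

end

section \<open>Koszul acyclicity of local cohomology in low degrees\<close>

text \<open>The sequence \<open>r\<close> is total, with all values of degree one; beyond
  \<open>t\<close> it may be zero. That the first \<open>t\<close> terms generate is expressed
  through ideals containing them.\<close>

locale standard_graded = graded_cring +
  fixes r :: "nat \<Rightarrow> 'a" and t :: nat
  assumes noeth: "noetherian_ring R" and r_deg: "r i \<in> \<A> 1"
    and irrelevant_generated: "ideal K R \<Longrightarrow> r ` {..<t} \<subseteq> K \<Longrightarrow> irrelevant_ideal R \<A> \<subseteq> K"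
begin

abbreviation "Rp \<equiv> irrelevant_ideal R \<A>"

lemma r_carrier: "r i \<in> carrier R"
  by (rule ds.sub[OF r_deg])

lemma graded_koszul: "module R E \<Longrightarrow> koszul R E r"
  by (intro koszul.intro koszul_axioms.intro r_carrier)

lemma r_power_mem: "r i [^] (N :: nat) \<in> ideal_power R Rp N"
proof (induction N)
  case (Suc N)
  have "r i \<otimes> r i [^] N \<in> ideal_prod R Rp (ideal_power R Rp N)"
    by (rule ideal_prod.prod[OF _ Suc]) (use degree_one_irrelevant r_deg in blast)
  moreover have "r i \<otimes> r i [^] N = r i [^] Suc N" using r_carrier by (simp add: m_comm)
  ultimately show ?case by (simp add: ideal_power_def)
qed (simp add: ideal_power_def)

text \<open>Induction on the sum of the exponents: multiplication by \<open>r l\<close> lowers the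
  exponent of \<open>l\<close> by one, so all \<open>r l x\<close> are torsion, and then so is
  \<open>x\<close>.\<close>

lemma torsion_of_powers:
  assumes "module R E" and x: "x \<in> carrier E" and k: "\<And>l. l < t \<Longrightarrow> (r l [^] (k l :: nat)) \<odot>\<^bsub>E\<^esub> x = \<zero>\<^bsub>E\<^esub>"
  shows "x \<in> torsion_submodule R Rp E"
  using x k
proof (induction "\<Sum>l<t. k l" arbitrary: x k rule: less_induct)
  case less
  interpret E: module R E by fact
  have T: "submodule (torsion_submodule R Rp E) R E" by (rule E.torsion_submodule_submodule[OF irrelevant_ideal_closed])
  have z: "\<zero>\<^bsub>E\<^esub> \<in> torsion_submodule R Rp E"
    by (rule additive_subgroup.zero_closed[OF submodule_additive_subgroup[OF T]])
  show ?case
  proof (rule E.torsion_of_generators[OF irrelevant_ideal_closed _ irrelevant_generated less.prems(1)])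
    fix s assume "s \<in> r ` {..<t}"
    then obtain l where l: "l < t" "s = r l" by auto
    show "s \<odot>\<^bsub>E\<^esub> x \<in> torsion_submodule R Rp E"
    proof (cases "k l")
      case 0
      then have "x = \<zero>\<^bsub>E\<^esub>" using less.prems(2)[OF l(1)] less.prems(1) by simp
      then show ?thesis using z l r_carrier by simp
    next
      case (Suc m)
      have rx: "r l \<odot>\<^bsub>E\<^esub> x \<in> carrier E" using r_carrier less.prems(1) by simp
      have "(r i [^] ((k(l := m)) i)) \<odot>\<^bsub>E\<^esub> (r l \<odot>\<^bsub>E\<^esub> x) = \<zero>\<^bsub>E\<^esub>" if i: "i < t" for i
      proof (cases "i = l")
        case True
        then show ?thesis
          using less.prems(2)[OF l(1)] less.prems(1) r_carrier Suc by (simp add: E.smult_assoc1)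
      next
        case False
        then show ?thesis using less.prems(2)[OF i] less.prems(1) r_carrier
          by (simp add: E.smult_lcomm[of _ "r l"])
      qed
      moreover have "(\<Sum>i<t. (k(l := m)) i) < (\<Sum>i<t. k i)"
        by (rule sum_strict_mono_ex1) (use l Suc in auto)
      ultimately show ?thesis unfolding l(2) by (intro less.hyps[OF _ rx])
    qed
  qed (use r_carrier in auto)
qed

lemma power_torsion_eq:
  assumes E: "graded_module R \<A> E \<E>"
  shows "power_torsion R E \<E> r t n = torsion_submodule R Rp E \<inter> \<E> n"
proof (intro Set.equalityI subsetI)
  interpret E: module R E by (rule graded_moduleD(1)[OF E])
  interpret d: direct_sum E \<E> by (rule graded_moduleD(2)[OF E])
  fix x
  show "x \<in> torsion_submodule R Rp E \<inter> \<E> n" if x: "x \<in> power_torsion R E \<E> r t n"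
  proof -
    obtain k where "\<And>l. l < t \<Longrightarrow> (r l [^] (k l :: nat)) \<odot>\<^bsub>E\<^esub> x = \<zero>\<^bsub>E\<^esub>"
      using power_torsionD(2)[OF x] by metis
    from torsion_of_powers[OF E.module_axioms d.sub[OF power_torsionD(1)[OF x]] this]
    show ?thesis using power_torsionD(1)[OF x] by blast
  qed
  show "x \<in> power_torsion R E \<E> r t n" if x: "x \<in> torsion_submodule R Rp E \<inter> \<E> n"
    using x r_power_mem unfolding torsion_submodule_def power_torsion_def by blast
qed

text \<open>A power of \<open>r l\<close> is homogeneous, so if it kills \<open>x\<close> it kills
  each component of \<open>x\<close>.\<close>

lemma torsion_homogeneous:
  assumes E: "graded_module R \<A> E \<E>" and x: "x \<in> torsion_submodule R Rp E"
  shows "gproj E \<E> n x \<in> torsion_submodule R Rp E"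
proof -
  interpret E: module R E by (rule graded_moduleD(1)[OF E])
  interpret d: direct_sum E \<E> by (rule graded_moduleD(2)[OF E])
  have xc: "x \<in> carrier E" using x by (simp add: torsion_submodule_def)
  obtain N where N: "\<And>a. a \<in> ideal_power R Rp N \<Longrightarrow> a \<odot>\<^bsub>E\<^esub> x = \<zero>\<^bsub>E\<^esub>"
    using x by (auto simp: torsion_submodule_def)
  have rd: "r l [^] k \<in> \<A> k" for l and k :: nat
  proof (induction k)
    case (Suc k) then show ?case using deg_mult[OF Suc r_deg[of l]] by simp
  qed (simp add: one_deg0)
  have "(r l [^] N) \<odot>\<^bsub>E\<^esub> d.pr n x = \<zero>\<^bsub>E\<^esub>" for l
    using graded_module_pr_smult[OF gr E rd[of l N] xc, of n] N[OF r_power_mem] additive_map.zero[OF d.pr_additive_map]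
    by simp
  then show ?thesis by (intro torsion_of_powers[of E _ "\<lambda>_. N"] E.module_axioms d.pr_closed xc)
qed

end

locale graded_resolution = standard_graded R \<A> r t
  for R :: "('a, 'r) ring_scheme" (structure) and \<A> r t +
  fixes M :: "('a, 'b, 'm) module_scheme" and \<M> :: "int \<Rightarrow> 'b set"
    and E :: "nat \<Rightarrow> ('a, 'e) module" and \<E> :: "nat \<Rightarrow> int \<Rightarrow> 'e set" and \<eta> and d
  assumes M: "graded_module R \<A> M \<M>" and fg: "finitely_generated_module R M"
    and res: "graded_injective_resolution R \<A> M \<M> E \<E> \<eta> d"
begin

lemma inj: "graded_injective_module R \<A> (E q) (\<E> q)"
  by (rule graded_injective_resolutionD(1)[OF res])

lemma grE: "graded_module R \<A> (E q) (\<E> q)"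
  using inj by (simp add: graded_injective_module_def)

lemma moduleE: "module R (E q)"
  by (rule graded_moduleD(1)[OF grE])

sublocale E: koszul R "E q" r for q
  by (rule graded_koszul[OF moduleE])

sublocale dE: direct_sum "E q" "\<E> q" for q
  by (rule graded_moduleD(2)[OF grE])

lemma d_hom: "d q \<in> mod_hom R (E q) (E (Suc q))"
  by (rule graded_injective_resolutionD(5)[OF res])

sublocale d: additive_map "E q" "E (Suc q)" "d q" for q
  by (rule mod_hom_additive_map[OF moduleE moduleE d_hom])

lemma d_deg: "x \<in> \<E> q n \<Longrightarrow> d q x \<in> \<E> (Suc q) n"
  by (rule graded_injective_resolutionD(9)[OF res])

lemma d_d: "x \<in> carrier (E q) \<Longrightarrow> d (Suc q) (d q x) = \<zero>\<^bsub>E (Suc (Suc q))\<^esub>"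
  using graded_injective_resolutionD(6)[OF res, of q] by (auto simp: mod_kernel_def)

lemma d_pr: "x \<in> carrier (E q) \<Longrightarrow> d q (dE.pr q n x) = dE.pr (Suc q) n (d q x)"
  by (rule graded_hom_pr[OF grE grE graded_injective_resolutionD(8)[OF res]])

lemma d_smult: "a \<in> carrier R \<Longrightarrow> x \<in> \<E> q n \<Longrightarrow> d q (a \<odot>\<^bsub>E q\<^esub> x) = a \<odot>\<^bsub>E (Suc q)\<^esub> d q x"
  by (rule mod_homD(3)[OF d_hom _ dE.sub])

lemma rE: "x \<in> \<E> q n \<Longrightarrow> r i \<odot>\<^bsub>E q\<^esub> x \<in> \<E> q (n + 1)"
  using graded_moduleD(3)[OF grE r_deg, of x q n i] by (simp add: add.commute)

text \<open>In degree \<open>n\<close>: \<open>T\<close> is the torsion of \<open>E q\<close>,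
  \<open>Z\<close> consists of the cocycles of the resolution, \<open>G\<close> of the torsion
  cocycles, and \<open>B\<close> of the coboundaries of torsion elements. Thus G/B is the component
  of local cohomology, while the Koszul argument is run on the larger Z/B.\<close>

definition T where "T q n = power_torsion R (E q) (\<E> q) r t n"
definition Z where "Z q n = {x \<in> \<E> q n. d q x = \<zero>\<^bsub>E (Suc q)\<^esub>}"
definition G where "G q n = T q n \<inter> Z q n"
definition B where "B q n = (case q of 0 \<Rightarrow> {\<zero>\<^bsub>E 0\<^esub>} | Suc p \<Rightarrow> d p ` T p n)"

lemma T_eq: "T q n = torsion_submodule R Rp (E q) \<inter> \<E> q n"
  unfolding T_def by (rule power_torsion_eq[OF grE])

lemma torsion_sub: "submodule (torsion_submodule R Rp (E q)) R (E q)"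
  by (rule E.torsion_submodule_submodule[OF irrelevant_ideal_closed])

lemma G_eq: "G q n = torsion_cocycles R Rp E d q \<inter> \<E> q n"
  using dE.sub by (auto simp: G_def T_eq Z_def torsion_cocycles_def mod_kernel_def)

text \<open>If a homogeneous coboundary comes from a torsion element, it also comes from the
  component of its own degree, and this is again torsion.\<close>

lemma B_eq: "B q n = torsion_coboundaries R Rp E d q \<inter> \<E> q n"
proof (cases q)
  case 0
  then show ?thesis using additive_subgroup.zero_closed[OF dE.subgroup] by (auto simp: B_def torsion_coboundaries_def)
next
  case (Suc p)
  have "d p x \<in> d p ` T p n" if x: "x \<in> torsion_submodule R Rp (E p)" and dx: "d p x \<in> \<E> q n" for x
  proof -
    have xc: "x \<in> carrier (E p)" using x by (simp add: torsion_submodule_def)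
    have "d p (dE.pr p n x) = d p x" using d_pr[OF xc] dE.pr_eq_self_iff[of "d p x" "Suc p" n] dx xc Suc by simp
    moreover have "dE.pr p n x \<in> T p n"
      using torsion_homogeneous[OF grE x] dE.pr_props(1)[OF xc] by (simp add: T_eq)
    ultimately show ?thesis by (metis imageI)
  qed
  then show ?thesis using d_deg by (auto simp: Suc B_def torsion_coboundaries_def T_eq)
qed

lemma TE: "T q n \<subseteq> \<E> q n" and ZE: "Z q n \<subseteq> \<E> q n" and GT: "G q n \<subseteq> T q n" and GZ: "G q n \<subseteq> Z q n"
  by (auto simp: T_eq Z_def G_def)

lemma d_T: "x \<in> T q n \<Longrightarrow> d q x \<in> T (Suc q) n"
  using E.mod_hom_torsion[OF moduleE d_hom irrelevant_ideal_closed] d_deg by (simp add: T_eq)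

lemma BG: "B q n \<subseteq> G q n"
proof (cases q)
  case 0
  then show ?thesis using additive_subgroup.zero_closed[OF dE.subgroup]
      additive_subgroup.zero_closed[OF submodule_additive_subgroup[OF torsion_sub]]
    by (simp add: B_def G_def T_eq Z_def)
next
  case (Suc p)
  have "d p y \<in> G q n" if y: "y \<in> T p n" for y
  proof -
    have yE: "y \<in> \<E> p n" using y TE by blast
    then show ?thesis using d_T[OF y] d_deg[OF yE] d_d[OF dE.sub[OF yE]] unfolding Suc G_def Z_def by simp
  qed
  then show ?thesis unfolding B_def Suc by auto
qed

lemma smult_deg0: "a \<in> \<A> 0 \<Longrightarrow> x \<in> \<E> q n \<Longrightarrow> a \<odot>\<^bsub>E q\<^esub> x \<in> \<E> q n"
  using graded_moduleD(3)[OF grE, of a 0 x q n] by simp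

lemma stable_E: "stable_subgroup (E q) (\<A> 0) (\<E> q n)"
  using smult_deg0 dE.subgroup by (simp add: stable_subgroup_def)

lemma stable_T: "stable_subgroup (E q) (\<A> 0) (T q n)"
proof -
  interpret T: submodule "torsion_submodule R Rp (E q)" R "E q" by (rule torsion_sub)
  have "additive_subgroup (T q n) (E q)" unfolding T_def by (rule E.power_torsion_subgroup[OF r_carrier dE.subgroup])
  then show ?thesis using T.smult_closed ds.sub smult_deg0 by (auto simp: stable_subgroup_def T_eq)
qed

lemma stable_Z: "stable_subgroup (E q) (\<A> 0) (Z q n)"
proof (rule E.stable_subgroupI)
  show "a \<odot>\<^bsub>E q\<^esub> x \<in> Z q n" if "a \<in> \<A> 0" "x \<in> Z q n" for a x
    using that smult_deg0[of a x q n] d_smult[OF ds.sub[OF that(1)], of x q n] ds.sub[OF that(1)] by (simp add: Z_def)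
qed (use E.stable_subgroup_closed[OF stable_E] in \<open>auto simp: Z_def dE.sub\<close>)

lemma stable_G: "stable_subgroup (E q) (\<A> 0) (G q n)"
  unfolding G_def
proof (rule E.stable_subgroupI)
  show "a \<odot>\<^bsub>E q\<^esub> x \<in> T q n \<inter> Z q n" if "a \<in> \<A> 0" "x \<in> T q n \<inter> Z q n" for a x
    using that stable_subgroupD(2)[OF stable_T that(1)] stable_subgroupD(2)[OF stable_Z that(1)] by blast
qed (auto simp: E.stable_subgroup_closed[OF stable_T] E.stable_subgroup_closed[OF stable_Z])

lemma stable_B: "stable_subgroup (E q) (\<A> 0) (B q n)"
proof (cases q)
  case 0
  then show ?thesis using ds.sub by (intro E.stable_subgroupI) (auto simp: B_def)
next
  case (Suc p)
  have "additive_subgroup (d p ` T p n) (E q)"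
    unfolding Suc by (rule d.additive_subgroup_image[OF stable_subgroupD(1)[OF stable_T]])
  moreover have "a \<odot>\<^bsub>E q\<^esub> d p x \<in> d p ` T p n" if "a \<in> \<A> 0" "x \<in> T p n" for a x
    using d_smult[OF ds.sub[OF that(1)] subsetD[OF TE that(2)]] stable_subgroupD(2)[OF stable_T that]
    unfolding Suc by (metis imageI)
  ultimately show ?thesis by (auto simp: stable_subgroup_def B_def Suc)
qed

lemma fam_E: "graded_family (E q) r t (\<E> q)"
  using rE dE.subgroup by (simp add: graded_family_def)

lemma fam_T: "graded_family (E q) r t (T q)"
proof -
  interpret T: submodule "torsion_submodule R Rp (E q)" R "E q" by (rule torsion_sub)
  show ?thesis unfolding graded_family_def
    using stable_subgroupD(1)[OF stable_T] rE T.smult_closed r_carrier by (auto simp: T_eq)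
qed

lemma fam_Z: "graded_family (E q) r t (Z q)"
  unfolding graded_family_def
  using stable_subgroupD(1)[OF stable_Z] rE d_smult[OF r_carrier] r_carrier unfolding Z_def by auto

lemma fam_G: "graded_family (E q) r t (G q)"
  unfolding graded_family_def
  using stable_subgroupD(1)[OF stable_G] graded_familyD(2)[OF fam_T] graded_familyD(2)[OF fam_Z] by (auto simp: G_def)

lemma fam_B: "graded_family (E q) r t (B q)"
  unfolding graded_family_def
proof (intro conjI allI ballI impI)
  show "additive_subgroup (B q n) (E q)" for n by (rule stable_subgroupD(1)[OF stable_B])
  fix i n x assume i: "i < t" and x: "x \<in> B q n"
  show "r i \<odot>\<^bsub>E q\<^esub> x \<in> B q (n + 1)"
  proof (cases q)
    case 0
    then show ?thesis using x r_carrier by (simp add: B_def)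
  next
    case (Suc p)
    then obtain y where y: "y \<in> T p n" "x = d p y" using x by (auto simp: B_def)
    have "r i \<odot>\<^bsub>E q\<^esub> x = d p (r i \<odot>\<^bsub>E p\<^esub> y)"
      unfolding Suc y(2) by (rule d_smult[OF r_carrier subsetD[OF TE y(1)], symmetric])
    then show ?thesis using graded_familyD(2)[OF fam_T i y(1)] by (simp add: Suc B_def)
  qed
qed

lemma koszul_acyclic_torsion: "koszul_acyclic (E q) r t (T q) (\<E> q) n"
  using koszul_acyclic_power_torsion[OF noeth inj r_deg order_refl] by (simp add: T_def[abs_def])

text \<open>Chain conditions are asked only below \<open>q\<close>, which is why the case where
  \<open>q\<close> equals the finite length dimension is included. The statement is about Z/B
  because this quotient is handed on by the differential; its subquotient G/B inherits the absence
  of a socle and so becomes artinian in low degrees.\<close>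

theorem koszul_acyclic_coboundaries:
  assumes "\<And>p. p < q \<Longrightarrow> \<exists>n0. \<forall>n\<le>n0. dcc (E p) (\<A> 0) (B p n) (G p n)"
  shows "\<exists>n0. \<forall>n\<le>n0. koszul_acyclic (E q) r t (B q) (Z q) n"
  using assms
proof (induction q)
  case 0
  interpret M: direct_sum M \<M> by (rule graded_moduleD(2)[OF M])
  obtain n0 where n0: "\<And>n. n < n0 \<Longrightarrow> \<M> n = {\<zero>\<^bsub>M\<^esub>}"
    using graded_module_bounded_below[OF M fg] by blast
  note \<eta> = graded_injective_resolutionD(2)[OF res]
  have \<eta>g: "\<eta> \<in> graded_hom R M \<M> (E 0) (\<E> 0)"
    using \<eta> graded_injective_resolutionD(7)[OF res] by (auto simp: graded_hom_def)
  interpret \<eta>: additive_map M "E 0" \<eta> by (rule mod_hom_additive_map[OF graded_moduleD(1)[OF M] moduleE \<eta>])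
  have Z0: "Z 0 n \<subseteq> B 0 n" if n: "n < n0" for n
  proof
    fix z assume z: "z \<in> Z 0 n"
    then have zE: "z \<in> \<E> 0 n" and "z \<in> mod_kernel (E 0) (E 1) (d 0)"
      using dE.sub by (auto simp: Z_def mod_kernel_def)
    then obtain x where x: "x \<in> carrier M" "z = \<eta> x" using graded_injective_resolutionD(4)[OF res] by blast
    have "z = dE.pr 0 n z" using dE.pr_eq_self_iff[of z 0 n] zE dE.sub[OF zE] by simp
    also have "\<dots> = \<eta> (M.pr n x)" using graded_hom_pr[OF M grE \<eta>g x(1), of n] x(2) by simp
    also have "M.pr n x = \<zero>\<^bsub>M\<^esub>" using M.pr_props(1)[OF x(1), of n] n0[OF n] by simp
    finally show "z \<in> B 0 n" by (simp add: B_def)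
  qed
  \<comment> \<open>The strand \<open>n\<close> involves degrees up to \<open>n + t\<close>, all of
    which must lie below \<open>n0\<close>.\<close>
  have "koszul_acyclic (E 0) r t (B 0) (Z 0) n" if n: "n < n0 - int t" for n
  proof -
    have "cochain_part (E 0) t (Z 0) n S = cochain_part (E 0) t (B 0) n S" for S
    proof (cases "S \<subseteq> {..<t}")
      case True
      have "card S \<le> t" using card_mono[OF _ True] by simp
      then have "Z 0 (n + int (card S)) = B 0 (n + int (card S))"
        using Z0[of "n + int (card S)"] BG[of 0 "n + int (card S)"] GZ[of 0 "n + int (card S)"] n by auto
      then show ?thesis by (simp add: cochain_part_def)
    qed (simp add: cochain_part_def)
    then have "cochains (E 0) t (Z 0) n = cochains (E 0) t (B 0) n" by (simp add: cochains_def)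
    then show ?thesis using E.koszul_acyclic_refl[OF fam_B, of 0 n] by (simp add: koszul_acyclic_def)
  qed
  then show ?case by (intro exI[of _ "n0 - int t - 1"]) simp
next
  case (Suc q)
  obtain n1 where n1: "\<And>n. n \<le> n1 \<Longrightarrow> koszul_acyclic (E q) r t (B q) (Z q) n"
    using Suc.IH Suc.prems by (metis less_Suc_eq)
  obtain n2 where n2: "\<And>n. n \<le> n2 \<Longrightarrow> dcc (E q) (\<A> 0) (B q n) (G q n)" using Suc.prems by blast
  have "\<exists>n3. \<forall>n\<le>n3. koszul_acyclic (E q) r t (B q) (G q) n"
  proof (rule E.koszul_acyclic_artinian[OF fam_B fam_G BG _ stable_B stable_G])
    show "\<A> 0 \<subseteq> carrier R" using ds.sub by blast
    fix n assume n: "n \<le> min n1 n2"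
    show "dcc (E q) (\<A> 0) (B q n) (G q n)" by (rule n2) (use n in simp)
    have *: "koszul_acyclic (E q) r t (B q) (Z q) n" by (rule n1) (use n in simp)
    show "x \<in> B q n" if "x \<in> G q n" "\<And>i. i < t \<Longrightarrow> r i \<odot>\<^bsub>E q\<^esub> x \<in> B q (n + 1)" for x
      by (rule E.koszul_acyclic_socle[OF fam_B fam_Z * subsetD[OF GZ that(1)] that(2)])
  qed
  then obtain n3 where n3: "\<And>n. n \<le> n3 \<Longrightarrow> koszul_acyclic (E q) r t (B q) (G q) n" by blast
  define TZ where "TZ n = {x \<in> \<E> q n. d q x \<in> B (Suc q) n}" for n
  have TZ_sum: "\<exists>a\<in>T q n. \<exists>b\<in>Z q n. x = a \<oplus>\<^bsub>E q\<^esub> b" if x: "x \<in> TZ n" for x n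
  proof -
    obtain a where a: "a \<in> T q n" "d q x = d q a" and xE: "x \<in> \<E> q n" using x by (auto simp: TZ_def B_def)
    have c: "a \<in> carrier (E q)" "x \<in> carrier (E q)" using a(1) TE xE dE.sub by blast+
    have "x \<ominus>\<^bsub>E q\<^esub> a \<in> Z q n"
      using E.stable_subgroup_closed(5)[OF stable_E xE] a TE c by (auto simp: Z_def E.minus_eq E.r_neg)
    moreover have "x = a \<oplus>\<^bsub>E q\<^esub> (x \<ominus>\<^bsub>E q\<^esub> a)" using E.minus_add_cancel(2)[OF c(2,1)] by simp
    ultimately show ?thesis using a(1) by blast
  qed
  have TTZ: "T q n \<subseteq> TZ n" for n using TE by (auto simp: TZ_def B_def)
  have ZTZ: "Z q n \<subseteq> TZ n" for n
    using E.stable_subgroup_closed(1)[OF stable_B, of "Suc q"] by (auto simp: TZ_def Z_def)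
  have TZE: "TZ n \<subseteq> \<E> q n" for n by (auto simp: TZ_def)
  have fam_TZ: "graded_family (E q) r t TZ"
    unfolding graded_family_def
  proof (intro conjI allI ballI impI)
    show "additive_subgroup (TZ n) (E q)" for n
      by (rule E.additive_subgroupI')
        (auto simp: TZ_def dE.sub E.stable_subgroup_closed[OF stable_E] E.stable_subgroup_closed[OF stable_B])
    fix i n x assume i: "i < t" and x: "x \<in> TZ n"
    then show "r i \<odot>\<^bsub>E q\<^esub> x \<in> TZ (n + 1)"
      using rE graded_familyD(2)[OF fam_B i] mod_homD(3)[OF d_hom r_carrier] dE.sub by (auto simp: TZ_def)
  qed
  have Zd: "Z (Suc q) n = d q ` \<E> q n" for n
  proof (intro Set.equalityI subsetI)
    fix z assume z: "z \<in> Z (Suc q) n"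
    then have zE: "z \<in> \<E> (Suc q) n" and "z \<in> mod_kernel (E (Suc q)) (E (Suc (Suc q))) (d (Suc q))"
      using dE.sub by (auto simp: Z_def mod_kernel_def)
    then obtain e where e: "e \<in> carrier (E q)" "z = d q e"
      using graded_injective_resolutionD(6)[OF res, of q] by blast
    have "z = d q (dE.pr q n e)" using d_pr[OF e(1)] dE.pr_eq_self_iff[of z "Suc q" n] zE dE.sub[OF zE] e by simp
    then show "z \<in> d q ` \<E> q n" using dE.pr_props(1)[OF e(1)] by blast
  qed (use d_deg d_d dE.sub in \<open>auto simp: Z_def\<close>)
  \<comment> \<open>In turn: Z/G is exact since G/B and Z/B are; \<open>TZ\<close> is the sum of
    \<open>T\<close> and \<open>Z\<close>, so TZ/T is a copy of Z/G; from E/T the complex of E/TZ is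
    obtained; and \<open>d q\<close> identifies E/TZ with the next Z/B.\<close>
  have "koszul_acyclic (E (Suc q)) r t (B (Suc q)) (Z (Suc q)) n" if n: "n \<le> min n1 n3" for n
  proof -
    have 1: "koszul_acyclic (E q) r t (G q) (Z q) n"
      by (rule E.koszul_acyclic_quotient[OF fam_B fam_G fam_Z BG GZ n3 n1]) (use n in auto)
    have 2: "koszul_acyclic (E q) r t (T q) TZ n"
      by (rule E.koszul_acyclic_sum[OF fam_T fam_Z fam_TZ TTZ ZTZ TZ_sum]) (use 1 in \<open>simp_all add: G_def[abs_def]\<close>)
    have 3: "koszul_acyclic (E q) r t TZ (\<E> q) n"
      by (rule E.koszul_acyclic_quotient[OF fam_T fam_TZ fam_E TTZ TZE 2 koszul_acyclic_torsion])
    show ?thesis by (rule E.koszul_acyclic_map[OF moduleE d_hom fam_E _ Zd 3]) (simp add: TZ_def)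
  qed
  then show ?case by blast
qed

end

section \<open>Graded components of local cohomology\<close>

text \<open>The map \<open>\<kappa>\<close> exhibits \<open>L\<close> as \<open>G/B\<close>, where only the subring \<open>S\<close> of \<open>R\<close> acts.\<close>

locale presentation = E: module R E + L: module S L
  for R :: "('a, 'r) ring_scheme" and E :: "('a, 'e, 'm) module_scheme"
    and S :: "('a, 's) ring_scheme" and L :: "('a, 'l, 'n) module_scheme" +
  fixes G B :: "'e set" and \<kappa> :: "'e \<Rightarrow> 'l"
  assumes S_sub: "carrier S \<subseteq> carrier R"
    and stG: "stable_subgroup E (carrier S) G" and stB: "stable_subgroup E (carrier S) B" and BG: "B \<subseteq> G"
    and surj: "\<kappa> ` G = carrier L"
    and add: "x \<in> G \<Longrightarrow> y \<in> G \<Longrightarrow> \<kappa> (x \<oplus>\<^bsub>E\<^esub> y) = \<kappa> x \<oplus>\<^bsub>L\<^esub> \<kappa> y"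
    and smult: "a \<in> carrier S \<Longrightarrow> x \<in> G \<Longrightarrow> \<kappa> (a \<odot>\<^bsub>E\<^esub> x) = a \<odot>\<^bsub>L\<^esub> \<kappa> x"
    and zero_iff: "x \<in> G \<Longrightarrow> \<kappa> x = \<zero>\<^bsub>L\<^esub> \<longleftrightarrow> x \<in> B"
begin

lemmas GD = E.stable_subgroup_closed[OF stG] and BD = E.stable_subgroup_closed[OF stB]

lemma closed: "x \<in> G \<Longrightarrow> \<kappa> x \<in> carrier L"
  using surj by blast

lemma eq_iff:
  assumes "x \<in> G" "y \<in> G"
  shows "\<kappa> x = \<kappa> y \<longleftrightarrow> x \<ominus>\<^bsub>E\<^esub> y \<in> B"
proof -
  have c: "x \<in> carrier E" "y \<in> carrier E" using assms GD(2) by auto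
  have xy: "x \<ominus>\<^bsub>E\<^esub> y \<in> G" by (rule GD(5)[OF assms])
  have "\<kappa> x = \<kappa> (x \<ominus>\<^bsub>E\<^esub> y) \<oplus>\<^bsub>L\<^esub> \<kappa> y" using add[OF xy assms(2)] E.minus_add_cancel(1)[OF c] by simp
  then have "\<kappa> x = \<kappa> y \<longleftrightarrow> \<kappa> (x \<ominus>\<^bsub>E\<^esub> y) = \<zero>\<^bsub>L\<^esub>"
    using L.add.r_cancel_one'[OF closed[OF assms(2)] closed[OF xy]] by auto
  then show ?thesis using zero_iff[OF xy] by simp
qed

lemma submodule_image:
  assumes Y: "stable_subgroup E (carrier S) Y" and YG: "Y \<subseteq> G"
  shows "submodule (\<kappa> ` Y) S L"
proof (rule submoduleI')
  note YD = E.stable_subgroup_closed[OF Y]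
  have YG': "x \<in> G" if "x \<in> Y" for x using YG that by blast
  have z: "\<kappa> \<zero>\<^bsub>E\<^esub> = \<zero>\<^bsub>L\<^esub>" using zero_iff[OF GD(1)] BD(1) by simp
  show "additive_subgroup (\<kappa> ` Y) L"
  proof (rule L.additive_subgroupI')
    show "\<kappa> ` Y \<subseteq> carrier L" using YG' closed by blast
    show "\<zero>\<^bsub>L\<^esub> \<in> \<kappa> ` Y" using z YD(1) by (metis imageI)
    fix u assume "u \<in> \<kappa> ` Y"
    then obtain x where x: "x \<in> Y" "u = \<kappa> x" by blast
    have "\<kappa> (\<ominus>\<^bsub>E\<^esub> x) \<oplus>\<^bsub>L\<^esub> \<kappa> x = \<zero>\<^bsub>L\<^esub>"
      using add[OF YG'[OF YD(4)[OF x(1)]] YG'[OF x(1)]] z YD(2)[OF x(1)] by (simp add: E.l_neg)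
    then have "\<ominus>\<^bsub>L\<^esub> u = \<kappa> (\<ominus>\<^bsub>E\<^esub> x)"
      using L.minus_equality closed[OF YG'[OF x(1)]] closed[OF YG'[OF YD(4)[OF x(1)]]] x(2) by simp
    then show "\<ominus>\<^bsub>L\<^esub> u \<in> \<kappa> ` Y" using YD(4)[OF x(1)] by simp
    show "u \<oplus>\<^bsub>L\<^esub> v \<in> \<kappa> ` Y" if v: "v \<in> \<kappa> ` Y" for v
    proof -
      obtain y where y: "y \<in> Y" "v = \<kappa> y" using v by blast
      then show ?thesis using add[OF YG'[OF x(1)] YG'[OF y(1)]] YD(3)[OF x(1) y(1)] x(2) by (metis imageI)
    qed
  qed
  show "a \<odot>\<^bsub>L\<^esub> u \<in> \<kappa> ` Y" if "a \<in> carrier S" "u \<in> \<kappa> ` Y" for a u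
    using that smult YG' stable_subgroupD(2)[OF Y that(1)] by force
qed

text \<open>A chain that never becomes stationary has a strictly decreasing subsequence. Its images
  in \<open>L\<close> stay distinct because all members contain \<open>B\<close>, and the first
  terms, read backwards, are ascending chains of any length.\<close>

lemma finite_length_dcc:
  assumes "module_length S L < \<infinity>"
  shows "dcc E (carrier S) B G"
  unfolding dcc_def
proof (intro allI impI)
  fix Y :: "nat \<Rightarrow> 'e set"
  assume "\<forall>s. stable_subgroup E (carrier S) (Y s) \<and> B \<subseteq> Y s \<and> Y s \<subseteq> G \<and> Y (Suc s) \<subseteq> Y s"
  then have Y: "\<And>s. stable_subgroup E (carrier S) (Y s)" "\<And>s. B \<subseteq> Y s" "\<And>s. Y s \<subseteq> G" "\<And>s. Y (Suc s) \<subseteq> Y s"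
    by auto
  have dec: "Y s' \<subseteq> Y s" if "s \<le> s'" for s s' using lift_Suc_antimono_le[of Y, OF Y(4) that] .
  show "\<exists>s0. \<forall>s\<ge>s0. Y s = Y s0"
  proof (rule ccontr)
    assume "\<not> ?thesis"
    then have "\<forall>s. \<exists>s'. Y s' \<subset> Y s" using dec by (meson psubsetI)
    then obtain g where g: "\<And>s. Y (g s) \<subset> Y s" by metis
    define h where "h i = Y ((g ^^ i) 0)" for i
    have h: "h (Suc i) \<subset> h i" for i using g by (simp add: h_def)
    have "\<kappa> ` h (Suc i) \<subset> \<kappa> ` h i" for i
    proof
      show "\<kappa> ` h (Suc i) \<subseteq> \<kappa> ` h i" using h[of i] by (intro image_mono) blast
      obtain z where z: "z \<in> h i" "z \<notin> h (Suc i)" using h[of i] by blast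
      have zG: "z \<in> G" using z(1) Y(3) unfolding h_def by blast
      have "\<kappa> z \<noteq> \<kappa> w" if w: "w \<in> h (Suc i)" for w
      proof
        assume eq: "\<kappa> z = \<kappa> w"
        have wG: "w \<in> G" using w Y(3) unfolding h_def by blast
        have "z \<ominus>\<^bsub>E\<^esub> w \<in> B" using eq_iff[OF zG wG] eq by blast
        then have "z \<ominus>\<^bsub>E\<^esub> w \<in> h (Suc i)" using Y(2) unfolding h_def by blast
        then have "z \<in> h (Suc i)"
          unfolding h_def by (rule E.mem_of_minus_mem[OF stable_subgroupD(1)[OF Y(1)] GD(2)[OF zG] w[unfolded h_def]])
        then show False using z(2) by simp
      qed
      then have "\<kappa> z \<notin> \<kappa> ` h (Suc i)" by blast
      then show "\<kappa> ` h (Suc i) \<noteq> \<kappa> ` h i" using z(1) by blast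
    qed
    then have strict: "\<kappa> ` h (n - i) \<subset> \<kappa> ` h (n - Suc i)" if "i < n" for i n
      using that by (metis Suc_diff_Suc)
    have sub: "submodule (\<kappa> ` h i) S L" for i unfolding h_def by (rule submodule_image[OF Y(1,3)])
    have "enat n \<le> module_length S L" for n
      unfolding module_length_def
    proof (rule Sup_upper, rule CollectI, intro exI conjI allI impI)
      show "enat n = enat n" ..
      show "submodule (\<kappa> ` h (n - i)) S L" for i by (rule sub)
      show "\<kappa> ` h (n - i) \<subset> \<kappa> ` h (n - Suc i)" if "i < n" for i by (rule strict[OF that])
    qed
    moreover obtain m where "module_length S L = enat m" using assms by auto
    ultimately have "Suc m \<le> m" by (metis enat_ord_simps(1))
    then show False by simp
  qed
qed

end

section \<open>Cohomology of the torsion complex\<close>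

lemma coset_carrier_update: "N +>\<^bsub>M\<lparr>carrier := S\<rparr>\<^esub> x = N +>\<^bsub>M\<^esub> x"
  by (simp add: a_r_coset_def')

lemma additive_subgroup_restrict:
  assumes M: "abelian_group M" and S: "abelian_group (M\<lparr>carrier := S\<rparr>)" "S \<subseteq> carrier M"
    and N: "additive_subgroup N M" "N \<subseteq> S"
  shows "additive_subgroup N (M\<lparr>carrier := S\<rparr>)"
proof -
  interpret M: abelian_group M by fact
  interpret S: abelian_group "M\<lparr>carrier := S\<rparr>" by fact
  interpret N: additive_subgroup N M by fact
  show ?thesis
  proof (rule S.additive_subgroupI')
    show "\<ominus>\<^bsub>M\<lparr>carrier := S\<rparr>\<^esub> x \<in> N" if x: "x \<in> N" for x
    proof -
      have "\<ominus>\<^bsub>M\<lparr>carrier := S\<rparr>\<^esub> x = \<ominus>\<^bsub>M\<^esub> x"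
        by (rule S.minus_equality) (use x N(2) N.a_Hcarr N.a_inv_closed in \<open>auto simp: M.l_neg\<close>)
      then show ?thesis using N.a_inv_closed[OF x] by simp
    qed
  qed (use N in auto)
qed

lemma torsion_coboundaries_submodule:
  fixes R :: "('a, 'r) ring_scheme" and E :: "nat \<Rightarrow> ('a, 'e) module" and d :: "nat \<Rightarrow> 'e \<Rightarrow> 'e"
  assumes E: "\<And>q. module R (E q)" and d: "\<And>q. d q \<in> mod_hom R (E q) (E (Suc q))"
    and dd: "\<And>q x. x \<in> carrier (E q) \<Longrightarrow> d (Suc q) (d q x) = \<zero>\<^bsub>E (Suc (Suc q))\<^esub>" and I: "I \<subseteq> carrier R"
  shows "module R ((E q)\<lparr>carrier := torsion_cocycles R I E d q\<rparr>)"
    and "submodule (torsion_coboundaries R I E d q) R ((E q)\<lparr>carrier := torsion_cocycles R I E d q\<rparr>)"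
proof -
  let ?C = "torsion_cocycles R I E d q" and ?N = "torsion_coboundaries R I E d q"
  let ?M = "(E q)\<lparr>carrier := ?C\<rparr>"
  interpret E: module R "E p" for p by (rule E)
  interpret d: additive_map "E p" "E (Suc p)" "d p" for p by (rule mod_hom_additive_map[OF E E d])
  interpret T: submodule "torsion_submodule R I (E p)" R "E p" for p by (rule E.torsion_submodule_submodule[OF I])
  have TC: "x \<in> carrier (E p)" if "x \<in> torsion_submodule R I (E p)" for x p using that by (simp add: torsion_submodule_def)
  have Ts: "additive_subgroup (torsion_submodule R I (E p)) (E p)" for p
    by (rule submodule_additive_subgroup[OF E.torsion_submodule_submodule[OF I]])
  note TD = additive_subgroup.zero_closed[OF Ts] additive_subgroup.a_closed[OF Ts] additive_subgroup.a_inv_closed[OF Ts]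
  have C: "additive_subgroup ?C (E q)"
    by (rule E.additive_subgroupI') (auto simp: torsion_cocycles_def mod_kernel_def TD)
  have Cs: "a \<odot>\<^bsub>E q\<^esub> x \<in> ?C" if "a \<in> carrier R" "x \<in> ?C" for a x
    using that T.smult_closed mod_homD(3)[OF d, of a x q] by (auto simp: torsion_cocycles_def mod_kernel_def)
  show M: "module R ?M"
    by (rule module_restrict[OF E E.R.is_cring subset_refl]) (use C Cs in auto)
  interpret M: module R ?M by (rule M)
  have N: "additive_subgroup ?N (E q)" "?N \<subseteq> ?C" "\<And>a x. a \<in> carrier R \<Longrightarrow> x \<in> ?N \<Longrightarrow> a \<odot>\<^bsub>E q\<^esub> x \<in> ?N"
  proof -
    have "additive_subgroup ?N (E q) \<and> ?N \<subseteq> ?C \<and> (\<forall>a\<in>carrier R. \<forall>x\<in>?N. a \<odot>\<^bsub>E q\<^esub> x \<in> ?N)"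
    proof (cases q)
      case 0
      have "additive_subgroup {\<zero>\<^bsub>E 0\<^esub>} (E 0)" by (rule E.additive_subgroupI') auto
      then show ?thesis using additive_subgroup.zero_closed[OF C]
        unfolding 0 by (simp add: torsion_coboundaries_def)
    next
      case (Suc p)
      have N: "?N = d p ` torsion_submodule R I (E p)" by (simp add: Suc torsion_coboundaries_def)
      have "d p x \<in> ?C" if "x \<in> torsion_submodule R I (E p)" for x
        using E.mod_hom_torsion[OF E d I that] dd[OF TC[OF that]] TC[OF that]
        unfolding Suc by (simp add: torsion_cocycles_def mod_kernel_def)
      moreover have "a \<odot>\<^bsub>E q\<^esub> d p x \<in> d p ` torsion_submodule R I (E p)"
        if "a \<in> carrier R" "x \<in> torsion_submodule R I (E p)" for a x
        using mod_homD(3)[OF d that(1) TC[OF that(2)]] T.smult_closed[OF that] unfolding Suc by (metis imageI)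
      ultimately show ?thesis unfolding N using d.additive_subgroup_image[OF Ts, of p] Suc by blast
    qed
    then show "additive_subgroup ?N (E q)" "?N \<subseteq> ?C"
      "\<And>a x. a \<in> carrier R \<Longrightarrow> x \<in> ?N \<Longrightarrow> a \<odot>\<^bsub>E q\<^esub> x \<in> ?N" by blast+
  qed
  have "additive_subgroup ?N ?M"
    by (rule additive_subgroup_restrict[OF E.abelian_group_axioms M.abelian_group_axioms _ N(1,2)])
      (auto simp: torsion_cocycles_def mod_kernel_def)
  then show "submodule ?N R ?M" by (rule submoduleI') (use N(3) in simp)
qed

context graded_resolution begin

abbreviation "R0 \<equiv> degree_zero_ring R \<A>"

definition component where
  "component q n = (torsion_cohomology R Rp E d q)
    \<lparr>carrier := (\<lambda>z. torsion_coboundaries R Rp E d q +>\<^bsub>E q\<^esub> z) ` G q n\<rparr>"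

text \<open>Cosets are taken modulo all coboundaries, yet a class of degree \<open>n\<close>
  vanishes only if its representative is in \<open>B q n\<close>; this is where \<open>B_eq\<close>
  is used.\<close>

lemma component_presentation:
  assumes R0: "cring R0"
  shows "presentation R (E q) R0 (component q n) (G q n) (B q n) (\<lambda>z. torsion_coboundaries R Rp E d q +>\<^bsub>E q\<^esub> z)"
proof -
  let ?C = "torsion_cocycles R Rp E d q" and ?N = "torsion_coboundaries R Rp E d q"
  let ?M = "(E q)\<lparr>carrier := ?C\<rparr>"
  let ?Q = "quotient_module ?M ?N"
  note sub = torsion_coboundaries_submodule[of R E d Rp q, OF moduleE d_hom d_d irrelevant_ideal_closed]
  interpret M: module R ?M by (rule sub(1))
  note NM = sub(2)
  have Q: "module R ?Q" by (rule M.quotient_is_module[OF NM])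
  have GC: "z \<in> ?C" if "z \<in> G q n" for z using that by (simp add: G_eq)
  let ?k = "\<lambda>z. ?N +>\<^bsub>E q\<^esub> z"
  have sel: "carrier (component q n) = ?k ` G q n" "x \<oplus>\<^bsub>component q n\<^esub> y = x \<oplus>\<^bsub>?Q\<^esub> y"
    "a \<odot>\<^bsub>component q n\<^esub> x = a \<odot>\<^bsub>?Q\<^esub> x" "\<zero>\<^bsub>component q n\<^esub> = \<zero>\<^bsub>?Q\<^esub>" for x y a
    by (simp_all add: component_def torsion_cohomology_def)
  have add: "?k x \<oplus>\<^bsub>?Q\<^esub> ?k y = ?k (x \<oplus>\<^bsub>E q\<^esub> y)" if "x \<in> G q n" "y \<in> G q n" for x y
    using M.quotient_module_add[OF NM, of x y] that GC by (simp add: coset_carrier_update)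
  have smult: "a \<odot>\<^bsub>?Q\<^esub> ?k x = ?k (a \<odot>\<^bsub>E q\<^esub> x)" if "a \<in> carrier R" "x \<in> G q n" for a x
    using M.quotient_module_smult[OF NM, of a x] that GC by (simp add: coset_carrier_update)
  have zero: "?k x = \<zero>\<^bsub>?Q\<^esub> \<longleftrightarrow> x \<in> B q n" if "x \<in> G q n" for x
    using M.quotient_module_zero_iff[OF NM, of x] that GC by (simp add: coset_carrier_update B_eq G_eq)
  have kG: "?k z \<in> carrier ?Q" if "z \<in> G q n" for z
    using GC[OF that] by (auto simp: quotient_module_sel coset_carrier_update)
  note GD = E.stable_subgroup_closed[OF stable_G]
  interpret Q: module R ?Q by (rule Q)
  have R0s: "carrier R0 = \<A> 0" by (simp add: degree_zero_ring_def)
  have "additive_subgroup (?k ` G q n) ?Q"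
  proof (rule Q.additive_subgroupI')
    show "?k ` G q n \<subseteq> carrier ?Q" using kG by blast
    show "\<zero>\<^bsub>?Q\<^esub> \<in> ?k ` G q n" using zero[OF GD(1)] E.stable_subgroup_closed(1)[OF stable_B] GD(1) by (metis imageI)
    show "x \<oplus>\<^bsub>?Q\<^esub> y \<in> ?k ` G q n" if "x \<in> ?k ` G q n" "y \<in> ?k ` G q n" for x y
      using that GD(3) add by auto
    show "\<ominus>\<^bsub>?Q\<^esub> x \<in> ?k ` G q n" if x: "x \<in> ?k ` G q n" for x
    proof -
      obtain z where z: "z \<in> G q n" "x = ?k z" using x by blast
      have "?k (\<ominus>\<^bsub>E q\<^esub> z) \<oplus>\<^bsub>?Q\<^esub> ?k z = \<zero>\<^bsub>?Q\<^esub>"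
        using add[OF GD(4)[OF z(1)] z(1)] zero[OF GD(1)] E.stable_subgroup_closed(1)[OF stable_B] GD(2)[OF z(1)]
        by (simp add: E.l_neg)
      then have "\<ominus>\<^bsub>?Q\<^esub> x = ?k (\<ominus>\<^bsub>E q\<^esub> z)"
        unfolding z(2) by (rule Q.minus_equality) (use kG GD(4) z(1) in auto)
      then show ?thesis using GD(4)[OF z(1)] by simp
    qed
  qed
  note S = this
  have L: "module R0 (component q n)"
    unfolding component_def torsion_cohomology_def
  proof (rule module_restrict[OF Q R0 _ _ _ _ S])
    show "a \<odot>\<^bsub>?Q\<^esub> x \<in> ?k ` G q n" if a: "a \<in> carrier R0" and x: "x \<in> ?k ` G q n" for a x
    proof -
      obtain z where z: "z \<in> G q n" "x = ?k z" using x by blast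
      have "a \<in> \<A> 0" using a by (simp add: R0s)
      then show ?thesis
        using smult[OF ds.sub z(1)] stable_subgroupD(2)[OF stable_G _ z(1)] unfolding z(2) by (metis imageI)
    qed
  qed (auto simp: degree_zero_ring_def ds.sub)
  show ?thesis
  proof (intro presentation.intro presentation_axioms.intro moduleE L BG)
    show "?k (a \<odot>\<^bsub>E q\<^esub> x) = a \<odot>\<^bsub>component q n\<^esub> ?k x" if "a \<in> carrier R0" "x \<in> G q n" for a x
      using smult[OF ds.sub that(2)] that(1) by (simp add: sel R0s)
  qed (auto simp: sel R0s ds.sub stable_G stable_B add zero)
qed

end

section \<open>Depth zero and depth one\<close>

lemma (in abelian_group) minus_minus_self: "x \<in> carrier G \<Longrightarrow> y \<in> carrier G \<Longrightarrow> x \<ominus> (x \<ominus> y) = y"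
  using minus_minus_cancel_left[of x y \<zero>] by (simp add: minus_zero_right)

lemma (in abelian_group) minus_add_minus_cancel:
  assumes "x \<in> carrier G" "y \<in> carrier G" "z \<in> carrier G"
  shows "(x \<ominus> y) \<oplus> (y \<ominus> z) = x \<ominus> z"
  using assms minus_add_cancel(1)[of x y] by (simp add: minus_eq[of _ z] a_assoc[symmetric])

text \<open>Nonvanishing of Hom(R/I, L).\<close>

definition has_socle :: "('a, 'r) ring_scheme \<Rightarrow> 'a set \<Rightarrow> ('a, 'b, 'm) module_scheme \<Rightarrow> bool"
  where "has_socle R I L \<longleftrightarrow> (\<exists>x\<in>carrier L. x \<noteq> \<zero>\<^bsub>L\<^esub> \<and> (\<forall>a\<in>I. a \<odot>\<^bsub>L\<^esub> x = \<zero>\<^bsub>L\<^esub>))"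

text \<open>If \<open>L\<close> has no socle, this says that \<open>Ext\<^sup>1(R/I, L) = Hom(I, L)/L\<close> is nonzero.\<close>

definition has_extra_hom :: "('a, 'r) ring_scheme \<Rightarrow> 'a set \<Rightarrow> ('a, 'b, 'm) module_scheme \<Rightarrow> bool"
  where "has_extra_hom R I L \<longleftrightarrow>
    (\<exists>f\<in>mod_hom R (ideal_module R I) L. \<forall>x\<in>carrier L. \<exists>a\<in>I. f a \<noteq> a \<odot>\<^bsub>L\<^esub> x)"

context module begin

text \<open>If \<open>x\<close> is not itself killed by \<open>I\<close>, some nonzero multiple of
  it is killed by a smaller power.\<close>

lemma killed_nonzero_socle:
  assumes I: "I \<subseteq> carrier R" and x: "x \<in> killed R I M N" "x \<noteq> \<zero>\<^bsub>M\<^esub>"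
  shows "has_socle R I M"
  using x
proof (induction N arbitrary: x)
  case 0 then show ?case by (simp add: killed_0[OF I])
next
  case (Suc N)
  have xc: "x \<in> carrier M" by (rule killed_carrier[OF I Suc.prems(1)])
  show ?case
  proof (cases "\<forall>a\<in>I. a \<odot>\<^bsub>M\<^esub> x = \<zero>\<^bsub>M\<^esub>")
    case True then show ?thesis using xc Suc.prems(2) by (auto simp: has_socle_def)
  next
    case False
    then obtain a where a: "a \<in> I" "a \<odot>\<^bsub>M\<^esub> x \<noteq> \<zero>\<^bsub>M\<^esub>" by blast
    moreover have "a \<odot>\<^bsub>M\<^esub> x \<in> killed R I M N" using killed_Suc[OF I xc] Suc.prems(1) a(1) by blast
    ultimately show ?thesis by (intro Suc.IH)
  qed
qed

lemma socle_iff_torsion: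
  assumes I: "I \<subseteq> carrier R"
  shows "has_socle R I M \<longleftrightarrow> torsion_submodule R I M \<noteq> {\<zero>\<^bsub>M\<^esub>}"
proof
  assume "has_socle R I M"
  then obtain x where x: "x \<in> carrier M" "x \<noteq> \<zero>\<^bsub>M\<^esub>" "\<forall>a\<in>I. a \<odot>\<^bsub>M\<^esub> x = \<zero>\<^bsub>M\<^esub>" by (auto simp: has_socle_def)
  then have "x \<in> killed R I M (Suc 0)" using killed_Suc[OF I x(1)] killed_0[OF I] by simp
  then show "torsion_submodule R I M \<noteq> {\<zero>\<^bsub>M\<^esub>}" using x(2) unfolding torsion_submodule_eq by blast
next
  assume "torsion_submodule R I M \<noteq> {\<zero>\<^bsub>M\<^esub>}"
  moreover have "\<zero>\<^bsub>M\<^esub> \<in> torsion_submodule R I M" using killed_0[OF I] unfolding torsion_submodule_eq by blast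
  ultimately obtain x where "x \<in> torsion_submodule R I M" "x \<noteq> \<zero>\<^bsub>M\<^esub>" by blast
  then show "has_socle R I M" using killed_nonzero_socle[OF I] unfolding torsion_submodule_eq by blast
qed

end

lemma torsion_cohomology_trivial_iff:
  fixes R :: "('a, 'r) ring_scheme" and E :: "nat \<Rightarrow> ('a, 'e) module" and d :: "nat \<Rightarrow> 'e \<Rightarrow> 'e"
  assumes E: "\<And>q. module R (E q)" and d: "\<And>q. d q \<in> mod_hom R (E q) (E (Suc q))"
    and dd: "\<And>q x. x \<in> carrier (E q) \<Longrightarrow> d (Suc q) (d q x) = \<zero>\<^bsub>E (Suc (Suc q))\<^esub>" and I: "I \<subseteq> carrier R"
  shows "carrier (torsion_cohomology R I E d q) = {\<zero>\<^bsub>torsion_cohomology R I E d q\<^esub>} \<longleftrightarrow>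
    torsion_cocycles R I E d q \<subseteq> torsion_coboundaries R I E d q"
proof -
  let ?C = "torsion_cocycles R I E d q" and ?N = "torsion_coboundaries R I E d q"
  let ?M = "(E q)\<lparr>carrier := ?C\<rparr>"
  note sub = torsion_coboundaries_submodule[of R E d I q, OF E d dd I]
  interpret M: module R ?M by (rule sub(1))
  have z: "?N +>\<^bsub>?M\<^esub> x = ?N \<longleftrightarrow> x \<in> ?N" if "x \<in> ?C" for x
    using M.quotient_module_zero_iff[OF sub(2), of x] that by (simp add: quotient_module_sel)
  have "\<zero>\<^bsub>?M\<^esub> \<in> ?C" using M.zero_closed by simp
  then show ?thesis using z by (auto simp: torsion_cohomology_def quotient_module_sel)
qed

context cring begin

text \<open>Depth is defined by local cohomology, while the passage between degrees needs Hom and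
  Ext^1 from R/I. The two are compared by hand on the chosen resolution in cohomological degrees 0
  and 1, which decide between depth 0, depth 1 and depth at least 2.\<close>

lemma depth_criterion:
  fixes L :: "('a, 'x, 'm) module_scheme"
  assumes noeth: "noetherian_ring R" and L: "module R L" and I: "ideal I R"
  shows "has_socle R I L \<Longrightarrow> depth R I L = 0"
    and "\<not> has_socle R I L \<Longrightarrow> has_extra_hom R I L \<Longrightarrow> depth R I L = 1"
    and "\<not> has_socle R I L \<Longrightarrow> \<not> has_extra_hom R I L \<Longrightarrow> depth R I L \<ge> 2"
proof -
  interpret L: module R L by (rule L)
  interpret I: ideal I R by (rule I)
  have Is: "I \<subseteq> carrier R" using I.a_Hcarr by blast
  obtain S where S: "S \<subseteq> carrier R" "finite S" "I = Idl S"
    using noetherian_ring.finetely_gen[OF noeth I] by blast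
  have S_gen: "I \<subseteq> K" if "ideal K R" "S \<subseteq> K" for K using genideal_minimal[OF that] S(3) by simp
  have SI: "S \<subseteq> I" using genideal_self[OF S(1)] S(3) by simp
  obtain E d \<eta> where ch: "chosen_resolution R L = (E, d)" and res: "injective_resolution R L E \<eta> d"
    by (rule chosen_resolution[OF is_cring noeth L]) blast
  have inj: "injective_module R (E q)" for q using res by (simp add: injective_resolution_def)
  have E: "module R (E q)" for q using inj by (simp add: injective_module_def)
  have ex: "exact_coresolution R L E \<eta> d" using res by (simp add: injective_resolution_def)
  have \<eta>: "\<eta> \<in> mod_hom R L (E 0)" "inj_on \<eta> (carrier L)" "\<eta> ` carrier L = mod_kernel (E 0) (E 1) (d 0)"
    and d: "d q \<in> mod_hom R (E q) (E (Suc q))"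
    and ker: "d q ` carrier (E q) = mod_kernel (E (Suc q)) (E (Suc (Suc q))) (d (Suc q))" for q
    using ex by (simp_all add: exact_coresolution_def)
  interpret E: module R "E p" for p by (rule E)
  interpret d: additive_map "E p" "E (Suc p)" "d p" for p by (rule mod_hom_additive_map[OF E E d])
  interpret \<eta>: additive_map L "E 0" \<eta> by (rule mod_hom_additive_map[OF L E \<eta>(1)])
  have dd: "d (Suc q) (d q x) = \<zero>\<^bsub>E (Suc (Suc q))\<^esub>" if "x \<in> carrier (E q)" for q x
    using ker[of q] that by (auto simp: mod_kernel_def)
  define nz where "nz i \<longleftrightarrow> \<not> torsion_cocycles R I E d i \<subseteq> torsion_coboundaries R I E d i" for i
  have "local_cohomology R I L i = torsion_cohomology R I E d i" for i by (simp add: local_cohomology_def ch)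
  then have depth: "depth R I L = Inf {enat i | i. nz i}"
    unfolding depth_def nz_def using torsion_cohomology_trivial_iff[of R E d I, OF E d dd Is] by simp
  let ?T = "\<lambda>q. torsion_submodule R I (E q)"
  have T: "submodule (?T q) R (E q)" for q by (rule E.torsion_submodule_submodule[OF Is])
  have Tc: "x \<in> carrier (E q)" if "x \<in> ?T q" for x q using that by (simp add: torsion_submodule_def)
  have Ts: "additive_subgroup (?T q) (E q)" for q by (rule submodule_additive_subgroup[OF T])
  note TD = additive_subgroup.zero_closed[OF Ts] additive_subgroup.a_closed[OF Ts]
    additive_subgroup_minus[OF E.abelian_group_axioms Ts]
  have \<eta>_eq: "\<eta> x = \<zero>\<^bsub>E 0\<^esub> \<longleftrightarrow> x = \<zero>\<^bsub>L\<^esub>" if "x \<in> carrier L" for x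
    using inj_onD[OF \<eta>(2), of x "\<zero>\<^bsub>L\<^esub>"] that by auto
  have \<eta>_ker: "x \<in> \<eta> ` carrier L" if "x \<in> carrier (E 0)" "d 0 x = \<zero>\<^bsub>E 1\<^esub>" for x
    using that \<eta>(3) by (simp add: mod_kernel_def)
  have d\<eta>: "d 0 (\<eta> x) = \<zero>\<^bsub>E 1\<^esub>" if "x \<in> carrier L" for x
    using that \<eta>(3) by (auto simp: mod_kernel_def)
  have soc_T: "has_socle R I L" if x: "x \<in> carrier L" "x \<noteq> \<zero>\<^bsub>L\<^esub>" "\<eta> x \<in> ?T 0" for x
  proof -
    obtain N where N: "\<eta> x \<in> killed R I (E 0) N" using x(3) unfolding torsion_submodule_eq by blast
    have "a \<odot>\<^bsub>L\<^esub> x = \<zero>\<^bsub>L\<^esub>" if a: "a \<in> ideal_power R I N" for a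
    proof -
      have ac: "a \<in> carrier R" using L.ideal_power_subset[OF Is] a by blast
      then have "\<eta> (a \<odot>\<^bsub>L\<^esub> x) = \<zero>\<^bsub>E 0\<^esub>" using mod_homD(3)[OF \<eta>(1) ac x(1)] N a by (simp add: killed_def)
      then show ?thesis using \<eta>_eq ac x(1) by simp
    qed
    then have "x \<in> killed R I L N" using x(1) by (simp add: killed_def)
    then show ?thesis by (rule L.killed_nonzero_socle[OF Is _ x(2)])
  qed
  have nz0: "nz 0 \<longleftrightarrow> has_socle R I L"
  proof
    assume "nz 0"
    then obtain z where z: "z \<in> ?T 0" "d 0 z = \<zero>\<^bsub>E 1\<^esub>" "z \<noteq> \<zero>\<^bsub>E 0\<^esub>"
      by (auto simp: nz_def torsion_cocycles_def torsion_coboundaries_def mod_kernel_def)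
    then obtain x where x: "x \<in> carrier L" "z = \<eta> x" using \<eta>_ker[OF Tc[OF z(1)] z(2)] by blast
    show "has_socle R I L" by (rule soc_T[OF x(1)]) (use z x in auto)
  next
    assume "has_socle R I L"
    then obtain x where x: "x \<in> torsion_submodule R I L" "x \<noteq> \<zero>\<^bsub>L\<^esub>"
      using L.socle_iff_torsion[OF Is] additive_subgroup.zero_closed[OF submodule_additive_subgroup[OF L.torsion_submodule_submodule[OF Is]]]
      by blast
    have xc: "x \<in> carrier L" using x(1) by (simp add: torsion_submodule_def)
    have "\<eta> x \<in> torsion_cocycles R I E d 0"
      using L.mod_hom_torsion[OF E \<eta>(1) Is x(1)] d\<eta>[OF xc] xc by (simp add: torsion_cocycles_def mod_kernel_def)
    moreover have "\<eta> x \<notin> torsion_coboundaries R I E d 0" using \<eta>_eq[OF xc] x(2) by (simp add: torsion_coboundaries_def)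
    ultimately show "nz 0" by (auto simp: nz_def)
  qed
  show "depth R I L = 0" if "has_socle R I L"
  proof -
    have "nz 0" using that nz0 by simp
    then have "depth R I L \<le> enat 0" unfolding depth by (intro Inf_lower) blast
    then show ?thesis by (simp add: zero_enat_def[symmetric])
  qed
  have nz1: "nz 1 \<longleftrightarrow> has_extra_hom R I L" if soc: "\<not> has_socle R I L"
  proof
    assume "has_extra_hom R I L"
    then obtain f where f: "f \<in> mod_hom R (ideal_module R I) L" "\<And>x. x \<in> carrier L \<Longrightarrow> \<exists>a\<in>I. f a \<noteq> a \<odot>\<^bsub>L\<^esub> x"
      by (auto simp: has_extra_hom_def)
    have fL: "f a \<in> carrier L" if "a \<in> I" for a using mod_homD(1)[OF f(1), of a] that by simp
    \<comment> \<open>Connecting map: \<open>f\<close>, followed by \<open>\<eta>\<close>, is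
      multiplication by some \<open>e\<close>. Then \<open>d 0 e\<close> is killed by
      \<open>I\<close>, and its class is nonzero unless \<open>f\<close> is multiplication by an
      element of \<open>L\<close>.\<close>
    have "(\<lambda>a. \<eta> (f a)) \<in> mod_hom R (ideal_module R I) (E 0)"
    proof (rule mod_homI)
      show "\<eta> (f (a \<oplus>\<^bsub>ideal_module R I\<^esub> b)) = \<eta> (f a) \<oplus>\<^bsub>E 0\<^esub> \<eta> (f b)"
        if "a \<in> carrier (ideal_module R I)" "b \<in> carrier (ideal_module R I)" for a b
        using mod_homD(2)[OF f(1) that] that fL by simp
      show "\<eta> (f (c \<odot>\<^bsub>ideal_module R I\<^esub> a)) = c \<odot>\<^bsub>E 0\<^esub> \<eta> (f a)"
        if "c \<in> carrier R" "a \<in> carrier (ideal_module R I)" for c a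
        using mod_homD(3)[OF f(1) that] mod_homD(3)[OF \<eta>(1) that(1) fL[of a]] that(2) by simp
    qed (use fL in simp)
    from injective_module_baer[OF inj I this]
    obtain e where e: "e \<in> carrier (E 0)" "\<And>a. a \<in> I \<Longrightarrow> \<eta> (f a) = a \<odot>\<^bsub>E 0\<^esub> e" by auto
    have dec: "d 0 e \<in> carrier (E 1)" using d.closed[OF e(1)] by simp
    have "a \<odot>\<^bsub>E 1\<^esub> d 0 e = \<zero>\<^bsub>E 1\<^esub>" if a: "a \<in> I" for a
      using mod_homD(3)[OF d, of a e 0] e(1) e(2)[OF a] d\<eta>[OF fL[OF a]] I.a_Hcarr[OF a] by simp
    then have "d 0 e \<in> killed R I (E 1) (Suc 0)"
      using E.killed_Suc[OF Is dec, of 0] E.killed_0[OF Is, of 1] by simp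
    then have "d 0 e \<in> ?T 1" unfolding torsion_submodule_eq by blast
    then have "d 0 e \<in> torsion_cocycles R I E d 1" using dd[OF e(1)] dec by (simp add: torsion_cocycles_def mod_kernel_def)
    moreover have "d 0 e \<notin> torsion_coboundaries R I E d 1"
    proof
      assume "d 0 e \<in> torsion_coboundaries R I E d 1"
      then obtain g where g: "g \<in> ?T 0" "d 0 e = d 0 g" by (auto simp: torsion_coboundaries_def)
      have gc: "g \<in> carrier (E 0)" by (rule Tc[OF g(1)])
      have "d 0 (e \<ominus>\<^bsub>E 0\<^esub> g) = \<zero>\<^bsub>E 1\<^esub>" using d.minus[OF e(1) gc] g(2) d.closed[OF gc] by (simp add: E.minus_eq E.r_neg)
      then obtain x where x: "x \<in> carrier L" "e \<ominus>\<^bsub>E 0\<^esub> g = \<eta> x" using \<eta>_ker[of "e \<ominus>\<^bsub>E 0\<^esub> g"] e(1) gc by auto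
      \<comment> \<open>The difference of both sides is mapped to \<open>a g\<close>, a torsion
        element; without a socle, \<open>L\<close> meets the torsion of \<open>E 0\<close> only in
        zero.\<close>
      have "f a = a \<odot>\<^bsub>L\<^esub> x" if a: "a \<in> I" for a
      proof -
        have ac: "a \<in> carrier R" using I.a_Hcarr[OF a] .
        have "\<eta> (f a \<ominus>\<^bsub>L\<^esub> a \<odot>\<^bsub>L\<^esub> x) = a \<odot>\<^bsub>E 0\<^esub> e \<ominus>\<^bsub>E 0\<^esub> a \<odot>\<^bsub>E 0\<^esub> (e \<ominus>\<^bsub>E 0\<^esub> g)"
          using e(2)[OF a] mod_homD(3)[OF \<eta>(1) ac x(1)] x fL[OF a] ac by simp
        also have "\<dots> = a \<odot>\<^bsub>E 0\<^esub> (e \<ominus>\<^bsub>E 0\<^esub> (e \<ominus>\<^bsub>E 0\<^esub> g))" using ac e(1) gc by (simp add: E.smult_minus_distrib)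
        also have "e \<ominus>\<^bsub>E 0\<^esub> (e \<ominus>\<^bsub>E 0\<^esub> g) = g"
          by (rule E.minus_minus_self[OF e(1) gc])
        also have "a \<odot>\<^bsub>E 0\<^esub> g \<in> ?T 0" by (rule submodule.smult_closed[OF T ac g(1)])
        finally have "f a \<ominus>\<^bsub>L\<^esub> a \<odot>\<^bsub>L\<^esub> x = \<zero>\<^bsub>L\<^esub>"
          using soc_T[of "f a \<ominus>\<^bsub>L\<^esub> a \<odot>\<^bsub>L\<^esub> x"] soc fL[OF a] ac x(1) by auto
        then show ?thesis using L.minus_eq_zero_iff fL[OF a] ac x(1) by simp
      qed
      then show False using f(2)[OF x(1)] by blast
    qed
    ultimately show "nz 1" by (auto simp: nz_def)
  next
    assume "nz 1"
    show "has_extra_hom R I L"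
    proof (rule ccontr)
      assume no: "\<not> has_extra_hom R I L"
      \<comment> \<open>Induction on the power of \<open>I\<close> that kills \<open>z\<close>. For
        \<open>a\<close> in \<open>I\<close> the cocycle \<open>a z\<close> has a torsion preimage
        \<open>g a\<close>, and with \<open>z = d 0 e\<close> the difference of \<open>a e\<close>
        and \<open>g a\<close> comes from an element \<open>f a\<close> of \<open>L\<close>.\<close>
      have lift: "\<exists>g\<in>?T 0. d 0 g = z" if "z \<in> killed R I (E 1) N" "d 1 z = \<zero>\<^bsub>E 2\<^esub>" for z N
        using that
      proof (induction N arbitrary: z)
        case 0
        then have "z = \<zero>\<^bsub>E 1\<^esub>" using E.killed_0[OF Is, of 1] by simp
        then show ?case using TD(1) d.zero[of 0] by (metis One_nat_def)
      next
        case (Suc N)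
        have zc: "z \<in> carrier (E 1)" by (rule E.killed_carrier[OF Is Suc.prems(1)])
        have "z \<in> mod_kernel (E (Suc 0)) (E (Suc (Suc 0))) (d (Suc 0))"
          using Suc.prems(2) zc by (simp add: mod_kernel_def numeral_2_eq_2)
        then obtain e where e: "e \<in> carrier (E 0)" "z = d 0 e" using ker[of 0] by blast
        have "\<exists>g. g \<in> ?T 0 \<and> d 0 g = a \<odot>\<^bsub>E 1\<^esub> z" if a: "a \<in> I" for a
        proof -
          have ac: "a \<in> carrier R" using I.a_Hcarr[OF a] .
          have "a \<odot>\<^bsub>E 1\<^esub> z \<in> killed R I (E 1) N" using E.killed_Suc[OF Is zc] Suc.prems(1) a by blast
          moreover have "d 1 (a \<odot>\<^bsub>E 1\<^esub> z) = \<zero>\<^bsub>E 2\<^esub>"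
            using mod_homD(3)[OF d ac, of z 1] zc Suc.prems(2) E.smult_r_null[OF ac, of 2] by (simp add: numeral_2_eq_2)
          ultimately show ?thesis using Suc.IH by blast
        qed
        then obtain g where g: "\<And>a. a \<in> I \<Longrightarrow> g a \<in> ?T 0" "\<And>a. a \<in> I \<Longrightarrow> d 0 (g a) = a \<odot>\<^bsub>E 1\<^esub> z" by metis
        have gc: "g a \<in> carrier (E 0)" if "a \<in> I" for a by (rule Tc[OF g(1)[OF that]])
        have "\<exists>x. x \<in> carrier L \<and> \<eta> x = a \<odot>\<^bsub>E 0\<^esub> e \<ominus>\<^bsub>E 0\<^esub> g a" if a: "a \<in> I" for a
        proof -
          have ac: "a \<in> carrier R" using I.a_Hcarr[OF a] .
          have "d 0 (a \<odot>\<^bsub>E 0\<^esub> e \<ominus>\<^bsub>E 0\<^esub> g a) = d 0 (a \<odot>\<^bsub>E 0\<^esub> e) \<ominus>\<^bsub>E 1\<^esub> d 0 (g a)"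
            using d.minus[of "a \<odot>\<^bsub>E 0\<^esub> e" 0 "g a"] gc[OF a] ac e(1) by simp
          also have "\<dots> = a \<odot>\<^bsub>E 1\<^esub> z \<ominus>\<^bsub>E 1\<^esub> a \<odot>\<^bsub>E 1\<^esub> z" using mod_homD(3)[OF d ac e(1)] g(2)[OF a] e(2) by simp
          also have "\<dots> = \<zero>\<^bsub>E 1\<^esub>" using ac zc by (simp add: E.minus_eq E.r_neg)
          finally show ?thesis using \<eta>_ker[of "a \<odot>\<^bsub>E 0\<^esub> e \<ominus>\<^bsub>E 0\<^esub> g a"] ac e(1) gc[OF a] by auto
        qed
        then obtain f where f: "\<And>a. a \<in> I \<Longrightarrow> f a \<in> carrier L" "\<And>a. a \<in> I \<Longrightarrow> \<eta> (f a) = a \<odot>\<^bsub>E 0\<^esub> e \<ominus>\<^bsub>E 0\<^esub> g a" by metis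
        \<comment> \<open>The \<open>g a\<close> are chosen without regard to addition. Still,
          \<open>f\<close> is a homomorphism, since the errors are torsion and \<open>L\<close> has
          no nonzero torsion.\<close>
        have uniq: "x = y" if "x \<in> carrier L" "y \<in> carrier L" "\<eta> x \<ominus>\<^bsub>E 0\<^esub> \<eta> y \<in> ?T 0" for x y
          using soc_T[of "x \<ominus>\<^bsub>L\<^esub> y"] soc that L.minus_eq_zero_iff by auto
        have fm: "f \<in> mod_hom R (ideal_module R I) L"
        proof (rule mod_homI)
          show "f a \<in> carrier L" if "a \<in> carrier (ideal_module R I)" for a using f(1) that by simp
          show "f (a \<oplus>\<^bsub>ideal_module R I\<^esub> b) = f a \<oplus>\<^bsub>L\<^esub> f b"
            if "a \<in> carrier (ideal_module R I)" "b \<in> carrier (ideal_module R I)" for a b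
          proof -
            have ab: "a \<in> I" "b \<in> I" "a \<oplus> b \<in> I" using that by auto
            note c = I.a_Hcarr[OF ab(1)] I.a_Hcarr[OF ab(2)] gc[OF ab(1)] gc[OF ab(2)] gc[OF ab(3)] e(1)
            have "\<eta> (f a \<oplus>\<^bsub>L\<^esub> f b) = (a \<oplus> b) \<odot>\<^bsub>E 0\<^esub> e \<ominus>\<^bsub>E 0\<^esub> (g a \<oplus>\<^bsub>E 0\<^esub> g b)"
              using c f ab(1,2) by (simp add: E.minus_add_distrib E.smult_l_distr)
            then have "\<eta> (f (a \<oplus> b)) \<ominus>\<^bsub>E 0\<^esub> \<eta> (f a \<oplus>\<^bsub>L\<^esub> f b) = (g a \<oplus>\<^bsub>E 0\<^esub> g b) \<ominus>\<^bsub>E 0\<^esub> g (a \<oplus> b)"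
              using c f(2)[OF ab(3)] by (simp add: E.minus_minus_cancel_left)
            also have "\<dots> \<in> ?T 0" using TD(3)[OF TD(2)[OF g(1) g(1)] g(1)] ab by blast
            finally show ?thesis using uniq f(1) ab by simp
          qed
          show "f (c \<odot>\<^bsub>ideal_module R I\<^esub> a) = c \<odot>\<^bsub>L\<^esub> f a"
            if "c \<in> carrier R" "a \<in> carrier (ideal_module R I)" for c a
          proof -
            have ca: "a \<in> I" "c \<otimes> a \<in> I" using that I.I_l_closed by auto
            note c = I.a_Hcarr[OF ca(1)] gc[OF ca(1)] gc[OF ca(2)] e(1) that(1)
            have "\<eta> (c \<odot>\<^bsub>L\<^esub> f a) = (c \<otimes> a) \<odot>\<^bsub>E 0\<^esub> e \<ominus>\<^bsub>E 0\<^esub> c \<odot>\<^bsub>E 0\<^esub> g a"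
              using c f[OF ca(1)] mod_homD(3)[OF \<eta>(1) that(1) f(1)[OF ca(1)]]
              by (simp add: E.smult_minus_distrib E.smult_assoc1)
            then have "\<eta> (f (c \<otimes> a)) \<ominus>\<^bsub>E 0\<^esub> \<eta> (c \<odot>\<^bsub>L\<^esub> f a) = (c \<odot>\<^bsub>E 0\<^esub> g a) \<ominus>\<^bsub>E 0\<^esub> g (c \<otimes> a)"
              using c f(2)[OF ca(2)] by (simp add: E.minus_minus_cancel_left)
            also have "\<dots> \<in> ?T 0" using TD(3)[OF submodule.smult_closed[OF T that(1) g(1)] g(1)] ca by blast
            finally show ?thesis using uniq f(1) ca that(1) by simp
          qed
        qed
        obtain x where x: "x \<in> carrier L" "\<And>a. a \<in> I \<Longrightarrow> f a = a \<odot>\<^bsub>L\<^esub> x"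
          using no fm unfolding has_extra_hom_def by blast
        have \<eta>x: "\<eta> x \<in> carrier (E 0)" using x(1) by simp
        \<comment> \<open>If \<open>f\<close> is multiplication by \<open>x\<close>, correcting
          \<open>e\<close> by \<open>\<eta> x\<close> gives \<open>s ?w = g s\<close> for each
          generator \<open>s\<close> of \<open>I\<close>. So \<open>?w\<close> is the wanted torsion
          preimage of \<open>z\<close>.\<close>
        let ?w = "e \<ominus>\<^bsub>E 0\<^esub> \<eta> x"
        have wc: "?w \<in> carrier (E 0)" using e(1) \<eta>x by simp
        have sw: "s \<odot>\<^bsub>E 0\<^esub> ?w \<in> ?T 0" if s: "s \<in> S" for s
        proof -
          have sI: "s \<in> I" and sc: "s \<in> carrier R" using s SI S(1) by blast+
          have "s \<odot>\<^bsub>E 0\<^esub> e \<ominus>\<^bsub>E 0\<^esub> g s = s \<odot>\<^bsub>E 0\<^esub> \<eta> x"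
            using f(2)[OF sI] x(2)[OF sI] mod_homD(3)[OF \<eta>(1) sc x(1)] by simp
          then have "s \<odot>\<^bsub>E 0\<^esub> ?w = s \<odot>\<^bsub>E 0\<^esub> e \<ominus>\<^bsub>E 0\<^esub> (s \<odot>\<^bsub>E 0\<^esub> e \<ominus>\<^bsub>E 0\<^esub> g s)"
            using sc e(1) \<eta>x by (simp add: E.smult_minus_distrib)
          also have "\<dots> = g s"
            by (rule E.minus_minus_self) (use sc e(1) gc[OF sI] in auto)
          finally show ?thesis using g(1)[OF sI] by simp
        qed
        have "?w \<in> ?T 0" by (rule E.torsion_of_generators[OF Is S(2) S_gen wc sw S(1)])
        moreover have "d 0 ?w = z"
          using d.minus[OF e(1) \<eta>x] d\<eta>[OF x(1)] e zc by (simp add: E.minus_zero_right)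
        ultimately show ?case by blast
      qed
      have "z \<in> torsion_coboundaries R I E d 1" if "z \<in> torsion_cocycles R I E d 1" for z
        using that lift by (auto simp: torsion_cocycles_def torsion_coboundaries_def mod_kernel_def torsion_submodule_eq[of R I "E (Suc 0)"] numeral_2_eq_2)
      then show False using \<open>nz 1\<close> by (auto simp: nz_def)
    qed
  qed
  show "depth R I L = 1" if "\<not> has_socle R I L" "has_extra_hom R I L"
  proof (rule antisym)
    have "nz 1" "\<not> nz 0" using that nz0 nz1 by auto
    show "depth R I L \<le> 1" unfolding depth by (rule Inf_lower) (use \<open>nz 1\<close> one_enat_def in blast)
    have "1 \<le> i" if "nz i" for i using \<open>\<not> nz 0\<close> that by (cases i) auto
    then show "1 \<le> depth R I L" unfolding depth by (intro Inf_greatest) (auto simp: one_enat_def)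
  qed
  show "depth R I L \<ge> 2" if "\<not> has_socle R I L" "\<not> has_extra_hom R I L"
  proof -
    have n: "\<not> nz 1" "\<not> nz 0" using that nz0 nz1 by auto
    have "2 \<le> i" if "nz i" for i
    proof -
      have "i \<noteq> 0" "i \<noteq> 1" using n that by metis+
      then show ?thesis by simp
    qed
    then show ?thesis unfolding depth by (intro Inf_greatest) (auto simp: numeral_eq_enat)
  qed
qed

end

section \<open>Depth of the graded components in low degrees\<close>

context presentation begin

lemma socle_iff: "has_socle S I L \<longleftrightarrow> (\<exists>z\<in>G. z \<notin> B \<and> (\<forall>a\<in>I. a \<odot>\<^bsub>E\<^esub> z \<in> B))" if I: "I \<subseteq> carrier S"
proof -
  have "a \<odot>\<^bsub>L\<^esub> \<kappa> z = \<zero>\<^bsub>L\<^esub> \<longleftrightarrow> a \<odot>\<^bsub>E\<^esub> z \<in> B" if "a \<in> I" "z \<in> G" for a z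
    using smult[OF subsetD[OF I that(1)] that(2)] zero_iff[OF stable_subgroupD(2)[OF stG subsetD[OF I that(1)] that(2)]]
    by simp
  then show ?thesis using zero_iff unfolding has_socle_def surj[symmetric] by auto
qed

text \<open>Homomorphisms into \<open>L\<close> are handled through chosen representatives in
  \<open>G\<close>, additive and linear only modulo \<open>B\<close>, so that they can be multiplied
  by elements of degree one, which lead out of \<open>L\<close>.\<close>

lemma extra_hom_lift:
  assumes I: "ideal I S" and "has_extra_hom S I L"
  obtains f where "\<And>a. a \<in> I \<Longrightarrow> f a \<in> G"
    "\<And>a b. a \<in> I \<Longrightarrow> b \<in> I \<Longrightarrow> f (a \<oplus>\<^bsub>S\<^esub> b) \<ominus>\<^bsub>E\<^esub> (f a \<oplus>\<^bsub>E\<^esub> f b) \<in> B"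
    "\<And>c a. c \<in> carrier S \<Longrightarrow> a \<in> I \<Longrightarrow> f (c \<otimes>\<^bsub>S\<^esub> a) \<ominus>\<^bsub>E\<^esub> c \<odot>\<^bsub>E\<^esub> f a \<in> B"
    "\<And>x. x \<in> G \<Longrightarrow> \<exists>a\<in>I. f a \<ominus>\<^bsub>E\<^esub> a \<odot>\<^bsub>E\<^esub> x \<notin> B"
proof -
  interpret I: ideal I S by (rule I)
  obtain g where g: "g \<in> mod_hom S (ideal_module S I) L" "\<And>x. x \<in> carrier L \<Longrightarrow> \<exists>a\<in>I. g a \<noteq> a \<odot>\<^bsub>L\<^esub> x"
    using assms(2) by (auto simp: has_extra_hom_def)
  have "\<exists>z. z \<in> G \<and> g a = \<kappa> z" if "a \<in> I" for a
  proof -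
    have "g a \<in> carrier L" using mod_homD(1)[OF g(1), of a] that by simp
    then show ?thesis using surj by auto
  qed
  then obtain f where f: "\<And>a. a \<in> I \<Longrightarrow> f a \<in> G" "\<And>a. a \<in> I \<Longrightarrow> g a = \<kappa> (f a)" by metis
  show thesis
  proof (rule that[of f])
    show "f a \<in> G" if "a \<in> I" for a by (rule f(1)[OF that])
    show "f (a \<oplus>\<^bsub>S\<^esub> b) \<ominus>\<^bsub>E\<^esub> (f a \<oplus>\<^bsub>E\<^esub> f b) \<in> B" if ab: "a \<in> I" "b \<in> I" for a b
    proof -
      have "\<kappa> (f (a \<oplus>\<^bsub>S\<^esub> b)) = \<kappa> (f a \<oplus>\<^bsub>E\<^esub> f b)"
        using mod_homD(2)[OF g(1), of a b] f ab add by simp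
      then show ?thesis using eq_iff[OF f(1)[OF I.a_closed[OF ab]] GD(3)[OF f(1)[OF ab(1)] f(1)[OF ab(2)]]] by simp
    qed
    show "f (c \<otimes>\<^bsub>S\<^esub> a) \<ominus>\<^bsub>E\<^esub> c \<odot>\<^bsub>E\<^esub> f a \<in> B" if c: "c \<in> carrier S" and a: "a \<in> I" for c a
    proof -
      have "\<kappa> (f (c \<otimes>\<^bsub>S\<^esub> a)) = \<kappa> (c \<odot>\<^bsub>E\<^esub> f a)"
        using mod_homD(3)[OF g(1) c, of a] f a I.I_l_closed[OF a c] smult[OF c f(1)[OF a]] by simp
      then show ?thesis using eq_iff[OF f(1)[OF I.I_l_closed[OF a c]] stable_subgroupD(2)[OF stG c f(1)[OF a]]] by simp
    qed
    show "\<exists>a\<in>I. f a \<ominus>\<^bsub>E\<^esub> a \<odot>\<^bsub>E\<^esub> x \<notin> B" if x: "x \<in> G" for x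
    proof -
      obtain a where a: "a \<in> I" "g a \<noteq> a \<odot>\<^bsub>L\<^esub> \<kappa> x" using g(2)[OF closed[OF x]] by blast
      have ac: "a \<in> carrier S" by (rule I.a_Hcarr[OF a(1)])
      have "\<kappa> (f a) \<noteq> \<kappa> (a \<odot>\<^bsub>E\<^esub> x)" using a f(2)[OF a(1)] smult[OF ac x] by simp
      then show ?thesis using eq_iff[OF f(1)[OF a(1)] stable_subgroupD(2)[OF stG ac x]] a(1) by blast
    qed
  qed
qed

lemma extra_homI:
  assumes I: "ideal I S" and f: "\<And>a. a \<in> I \<Longrightarrow> f a \<in> G"
    and f_add: "\<And>a b. a \<in> I \<Longrightarrow> b \<in> I \<Longrightarrow> f (a \<oplus>\<^bsub>S\<^esub> b) \<ominus>\<^bsub>E\<^esub> (f a \<oplus>\<^bsub>E\<^esub> f b) \<in> B"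
    and f_mult: "\<And>c a. c \<in> carrier S \<Longrightarrow> a \<in> I \<Longrightarrow> f (c \<otimes>\<^bsub>S\<^esub> a) \<ominus>\<^bsub>E\<^esub> c \<odot>\<^bsub>E\<^esub> f a \<in> B"
    and extra: "\<And>x. x \<in> G \<Longrightarrow> \<exists>a\<in>I. f a \<ominus>\<^bsub>E\<^esub> a \<odot>\<^bsub>E\<^esub> x \<notin> B"
  shows "has_extra_hom S I L"
proof -
  interpret I: ideal I S by (rule I)
  have "(\<lambda>a. \<kappa> (f a)) \<in> mod_hom S (ideal_module S I) L"
  proof (rule mod_homI)
    show "\<kappa> (f a) \<in> carrier L" if "a \<in> carrier (ideal_module S I)" for a using that f closed by simp
    show "\<kappa> (f (a \<oplus>\<^bsub>ideal_module S I\<^esub> b)) = \<kappa> (f a) \<oplus>\<^bsub>L\<^esub> \<kappa> (f b)"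
      if "a \<in> carrier (ideal_module S I)" "b \<in> carrier (ideal_module S I)" for a b
    proof -
      have ab: "a \<in> I" "b \<in> I" using that by auto
      show ?thesis
        unfolding ideal_module_sel add[OF f[OF ab(1)] f[OF ab(2)], symmetric]
        by (rule iffD2[OF eq_iff[OF f[OF I.a_closed[OF ab]] GD(3)[OF f[OF ab(1)] f[OF ab(2)]]] f_add[OF ab]])
    qed
    show "\<kappa> (f (c \<odot>\<^bsub>ideal_module S I\<^esub> a)) = c \<odot>\<^bsub>L\<^esub> \<kappa> (f a)"
      if c: "c \<in> carrier S" and "a \<in> carrier (ideal_module S I)" for c a
    proof -
      have a: "a \<in> I" using that by simp
      show ?thesis
        unfolding ideal_module_sel smult[OF c f[OF a], symmetric]
        by (rule iffD2[OF eq_iff[OF f[OF I.I_l_closed[OF a c]] stable_subgroupD(2)[OF stG c f[OF a]]] f_mult[OF c a]])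
    qed
  qed
  moreover have "\<exists>a\<in>I. \<kappa> (f a) \<noteq> a \<odot>\<^bsub>L\<^esub> u" if u: "u \<in> carrier L" for u
  proof -
    obtain x where x: "x \<in> G" "u = \<kappa> x" using u unfolding surj[symmetric] by blast
    obtain a where a: "a \<in> I" "f a \<ominus>\<^bsub>E\<^esub> a \<odot>\<^bsub>E\<^esub> x \<notin> B" using extra[OF x(1)] by blast
    have ac: "a \<in> carrier S" by (rule I.a_Hcarr[OF a(1)])
    have "\<kappa> (f a) \<noteq> \<kappa> (a \<odot>\<^bsub>E\<^esub> x)"
      using iffD1[OF eq_iff[OF f[OF a(1)] stable_subgroupD(2)[OF stG ac x(1)]]] a(2) by blast
    then show ?thesis using a(1) unfolding x(2) smult[OF ac x(1)] by (intro bexI)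
  qed
  ultimately show ?thesis unfolding has_extra_hom_def by (intro bexI[of _ "\<lambda>a. \<kappa> (f a)"] ballI)
qed

end

text \<open>If \<open>P\<close> does not fail throughout low degrees, it holds at some
  \<open>k\<close> below any given \<open>n\<close>, and from there it climbs up to
  \<open>n\<close>.\<close>

lemma int_upward_dichotomy:
  fixes P :: "int \<Rightarrow> bool"
  assumes "\<And>n. n \<le> n0 \<Longrightarrow> P n \<Longrightarrow> P (n + 1)"
  shows "(\<exists>n1. \<forall>n\<le>n1. P n) \<or> (\<exists>n1. \<forall>n\<le>n1. \<not> P n)"
proof (cases "\<exists>n1. \<forall>n\<le>n1. \<not> P n")
  case False
  have "P n" if n: "n \<le> n0" for n
  proof -
    obtain k where k: "k \<le> n" "P k" using False by blast
    have "k \<le> l \<Longrightarrow> l \<le> n0 \<Longrightarrow> P l" for l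
      by (induction l rule: int_ge_induct) (use k(2) assms in auto)
    then show ?thesis using k n by blast
  qed
  then show ?thesis by blast
qed blast

section \<open>Passing from one degree to the next\<close>

context graded_resolution begin

lemma R0_carrier: "carrier R0 = \<A> 0"
  by (simp add: degree_zero_ring_def)

context
  fixes I and q :: nat
  assumes R0: "cring R0" and I: "ideal I R0"
begin

interpretation C: presentation R "E q" R0 "component q n" "G q n" "B q n"
    "\<lambda>z. torsion_coboundaries R Rp E d q +>\<^bsub>E q\<^esub> z" for n
  by (rule component_presentation[OF R0])

lemma I_subset: "I \<subseteq> \<A> 0"
  using additive_subgroup.a_Hcarr[OF ideal.axioms(1)[OF I]] by (auto simp: R0_carrier)

lemma socle_step:
  assumes acyc: "koszul_acyclic (E q) r t (B q) (Z q) n" and soc: "has_socle R0 I (component q n)"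
  shows "has_socle R0 I (component q (n + 1))"
proof -
  have I0: "I \<subseteq> carrier R0" using I_subset by (simp add: R0_carrier)
  obtain z where z: "z \<in> G q n" "z \<notin> B q n" "\<And>a. a \<in> I \<Longrightarrow> a \<odot>\<^bsub>E q\<^esub> z \<in> B q n"
    using soc C.socle_iff[OF I0] by blast
  \<comment> \<open>Were all \<open>r i z\<close> coboundaries, exactness at the first place would
    make \<open>z\<close> one too.\<close>
  obtain i where i: "i < t" "r i \<odot>\<^bsub>E q\<^esub> z \<notin> B q (n + 1)"
    using E.koszul_acyclic_socle[OF fam_B fam_Z acyc subsetD[OF GZ z(1)]] z(2) by blast
  have zc: "z \<in> carrier (E q)" by (rule C.GD(2)[OF z(1)])
  have "a \<odot>\<^bsub>E q\<^esub> (r i \<odot>\<^bsub>E q\<^esub> z) \<in> B q (n + 1)" if a: "a \<in> I" for a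
    using graded_familyD(2)[OF fam_B i(1) z(3)[OF a]] E.smult_lcomm[OF ds.sub r_carrier zc, of a 0 i] a I_subset by auto
  moreover have "r i \<odot>\<^bsub>E q\<^esub> z \<in> G q (n + 1)" by (rule graded_familyD(2)[OF fam_G i(1) z(1)])
  ultimately show ?thesis using C.socle_iff[OF I0] i(2) by blast
qed

text \<open>Suppose each \<open>r i f\<close> were multiplication by some \<open>y i\<close> modulo
  \<open>B\<close>. Without a socle in degree \<open>n + 2\<close> the \<open>y i\<close> are
  compatible, so by exactness at the second place they are the multiples \<open>r i x\<close> of one
  element. By exactness at the first place \<open>f\<close> is then multiplication by
  \<open>x\<close>.\<close>

lemma extra_hom_step:
  assumes acyc: "koszul_acyclic (E q) r t (B q) (Z q) n" and extra: "has_extra_hom R0 I (component q n)"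
    and no_soc: "\<not> has_socle R0 I (component q (n + 2))"
  shows "has_extra_hom R0 I (component q (n + 1))"
proof (rule ccontr)
  assume no: "\<not> has_extra_hom R0 I (component q (n + 1))"
  have I0: "I \<subseteq> carrier R0" using I_subset by (simp add: R0_carrier)
  have Ic: "a \<in> carrier R" if "a \<in> I" for a using that I_subset ds.sub by blast
  have I_closed: "a \<oplus>\<^bsub>R0\<^esub> b \<in> I" "c \<in> \<A> 0 \<Longrightarrow> c \<otimes>\<^bsub>R0\<^esub> a \<in> I" if "a \<in> I" "b \<in> I" for a b c
    using that additive_subgroup.a_closed[OF ideal.axioms(1)[OF I]] ideal.I_l_closed[OF I] by (auto simp: R0_carrier)
  obtain f where f: "\<And>a. a \<in> I \<Longrightarrow> f a \<in> G q n"
    "\<And>a b. a \<in> I \<Longrightarrow> b \<in> I \<Longrightarrow> f (a \<oplus>\<^bsub>R0\<^esub> b) \<ominus>\<^bsub>E q\<^esub> (f a \<oplus>\<^bsub>E q\<^esub> f b) \<in> B q n"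
    "\<And>c a. c \<in> carrier R0 \<Longrightarrow> a \<in> I \<Longrightarrow> f (c \<otimes>\<^bsub>R0\<^esub> a) \<ominus>\<^bsub>E q\<^esub> c \<odot>\<^bsub>E q\<^esub> f a \<in> B q n"
    "\<And>x. x \<in> G q n \<Longrightarrow> \<exists>a\<in>I. f a \<ominus>\<^bsub>E q\<^esub> a \<odot>\<^bsub>E q\<^esub> x \<notin> B q n"
    by (rule C.extra_hom_lift[OF I extra]) blast
  have fc: "f a \<in> carrier (E q)" if "a \<in> I" for a by (rule C.GD(2)[OF f(1)[OF that]])
  note rB = graded_familyD(2)[OF fam_B] and rG = graded_familyD(2)[OF fam_G]
  have "\<exists>y. y \<in> G q (n + 1) \<and> (\<forall>a\<in>I. r i \<odot>\<^bsub>E q\<^esub> f a \<ominus>\<^bsub>E q\<^esub> a \<odot>\<^bsub>E q\<^esub> y \<in> B q (n + 1))" if i: "i < t" for i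
  proof (rule ccontr)
    assume none: "\<not> ?thesis"
    have "has_extra_hom R0 I (component q (n + 1))"
    proof (rule C.extra_homI[OF I])
      show "r i \<odot>\<^bsub>E q\<^esub> f a \<in> G q (n + 1)" if "a \<in> I" for a by (rule rG[OF i f(1)[OF that]])
      show "r i \<odot>\<^bsub>E q\<^esub> f (a \<oplus>\<^bsub>R0\<^esub> b) \<ominus>\<^bsub>E q\<^esub> (r i \<odot>\<^bsub>E q\<^esub> f a \<oplus>\<^bsub>E q\<^esub> r i \<odot>\<^bsub>E q\<^esub> f b) \<in> B q (n + 1)"
        if ab: "a \<in> I" "b \<in> I" for a b
        using rB[OF i f(2)[OF ab]] fc[OF ab(1)] fc[OF ab(2)] fc[OF I_closed(1)[OF ab]] r_carrier
        by (simp add: E.smult_minus_distrib E.smult_r_distr)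
      show "r i \<odot>\<^bsub>E q\<^esub> f (c \<otimes>\<^bsub>R0\<^esub> a) \<ominus>\<^bsub>E q\<^esub> c \<odot>\<^bsub>E q\<^esub> (r i \<odot>\<^bsub>E q\<^esub> f a) \<in> B q (n + 1)"
        if c: "c \<in> carrier R0" and a: "a \<in> I" for c a
      proof -
        have cA: "c \<in> \<A> 0" using c by (simp add: R0_carrier)
        have cc: "c \<in> carrier R" by (rule ds.sub[OF cA])
        have "r i \<odot>\<^bsub>E q\<^esub> (f (c \<otimes>\<^bsub>R0\<^esub> a) \<ominus>\<^bsub>E q\<^esub> c \<odot>\<^bsub>E q\<^esub> f a)
            = r i \<odot>\<^bsub>E q\<^esub> f (c \<otimes>\<^bsub>R0\<^esub> a) \<ominus>\<^bsub>E q\<^esub> c \<odot>\<^bsub>E q\<^esub> (r i \<odot>\<^bsub>E q\<^esub> f a)"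
          using fc[OF a] fc[OF I_closed(2)[OF a a cA]] r_carrier cc
          by (simp add: E.smult_minus_distrib E.smult_lcomm[OF cc r_carrier])
        then show ?thesis using rB[OF i f(3)[OF c a]] by simp
      qed
      show "\<exists>a\<in>I. r i \<odot>\<^bsub>E q\<^esub> f a \<ominus>\<^bsub>E q\<^esub> a \<odot>\<^bsub>E q\<^esub> x \<notin> B q (n + 1)" if "x \<in> G q (n + 1)" for x
        using none that by blast
    qed
    then show False using no by simp
  qed
  then obtain y where y: "\<And>i. i < t \<Longrightarrow> y i \<in> G q (n + 1)"
    "\<And>i a. i < t \<Longrightarrow> a \<in> I \<Longrightarrow> r i \<odot>\<^bsub>E q\<^esub> f a \<ominus>\<^bsub>E q\<^esub> a \<odot>\<^bsub>E q\<^esub> y i \<in> B q (n + 1)" by metis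
  have yc: "y i \<in> carrier (E q)" if "i < t" for i by (rule C.GD(2)[OF y(1)[OF that]])
  \<comment> \<open>Multiplied by \<open>a\<close> in \<open>I\<close>, both terms become
    \<open>r i r k f a\<close> modulo \<open>B\<close>. The difference is thus killed by
    \<open>I\<close>, and degree \<open>n + 2\<close> has no socle.\<close>
  have cocycle: "r k \<odot>\<^bsub>E q\<^esub> y i \<ominus>\<^bsub>E q\<^esub> r i \<odot>\<^bsub>E q\<^esub> y k \<in> B q (n + 2)" if ik: "i < t" "k < t" for i k
  proof (rule ccontr)
    assume *: "r k \<odot>\<^bsub>E q\<^esub> y i \<ominus>\<^bsub>E q\<^esub> r i \<odot>\<^bsub>E q\<^esub> y k \<notin> B q (n + 2)"
    have n2: "n + 1 + 1 = n + 2" by simp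
    have "r k \<odot>\<^bsub>E q\<^esub> y i \<ominus>\<^bsub>E q\<^esub> r i \<odot>\<^bsub>E q\<^esub> y k \<in> G q (n + 2)"
      using C.GD(5)[OF rG[OF ik(2) y(1)[OF ik(1)]] rG[OF ik(1) y(1)[OF ik(2)]]] by (simp add: n2)
    moreover have "a \<odot>\<^bsub>E q\<^esub> (r k \<odot>\<^bsub>E q\<^esub> y i \<ominus>\<^bsub>E q\<^esub> r i \<odot>\<^bsub>E q\<^esub> y k) \<in> B q (n + 2)" if a: "a \<in> I" for a
    proof -
      note c = Ic[OF a] r_carrier yc[OF ik(1)] yc[OF ik(2)] fc[OF a]
      let ?u = "r i \<odot>\<^bsub>E q\<^esub> (r k \<odot>\<^bsub>E q\<^esub> f a \<ominus>\<^bsub>E q\<^esub> a \<odot>\<^bsub>E q\<^esub> y k)"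
      let ?v = "r k \<odot>\<^bsub>E q\<^esub> (r i \<odot>\<^bsub>E q\<^esub> f a \<ominus>\<^bsub>E q\<^esub> a \<odot>\<^bsub>E q\<^esub> y i)"
      have "?u \<ominus>\<^bsub>E q\<^esub> ?v \<in> B q (n + 2)"
        using C.BD(5)[OF rB[OF ik(1) y(2)[OF ik(2) a]] rB[OF ik(2) y(2)[OF ik(1) a]]] by (simp add: n2)
      also have "?u = r k \<odot>\<^bsub>E q\<^esub> (r i \<odot>\<^bsub>E q\<^esub> f a) \<ominus>\<^bsub>E q\<^esub> a \<odot>\<^bsub>E q\<^esub> (r i \<odot>\<^bsub>E q\<^esub> y k)"
        using c by (simp add: E.smult_minus_distrib E.smult_lcomm[of "r i" "r k"] E.smult_lcomm[of "r i" a])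
      also have "?v = r k \<odot>\<^bsub>E q\<^esub> (r i \<odot>\<^bsub>E q\<^esub> f a) \<ominus>\<^bsub>E q\<^esub> a \<odot>\<^bsub>E q\<^esub> (r k \<odot>\<^bsub>E q\<^esub> y i)"
        using c by (simp add: E.smult_minus_distrib E.smult_lcomm[of "r k" a])
      finally show ?thesis using c by (simp add: E.minus_minus_cancel_left E.smult_minus_distrib)
    qed
    ultimately have "has_socle R0 I (component q (n + 2))" using C.socle_iff[OF I0] * by blast
    then show False using no_soc by simp
  qed
  have BZ: "B q m \<subseteq> Z q m" for m using BG GZ by blast
  obtain x where x: "x \<in> Z q n" "\<And>i. i < t \<Longrightarrow> y i \<ominus>\<^bsub>E q\<^esub> r i \<odot>\<^bsub>E q\<^esub> x \<in> B q (n + 1)"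
    using E.koszul_acyclic_cocycle[OF fam_B fam_Z BZ acyc subsetD[OF GZ y(1)] cocycle] by blast
  have xE: "x \<in> \<E> q n" using x(1) ZE by blast
  have xc: "x \<in> carrier (E q)" by (rule dE.sub[OF xE])
  have rx: "r i \<odot>\<^bsub>E q\<^esub> x \<in> carrier (E q)" for i using xc r_carrier by simp
  have rxG: "r i \<odot>\<^bsub>E q\<^esub> x \<in> G q (n + 1)" if i: "i < t" for i
  proof -
    have "y i \<ominus>\<^bsub>E q\<^esub> (y i \<ominus>\<^bsub>E q\<^esub> r i \<odot>\<^bsub>E q\<^esub> x) \<in> G q (n + 1)"
      by (rule C.GD(5)[OF y(1)[OF i] subsetD[OF BG x(2)[OF i]]])
    then show ?thesis by (simp only: E.minus_minus_self[OF yc[OF i] rx])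
  qed
  \<comment> \<open>Exactness only supplies \<open>x\<close> among all cocycles. It is torsion since
    every \<open>r i x\<close> differs from the torsion element \<open>y i\<close> by a coboundary
    of torsion elements.\<close>
  have "x \<in> torsion_submodule R Rp (E q)"
  proof (rule E.torsion_of_generators[OF irrelevant_ideal_closed _ irrelevant_generated xc])
    show "s \<odot>\<^bsub>E q\<^esub> x \<in> torsion_submodule R Rp (E q)" if "s \<in> r ` {..<t}" for s
      using that rxG GT by (auto simp: T_eq)
  qed (use r_carrier in auto)
  then have xG: "x \<in> G q n" using x(1) xE by (simp add: G_def T_eq)
  have "f a \<ominus>\<^bsub>E q\<^esub> a \<odot>\<^bsub>E q\<^esub> x \<in> B q n" if a: "a \<in> I" for a
  proof (rule E.koszul_acyclic_socle[OF fam_B fam_Z acyc])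
    have a0: "a \<in> carrier R0" using a I0 by blast
    show "f a \<ominus>\<^bsub>E q\<^esub> a \<odot>\<^bsub>E q\<^esub> x \<in> Z q n"
      using C.GD(5)[OF f(1)[OF a] stable_subgroupD(2)[OF C.stG a0 xG]] GZ by blast
    fix i assume i: "i < t"
    note c = Ic[OF a] r_carrier yc[OF i] fc[OF a] xc
    let ?u = "r i \<odot>\<^bsub>E q\<^esub> f a \<ominus>\<^bsub>E q\<^esub> a \<odot>\<^bsub>E q\<^esub> y i" and ?v = "a \<odot>\<^bsub>E q\<^esub> (y i \<ominus>\<^bsub>E q\<^esub> r i \<odot>\<^bsub>E q\<^esub> x)"
    have "?u \<oplus>\<^bsub>E q\<^esub> ?v \<in> B q (n + 1)"
      by (rule C.BD(3)[OF y(2)[OF i a] stable_subgroupD(2)[OF C.stB a0 x(2)[OF i]]])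
    also have "?u \<oplus>\<^bsub>E q\<^esub> ?v = r i \<odot>\<^bsub>E q\<^esub> (f a \<ominus>\<^bsub>E q\<^esub> a \<odot>\<^bsub>E q\<^esub> x)"
    proof -
      have "?v = a \<odot>\<^bsub>E q\<^esub> y i \<ominus>\<^bsub>E q\<^esub> r i \<odot>\<^bsub>E q\<^esub> (a \<odot>\<^bsub>E q\<^esub> x)"
        using c by (simp add: E.smult_minus_distrib E.smult_lcomm[of a "r i"])
      then show ?thesis using c E.minus_add_minus_cancel by (simp add: E.smult_minus_distrib)
    qed
    finally show "r i \<odot>\<^bsub>E q\<^esub> (f a \<ominus>\<^bsub>E q\<^esub> a \<odot>\<^bsub>E q\<^esub> x) \<in> B q (n + 1)" .
  qed
  then show False using f(4)[OF xG] by blast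
qed

end

end

section \<open>Generators of degree one\<close>

lemma generated_in_degree_one_standard:
  assumes gr: "graded_ring R \<A>" and noeth: "noetherian_ring R" and gen: "generated_in_degree_one R \<A>"
  obtains r t where "standard_graded R \<A> r t"
proof -
  interpret cring R by (rule graded_ringD(1)[OF gr])
  interpret graded_cring R \<A> by unfold_locales (rule gr)
  obtain S where S: "finite S" "S \<subseteq> \<A> 1" "generate_ring R (\<A> 0 \<union> S) = carrier R"
    using gen by (auto simp: generated_in_degree_one_def)
  obtain xs where xs: "set xs = S" using finite_list[OF S(1)] by blast
  \<comment> \<open>Padding with zero keeps every term of degree one, as the locale demands.\<close>
  define r where "r i = (if i < length xs then xs ! i else \<zero>\<^bsub>R\<^esub>)" for i
  have "r i \<in> \<A> 1" for i
    using nth_mem[of i xs] xs S(2) additive_subgroup.zero_closed[OF ds.subgroup] by (auto simp: r_def)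
  moreover have "r ` {..<length xs} = S" using xs by (force simp: r_def in_set_conv_nth)
  ultimately have "standard_graded R \<A> r (length xs)"
    using irrelevant_ideal_subset[OF S(2,3)] noeth
    by (intro standard_graded.intro graded_cring_axioms standard_graded_axioms.intro) auto
  then show thesis by (rule that)
qed

theorem corollary2p6:
  fixes R :: "('a, 'r) ring_scheme" and \<A> :: "nat \<Rightarrow> 'a set"
    and M :: "('a, 'b, 'm) module_scheme" and \<M> :: "int \<Rightarrow> 'b set"
    and \<mm>\<^sub>0 :: "'a set" and j :: nat
  defines "R\<^sub>0 \<equiv> degree_zero_ring R \<A>"
    and "H \<equiv> graded_local_cohomology_component R \<A> (irrelevant_ideal R \<A>) M \<M> j"
    and "g \<equiv> cohomological_finite_length_dimension R \<A> M \<M>"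
  assumes "graded_ring R \<A>" and "noetherian_ring R"
    and "noetherian_ring R\<^sub>0" and "local_ring R\<^sub>0 \<mm>\<^sub>0"
    and "generated_in_degree_one R \<A>"
    and "graded_module R \<A> M \<M>" and "finitely_generated_module R M"
    and "carrier M \<noteq> {\<zero>\<^bsub>M\<^esub>}"
    and "g < \<infinity>" and "enat j \<le> g"
  shows "(\<exists>n\<^sub>0. \<forall>n\<le>n\<^sub>0. depth R\<^sub>0 \<mm>\<^sub>0 (H n) = 0) \<or>
         (\<exists>n\<^sub>0. \<forall>n\<le>n\<^sub>0. depth R\<^sub>0 \<mm>\<^sub>0 (H n) = 1) \<or>
         (\<exists>n\<^sub>0. \<forall>n\<le>n\<^sub>0. depth R\<^sub>0 \<mm>\<^sub>0 (H n) \<ge> 2)"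
proof -
  obtain r t where "standard_graded R \<A> r t"
    by (rule generated_in_degree_one_standard[OF assms(4,5,8)])
  then interpret standard_graded R \<A> r t .
  obtain E \<E> d \<eta> where ch: "chosen_graded_resolution R \<A> M \<M> = (E, \<E>, d)"
    and res: "graded_injective_resolution R \<A> M \<M> E \<E> \<eta> d"
    by (rule chosen_graded_resolution[OF assms(5,9)])
  interpret graded_resolution R \<A> r t M \<M> E \<E> \<eta> d
    by unfold_locales (fact assms(9,10) res)+
  have R0: "cring R0" and I: "ideal \<mm>\<^sub>0 R0"
    using assms(7) unfolding R\<^sub>0_def local_ring_def by (auto intro: maximalideal.axioms(1))
  interpret R0: cring R0 by (rule R0)
  have noeth0: "noetherian_ring R0" using assms(6) by (simp add: R\<^sub>0_def)
  have comp: "graded_local_cohomology_component R \<A> Rp M \<M> q n = component q n" for q n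
    by (simp add: graded_local_cohomology_component_def component_def ch G_eq)
  have dcc: "\<exists>n0. \<forall>n\<le>n0. dcc (E p) (\<A> 0) (B p n) (G p n)" if p: "p < j" for p
  proof -
    have "enat p < g" using p assms(13) by (meson enat_ord_simps(2) less_le_trans)
    \<comment> \<open>As \<open>g\<close> is a supremum, \<open>p < g\<close> yields an index
      \<open>i\<close> beyond \<open>p\<close> below which all components have finite length in low
      degrees; \<open>p\<close> is one of these.\<close>
    then obtain i where "enat p < enat i"
      "\<forall>j<i. \<exists>n\<^sub>0. \<forall>n\<le>n\<^sub>0. module_length R0 (graded_local_cohomology_component R \<A> Rp M \<M> j n) < \<infinity>"
      unfolding g_def cohomological_finite_length_dimension_def less_Sup_iff by blast
    then obtain n0 where "\<And>n. n \<le> n0 \<Longrightarrow> module_length R0 (component p n) < \<infinity>" unfolding comp by auto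
    then have "dcc (E p) (\<A> 0) (B p n) (G p n)" if "n \<le> n0" for n
      using presentation.finite_length_dcc[OF component_presentation[OF R0, of p n]] that unfolding R0_carrier by blast
    then show ?thesis by blast
  qed
  obtain n1 where n1: "\<And>n. n \<le> n1 \<Longrightarrow> koszul_acyclic (E j) r t (B j) (Z j) n"
    using koszul_acyclic_coboundaries[OF dcc] by blast
  have L: "module R0 (H n)" for n
  proof -
    interpret presentation R "E j" R0 "component j n" "G j n" "B j n"
        "\<lambda>z. torsion_coboundaries R Rp E d j +>\<^bsub>E j\<^esub> z"
      by (rule component_presentation[OF R0])
    show ?thesis unfolding H_def comp by (rule L.module_axioms)
  qed
  let ?soc = "\<lambda>n. has_socle R0 \<mm>\<^sub>0 (H n)" and ?ext = "\<lambda>n. has_extra_hom R0 \<mm>\<^sub>0 (H n)"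
  have depth: "?soc n \<Longrightarrow> depth R\<^sub>0 \<mm>\<^sub>0 (H n) = 0"
    "\<not> ?soc n \<Longrightarrow> ?ext n \<Longrightarrow> depth R\<^sub>0 \<mm>\<^sub>0 (H n) = 1"
    "\<not> ?soc n \<Longrightarrow> \<not> ?ext n \<Longrightarrow> depth R\<^sub>0 \<mm>\<^sub>0 (H n) \<ge> 2" for n
    unfolding R\<^sub>0_def using R0.depth_criterion[OF noeth0 L I] by simp_all
  have H: "H n = component j n" for n by (simp add: H_def comp)
  have "(\<exists>n2. \<forall>n\<le>n2. ?soc n) \<or> (\<exists>n2. \<forall>n\<le>n2. \<not> ?soc n)"
  proof (rule int_upward_dichotomy)
    show "?soc (n + 1)" if "n \<le> n1" "?soc n" for n
      unfolding H by (rule socle_step[OF R0 I n1[OF that(1)] that(2)[unfolded H]])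
  qed
  then show ?thesis
  proof
    assume "\<exists>n2. \<forall>n\<le>n2. ?soc n"
    then obtain n2 where "\<And>n. n \<le> n2 \<Longrightarrow> ?soc n" by blast
    then have "depth R\<^sub>0 \<mm>\<^sub>0 (H n) = 0" if "n \<le> n2" for n using depth(1)[of n] that by simp
    then show ?thesis by blast
  next
    assume "\<exists>n2. \<forall>n\<le>n2. \<not> ?soc n"
    then obtain n2 where n2: "\<And>n. n \<le> n2 \<Longrightarrow> \<not> ?soc n" by blast
    have "(\<exists>n3. \<forall>n\<le>n3. ?ext n) \<or> (\<exists>n3. \<forall>n\<le>n3. \<not> ?ext n)"
    proof (rule int_upward_dichotomy)
      \<comment> \<open>The bound \<open>n2 - 2\<close> leaves room for the two degrees above
        \<open>n\<close>: the step to \<open>n + 1\<close> requires that degree \<open>n + 2\<close>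
        has no socle.\<close>
      fix n assume n: "n \<le> min n1 (n2 - 2)" and ext: "?ext n"
      have acyc: "koszul_acyclic (E j) r t (B j) (Z j) n" by (rule n1) (use n in simp)
      have no_soc: "\<not> ?soc (n + 2)" by (rule n2) (use n in simp)
      show "?ext (n + 1)" unfolding H by (rule extra_hom_step[OF R0 I acyc ext[unfolded H] no_soc[unfolded H]])
    qed
    then show ?thesis
    proof
      assume "\<exists>n3. \<forall>n\<le>n3. ?ext n"
      then obtain n3 where "\<And>n. n \<le> n3 \<Longrightarrow> ?ext n" by blast
      then have "depth R\<^sub>0 \<mm>\<^sub>0 (H n) = 1" if "n \<le> min n2 n3" for n using depth(2)[of n] n2[of n] that by simp
      then show ?thesis by blast
    next
      assume "\<exists>n3. \<forall>n\<le>n3. \<not> ?ext n"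
      then obtain n3 where "\<And>n. n \<le> n3 \<Longrightarrow> \<not> ?ext n" by blast
      then have "depth R\<^sub>0 \<mm>\<^sub>0 (H n) \<ge> 2" if "n \<le> min n2 n3" for n using depth(3)[of n] n2[of n] that by simp
      then show ?thesis by blast
    qed
  qed
qed

end
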